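(* Let $M=(X,\mathrm{d},\mathfrak{m})$ be an infinitesimally Hilbertian metric measure space, let $v,w:X\to\mathbb{R}$ be bounded continuous functions, and let $M'=(X,\mathrm{d}',\mathfrak{m}')$ be obtained from $M$ by the conformal transformation $\mathrm{d}'=e^{w}\mathrm{d}$, $\mathfrak{m}'=e^{v}\mathfrak{m}$. Then for every $f\in W^{1,2}(M)=W^{1,2}(M')$ $$\nabla'f=e^{-2w}\nabla f\qquad\mathfrak{m}\text{-a.e.},$$ and for all $X,Y\in L^2(TM)$ $$\langle X,Y\rangle_{M'}=e^{2w}\langle X,Y\rangle_M\qquad\mathfrak{m}\text{-a.e.}$$
   Context: Standing assumptions on metric measure spaces $(X,\mathrm{d},\mathfrak{m})$: $(X,\mathrm{d})$ is complete, separable, geodesic; $\mathfrak m$ is a Borel measure with $\operatorname{supp}\mathfrak{m}=X$ and $\mathfrak{m}(B_r(x_0))<c_1\exp(c_2r^2)$ for every $r>0$, for some $c_1,c_2\ge 0$, $x_0\in X$. Conformal transformation: $\mathfrak{m}'=e^v\mathfrak{m}$ and $\mathrm{d}'=e^w\mathrm{d}$ denotes the distance $\mathrm{d}'(x,y)=\inf_\gamma\int_0^1|\dot\gamma_t|e^{w(\gamma_t)}\,\mathrm{d}t$, the infimum being over $\mathrm{d}$-absolutely continuous curves $\gamma:[0,1]\to X$ with $\gamma_0=x$, $\gamma_1=y$, and $|\dot\gamma_t|$ the metric speed with respect to $\mathrm{d}$. One has $W^{1,2}(M)=W^{1,2}(M')$ as sets. Sobolev space: $\mathrm{lip}(f)(x)=\limsup_{y\to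 x}|f(y)-f(x)|/\mathrm{d}(x,y)$ ($0$ if $x$ is isolated). $f\in L^2(X,\mathfrak m)$ belongs to $W^{1,2}(M)$ if there are Lipschitz $f_n\in L^2$ with $f_n\to f$ and $\mathrm{lip}(f_n)\to G$ in $L^2(X,\mathfrak{m})$ for some $G\in L^2$; the $\mathfrak m$-a.e. minimal such $G$ is $|\mathrm{D}f|$. $M$ is infinitesimally Hilbertian if $W^{1,2}(M)$ with norm $\|f\|^2=\|f\|_{L^2}^2+\||\mathrm{D}f|\|_{L^2}^2$ is Hilbert; then $\Gamma(f,g)=\frac14(|\mathrm{D}(f+g)|^2-|\mathrm{D}(f-g)|^2)$. Cotangent module $L^2(T^*M)$ (Gigli): the completion of the set of classes $[(B_i,f_i)]_{i\in\mathbb{N}}$ ($\{B_i\}$ Borel partition of $X$, $f_i\in W^{1,2}(M)$, $\sum_i\int_{B_i}|\mathrm{D}f_i|^2\,\mathrm{d}\mathfrak m<\infty$; $(A_i,f_i)\sim(B_j,g_j)$ iff $|\mathrm{D}(f_i-g_j)|=0$ a.e. on $A_i\cap B_j$) under the norm $\|\,|\cdot|\,\|_{L^2}$ with pointwise norm $|[(B_i,f_i)]|=\sum_i\chi_{B_i}|\mathrm{D}f_i|$; $\mathrm{d}f:=[(X,f)]$. It is an $L^\infty$-module with pointwise inner product determined by $\langle\mathrm{d}f,\mathrm{d}g\rangle=\Gamma(f,g)$. The tangent module $L^2(TM)$ is the module of continuous $L^\infty$-linear maps $L^2(T^*M)\to L^1(M)$; $\nabla f\in L^2(TM)$ is the element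 with $\mathrm{d}g(\nabla f)=\Gamma(f,g)$ for all $g\in W^{1,2}(M)$, and $L^2(TM)$ carries the pointwise inner product $\langle\cdot,\cdot\rangle_M$ induced by the Riesz isomorphism (so $\langle\nabla f,\nabla g\rangle=\Gamma(f,g)$). $\nabla'$, $\langle\cdot,\cdot\rangle_{M'}$, $L^2(TM')$ are the corresponding objects on $M'$; $L^2(TM)$ and $L^2(TM')$ are identified through their action on differentials $\mathrm{d}f$ of Sobolev functions. *)

theory Defs
  imports "HOL-Analysis.Analysis" "HOL-Library.Nat_Bijection"
begin

text \<open>
  The underlying set is a type. A second distance on the same type is needed, so all
  notions take the distance \<open>d\<close> and the measure \<open>m\<close> as parameters. As usual for L^p spaces in
  HOL-Analysis, elements of function spaces and of the modules are represented by representatives,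
  and equality of elements is equality almost everywhere.
\<close>

section \<open>Metric measure spaces and conformal transformations\<close>

definition geodesic_distance :: "('a \<Rightarrow> 'a \<Rightarrow> real) \<Rightarrow> bool" where
  "geodesic_distance d \<longleftrightarrow>
    (\<forall>x y. \<exists>\<gamma> :: real \<Rightarrow> 'a. \<gamma> 0 = x \<and> \<gamma> 1 = y \<and>
      (\<forall>s\<in>{0..1}. \<forall>t\<in>{0..1}. d (\<gamma> s) (\<gamma> t) = \<bar>s - t\<bar> * d x y))"

definition supp :: "'a::metric_space measure \<Rightarrow> 'a set" where
  "supp m = {x. \<forall>r>0. emeasure m (ball x r) > 0}"

text \<open>Completeness and separability are part of the class \<^class>\<open>polish_space\<close>.\<close>

definition metric_measure_space :: "'a::polish_space measure \<Rightarrow> bool" where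
  "metric_measure_space m \<longleftrightarrow>
    geodesic_distance (dist :: 'a \<Rightarrow> 'a \<Rightarrow> real) \<and>
    sets m = sets borel \<and>
    supp m = UNIV \<and>
    (\<exists>x0. \<exists>c1\<ge>0. \<exists>c2\<ge>0. \<forall>r>0. emeasure m (ball x0 r) < ennreal (c1 * exp (c2 * r\<^sup>2)))"

definition abs_cont_curve :: "('a \<Rightarrow> 'a \<Rightarrow> real) \<Rightarrow> (real \<Rightarrow> 'a) \<Rightarrow> bool" where
  "abs_cont_curve d \<gamma> \<longleftrightarrow>
    (\<exists>g :: real \<Rightarrow> real. set_integrable lebesgue {0..1} g \<and>
      (\<forall>s t. 0 \<le> s \<and> s \<le> t \<and> t \<le> 1 \<longrightarrow> d (\<gamma> s) (\<gamma> t) \<le> (LINT r:{s..t}|lebesgue. g r)))"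

text \<open>For an absolutely continuous curve the limit exists for almost every t in [0,1].\<close>

definition metric_speed :: "('a \<Rightarrow> 'a \<Rightarrow> real) \<Rightarrow> (real \<Rightarrow> 'a) \<Rightarrow> real \<Rightarrow> real" where
  "metric_speed d \<gamma> t = Lim (at t within {0..1}) (\<lambda>s. d (\<gamma> s) (\<gamma> t) / \<bar>s - t\<bar>)"

definition conformal_dist :: "('a \<Rightarrow> 'a \<Rightarrow> real) \<Rightarrow> ('a \<Rightarrow> real) \<Rightarrow> 'a \<Rightarrow> 'a \<Rightarrow> real" where
  "conformal_dist d w x y =
    enn2real (INF \<gamma>\<in>{\<gamma>. abs_cont_curve d \<gamma> \<and> \<gamma> 0 = x \<and> \<gamma> 1 = y}.
      \<integral>\<^sup>+t\<in>{0..1}. ennreal (metric_speed d \<gamma> t * exp (w (\<gamma> t))) \<partial>lebesgue)"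

definition conformal_measure :: "'a measure \<Rightarrow> ('a \<Rightarrow> real) \<Rightarrow> 'a measure" where
  "conformal_measure m v = density m (\<lambda>x. ennreal (exp (v x)))"

section \<open>Sobolev spaces\<close>

definition L2 :: "'a measure \<Rightarrow> ('a \<Rightarrow> real) set" where
  "L2 m = {f. f \<in> borel_measurable m \<and> integrable m (\<lambda>x. (f x)\<^sup>2)}"

definition L2_norm :: "'a measure \<Rightarrow> ('a \<Rightarrow> real) \<Rightarrow> real" where
  "L2_norm m f = sqrt (LINT x|m. (f x)\<^sup>2)"

definition L2_lim :: "'a measure \<Rightarrow> (nat \<Rightarrow> 'a \<Rightarrow> real) \<Rightarrow> ('a \<Rightarrow> real) \<Rightarrow> bool" where
  "L2_lim m F f \<longleftrightarrow> (\<forall>n. F n \<in> L2 m) \<and> f \<in> L2 m \<and>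
    (\<lambda>n. L2_norm m (\<lambda>x. F n x - f x)) \<longlonglongrightarrow> 0"

definition Linf :: "'a measure \<Rightarrow> ('a \<Rightarrow> real) set" where
  "Linf m = {h. h \<in> borel_measurable m \<and> (\<exists>K. AE x in m. \<bar>h x\<bar> \<le> K)}"

definition lipschitz_wrt :: "('a \<Rightarrow> 'a \<Rightarrow> real) \<Rightarrow> ('a \<Rightarrow> real) \<Rightarrow> bool" where
  "lipschitz_wrt d f \<longleftrightarrow> (\<exists>L\<ge>0. \<forall>x y. \<bar>f x - f y\<bar> \<le> L * d x y)"

definition punctured_nhds :: "('a \<Rightarrow> 'a \<Rightarrow> real) \<Rightarrow> 'a \<Rightarrow> 'a filter" where
  "punctured_nhds d x = (INF r\<in>{0<..}. principal {y. y \<noteq> x \<and> d x y < r})"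

text \<open>At an isolated point the filter is \<open>bot\<close>, and the limsup of nonnegative extended
  reals along it is \<open>0\<close>. For Lipschitz functions, the only ones to which \<open>lip\<close> is
  applied below, the limsup is finite.\<close>

definition lip :: "('a \<Rightarrow> 'a \<Rightarrow> real) \<Rightarrow> ('a \<Rightarrow> real) \<Rightarrow> 'a \<Rightarrow> real" where
  "lip d f x = enn2real (Limsup (punctured_nhds d x) (\<lambda>y. ennreal (\<bar>f y - f x\<bar> / d x y)))"

definition relaxed_slope ::
  "('a \<Rightarrow> 'a \<Rightarrow> real) \<Rightarrow> 'a measure \<Rightarrow> ('a \<Rightarrow> real) \<Rightarrow> ('a \<Rightarrow> real) \<Rightarrow> bool" where
  "relaxed_slope d m f G \<longleftrightarrow>
    (\<exists>F. (\<forall>n. lipschitz_wrt d (F n)) \<and> L2_lim m F f \<and> L2_lim m (\<lambda>n. lip d (F n)) G)"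

definition sobolev :: "('a \<Rightarrow> 'a \<Rightarrow> real) \<Rightarrow> 'a measure \<Rightarrow> ('a \<Rightarrow> real) set" where
  "sobolev d m = {f \<in> L2 m. \<exists>G. relaxed_slope d m f G}"

text \<open>The minimal relaxed slope |Df|, unique up to null sets.\<close>

definition min_slope :: "('a \<Rightarrow> 'a \<Rightarrow> real) \<Rightarrow> 'a measure \<Rightarrow> ('a \<Rightarrow> real) \<Rightarrow> 'a \<Rightarrow> real" where
  "min_slope d m f = (SOME G. relaxed_slope d m f G \<and>
    (\<forall>H. relaxed_slope d m f H \<longrightarrow> (AE x in m. G x \<le> H x)))"

definition sobolev_norm :: "('a \<Rightarrow> 'a \<Rightarrow> real) \<Rightarrow> 'a measure \<Rightarrow> ('a \<Rightarrow> real) \<Rightarrow> real" where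
  "sobolev_norm d m f = sqrt ((L2_norm m f)\<^sup>2 + (L2_norm m (min_slope d m f))\<^sup>2)"

text \<open>Hilbert: the norm comes from an inner product, and the space is complete.\<close>

definition infinitesimally_hilbertian :: "('a \<Rightarrow> 'a \<Rightarrow> real) \<Rightarrow> 'a measure \<Rightarrow> bool" where
  "infinitesimally_hilbertian d m \<longleftrightarrow>
    (\<exists>B :: ('a \<Rightarrow> real) \<Rightarrow> ('a \<Rightarrow> real) \<Rightarrow> real.
      (\<forall>f\<in>sobolev d m. \<forall>g\<in>sobolev d m. B f g = B g f) \<and>
      (\<forall>f\<in>sobolev d m. \<forall>g\<in>sobolev d m. \<forall>h\<in>sobolev d m.
         B (\<lambda>x. f x + g x) h = B f h + B g h) \<and>
      (\<forall>c. \<forall>f\<in>sobolev d m. \<forall>g\<in>sobolev d m. B (\<lambda>x. c * f x) g = c * B f g) \<and>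
      (\<forall>f\<in>sobolev d m. B f f = (sobolev_norm d m f)\<^sup>2)) \<and>
    (\<forall>F. (\<forall>n. F n \<in> sobolev d m) \<and>
         (\<forall>e>0. \<exists>N. \<forall>n\<ge>N. \<forall>k\<ge>N. sobolev_norm d m (\<lambda>x. F n x - F k x) < e) \<longrightarrow>
         (\<exists>f\<in>sobolev d m. (\<lambda>n. sobolev_norm d m (\<lambda>x. F n x - f x)) \<longlonglongrightarrow> 0))"

definition carre_du_champ ::
  "('a \<Rightarrow> 'a \<Rightarrow> real) \<Rightarrow> 'a measure \<Rightarrow> ('a \<Rightarrow> real) \<Rightarrow> ('a \<Rightarrow> real) \<Rightarrow> 'a \<Rightarrow> real" where
  "carre_du_champ d m f g x =
    ((min_slope d m (\<lambda>y. f y + g y) x)\<^sup>2 - (min_slope d m (\<lambda>y. f y - g y) x)\<^sup>2) / 4"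

section \<open>The cotangent module\<close>

text \<open>A preform is a sequence of pairs \<open>(B i, f i)\<close>, with the \<open>B i\<close> a Borel partition (empty
  pieces are allowed). Two preforms are equivalent in the sense of the pre-cotangent module
  iff the pointwise norm of their difference vanishes almost everywhere.\<close>

type_synonym 'a preform = "nat \<Rightarrow> 'a set \<times> ('a \<Rightarrow> real)"

definition preforms :: "('a \<Rightarrow> 'a \<Rightarrow> real) \<Rightarrow> 'a measure \<Rightarrow> 'a preform set" where
  "preforms d m = {p. (\<forall>i. fst (p i) \<in> sets m) \<and> disjoint_family (\<lambda>i. fst (p i)) \<and>
     (\<Union>i. fst (p i)) = space m \<and> (\<forall>i. snd (p i) \<in> sobolev d m) \<and>
     (\<Sum>i. \<integral>\<^sup>+x\<in>fst (p i). ennreal ((min_slope d m (snd (p i)) x)\<^sup>2) \<partial>m) < \<infinity>}"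

definition preform_norm ::
  "('a \<Rightarrow> 'a \<Rightarrow> real) \<Rightarrow> 'a measure \<Rightarrow> 'a preform \<Rightarrow> 'a \<Rightarrow> real" where
  "preform_norm d m p x = (\<Sum>i. indicator (fst (p i)) x * min_slope d m (snd (p i)) x)"

text \<open>Operations on the common refinement of the two partitions.\<close>

definition preform_add :: "'a preform \<Rightarrow> 'a preform \<Rightarrow> 'a preform" where
  "preform_add p q = (\<lambda>n. case prod_decode n of (i, j) \<Rightarrow>
     (fst (p i) \<inter> fst (q j), \<lambda>x. snd (p i) x + snd (q j) x))"

definition preform_diff :: "'a preform \<Rightarrow> 'a preform \<Rightarrow> 'a preform" where
  "preform_diff p q = (\<lambda>n. case prod_decode n of (i, j) \<Rightarrow>
     (fst (p i) \<inter> fst (q j), \<lambda>x. snd (p i) x - snd (q j) x))"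

text \<open>The product with the countably valued function \<open>\<lfloor>2^N h\<rfloor> / 2^N\<close>: a function with value
  \<open>c\<close> on the piece \<open>C\<close> sends \<open>(B i, f i)\<close> to \<open>(B i \<inter> C, c f i)\<close>.\<close>

definition preform_dyadic_mult :: "nat \<Rightarrow> ('a \<Rightarrow> real) \<Rightarrow> 'a preform \<Rightarrow> 'a preform" where
  "preform_dyadic_mult N h p = (\<lambda>n. case prod_decode n of (i, j) \<Rightarrow>
     (fst (p i) \<inter> {x. \<lfloor>2 ^ N * h x\<rfloor> = int_decode j},
      \<lambda>x. of_int (int_decode j) / 2 ^ N * snd (p i) x))"

text \<open>The completion, as the space of Cauchy sequences of preforms.\<close>

type_synonym 'a form = "nat \<Rightarrow> 'a preform"

definition cotangent :: "('a \<Rightarrow> 'a \<Rightarrow> real) \<Rightarrow> 'a measure \<Rightarrow> 'a form set" where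
  "cotangent d m = {\<omega>. (\<forall>n. \<omega> n \<in> preforms d m) \<and>
     (\<forall>e>0. \<exists>N. \<forall>n\<ge>N. \<forall>k\<ge>N.
        L2_norm m (preform_norm d m (preform_diff (\<omega> n) (\<omega> k))) < e)}"

definition form_norm :: "('a \<Rightarrow> 'a \<Rightarrow> real) \<Rightarrow> 'a measure \<Rightarrow> 'a form \<Rightarrow> 'a \<Rightarrow> real" where
  "form_norm d m \<omega> = (SOME G. L2_lim m (\<lambda>n. preform_norm d m (\<omega> n)) G)"

definition form_add :: "'a form \<Rightarrow> 'a form \<Rightarrow> 'a form" where
  "form_add \<omega> \<eta> = (\<lambda>n. preform_add (\<omega> n) (\<eta> n))"

definition form_diff :: "'a form \<Rightarrow> 'a form \<Rightarrow> 'a form" where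
  "form_diff \<omega> \<eta> = (\<lambda>n. preform_diff (\<omega> n) (\<eta> n))"

text \<open>The L^infinity action, extended from countably valued functions by continuity:
  \<open>\<lfloor>2^n h\<rfloor> / 2^n\<close> converges to \<open>h\<close> uniformly.\<close>

definition form_mult :: "('a \<Rightarrow> real) \<Rightarrow> 'a form \<Rightarrow> 'a form" where
  "form_mult h \<omega> = (\<lambda>n. preform_dyadic_mult n h (\<omega> n))"

text \<open>The pointwise inner product, by polarization of the pointwise norm.\<close>

definition form_inner ::
  "('a \<Rightarrow> 'a \<Rightarrow> real) \<Rightarrow> 'a measure \<Rightarrow> 'a form \<Rightarrow> 'a form \<Rightarrow> 'a \<Rightarrow> real" where
  "form_inner d m \<omega> \<eta> x =
    ((form_norm d m (form_add \<omega> \<eta>) x)\<^sup>2 - (form_norm d m (form_diff \<omega> \<eta>) x)\<^sup>2) / 4"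

text \<open>The class of \<open>(X, f)\<close>, with the partition padded by empty pieces.\<close>

definition differential :: "'a measure \<Rightarrow> ('a \<Rightarrow> real) \<Rightarrow> 'a form" where
  "differential m f = (\<lambda>n i. (if i = 0 then space m else {}, f))"

section \<open>The tangent module\<close>

text \<open>Continuous L^infinity-linear maps into L^1. Being continuous with respect to the
  seminorm on representatives, they respect equality in the cotangent module.\<close>

type_synonym 'a vfield = "'a form \<Rightarrow> 'a \<Rightarrow> real"

definition tangent :: "('a \<Rightarrow> 'a \<Rightarrow> real) \<Rightarrow> 'a measure \<Rightarrow> 'a vfield set" where
  "tangent d m = {T.
     (\<forall>\<omega>\<in>cotangent d m. integrable m (T \<omega>)) \<and>
     (\<forall>\<omega>\<in>cotangent d m. \<forall>\<eta>\<in>cotangent d m.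
        AE x in m. T (form_add \<omega> \<eta>) x = T \<omega> x + T \<eta> x) \<and>
     (\<forall>h\<in>Linf m. \<forall>\<omega>\<in>cotangent d m. AE x in m. T (form_mult h \<omega>) x = h x * T \<omega> x) \<and>
     (\<forall>W. \<forall>\<omega>\<in>cotangent d m. (\<forall>n. W n \<in> cotangent d m) \<and>
        (\<lambda>n. L2_norm m (form_norm d m (form_diff (W n) \<omega>))) \<longlonglongrightarrow> 0 \<longrightarrow>
        (\<lambda>n. LINT x|m. \<bar>T (W n) x - T \<omega> x\<bar>) \<longlonglongrightarrow> 0)}"

definition vfield_mult :: "('a \<Rightarrow> real) \<Rightarrow> 'a vfield \<Rightarrow> 'a vfield" where
  "vfield_mult h T = (\<lambda>\<omega> x. h x * T \<omega> x)"

definition gradient ::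
  "('a \<Rightarrow> 'a \<Rightarrow> real) \<Rightarrow> 'a measure \<Rightarrow> ('a \<Rightarrow> real) \<Rightarrow> 'a vfield" where
  "gradient d m f = (SOME T. T \<in> tangent d m \<and>
     (\<forall>g\<in>sobolev d m. AE x in m. T (differential m g) x = carre_du_champ d m f g x))"

text \<open>The form representing a vector field under the Riesz isomorphism.\<close>

definition riesz :: "('a \<Rightarrow> 'a \<Rightarrow> real) \<Rightarrow> 'a measure \<Rightarrow> 'a vfield \<Rightarrow> 'a form" where
  "riesz d m T = (SOME \<omega>. \<omega> \<in> cotangent d m \<and>
     (\<forall>\<eta>\<in>cotangent d m. AE x in m. T \<eta> x = form_inner d m \<omega> \<eta> x))"

definition vfield_inner ::
  "('a \<Rightarrow> 'a \<Rightarrow> real) \<Rightarrow> 'a measure \<Rightarrow> 'a vfield \<Rightarrow> 'a vfield \<Rightarrow> 'a \<Rightarrow> real" where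
  "vfield_inner d m S T = form_inner d m (riesz d m S) (riesz d m T)"

text \<open>The identification of the tangent module of \<open>(d, m)\<close> with that of \<open>(d', m')\<close> through
  the action on differentials of Sobolev functions.\<close>

definition tangent_ident ::
  "('a \<Rightarrow> 'a \<Rightarrow> real) \<Rightarrow> 'a measure \<Rightarrow> ('a \<Rightarrow> 'a \<Rightarrow> real) \<Rightarrow> 'a measure \<Rightarrow> 'a vfield \<Rightarrow> 'a vfield" where
  "tangent_ident d m d' m' T = (SOME T'. T' \<in> tangent d' m' \<and>
     (\<forall>f\<in>sobolev d m. AE x in m. T' (differential m' f) x = T (differential m f) x))"

end

theory Submission
  imports Defs
begin

text \<open>
  The metric speed of an absolutely continuous curve recovers its length: Vitali coverings combined
  with Henstock's lemma bound \<open>dist (\<gamma> 0) (\<gamma> 1)\<close> by the integral of the speed. Together with geodesics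
  and continuity of \<open>w\<close> this shows that \<open>d' x y / dist x y\<close> tends to \<open>exp (w x)\<close> as \<open>y\<close> tends to
  \<open>x\<close>. So the slopes of Lipschitz functions, and with them the minimal relaxed slopes, get multiplied by
  \<open>exp (- w)\<close>. Since all weights are bounded above and below, the cotangent and tangent modules of
  the two spaces coincide as sets, and the inner product of forms is multiplied by \<open>exp (- 2 w)\<close>.
  The two formulas follow, because a vector field acts on forms by the inner product with the form
  representing it.

  The inner product of forms is bilinear because the parallelogram law for the Sobolev norm localizes to
  the pointwise law for \<open>|Df|\<close>. The minimal slope is local and satisfies the chain rule for sawtooth
  functions, so one can test the integrated parallelogram law on products of cutoffs with functions that
  are uniformly small but have the given slopes.
\<close>

section \<open>Metric speed and the conformal distance\<close>

text \<open>The formulas look like a formal rescaling, but nearly every object in them is a choice: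
  the speed is a \<open>Lim\<close>, and \<open>min_slope\<close>, \<open>form_norm\<close>,
  \<open>gradient\<close>, \<open>riesz\<close> and \<open>tangent_ident\<close> are picked by
  \<open>SOME\<close>. Nothing can be said about such a choice before some object has the defining
  property, so the existence of minimal slopes, of pointwise norms and of Riesz representatives has
  to be established, and equalities hold almost everywhere only. The theory of \<open>M\<close> is
  developed for the distance \<open>dist\<close> of the type class. Hence \<open>M'\<close> is never
  an instance of it, and every notion on \<open>M'\<close> is reduced to the one on
  \<open>M\<close>. The parallelogram law is the bottleneck: it is given for integrals, while the
  representative \<open>exp (2 * w) * \<omega>\<close> of a vector field on \<open>M'\<close>
  requires an inner product that is linear over bounded functions at almost every point.\<close>

definition seg :: "real \<times> real \<Rightarrow> real set" where
  "seg p = {min (fst p) (snd p)..max (fst p) (snd p)}"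

text \<open>The tag \<open>fst p\<close> is an endpoint, so that intervals record difference
  quotients at the tag. Vitali's theorem speaks of balls and Henstock's lemma of boxes, and the same
  interval has to serve both.\<close>

lemma seg_cball: "seg p = cball ((fst p + snd p) / 2) (\<bar>snd p - fst p\<bar> / 2)"
  by (auto simp: seg_def cball_eq_atLeastAtMost min_def max_def field_simps)

lemma seg_cbox: "seg p = cbox (min (fst p) (snd p)) (max (fst p) (snd p))"
  by (simp add: seg_def)

lemma content_seg: "measure lborel (seg p) = \<bar>snd p - fst p\<bar>"
  by (auto simp: seg_def min_def max_def)

lemma seg_lmeasurable: "seg p \<in> lmeasurable"
  by (simp add: seg_cbox)

lemma endpoints_in_seg: "fst p \<in> seg p" "snd p \<in> seg p"
  by (auto simp: seg_def)

lemma seg_subset: "fst p \<in> {a<..<b} \<Longrightarrow> snd p \<in> {a<..<b} \<Longrightarrow> seg p \<subseteq> {a<..<b}"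
  by (auto simp: seg_def min_def max_def split: if_splits)

text \<open>A Vitali cover by tagged intervals can be thinned out to an almost disjoint cover on which
  every finite Riemann sum is controlled by Henstock's lemma.\<close>

lemma vitali_henstock:
  fixes f :: "real \<Rightarrow> real"
  assumes f: "f integrable_on {a..b}" and e: "0 < e"
    and S: "S \<subseteq> {a<..<b}"
    and cov: "\<forall>t\<in>S. \<forall>r>0. \<exists>s\<in>{a<..<b}. s \<noteq> t \<and> \<bar>s - t\<bar> < r \<and> P t s"
  shows "\<exists>C. countable C \<and>
    (\<forall>p\<in>C. fst p \<in> S \<and> snd p \<in> {a<..<b} \<and> snd p \<noteq> fst p \<and> P (fst p) (snd p)) \<and>
    (\<forall>p\<in>C. \<forall>q\<in>C. p \<noteq> q \<longrightarrow> seg p \<inter> seg q = {}) \<and>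
    negligible (S - (\<Union>p\<in>C. seg p)) \<and>
    (\<forall>C0. finite C0 \<and> C0 \<subseteq> C \<longrightarrow>
      (\<Sum>p\<in>C0. \<bar>\<bar>snd p - fst p\<bar> * f (fst p) - integral (seg p) f\<bar>) < e)"
proof -
  obtain \<gamma> where \<gamma>: "gauge \<gamma>"
    and hen: "\<And>p. \<lbrakk>p tagged_partial_division_of (cbox a b); \<gamma> fine p\<rbrakk> \<Longrightarrow>
             sum (\<lambda>(x,k). norm(measure lborel k *\<^sub>R f x - integral k f)) p < e"
    using Henstock_lemma[of f a b e] f e by auto
  \<comment> \<open>The last condition makes every finite subfamily fine for the Henstock gauge, so
    the selection made by Vitali's theorem cannot spoil the error bound.\<close>
  define K where "K = {p. fst p \<in> S \<and> snd p \<in> {a<..<b} \<and> snd p \<noteq> fst p \<and> P (fst p) (snd p)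
    \<and> seg p \<subseteq> \<gamma> (fst p)}"
  have "\<exists>p. p \<in> K \<and> t \<in> cball ((fst p + snd p) / 2) (\<bar>snd p - fst p\<bar> / 2) \<and> \<bar>snd p - fst p\<bar> / 2 < r"
    if t: "t \<in> S" and r: "0 < r" for t r
  proof -
    obtain r' where r': "r' > 0" "ball t r' \<subseteq> \<gamma> t"
      using \<gamma> by (metis gauge_def open_contains_ball)
    obtain s where s: "s \<in> {a<..<b}" "s \<noteq> t" "\<bar>s - t\<bar> < min r r'" "P t s"
      using cov[rule_format, OF t, of "min r r'"] r r' by auto
    have "seg (t, s) \<subseteq> ball t r'"
      using s by (auto simp: seg_def ball_def dist_real_def min_def max_def split: if_splits)
    then have "(t, s) \<in> K" using s r' t by (auto simp: K_def)
    moreover have "t \<in> seg (t, s)" by (auto simp: seg_def)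
    ultimately show ?thesis using s by (intro exI[of _ "(t, s)"]) (auto simp: seg_cball)
  qed
  note covK = this
  have posK: "0 < \<bar>snd p - fst p\<bar> / 2" if "p \<in> K" for p :: "real \<times> real"
    using that by (auto simp: K_def)
  obtain C where C: "countable C" "C \<subseteq> K"
     "pairwise (\<lambda>p q. disjnt (cball ((fst p + snd p) / 2) (\<bar>snd p - fst p\<bar> / 2))
        (cball ((fst q + snd q) / 2) (\<bar>snd q - fst q\<bar> / 2))) C"
     "negligible (S - (\<Union>p\<in>C. cball ((fst p + snd p) / 2) (\<bar>snd p - fst p\<bar> / 2)))"
    by (rule Vitali_covering_theorem_cballs[OF posK covK])
  note C = C[folded seg_cball]
  have disj: "seg p \<inter> seg q = {}" if "p \<in> C" "q \<in> C" "p \<noteq> q" for p q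
    using C(3) that by (auto simp: pairwise_def disjnt_def)
  show ?thesis
  proof (intro exI[of _ C] conjI allI impI ballI C(1) C(4))
    show "fst p \<in> S" "snd p \<in> {a<..<b}" "snd p \<noteq> fst p" "P (fst p) (snd p)" if "p \<in> C" for p
      using that C(2) by (auto simp: K_def)
    show "seg p \<inter> seg q = {}" if "p \<in> C" "q \<in> C" "p \<noteq> q" for p q
      by (rule disj) fact+
    fix C0 assume "finite C0 \<and> C0 \<subseteq> C"
    then have C0: "finite C0" "C0 \<subseteq> C" by auto
    let ?h = "\<lambda>p. (fst p, seg p)"
    \<comment> \<open>Distinct members have disjoint nonempty intervals, so no term is lost when the
      sum is read over a tagged partial division.\<close>
    have inj: "inj_on ?h C0"
    proof (rule inj_onI)
      fix p q assume "p \<in> C0" "q \<in> C0" "?h p = ?h q"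
      then show "p = q" using disj[of p q] C0(2) endpoints_in_seg(1)[of p] by auto
    qed
    have "(?h ` C0) tagged_partial_division_of (cbox a b)"
      unfolding tagged_partial_division_of_def
    proof (intro conjI allI impI)
      fix x L assume "(x, L) \<in> ?h ` C0"
      then obtain p where p: "p \<in> C0" "x = fst p" "L = seg p" by auto
      then show "x \<in> L" by (simp add: endpoints_in_seg)
      have "L \<subseteq> {a<..<b}"
        using p C0(2) C(2) S unfolding p(3) by (intro seg_subset) (fastforce simp: K_def)+
      then show "L \<subseteq> cbox a b" by auto
      show "\<exists>a b. L = cbox a b" using p seg_cbox by blast
    next
      fix x1 K1 x2 K2 assume *: "(x1, K1) \<in> ?h ` C0 \<and> (x2, K2) \<in> ?h ` C0 \<and> (x1, K1) \<noteq> (x2, K2)"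
      then obtain p q where "p \<in> C0" "q \<in> C0" "p \<noteq> q" "K1 = seg p" "K2 = seg q" by auto
      then have "K1 \<inter> K2 = {}" using disj[of p q] C0(2) by auto
      then show "interior K1 \<inter> interior K2 = {}" using interior_subset by blast
    qed (use C0 in auto)
    moreover have "\<gamma> fine (?h ` C0)"
      using C0(2) C(2) by (auto simp: fine_def K_def)
    ultimately have "sum (\<lambda>(x,k). norm(measure lborel k *\<^sub>R f x - integral k f)) (?h ` C0) < e"
      by (rule hen)
    then show "(\<Sum>p\<in>C0. \<bar>\<bar>snd p - fst p\<bar> * f (fst p) - integral (seg p) f\<bar>) < e"
      by (simp add: sum.reindex[OF inj] content_seg)
  qed
qed

lemma measure_UN_seg:
  assumes "finite C" "\<And>p q. p \<in> C \<Longrightarrow> q \<in> C \<Longrightarrow> p \<noteq> q \<Longrightarrow> seg p \<inter> seg q = {}"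
  shows "measure lebesgue (\<Union>p\<in>C. seg p) = (\<Sum>p\<in>C. \<bar>snd p - fst p\<bar>)"
proof -
  have "measure lebesgue (\<Union>p\<in>C. seg p) = (\<Sum>p\<in>C. measure lebesgue (seg p))"
    using assms(2) by (intro measure_finite_Union[OF assms(1)]) 
      (auto simp: disjoint_family_on_def simp del: split_paired_All split_paired_Ex, simp_all add: seg_cbox)
  also have "\<dots> = (\<Sum>p\<in>C. \<bar>snd p - fst p\<bar>)"
    by (intro sum.cong) (auto simp: seg_cbox min_def max_def)
  finally show ?thesis .
qed

text \<open>Where the quotients deviate by more than \<open>1 / Suc k\<close>, Vitali's theorem
  yields disjoint intervals whose lengths are at most \<open>Suc k\<close> times their Henstock
  errors. The errors add up to less than \<open>e / Suc k\<close>, so these points have outer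
  measure at most \<open>e\<close>.\<close>

lemma lebesgue_differentiation:
  fixes f :: "real \<Rightarrow> real"
  assumes f: "f integrable_on {a..b}"
  shows "negligible {t \<in> {a<..<b}. \<not> (\<forall>e>0. \<exists>r>0. \<forall>s\<in>{a<..<b}. \<bar>s - t\<bar> < r \<longrightarrow>
    \<bar>\<bar>s - t\<bar> * f t - integral (seg (t, s)) f\<bar> \<le> e * \<bar>s - t\<bar>)}" (is "negligible ?N")
proof -
  define E where "E k = {t \<in> {a<..<b}. \<forall>r>0. \<exists>s\<in>{a<..<b}. \<bar>s - t\<bar> < r \<and>
    \<bar>\<bar>s - t\<bar> * f t - integral (seg (t, s)) f\<bar> > (1 / Suc k) * \<bar>s - t\<bar>}" for k :: nat
  have "negligible (E k)" for k
    unfolding negligible_outer_le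
  proof (intro allI impI)
    fix e :: real assume e: "0 < e"
    let ?P = "\<lambda>t s. \<bar>\<bar>s - t\<bar> * f t - integral (seg (t, s)) f\<bar> > (1 / Suc k) * \<bar>s - t\<bar>"
    have e': "0 < e / Suc k" using e by simp
    have "\<exists>s\<in>{a<..<b}. s \<noteq> t \<and> \<bar>s - t\<bar> < r \<and> ?P t s" if tE: "t \<in> E k" and r0: "0 < r" for t r
    proof -
      obtain s where s: "s \<in> {a<..<b}" "\<bar>s - t\<bar> < r" "?P t s"
        using tE r0 unfolding E_def by blast
      have "s \<noteq> t" using s(3) by (auto simp: seg_def)
      then show ?thesis using s by blast
    qed
    then have cov: "\<forall>t\<in>E k. \<forall>r>0. \<exists>s\<in>{a<..<b}. s \<noteq> t \<and> \<bar>s - t\<bar> < r \<and> ?P t s"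
      by blast
    have sub: "E k \<subseteq> {a<..<b}" by (auto simp: E_def)
    obtain C where "countable C"
      "\<forall>p\<in>C. fst p \<in> E k \<and> snd p \<in> {a<..<b} \<and> snd p \<noteq> fst p \<and> ?P (fst p) (snd p)"
      "\<forall>p\<in>C. \<forall>q\<in>C. p \<noteq> q \<longrightarrow> seg p \<inter> seg q = {}"
      "negligible (E k - (\<Union>p\<in>C. seg p))"
      "\<forall>C0. finite C0 \<and> C0 \<subseteq> C \<longrightarrow>
        (\<Sum>p\<in>C0. \<bar>\<bar>snd p - fst p\<bar> * f (fst p) - integral (seg p) f\<bar>) < e / Suc k"
      using vitali_henstock[OF f e' sub cov] by (elim exE conjE) (rule that)
    note C = this(1) this(2,3)[rule_format] this(4) this(5)[rule_format, OF conjI]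
    have fin: "measure lebesgue (\<Union>p\<in>C0. seg p) \<le> e" if C0: "finite C0" "C0 \<subseteq> C" for C0
    proof -
      have "measure lebesgue (\<Union>p\<in>C0. seg p) = (\<Sum>p\<in>C0. \<bar>snd p - fst p\<bar>)"
        using C0 C(3) by (intro measure_UN_seg) blast+
      also have "\<dots> \<le> (\<Sum>p\<in>C0. Suc k * \<bar>\<bar>snd p - fst p\<bar> * f (fst p) - integral (seg p) f\<bar>)"
      proof (rule sum_mono)
        fix p assume "p \<in> C0"
        then have "?P (fst p) (snd p)" using C(2) C0(2) by blast
        then show "\<bar>snd p - fst p\<bar> \<le> Suc k * \<bar>\<bar>snd p - fst p\<bar> * f (fst p) - integral (seg p) f\<bar>"
          by (simp add: field_simps)
      qed
      also have "\<dots> = Suc k * (\<Sum>p\<in>C0. \<bar>\<bar>snd p - fst p\<bar> * f (fst p) - integral (seg p) f\<bar>)"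
        by (simp add: sum_distrib_left)
      also have "\<dots> \<le> Suc k * (e / Suc k)"
        using C(5)[OF C0] by (intro mult_left_mono) auto
      finally show ?thesis by simp
    qed
    have sub: "seg p \<subseteq> {a<..<b}" if "p \<in> C" for p
      using C(2)[OF that] by (intro seg_subset) (auto simp: E_def)
    have lm: "(\<Union>p\<in>C. seg p) \<in> lmeasurable"
    proof (rule fmeasurable_UN[of _ _ "{a..b}"])
      show "seg p \<subseteq> {a..b}" if "p \<in> C" for p using sub[OF that] by auto
    qed (use C(1) in \<open>simp_all add: seg_cbox\<close>)
    \<comment> \<open>The Henstock bound concerns finite subfamilies only; the countable union is
      approximated by them from inside.\<close>
    have "measure lebesgue (\<Union>(seg ` C)) \<le> e"
    proof (rule ccontr)
      assume "\<not> ?thesis"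
      then have pos: "measure lebesgue (\<Union>(seg ` C)) - e > 0" by simp
      have fin': "measure lebesgue (\<Union>D') \<le> e" if D': "D' \<subseteq> seg ` C" "finite D'" for D'
      proof -
        obtain C0 where "C0 \<subseteq> C" "finite C0" "D' = seg ` C0"
          using D' by (meson finite_subset_image)
        then show ?thesis using fin[of C0] by auto
      qed
      obtain D' where "D' \<subseteq> seg ` C" "finite D'" 
          "measure lebesgue (\<Union>(seg ` C)) - (measure lebesgue (\<Union>(seg ` C)) - e) < measure lebesgue (\<Union>D')"
        by (rule measure_countable_Union_approachable[OF _ pos _ fin'])
           (use C(1) seg_lmeasurable in auto)
      then show False using fin'[of D'] by auto
    qed
    moreover have "measure lebesgue ((E k - (\<Union>p\<in>C. seg p)) \<union> (\<Union>p\<in>C. seg p)) = measure lebesgue (\<Union>p\<in>C. seg p)"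
      using C(4) lm by (metis Un_commute fmeasurableD measure_Un_null_set negligible_iff_null_sets)
    moreover have "(E k - (\<Union>p\<in>C. seg p)) \<union> (\<Union>p\<in>C. seg p) \<in> lmeasurable"
      using lm negligible_imp_measurable[OF C(4)] by (intro fmeasurable.Un)
    ultimately show "\<exists>T. E k \<subseteq> T \<and> T \<in> lmeasurable \<and> measure lebesgue T \<le> e"
      by (intro exI[of _ "(E k - (\<Union>p\<in>C. seg p)) \<union> (\<Union>p\<in>C. seg p)"]) auto
  qed
  then have "negligible (\<Union>k. E k)" by (intro negligible_countable_Union) auto
  moreover have "?N \<subseteq> (\<Union>k. E k)"
  proof
    fix t assume t: "t \<in> ?N"
    then obtain e where e: "e > 0" and ne: "\<And>r. r > 0 \<Longrightarrow> \<exists>s\<in>{a<..<b}. \<bar>s - t\<bar> < r \<and>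
        \<not> \<bar>\<bar>s - t\<bar> * f t - integral (seg (t, s)) f\<bar> \<le> e * \<bar>s - t\<bar>" by blast
    obtain k where k: "1 / Suc k < e" using e nat_approx_posE by (metis of_nat_Suc)
    have "t \<in> E k"
      unfolding E_def
    proof (intro CollectI conjI allI impI)
      fix r :: real assume "r > 0"
      from ne[OF this] obtain s where s: "s\<in>{a<..<b}" "\<bar>s - t\<bar> < r"
        "e * \<bar>s - t\<bar> < \<bar>\<bar>s - t\<bar> * f t - integral (seg (t, s)) f\<bar>" by auto
      have "(1 / Suc k) * \<bar>s - t\<bar> \<le> e * \<bar>s - t\<bar>" using k by (intro mult_right_mono) auto
      then show "\<exists>s\<in>{a<..<b}. \<bar>s - t\<bar> < r \<and>
          \<bar>\<bar>s - t\<bar> * f t - integral (seg (t, s)) f\<bar> > (1 / Suc k) * \<bar>s - t\<bar>" using s by force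
    qed (use t in auto)
    then show "t \<in> (\<Union>k. E k)" by blast
  qed
  ultimately show ?thesis by (rule negligible_subset)
qed

text \<open>Walking from \<open>a\<close> to \<open>b\<close>, the chosen intervals are paid by
  \<open>D\<close> and the gaps by \<open>G\<close>; additivity turns the cost of the gaps into
  \<open>G a b\<close> minus the \<open>G\<close>-cost of the chosen intervals. The induction splits
  off the leftmost interval.\<close>

lemma chain_bound:
  fixes D G :: "real \<Rightarrow> real \<Rightarrow> real"
  assumes tri: "\<And>u v w. D u w \<le> D u v + D v w"
    and G: "\<And>u v w. a \<le> u \<Longrightarrow> u \<le> v \<Longrightarrow> v \<le> w \<Longrightarrow> w \<le> b \<Longrightarrow> G u w = G u v + G v w"
    and DG: "\<And>u v. a \<le> u \<Longrightarrow> u \<le> v \<Longrightarrow> v \<le> b \<Longrightarrow> D u v \<le> G u v"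
    and "finite C" "a \<le> b"
    and "\<And>p. p \<in> C \<Longrightarrow> seg p \<subseteq> {a..b}"
    and "\<And>p q. p \<in> C \<Longrightarrow> q \<in> C \<Longrightarrow> p \<noteq> q \<Longrightarrow> seg p \<inter> seg q = {}"
  shows "D a b \<le> (\<Sum>p\<in>C. D (min (fst p) (snd p)) (max (fst p) (snd p))) + G a b
    - (\<Sum>p\<in>C. G (min (fst p) (snd p)) (max (fst p) (snd p)))"
  using assms
proof (induction "card C" arbitrary: C a)
  case 0
  have "C = {}" using 0(1) 0(5) by (metis card_0_eq)
  moreover have "D a b \<le> G a b" by (rule 0(4)) (use 0(6) in simp_all)
  ultimately show ?case by (simp only: sum.empty add_0 diff_0_right)
next
  case (Suc n)
  let ?lo = "\<lambda>p::real\<times>real. min (fst p) (snd p)" and ?hi = "\<lambda>p::real\<times>real. max (fst p) (snd p)"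
  have "C \<noteq> {}" using Suc.hyps(2) by auto
  then have "Min (?lo ` C) \<in> ?lo ` C" using Suc.prems(4) by simp
  then obtain p where p: "Min (?lo ` C) = ?lo p" "p \<in> C" by (rule imageE)
  note p = p(2) p(1)[symmetric]
  have lo: "?lo p \<le> ?lo q" if "q \<in> C" for q
    unfolding p(2) using Suc.prems(4) that by (intro Min_le) auto
  have mem: "a \<le> ?lo q" "?hi q \<le> b" "?lo q \<le> ?hi q" if "q \<in> C" for q
    using Suc.prems(6)[OF that] by (auto simp: seg_def)
  have later: "?hi p < ?lo q" if "q \<in> C - {p}" for q
  proof (rule ccontr)
    assume "\<not> ?thesis"
    then have "?lo q \<in> seg p" using lo[of q] that by (auto simp: seg_def)
    moreover have "?lo q \<in> seg q" by (auto simp: seg_def)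
    ultimately show False using Suc.prems(7)[of p q] that p(1) by auto
  qed
  have IH: "D (?hi p) b \<le> (\<Sum>q\<in>C-{p}. D (?lo q) (?hi q)) + G (?hi p) b
      - (\<Sum>q\<in>C-{p}. G (?lo q) (?hi q))"
  proof (rule Suc.hyps(1))
    show "n = card (C - {p})" using Suc.hyps(2) p(1) Suc.prems(4) by simp
    show "seg q \<subseteq> {?hi p..b}" if "q \<in> C - {p}" for q
    proof -
      have "?hi p < ?lo q" "?hi q \<le> b" using later[OF that] mem(2)[of q] that by auto
      then show ?thesis unfolding seg_def by fastforce
    qed
    show "seg q \<inter> seg q' = {}" if "q \<in> C - {p}" "q' \<in> C - {p}" "q \<noteq> q'" for q q'
      using that by (intro Suc.prems(7)) auto
    show "G u w = G u v + G v w" if "?hi p \<le> u" "u \<le> v" "v \<le> w" "w \<le> b" for u v w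
      using that mem(1,3)[OF p(1)] by (intro Suc.prems(2)) auto
    show "D u v \<le> G u v" if "?hi p \<le> u" "u \<le> v" "v \<le> b" for u v
      using that mem(1,3)[OF p(1)] by (intro Suc.prems(3)) auto
    show "finite (C - {p})" "?hi p \<le> b" using Suc.prems(4) mem(2)[OF p(1)] by auto
    show "\<And>u v w. D u w \<le> D u v + D v w" by (rule Suc.prems(1))
  qed
  have "D a b \<le> D a (?lo p) + (D (?lo p) (?hi p) + D (?hi p) b)"
    using Suc.prems(1)[of a b "?lo p"] Suc.prems(1)[of "?lo p" b "?hi p"] by simp
  also have "D a (?lo p) \<le> G a (?lo p)"
    using mem[OF p(1)] by (intro Suc.prems(3)) auto
  finally have "D a b \<le> G a (?lo p) + D (?lo p) (?hi p) + D (?hi p) b" by simp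
  moreover have "G a b = G a (?lo p) + (G (?lo p) (?hi p) + G (?hi p) b)"
  proof -
    have "?lo p \<le> b" using mem[OF p(1)] by (meson order_trans)
    then show ?thesis
      using Suc.prems(2)[OF order_refl mem(1)[OF p(1)]] Suc.prems(2)[OF mem(1,3,2)[OF p(1)] order_refl]
      by (metis order_refl)
  qed
  moreover have "(\<Sum>q\<in>C. D (?lo q) (?hi q)) = D (?lo p) (?hi p) + (\<Sum>q\<in>C-{p}. D (?lo q) (?hi q))"
    using p(1) Suc.prems(4) by (intro sum.remove) auto
  moreover have "(\<Sum>q\<in>C. G (?lo q) (?hi q)) = G (?lo p) (?hi p) + (\<Sum>q\<in>C-{p}. G (?lo q) (?hi q))"
    using p(1) Suc.prems(4) by (intro sum.remove) auto
  ultimately show ?case using IH by linarith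
qed

lemma exhaust_by_finite_sets:
  assumes "countable C"
  obtains F :: "nat \<Rightarrow> 'b set" where "\<And>n. finite (F n)" "\<And>n. F n \<subseteq> C" "mono F" "(\<Union>n. F n) = C"
proof
  let ?F = "\<lambda>n. from_nat_into C ` {..n} \<inter> C"
  show "mono ?F" by (intro monoI) (auto intro: image_mono)
  show "(\<Union>n. ?F n) = C"
  proof (intro equalityI subsetI)
    fix x assume x: "x \<in> C"
    then obtain n where "from_nat_into C n = x" using from_nat_into_surj[OF assms] by blast
    then show "x \<in> (\<Union>n. ?F n)" using x by blast
  qed auto
qed auto

text \<open>It suffices that at almost every \<open>t\<close>, at every scale, some single
  \<open>s\<close> has a small quotient: such pairs form a Vitali cover. Disjoint intervals from it
  are paid by \<open>h\<close> up to a Henstock error, and the gaps by \<open>g\<close>, whose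
  integral over them tends to 0.\<close>

lemma dist_le_integral_of_lower_speed:
  fixes \<gamma> :: "real \<Rightarrow> 'a::metric_space" and g h :: "real \<Rightarrow> real"
  assumes g: "set_integrable lebesgue {0..1} g" and h: "set_integrable lebesgue {0..1} h"
    and ac: "\<And>s t. 0 \<le> s \<Longrightarrow> s \<le> t \<Longrightarrow> t \<le> 1 \<Longrightarrow> dist (\<gamma> s) (\<gamma> t) \<le> (LINT r:{s..t}|lebesgue. g r)"
    and nonneg: "\<And>t. 0 \<le> g t" "\<And>t. 0 \<le> h t"
    and N: "negligible N"
    and low: "\<And>t e r. t \<in> {0<..<1} - N \<Longrightarrow> 0 < e \<Longrightarrow> 0 < r \<Longrightarrow>
      \<exists>s\<in>{0<..<1}. s \<noteq> t \<and> \<bar>s - t\<bar> < r \<and> dist (\<gamma> s) (\<gamma> t) \<le> (h t + e) * \<bar>s - t\<bar>"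
    and ab: "0 \<le> a" "a \<le> b" "b \<le> 1"
  shows "dist (\<gamma> a) (\<gamma> b) \<le> (LINT r:{a..b}|lebesgue. h r)"
proof (cases "a = b")
  case True
  then show ?thesis using nonneg(2) by (simp add: set_lebesgue_integral_def)
next
  case False
  then have "a < b" using ab by simp
  have gi: "set_integrable lebesgue S g" if "S \<subseteq> {0..1}" "S \<in> sets lebesgue" for S
    using that by (intro set_integrable_subset[OF g]) auto
  have hi: "set_integrable lebesgue S h" if "S \<subseteq> {0..1}" "S \<in> sets lebesgue" for S
    using that by (intro set_integrable_subset[OF h]) auto
  let ?G = "\<lambda>u v. LINT r:{u..v}|lebesgue. g r"
  have G_add: "?G u w = ?G u v + ?G v w" if "a \<le> u" "u \<le> v" "v \<le> w" "w \<le> b" for u v w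
  proof -
    have "{u..w} \<subseteq> {0..1}" "{u..v} \<subseteq> {0..1}" "{v..w} \<subseteq> {0..1}" using that ab by auto
    then show ?thesis
      using that Henstock_Kurzweil_Integration.integral_combine[of u v w g]
        set_lebesgue_integral_eq_integral[OF gi] by simp
  qed
  show ?thesis
  proof (rule field_le_epsilon)
    fix e0 :: real assume e0: "0 < e0"
    \<comment> \<open>Three errors: the gaps, the Henstock sum, and the slack
      \<open>e * \<bar>s - t\<bar>\<close>, which sums to at most \<open>e\<close> because disjoint
      intervals in [0, 1] have total length at most 1.\<close>
    define e where "e = e0 / 3"
    have e: "0 < e" using e0 by (simp add: e_def)
    let ?P = "\<lambda>t s. dist (\<gamma> s) (\<gamma> t) \<le> (h t + e) * \<bar>s - t\<bar>"
    let ?S = "{a<..<b} - N"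
    have hab: "h integrable_on {a..b}"
      using set_lebesgue_integral_eq_integral(1)[OF hi[of "{a..b}"]] ab by auto
    have cov: "\<forall>t\<in>?S. \<forall>r>0. \<exists>s\<in>{a<..<b}. s \<noteq> t \<and> \<bar>s - t\<bar> < r \<and> ?P t s"
    proof (intro ballI allI impI)
      fix t r :: real assume t: "t \<in> ?S" and r: "0 < r"
      have "0 < min r (min (t - a) (b - t))" "t \<in> {0<..<1} - N" using t r ab by auto
      from low[OF this(2) e this(1)] obtain s where "s \<noteq> t" "\<bar>s - t\<bar> < min r (min (t - a) (b - t))" "?P t s"
        by blast
      then show "\<exists>s\<in>{a<..<b}. s \<noteq> t \<and> \<bar>s - t\<bar> < r \<and> ?P t s" by (intro bexI[of _ s]) auto
    qed
    have "?S \<subseteq> {a<..<b}" by auto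
    obtain C where "countable C"
      "\<forall>p\<in>C. fst p \<in> ?S \<and> snd p \<in> {a<..<b} \<and> snd p \<noteq> fst p \<and> ?P (fst p) (snd p)"
      "\<forall>p\<in>C. \<forall>q\<in>C. p \<noteq> q \<longrightarrow> seg p \<inter> seg q = {}"
      "negligible (?S - (\<Union>p\<in>C. seg p))"
      "\<forall>C0. finite C0 \<and> C0 \<subseteq> C \<longrightarrow>
        (\<Sum>p\<in>C0. \<bar>\<bar>snd p - fst p\<bar> * h (fst p) - integral (seg p) h\<bar>) < e"
      using vitali_henstock[OF hab e \<open>?S \<subseteq> {a<..<b}\<close> cov] by (elim exE conjE) (rule that)
    note C = this(1) this(2,3)[rule_format] this(4) this(5)[rule_format, OF conjI]
    obtain F :: "nat \<Rightarrow> _" where F: "\<And>n. finite (F n)" "\<And>n. F n \<subseteq> C" "mono F" "(\<Union>n. F n) = C"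
      using exhaust_by_finite_sets[OF C(1)] by metis
    have sub: "seg p \<subseteq> {a<..<b}" if "p \<in> C" for p
      using C(2)[OF that] by (intro seg_subset) auto
    have segm [measurable]: "seg p \<in> sets lebesgue" for p using seg_lmeasurable fmeasurableD by blast
    let ?U = "\<lambda>n. \<Union>p\<in>F n. seg p"
    have Um [measurable]: "?U n \<in> sets lebesgue" for n
      using F(1) by (intro sets.finite_UN) auto
    have U_sub: "?U n \<subseteq> {a..b}" for n
      using sub F(2)[of n] greaterThanLessThan_subseteq_atLeastAtMost_iff[of a b a b] by fastforce
    have disj: "disjoint_family_on seg (F n)" for n
      using C(3) F(2)[of n] unfolding disjoint_family_on_def by blast
    \<comment> \<open>The finite unions exhaust \<open>{a..b}\<close> up to a null set, so dominated
      convergence makes the cost of the gaps vanish.\<close>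
    have "(\<lambda>n. LINT x|lebesgue. indicator ({a..b} - ?U n) x * g x) \<longlonglongrightarrow> (LINT x::real|lebesgue. 0)"
    proof (rule integral_dominated_convergence)
      show "integrable lebesgue (\<lambda>x. indicator {a..b} x * g x)"
        using gi[of "{a..b}"] ab by (auto simp: set_integrable_def)
      have *: "set_integrable lebesgue ({a..b} - ?U n) g" for n
        using ab by (intro gi) auto
      show "(\<lambda>x. indicator ({a..b} - ?U n) x * g x) \<in> borel_measurable lebesgue" for n
        using *[of n] by (auto simp: set_integrable_def)
      show "AE x in lebesgue. norm (indicator ({a..b} - ?U n) x * g x) \<le> indicator {a..b} x * g x" for n
        using nonneg by (intro AE_I2) (auto simp: indicator_def)
      have neg: "negligible ((?S - (\<Union>p\<in>C. seg p)) \<union> N \<union> {a} \<union> {b})"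
        using C(4) N by auto
      have *: "(\<lambda>n. indicator ({a..b} - ?U n) x * g x) \<longlonglongrightarrow> 0"
        if x: "x \<notin> (?S - (\<Union>p\<in>C. seg p)) \<union> N \<union> {a} \<union> {b}" for x
      proof (cases "x \<in> {a..b}")
        case True
        then have "x \<in> (\<Union>p\<in>C. seg p)" using x by auto
        then obtain k p where p: "p \<in> F k" "x \<in> seg p" using F(4) by blast
        have "\<forall>n\<ge>k. indicator ({a..b} - ?U n) x * g x = 0"
        proof (intro allI impI)
          fix n assume "k \<le> n"
          then have "p \<in> F n" using p(1) monoD[OF F(3)] by blast
          then show "indicator ({a..b} - ?U n) x * g x = 0" using p(2) by (auto simp: indicator_def)
        qed
        then show ?thesis by (intro tendsto_eventually) (auto simp: eventually_sequentially)
      next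
        case False
        then have "(\<lambda>n. indicator ({a..b} - ?U n) x * g x) = (\<lambda>n. 0)"
          by (intro ext) (auto simp: indicator_def)
        then show ?thesis by simp
      qed
      show "AE x in lebesgue. (\<lambda>n. indicator ({a..b} - ?U n) x * g x) \<longlonglongrightarrow> 0"
        using neg * unfolding negligible_iff_null_sets by (intro AE_I'[of "(?S - (\<Union>p\<in>C. seg p)) \<union> N \<union> {a} \<union> {b}"]) blast+
    qed auto
    then have "(\<lambda>n. LINT x:({a..b} - ?U n)|lebesgue. g x) \<longlonglongrightarrow> 0"
      by (simp add: set_lebesgue_integral_def)
    then have "\<forall>\<^sub>F n in sequentially. (LINT x:({a..b} - ?U n)|lebesgue. g x) < e"
      using e by (rule order_tendstoD)
    then obtain n where n: "(LINT x:({a..b} - ?U n)|lebesgue. g x) < e"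
      by (auto simp: eventually_sequentially)
    have seg01: "seg p \<subseteq> {0..1}" if "p \<in> F n" for p using sub[of p] F(2)[of n] that ab by fastforce
    have "?G a b = (LINT x:(({a..b} - ?U n) \<union> ?U n)|lebesgue. g x)"
      using U_sub[of n] by (simp add: Un_absorb2)
    also have "\<dots> = (LINT x:({a..b} - ?U n)|lebesgue. g x) + (LINT x:?U n|lebesgue. g x)"
      using ab U_sub[of n] by (intro set_integral_Un gi) auto
    also have "(LINT x:?U n|lebesgue. g x) = (\<Sum>p\<in>F n. LINT x:seg p|lebesgue. g x)"
      using disj[of n] seg01 by (intro set_integral_finite_Union F gi) auto
    finally have Gsum: "?G a b - (\<Sum>p\<in>F n. LINT x:seg p|lebesgue. g x) < e" using n by simp
    have "dist (\<gamma> a) (\<gamma> b) \<le> (\<Sum>p\<in>F n. dist (\<gamma> (min (fst p) (snd p))) (\<gamma> (max (fst p) (snd p)))) + ?G a b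
      - (\<Sum>p\<in>F n. ?G (min (fst p) (snd p)) (max (fst p) (snd p)))"
    proof (rule chain_bound[where D = "\<lambda>u v. dist (\<gamma> u) (\<gamma> v)" and G = ?G])
      show "seg p \<subseteq> {a..b}" if "p \<in> F n" for p using sub[of p] F(2)[of n] that by fastforce
      show "seg p \<inter> seg q = {}" if "p \<in> F n" "q \<in> F n" "p \<noteq> q" for p q
        using C(3)[of p q] F(2)[of n] that by blast
      show "?G u w = ?G u v + ?G v w" if "a \<le> u" "u \<le> v" "v \<le> w" "w \<le> b" for u v w
        by (rule G_add) fact+
      show "dist (\<gamma> u) (\<gamma> v) \<le> ?G u v" if "a \<le> u" "u \<le> v" "v \<le> b" for u v
        using that ab by (intro ac) auto
    qed (use F(1) ab in \<open>auto intro: dist_triangle\<close>)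
    also have "(\<Sum>p\<in>F n. dist (\<gamma> (min (fst p) (snd p))) (\<gamma> (max (fst p) (snd p))))
      = (\<Sum>p\<in>F n. dist (\<gamma> (snd p)) (\<gamma> (fst p)))"
      by (intro sum.cong) (auto simp: min_def max_def dist_commute)
    also have "\<dots> \<le> (\<Sum>p\<in>F n. \<bar>snd p - fst p\<bar> * h (fst p) + e * \<bar>snd p - fst p\<bar>)"
      using C(2) F(2)[of n] by (intro sum_mono) (force simp: algebra_simps)
    also have "\<dots> \<le> (\<Sum>p\<in>F n. (LINT x:seg p|lebesgue. h x) 
        + \<bar>\<bar>snd p - fst p\<bar> * h (fst p) - integral (seg p) h\<bar> + e * \<bar>snd p - fst p\<bar>)"
      using set_lebesgue_integral_eq_integral(2)[OF hi[OF seg01 segm]] by (intro sum_mono) auto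
    also have "\<dots> = (\<Sum>p\<in>F n. (LINT x:seg p|lebesgue. h x))
        + (\<Sum>p\<in>F n. \<bar>\<bar>snd p - fst p\<bar> * h (fst p) - integral (seg p) h\<bar>) + e * (\<Sum>p\<in>F n. \<bar>snd p - fst p\<bar>)"
      by (simp add: sum.distrib sum_distrib_left)
    also have "(\<Sum>p\<in>F n. (LINT x:seg p|lebesgue. h x)) = (LINT x:?U n|lebesgue. h x)"
      using disj[of n] seg01 by (intro set_integral_finite_Union[symmetric] F hi) auto
    also have "\<dots> \<le> (LINT x:{a..b}|lebesgue. h x)"
    proof -
      have "?U n \<subseteq> {0..1}" "{a..b} \<subseteq> {0..1}" using U_sub[of n] ab by auto
      then show ?thesis
        using nonneg(2) U_sub[of n] hi[OF _ Um, of n] hi[of "{a..b}"]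
        unfolding set_lebesgue_integral_def set_integrable_def
        by (intro integral_mono) (auto simp: indicator_def)
    qed
    also have "(\<Sum>p\<in>F n. \<bar>\<bar>snd p - fst p\<bar> * h (fst p) - integral (seg p) h\<bar>) \<le> e"
      using C(5)[OF F(1,2)] less_imp_le by blast
    also have "(\<Sum>p\<in>F n. \<bar>snd p - fst p\<bar>) = measure lebesgue (?U n)"
      using C(3) F(1,2) by (intro measure_UN_seg[symmetric]) blast+
    also have "measure lebesgue (?U n) \<le> measure lebesgue {a..b}"
      using U_sub[of n] Um by (intro measure_mono_fmeasurable) auto
    also have "measure lebesgue {a..b} \<le> 1" using ab by simp
    finally have "dist (\<gamma> a) (\<gamma> b) \<le> (LINT x:{a..b}|lebesgue. h x) + e + e * 1 + ?G a b
      - (\<Sum>p\<in>F n. ?G (min (fst p) (snd p)) (max (fst p) (snd p)))" using e by simp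
    then show "dist (\<gamma> a) (\<gamma> b) \<le> (LINT r:{a..b}|lebesgue. h r) + e0"
      using Gsum unfolding seg_def e_def by linarith
  qed
qed

section \<open>Metric speed of absolutely continuous curves\<close>

lemma abs_cont_curve_continuous:
  fixes \<gamma> :: "real \<Rightarrow> 'a::metric_space"
  assumes g: "set_integrable lebesgue {0..1} g"
    and ac: "\<And>s t. 0 \<le> s \<Longrightarrow> s \<le> t \<Longrightarrow> t \<le> 1 \<Longrightarrow> dist (\<gamma> s) (\<gamma> t) \<le> (LINT r:{s..t}|lebesgue. g r)"
  shows "continuous_on {0..1} \<gamma>"
proof -
  let ?F = "\<lambda>x. integral {0..x} g"
  have gi: "g integrable_on {0..1}" using set_lebesgue_integral_eq_integral(1)[OF g] .
  have F: "continuous_on {0..1} ?F" by (rule indefinite_integral_continuous_1[OF gi])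
  have le: "dist (\<gamma> s) (\<gamma> t) \<le> dist (?F s) (?F t)" if "0 \<le> s" "s \<le> t" "t \<le> 1" for s t
  proof -
    have "set_integrable lebesgue {s..t} g" using that by (intro set_integrable_subset[OF g]) auto
    then have "dist (\<gamma> s) (\<gamma> t) \<le> integral {s..t} g"
      using ac[OF that] set_lebesgue_integral_eq_integral(2) by metis
    also have "\<dots> = ?F t - ?F s"
      using that integrable_on_subinterval[OF gi, of 0 t]
        Henstock_Kurzweil_Integration.integral_combine[of 0 s t g] by auto
    finally show ?thesis by (simp add: dist_real_def)
  qed
  have le': "dist (\<gamma> s) (\<gamma> t) \<le> dist (?F s) (?F t)" if "s \<in> {0..1}" "t \<in> {0..1}" for s t
    using le[of s t] le[of t s] that by (cases "s \<le> t") (auto simp: dist_commute)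
  show ?thesis
    unfolding continuous_on_iff
  proof (intro ballI allI impI)
    fix x e :: real assume "x \<in> {0..1}" "0 < e"
    then obtain d where "d > 0" "\<And>y. y \<in> {0..1} \<Longrightarrow> dist y x < d \<Longrightarrow> dist (?F y) (?F x) < e"
      using F unfolding continuous_on_iff by metis
    then show "\<exists>d>0. \<forall>x'\<in>{0..1}. dist x' x < d \<longrightarrow> dist (\<gamma> x') (\<gamma> x) < e"
      using le' \<open>x \<in> {0..1}\<close> by (meson le_less_trans)
  qed
qed

text \<open>Where the limit fails to exist \<open>metric_speed\<close> is arbitrary, so a measurable
  substitute \<open>h\<close> is produced: the lower limit of the quotients. It lies below
  \<open>g\<close> almost everywhere, it already bounds distances by
  \<open>dist_le_integral_of_lower_speed\<close>, and differentiating its integral bounds the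
  quotients from above by \<open>h\<close>. Hence the limit exists almost everywhere and equals
  \<open>h\<close>.\<close>

lemma metric_speed_AE:
  fixes \<gamma> :: "real \<Rightarrow> 'a::metric_space"
  assumes "abs_cont_curve dist \<gamma>"
  obtains h where "\<And>t. 0 \<le> h t" "set_integrable lebesgue {0..1} h"
    "AE t in lebesgue. t \<in> {0..1} \<longrightarrow> metric_speed dist \<gamma> t = h t"
    "\<And>s t. 0 \<le> s \<Longrightarrow> s \<le> t \<Longrightarrow> t \<le> 1 \<Longrightarrow> dist (\<gamma> s) (\<gamma> t) \<le> (LINT r:{s..t}|lebesgue. h r)"
proof -
  obtain g0 where g0: "set_integrable lebesgue {0..1} g0"
      "\<And>s t. 0 \<le> s \<Longrightarrow> s \<le> t \<Longrightarrow> t \<le> 1 \<Longrightarrow> dist (\<gamma> s) (\<gamma> t) \<le> (LINT r:{s..t}|lebesgue. g0 r)"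
    using assms unfolding abs_cont_curve_def by blast
  \<comment> \<open>\<open>abs_cont_curve\<close> does not ask for a nonnegative integrand, whereas
    the covering argument does.\<close>
  define g where "g = (\<lambda>t. \<bar>g0 t\<bar>)"
  have g: "set_integrable lebesgue {0..1} g"
    unfolding g_def by (rule set_integrable_abs[OF g0(1)])
  have gsub: "set_integrable lebesgue {s..t} g" if "0 \<le> s" "t \<le> 1" for s t
    using that by (intro set_integrable_subset[OF g]) auto
  have ac: "dist (\<gamma> s) (\<gamma> t) \<le> (LINT r:{s..t}|lebesgue. g r)" if "0 \<le> s" "s \<le> t" "t \<le> 1" for s t
  proof -
    have "set_integrable lebesgue {s..t} g0" using that by (intro set_integrable_subset[OF g0(1)]) auto
    then have "(LINT r:{s..t}|lebesgue. g0 r) \<le> (LINT r:{s..t}|lebesgue. g r)"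
      using gsub[of s t] that by (intro set_integral_mono) (auto simp: g_def)
    then show ?thesis using g0(2)[OF that] by simp
  qed
  have cont: "continuous_on {0..1} \<gamma>" using g ac by (rule abs_cont_curve_continuous)
  have acseg: "dist (\<gamma> s) (\<gamma> t) \<le> integral (seg (t, s)) k"
    if k: "set_integrable lebesgue {0..1} k"
      "\<And>s t. 0 \<le> s \<Longrightarrow> s \<le> t \<Longrightarrow> t \<le> 1 \<Longrightarrow> dist (\<gamma> s) (\<gamma> t) \<le> (LINT r:{s..t}|lebesgue. k r)"
    and st: "s \<in> {0..1}" "t \<in> {0..1}" for k s t
  proof -
    have "set_integrable lebesgue {u..v} k" if "0 \<le> u" "v \<le> 1" for u v
      using that by (intro set_integrable_subset[OF k(1)]) auto
    note * = set_lebesgue_integral_eq_integral(2)[OF this]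
    show ?thesis
      using k(2)[of s t] k(2)[of t s] *[of s t] *[of t s] st
      by (cases "s \<le> t") (auto simp: seg_def dist_commute)
  qed
  \<comment> \<open>The lower limit is a \<open>SUP\<close> over scales of an \<open>INF\<close>
    over \<open>s\<close>; both variables stay in the open interval because nothing is known about
    the curve outside [0, 1].\<close>
  define I where "I n t = (INF s\<in>{s\<in>{0<..<1}. s \<noteq> t \<and> \<bar>s - t\<bar> < 1 / Suc n}. ennreal (dist (\<gamma> s) (\<gamma> t) / \<bar>s - t\<bar>))"
    for n :: nat and t :: real
  define J where "J t = (SUP n. indicator {0<..<1} t * I n t)" for t :: real
  have J: "J t = (SUP n. I n t)" if "t \<in> {0<..<1}" for t using that by (simp add: J_def)
  \<comment> \<open>Measurable although the infimum runs over uncountably many \<open>s\<close>: for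
    fixed \<open>s\<close> the quotient is continuous in \<open>t\<close>, so the sublevel sets
    inside the open interval are unions of open sets.\<close>
  have "(\<lambda>t. indicator {0<..<1} t * I n t) \<in> borel_measurable borel" for n
  proof (rule borel_measurableI_less)
    fix c :: ennreal
    let ?A = "\<lambda>s. {t\<in>{0<..<1}. t \<noteq> s \<and> \<bar>s - t\<bar> < 1 / Suc n}"
    have "open (?A s)" for s
    proof -
      have "?A s = {0<..<1} \<inter> - {s} \<inter> ball s (1 / Suc n)" by (auto simp: dist_real_def)
      then show ?thesis by (metis open_Compl open_Int open_ball open_greaterThanLessThan closed_singleton)
    qed
    moreover have "continuous_on (?A s) (\<lambda>t. ennreal (dist (\<gamma> s) (\<gamma> t) / \<bar>s - t\<bar>))" for s
      by (intro continuous_on_ennreal continuous_intros continuous_on_subset[OF cont]) auto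
    ultimately have "open (?A s \<inter> (\<lambda>t. ennreal (dist (\<gamma> s) (\<gamma> t) / \<bar>s - t\<bar>)) -` {..<c})" for s
      by (intro continuous_open_preimage) auto
    then have "open (\<Union>s\<in>{0<..<1}. ?A s \<inter> (\<lambda>t. ennreal (dist (\<gamma> s) (\<gamma> t) / \<bar>s - t\<bar>)) -` {..<c})"
      by blast
    also have "(\<Union>s\<in>{0<..<1}. ?A s \<inter> (\<lambda>t. ennreal (dist (\<gamma> s) (\<gamma> t) / \<bar>s - t\<bar>)) -` {..<c})
        = {t\<in>{0<..<1}. I n t < c}"
      unfolding I_def INF_less_iff by auto
    finally have "open {t\<in>{0<..<1}. I n t < c}" .
    moreover have "{t \<in> space borel. indicator {0<..<1} t * I n t < c} =
        {t\<in>{0<..<1}. I n t < c} \<union> (if 0 < c then - {0<..<1} else {})"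
      by (auto simp: indicator_def split: if_splits)
    ultimately show "{t \<in> space borel. indicator {0<..<1} t * I n t < c} \<in> sets borel"
      by auto
  qed
  then have Jm: "J \<in> borel_measurable borel" unfolding J_def by measurable
  define N1 where "N1 = {t \<in> {0<..<1}. \<not> (\<forall>e>0. \<exists>r>0. \<forall>s\<in>{0<..<1}. \<bar>s - t\<bar> < r \<longrightarrow>
    \<bar>\<bar>s - t\<bar> * g t - integral (seg (t, s)) g\<bar> \<le> e * \<bar>s - t\<bar>)}"
  have N1: "negligible N1"
    unfolding N1_def by (rule lebesgue_differentiation[OF set_lebesgue_integral_eq_integral(1)[OF g]])
  have J_le: "J t \<le> ennreal (g t)" if t: "t \<in> {0<..<1} - N1" for t
    unfolding J[OF DiffD1[OF t]]
  proof (rule SUP_least)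
    fix n
    show "I n t \<le> ennreal (g t)"
    proof (rule ennreal_le_epsilon)
      fix e :: real assume e: "0 < e"
      obtain r where r: "r > 0" "\<And>s. s\<in>{0<..<1} \<Longrightarrow> \<bar>s - t\<bar> < r \<Longrightarrow>
          \<bar>\<bar>s - t\<bar> * g t - integral (seg (t, s)) g\<bar> \<le> e * \<bar>s - t\<bar>"
        using t e unfolding N1_def by blast
      define q where "q = min (min r (1 / Suc n)) (1 - t)"
      define s where "s = t + q / 2"
      have q: "0 < q" "q \<le> r" "q \<le> 1 / Suc n" "q \<le> 1 - t" using r t by (auto simp: q_def)
      have "s \<in> {0<..<1}" "s \<noteq> t" "\<bar>s - t\<bar> < q"
        using q(1,4) t by (auto simp: s_def)
      then have s: "s \<in> {0<..<1}" "s \<noteq> t" "\<bar>s - t\<bar> < r" "\<bar>s - t\<bar> < 1 / Suc n"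
        using q(2,3) by auto
      have "dist (\<gamma> s) (\<gamma> t) \<le> integral (seg (t, s)) g"
        using s(1) t by (intro acseg g ac) auto
      also have "\<dots> \<le> (g t + e) * \<bar>s - t\<bar>" using r(2)[OF s(1,3)] by (simp add: algebra_simps)
      finally have "dist (\<gamma> s) (\<gamma> t) / \<bar>s - t\<bar> \<le> g t + e" using s(2) by (simp add: divide_le_eq)
      then have "I n t \<le> ennreal (g t + e)"
        unfolding I_def using s by (intro INF_lower2[of s]) (auto intro: ennreal_leI)
      then show "I n t \<le> ennreal (g t) + ennreal e" using e by (simp add: g_def)
    qed
  qed
  define h where "h t = enn2real (J t)" for t
  have h0: "0 \<le> h t" for t by (simp add: h_def)
  have h_ennreal: "ennreal (h t) = J t" if "t \<in> {0<..<1} - N1" for t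
  proof -
    have "J t < top" using J_le[OF that] by (rule order.strict_trans1) simp
    then show ?thesis by (simp add: h_def)
  qed
  have ae: "AE t in lebesgue. t \<notin> N" if "negligible N" for N :: "real set"
    using that unfolding negligible_iff_null_sets by (rule AE_not_in)
  have h: "set_integrable lebesgue {0..1} h"
    unfolding set_integrable_def
  proof (rule Bochner_Integration.integrable_bound)
    show "integrable lebesgue (\<lambda>x. indicator {0..1} x *\<^sub>R g x)"
      using g by (simp add: set_integrable_def)
    have "h \<in> borel_measurable borel" unfolding h_def using Jm by (rule borel_measurable_enn2real)
    then have "h \<in> borel_measurable lebesgue" by (intro measurable_completion) simp
    then show "(\<lambda>x. indicator {0..1} x *\<^sub>R h x) \<in> borel_measurable lebesgue"
      by (intro borel_measurable_scaleR borel_measurable_indicator) auto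
    have "negligible (N1 \<union> {0} \<union> {1})" using N1 by simp
    from ae[OF this] show "AE x in lebesgue. norm (indicator {0..1} x *\<^sub>R h x) \<le> norm (indicator {0..1} x *\<^sub>R g x)"
    proof eventually_elim
      case (elim x)
      show ?case
      proof (cases "x \<in> {0..1}")
        case True
        then have x: "x \<in> {0<..<1} - N1" using elim by auto
        have "ennreal (h x) \<le> ennreal (g x)" using J_le[OF x] h_ennreal[OF x] by simp
        then show ?thesis using h0[of x] by (auto simp: g_def ennreal_le_iff indicator_def)
      qed simp
    qed
  qed
  have low: "\<exists>s\<in>{0<..<1}. s \<noteq> t \<and> \<bar>s - t\<bar> < r \<and> dist (\<gamma> s) (\<gamma> t) \<le> (h t + e) * \<bar>s - t\<bar>"
    if t: "t \<in> {0<..<1} - N1" and e: "0 < e" and r: "0 < r" for t e r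
  proof -
    obtain n where n: "1 / Suc n < r" using r nat_approx_posE by (metis of_nat_Suc)
    have "I n t \<le> J t" using t by (subst J) (auto intro: SUP_upper)
    also have "J t < ennreal (h t + e)"
      unfolding h_ennreal[OF t, symmetric] using e h0[of t] by (simp add: ennreal_lessI)
    finally obtain s where s: "s \<in> {0<..<1}" "s \<noteq> t" "\<bar>s - t\<bar> < 1 / Suc n"
        "ennreal (dist (\<gamma> s) (\<gamma> t) / \<bar>s - t\<bar>) < ennreal (h t + e)"
      unfolding I_def INF_less_iff by auto
    have "dist (\<gamma> s) (\<gamma> t) / \<bar>s - t\<bar> < h t + e" using s(4) by (simp add: ennreal_less_iff)
    then have "dist (\<gamma> s) (\<gamma> t) \<le> (h t + e) * \<bar>s - t\<bar>" using s(2) by (simp add: field_simps)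
    then show ?thesis using s n by (intro bexI[of _ s]) auto
  qed
  have g_nonneg: "0 \<le> g t" for t by (simp add: g_def)
  \<comment> \<open>From here on \<open>h\<close> replaces \<open>g\<close> as an integrand
    dominating the distances, so that Lebesgue differentiation of \<open>h\<close> applies to the
    quotients.\<close>
  have dist_h: "dist (\<gamma> s) (\<gamma> t) \<le> (LINT r:{s..t}|lebesgue. h r)" if "0 \<le> s" "s \<le> t" "t \<le> 1" for s t
    by (rule dist_le_integral_of_lower_speed[OF g h ac g_nonneg h0 N1 low that])
  define N2 where "N2 = {t \<in> {0<..<1}. \<not> (\<forall>e>0. \<exists>r>0. \<forall>s\<in>{0<..<1}. \<bar>s - t\<bar> < r \<longrightarrow>
    \<bar>\<bar>s - t\<bar> * h t - integral (seg (t, s)) h\<bar> \<le> e * \<bar>s - t\<bar>)}"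
  have N2: "negligible N2"
    unfolding N2_def by (rule lebesgue_differentiation[OF set_lebesgue_integral_eq_integral(1)[OF h]])
  have speed: "metric_speed dist \<gamma> t = h t" if t: "t \<in> {0<..<1} - (N1 \<union> N2)" for t
    unfolding metric_speed_def
  proof (rule tendsto_Lim)
    have "t islimpt {0..1}" using t by (auto simp: islimpt_Icc)
    then show "at t within {0..1} \<noteq> bot" by (simp add: trivial_limit_within)
    show "((\<lambda>s. dist (\<gamma> s) (\<gamma> t) / \<bar>s - t\<bar>) \<longlongrightarrow> h t) (at t within {0..1})"
    proof (rule tendstoI)
      fix e0 :: real assume "0 < e0"
      define e where "e = e0 / 2"
      have e: "0 < e" "e < e0" using \<open>0 < e0\<close> by (auto simp: e_def)
      obtain r1 where r1: "r1 > 0" "\<And>s. s\<in>{0<..<1} \<Longrightarrow> \<bar>s - t\<bar> < r1 \<Longrightarrow>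
          \<bar>\<bar>s - t\<bar> * h t - integral (seg (t, s)) h\<bar> \<le> e * \<bar>s - t\<bar>"
        using t e(1) unfolding N2_def by blast
      have "\<exists>r2>0. \<forall>s\<in>{0<..<1}. s \<noteq> t \<and> \<bar>s - t\<bar> < r2 \<longrightarrow> h t - e \<le> dist (\<gamma> s) (\<gamma> t) / \<bar>s - t\<bar>"
      proof (cases "h t - e \<le> 0")
        case True
        have "h t - e \<le> dist (\<gamma> s) (\<gamma> t) / \<bar>s - t\<bar>" for s
          by (rule order_trans[OF True]) simp
        then show ?thesis by (intro exI[of _ 1]) auto
      next
        case False
        then have "ennreal (h t - e) < J t"
          using t e(1) by (subst h_ennreal[symmetric]) (auto simp: ennreal_less_iff)
        then obtain n where n: "ennreal (h t - e) < I n t"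
          using t by (subst (asm) J) (auto simp: less_SUP_iff)
        show ?thesis
        proof (intro exI[of _ "1 / Suc n"] conjI ballI impI)
          fix s assume s: "s \<in> {0<..<1}" "s \<noteq> t \<and> \<bar>s - t\<bar> < 1 / real (Suc n)"
          have "I n t \<le> ennreal (dist (\<gamma> s) (\<gamma> t) / \<bar>s - t\<bar>)"
            unfolding I_def using s by (intro INF_lower) auto
          with n have "ennreal (h t - e) < ennreal (dist (\<gamma> s) (\<gamma> t) / \<bar>s - t\<bar>)" by (rule less_le_trans)
          then show "h t - e \<le> dist (\<gamma> s) (\<gamma> t) / \<bar>s - t\<bar>" using False by (simp add: ennreal_less_iff)
        qed simp
      qed
      then obtain r2 where r2: "r2 > 0"
        "\<And>s. s\<in>{0<..<1} \<Longrightarrow> s \<noteq> t \<Longrightarrow> \<bar>s - t\<bar> < r2 \<Longrightarrow> h t - e \<le> dist (\<gamma> s) (\<gamma> t) / \<bar>s - t\<bar>" by blast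
      let ?r = "min (min r1 r2) (min t (1 - t))"
      have "0 < ?r" using r1(1) r2(1) t by auto
      moreover have "dist (dist (\<gamma> s) (\<gamma> t) / \<bar>s - t\<bar>) (h t) < e0" if s: "s \<noteq> t" "dist s t < ?r" for s
      proof -
        have s': "s \<in> {0<..<1}" "\<bar>s - t\<bar> < r1" "\<bar>s - t\<bar> < r2"
          using s by (auto simp: dist_real_def)
        have "dist (\<gamma> s) (\<gamma> t) \<le> integral (seg (t, s)) h"
          using s'(1) t by (intro acseg h dist_h) auto
        also have "\<dots> \<le> (h t + e) * \<bar>s - t\<bar>" using r1(2)[OF s'(1,2)] by (simp add: algebra_simps)
        finally have "dist (\<gamma> s) (\<gamma> t) / \<bar>s - t\<bar> \<le> h t + e" using s(1) by (simp add: divide_le_eq)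
        then show ?thesis using r2(2)[OF s'(1) s(1) s'(3)] e(2) unfolding dist_real_def by linarith
      qed
      ultimately show "\<forall>\<^sub>F s in at t within {0..1}. dist (dist (\<gamma> s) (\<gamma> t) / \<bar>s - t\<bar>) (h t) < e0"
        unfolding eventually_at by blast
    qed
  qed
  have "negligible (N1 \<union> N2 \<union> {0} \<union> {1})" using N1 N2 by simp
  from ae[OF this] have "AE t in lebesgue. t \<in> {0..1} \<longrightarrow> metric_speed dist \<gamma> t = h t"
    by eventually_elim (auto intro!: speed simp: less_le)
  then show thesis by (intro that[OF h0 h _ dist_h])
qed

text \<open>Only the part up to time \<open>T\<close> is counted: a curve may leave the region where
  \<open>w\<close> is at least \<open>c\<close>, and it is then stopped at its first exit.\<close>

lemma weighted_length_ge:
  fixes \<gamma> :: "real \<Rightarrow> 'a::metric_space"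
  assumes \<gamma>: "abs_cont_curve dist \<gamma>" and T: "0 \<le> T" "T \<le> 1"
    and c: "\<And>t. 0 \<le> t \<Longrightarrow> t \<le> T \<Longrightarrow> c \<le> w (\<gamma> t)"
  shows "ennreal (exp c * dist (\<gamma> 0) (\<gamma> T))
    \<le> (\<integral>\<^sup>+t\<in>{0..1}. ennreal (metric_speed dist \<gamma> t * exp (w (\<gamma> t))) \<partial>lebesgue)"
proof -
  obtain h where h: "\<And>t. 0 \<le> h t" "set_integrable lebesgue {0..1} h"
    "AE t in lebesgue. t \<in> {0..1} \<longrightarrow> metric_speed dist \<gamma> t = h t"
    "\<And>s t. 0 \<le> s \<Longrightarrow> s \<le> t \<Longrightarrow> t \<le> 1 \<Longrightarrow> dist (\<gamma> s) (\<gamma> t) \<le> (LINT r:{s..t}|lebesgue. h r)"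
    using metric_speed_AE[OF \<gamma>] by blast
  have hT: "integrable lebesgue (\<lambda>t. exp c * (indicator {0..T} t * h t))"
  proof -
    have "set_integrable lebesgue {0..T} h" using T by (intro set_integrable_subset[OF h(2)]) auto
    then show ?thesis by (simp add: set_integrable_def)
  qed
  have "exp c * dist (\<gamma> 0) (\<gamma> T) \<le> exp c * (LINT r:{0..T}|lebesgue. h r)"
    using h(4)[of 0 T] T by simp
  also have "\<dots> = (LINT t|lebesgue. exp c * (indicator {0..T} t * h t))"
    by (simp add: set_lebesgue_integral_def)
  finally have "ennreal (exp c * dist (\<gamma> 0) (\<gamma> T)) \<le> ennreal (LINT t|lebesgue. exp c * (indicator {0..T} t * h t))"
    by (rule ennreal_leI)
  also have "\<dots> = (\<integral>\<^sup>+t. ennreal (exp c * (indicator {0..T} t * h t)) \<partial>lebesgue)"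
    using h(1) by (intro nn_integral_eq_integral[symmetric] hT) auto
  also have "\<dots> \<le> (\<integral>\<^sup>+t\<in>{0..1}. ennreal (metric_speed dist \<gamma> t * exp (w (\<gamma> t))) \<partial>lebesgue)"
    using h(3)
  proof (intro nn_integral_mono_AE, eventually_elim)
    case (elim t)
    show ?case
    proof (cases "t \<in> {0..T}")
      case True
      then have "exp c * h t \<le> h t * exp (w (\<gamma> t))"
        using c[of t] h(1)[of t] by (subst mult.commute, intro mult_left_mono) auto
      then show ?thesis using True elim T by (auto simp: indicator_def intro!: ennreal_leI)
    qed simp
  qed
  finally show ?thesis .
qed

text \<open>A constant speed geodesic is the competitor; it stays within \<open>dist x y\<close> of
  \<open>x\<close>, where \<open>w\<close> is at most \<open>c\<close>. The bound is for the infimum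
  before \<open>enn2real\<close>, because \<open>enn2real\<close> sends infinity to 0 and lower
  bounds therefore require finiteness.\<close>

lemma conformal_dist_le:
  fixes x y :: "'a::metric_space"
  assumes geo: "geodesic_distance (dist :: 'a \<Rightarrow> 'a \<Rightarrow> real)"
    and c: "\<And>z. dist x z \<le> dist x y \<Longrightarrow> w z \<le> c"
  shows "(INF \<gamma>\<in>{\<gamma>. abs_cont_curve dist \<gamma> \<and> \<gamma> 0 = x \<and> \<gamma> 1 = y}.
      \<integral>\<^sup>+t\<in>{0..1}. ennreal (metric_speed dist \<gamma> t * exp (w (\<gamma> t))) \<partial>lebesgue) \<le> ennreal (exp c * dist x y)"
proof -
  obtain \<gamma> where \<gamma>: "\<gamma> 0 = x" "\<gamma> 1 = y"
      "\<And>s t. s \<in> {0..1} \<Longrightarrow> t \<in> {0..1} \<Longrightarrow> dist (\<gamma> s) (\<gamma> t) = \<bar>s - t\<bar> * dist x y"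
    using geo unfolding geodesic_distance_def by blast
  have "abs_cont_curve dist \<gamma>"
    unfolding abs_cont_curve_def
  proof (intro exI[of _ "\<lambda>_. dist x y"] conjI allI impI)
    show "set_integrable lebesgue {0..1::real} (\<lambda>_. dist x y)"
      by (simp add: set_integrable_def)
    show "dist (\<gamma> s) (\<gamma> t) \<le> (LINT r:{s..t}|lebesgue. dist x y)" if "0 \<le> s \<and> s \<le> t \<and> t \<le> 1" for s t
      using that \<gamma>(3)[of s t] by (simp add: set_lebesgue_integral_def)
  qed
  have speed: "metric_speed dist \<gamma> t = dist x y" if t: "t \<in> {0..1}" for t
    unfolding metric_speed_def
  proof (rule tendsto_Lim)
    have "t islimpt {0..1}" using t by (auto simp: islimpt_Icc)
    then show "at t within {0..1} \<noteq> bot" by (simp add: trivial_limit_within)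
    have "\<forall>\<^sub>F s in at t within {0..1}. dist x y = dist (\<gamma> s) (\<gamma> t) / \<bar>s - t\<bar>"
      unfolding eventually_at using \<gamma>(3) t by (intro exI[of _ 1]) auto
    then show "((\<lambda>s. dist (\<gamma> s) (\<gamma> t) / \<bar>s - t\<bar>) \<longlongrightarrow> dist x y) (at t within {0..1})"
      by (rule Lim_transform_eventually[OF tendsto_const])
  qed
  have "(INF \<gamma>\<in>{\<gamma>. abs_cont_curve dist \<gamma> \<and> \<gamma> 0 = x \<and> \<gamma> 1 = y}.
      \<integral>\<^sup>+t\<in>{0..1}. ennreal (metric_speed dist \<gamma> t * exp (w (\<gamma> t))) \<partial>lebesgue)
    \<le> (\<integral>\<^sup>+t\<in>{0..1}. ennreal (metric_speed dist \<gamma> t * exp (w (\<gamma> t))) \<partial>lebesgue)"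
    using \<open>abs_cont_curve dist \<gamma>\<close> \<gamma>(1,2) by (intro INF_lower) auto
  also have "\<dots> \<le> (\<integral>\<^sup>+t. ennreal (exp c * dist x y) * indicator {0..1::real} t \<partial>lebesgue)"
  proof (intro nn_integral_mono)
    fix t :: real
    show "ennreal (metric_speed dist \<gamma> t * exp (w (\<gamma> t))) * indicator {0..1} t
        \<le> ennreal (exp c * dist x y) * indicator {0..1} t"
    proof (cases "t \<in> {0..1}")
      case True
      have "dist x (\<gamma> t) \<le> dist x y"
        using \<gamma>(3)[of 0 t] \<gamma>(1) True by (simp add: mult_left_le_one_le)
      then have "exp (w (\<gamma> t)) \<le> exp c" using c by simp
      then show ?thesis using True speed[OF True]
        by (auto intro!: ennreal_leI mult_left_mono simp: mult.commute[of "exp c"])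
    qed simp
  qed
  also have "\<dots> = ennreal (exp c * dist x y)"
    by (subst nn_integral_cmult_indicator) auto
  finally show ?thesis .
qed

lemma conformal_dist_upper:
  fixes x y :: "'a::metric_space"
  assumes "geodesic_distance (dist :: 'a \<Rightarrow> 'a \<Rightarrow> real)"
    and "\<And>z. dist x z \<le> dist x y \<Longrightarrow> w z \<le> c"
  shows "conformal_dist dist w x y \<le> exp c * dist x y"
  unfolding conformal_dist_def using conformal_dist_le[of x y w c, OF assms]
  by (intro enn2real_leI) auto

text \<open>Either the curve stays in the closed ball of radius \<open>r\<close>, where
  \<open>w\<close> is at least \<open>c\<close>, or it has already paid for a distance
  \<open>r\<close> on reaching the sphere of that radius. Hence the minimum.\<close>

lemma conformal_dist_lower:
  fixes x y :: "'a::metric_space"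
  assumes geo: "geodesic_distance (dist :: 'a \<Rightarrow> 'a \<Rightarrow> real)"
    and w: "bounded (range w)" and r: "0 < r"
    and c: "\<And>z. dist x z \<le> r \<Longrightarrow> c \<le> w z"
  shows "exp c * min (dist x y) r \<le> conformal_dist dist w x y"
proof -
  let ?I = "INF \<gamma>\<in>{\<gamma>. abs_cont_curve dist \<gamma> \<and> \<gamma> 0 = x \<and> \<gamma> 1 = y}.
      \<integral>\<^sup>+t\<in>{0..1}. ennreal (metric_speed dist \<gamma> t * exp (w (\<gamma> t))) \<partial>lebesgue"
  obtain K where K: "\<And>z. w z \<le> K" using w by (auto simp: bounded_iff abs_le_iff)
  have fin: "?I < top" using conformal_dist_le[OF geo, of x y w K] K by (auto intro: le_less_trans)
  have "ennreal (exp c * min (dist x y) r) \<le> ?I"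
  proof (rule INF_greatest)
    fix \<gamma> assume "\<gamma> \<in> {\<gamma>. abs_cont_curve dist \<gamma> \<and> \<gamma> 0 = x \<and> \<gamma> 1 = y}"
    then have \<gamma>: "abs_cont_curve dist \<gamma>" "\<gamma> 0 = x" "\<gamma> 1 = y" by auto
    have "continuous_on {0..1} \<gamma>"
      using \<gamma>(1) abs_cont_curve_continuous unfolding abs_cont_curve_def by blast
    then have cont: "continuous_on {0..1} (\<lambda>t. dist x (\<gamma> t))" by (intro continuous_intros)
    have "\<exists>T. 0 \<le> T \<and> T \<le> 1 \<and> min (dist x y) r \<le> dist x (\<gamma> T) \<and> (\<forall>t. 0 \<le> t \<and> t \<le> T \<longrightarrow> dist x (\<gamma> t) \<le> r)"
    proof (cases "\<forall>t\<in>{0..1}. dist x (\<gamma> t) \<le> r")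
      case True
      then show ?thesis using \<gamma>(3) by (intro exI[of _ 1]) auto
    next
      case False
      then obtain t1 where t1: "0 \<le> t1" "t1 \<le> 1" "r < dist x (\<gamma> t1)" by force
      \<comment> \<open>The first time at distance exactly \<open>r\<close> exists because these
        times form a nonempty compact set; before it the curve cannot exceed \<open>r\<close> by the
        intermediate value theorem.\<close>
      let ?A = "{0..1} \<inter> (\<lambda>t. dist x (\<gamma> t)) -` {r}"
      have hit: "\<exists>t'. 0 \<le> t' \<and> t' \<le> t \<and> dist x (\<gamma> t') = r" if "0 \<le> t" "t \<le> 1" "r < dist x (\<gamma> t)" for t
        using that r \<gamma>(2) by (intro IVT' continuous_on_subset[OF cont]) auto
      have "closed ?A" by (rule continuous_closed_preimage[OF cont]) auto
      then have "compact ?A" by (auto simp: compact_eq_bounded_closed intro: bounded_Int)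
      moreover have "?A \<noteq> {}" using hit[OF t1] t1 by fastforce
      ultimately obtain T where T: "T \<in> ?A" "\<And>t. t \<in> ?A \<Longrightarrow> T \<le> t"
        using compact_attains_inf[of ?A] by blast
      have "dist x (\<gamma> t) \<le> r" if t: "0 \<le> t" "t \<le> T" for t
      proof (rule ccontr)
        assume n: "\<not> ?thesis"
        then obtain t' where "0 \<le> t'" "t' \<le> t" "dist x (\<gamma> t') = r" using hit[of t] t T(1) by auto
        then have "t' = t" using T(2)[of t'] t T(1) by auto
        then show False using n \<open>dist x (\<gamma> t') = r\<close> by simp
      qed
      then show ?thesis using T(1) by (intro exI[of _ T]) auto
    qed
    then obtain T where T: "0 \<le> T" "T \<le> 1" "min (dist x y) r \<le> dist x (\<gamma> T)"
      "\<And>t. 0 \<le> t \<Longrightarrow> t \<le> T \<Longrightarrow> dist x (\<gamma> t) \<le> r" by blast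
    have "ennreal (exp c * min (dist x y) r) \<le> ennreal (exp c * dist (\<gamma> 0) (\<gamma> T))"
      using T(3) \<gamma>(2) by (intro ennreal_leI mult_left_mono) auto
    also have "\<dots> \<le> (\<integral>\<^sup>+t\<in>{0..1}. ennreal (metric_speed dist \<gamma> t * exp (w (\<gamma> t))) \<partial>lebesgue)"
      using T c by (intro weighted_length_ge \<gamma>(1)) auto
    finally show "ennreal (exp c * min (dist x y) r)
      \<le> (\<integral>\<^sup>+t\<in>{0..1}. ennreal (metric_speed dist \<gamma> t * exp (w (\<gamma> t))) \<partial>lebesgue)" .
  qed
  then have "enn2real (ennreal (exp c * min (dist x y) r)) \<le> enn2real ?I"
    using fin by (intro enn2real_mono)
  then show ?thesis unfolding conformal_dist_def using r by simp
qed

lemma conformal_dist_ge_exp: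
  fixes x y :: "'a::metric_space"
  assumes geo: "geodesic_distance (dist :: 'a \<Rightarrow> 'a \<Rightarrow> real)"
    and w: "bounded (range w)" and c: "\<And>z. c \<le> w z"
  shows "exp c * dist x y \<le> conformal_dist dist w x y"
proof (cases "x = y")
  case True
  then show ?thesis by (simp add: conformal_dist_def)
next
  case False
  then show ?thesis using conformal_dist_lower[OF geo w, of "dist x y" x c y] c by simp
qed

lemma conformal_dist_local:
  fixes x :: "'a::metric_space"
  assumes geo: "geodesic_distance (dist :: 'a \<Rightarrow> 'a \<Rightarrow> real)"
    and cont: "continuous_on UNIV w" and w: "bounded (range w)" and e: "0 < e"
  obtains r where "0 < r"
    "\<And>y. dist x y < r \<Longrightarrow> conformal_dist dist w x y \<le> exp (w x + e) * dist x y"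
    "\<And>y. dist x y < r \<Longrightarrow> exp (w x - e) * dist x y \<le> conformal_dist dist w x y"
proof -
  obtain r0 where r0: "r0 > 0" "\<And>z. dist z x < r0 \<Longrightarrow> dist (w z) (w x) < e"
    using cont e unfolding continuous_on_iff by (metis UNIV_I)
  have near: "w z \<le> w x + e" "w x - e \<le> w z" if "dist x z < r0" for z
    using r0(2)[of z] that by (auto simp: dist_commute dist_real_def abs_less_iff)
  show thesis
  \<comment> \<open>Half the continuity radius, since the lower bound uses the values of
    \<open>w\<close> on a closed ball.\<close>
  proof (rule that[of "r0 / 2"])
    show "0 < r0 / 2" using r0 by simp
    fix y assume y: "dist x y < r0 / 2"
    show "conformal_dist dist w x y \<le> exp (w x + e) * dist x y"
      using y r0(1) near by (intro conformal_dist_upper[OF geo]) auto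
    show "exp (w x - e) * dist x y \<le> conformal_dist dist w x y"
      using y r0(1) near conformal_dist_lower[OF geo w, of "r0 / 2" x "w x - e" y] by auto
  qed
qed

section \<open>The space L2\<close>

lemma L2_measurable: "f \<in> L2 m \<Longrightarrow> f \<in> borel_measurable m"
  and L2_integrable_square: "f \<in> L2 m \<Longrightarrow> integrable m (\<lambda>x. (f x)\<^sup>2)"
  by (simp_all add: L2_def)

lemma L2_mult_integrable:
  assumes "f \<in> L2 m" "g \<in> L2 m"
  shows "integrable m (\<lambda>x. f x * g x)"
proof (rule Bochner_Integration.integrable_bound)
  note [measurable] = L2_measurable[OF assms(1)] L2_measurable[OF assms(2)]
  show "integrable m (\<lambda>x. (f x)\<^sup>2 + (g x)\<^sup>2)" using assms by (auto simp: L2_def)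
  show "(\<lambda>x. f x * g x) \<in> borel_measurable m" by measurable
  have "\<bar>a * b\<bar> \<le> a\<^sup>2 + b\<^sup>2" for a b :: real
  proof -
    have "0 \<le> \<bar>a\<bar> * \<bar>b\<bar>" by simp
    then show ?thesis
      using sum_squares_bound[of "\<bar>a\<bar>" "\<bar>b\<bar>"] unfolding abs_mult power2_abs by linarith
  qed
  then show "AE x in m. norm (f x * g x) \<le> norm ((f x)\<^sup>2 + (g x)\<^sup>2)" by simp
qed

lemma L2_bounded:
  assumes f: "f \<in> borel_measurable m" and g: "g \<in> L2 m" and le: "AE x in m. \<bar>f x\<bar> \<le> \<bar>g x\<bar>"
  shows "f \<in> L2 m"
proof -
  note [measurable] = f
  have "integrable m (\<lambda>x. (f x)\<^sup>2)"
    by (rule Bochner_Integration.integrable_bound[OF L2_integrable_square[OF g]])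
      (use le in \<open>auto elim!: eventually_mono simp: abs_le_square_iff\<close>)
  then show ?thesis using f by (simp add: L2_def)
qed

lemma L2_norm_mono:
  assumes f: "f \<in> borel_measurable m" and g: "g \<in> L2 m" and le: "AE x in m. \<bar>f x\<bar> \<le> \<bar>g x\<bar>"
  shows "L2_norm m f \<le> L2_norm m g"
  unfolding L2_norm_def
  using L2_integrable_square[OF L2_bounded[OF assms]] L2_integrable_square[OF g] le
  by (intro real_sqrt_le_mono integral_mono_AE) (auto elim!: eventually_mono simp: abs_le_square_iff)

lemma L2_norm_nonneg [simp]: "0 \<le> L2_norm m f"
  by (simp add: L2_norm_def)

lemma L2_norm_square: "(L2_norm m f)\<^sup>2 = (LINT x|m. (f x)\<^sup>2)"
  by (simp add: L2_norm_def)

lemma L2_norm_cong_AE: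
  assumes "f \<in> borel_measurable m" "g \<in> borel_measurable m" "AE x in m. \<bar>f x\<bar> = \<bar>g x\<bar>"
  shows "L2_norm m f = L2_norm m g"
proof -
  note [measurable] = assms(1,2)
  have "(LINT x|m. (f x)\<^sup>2) = (LINT x|m. (g x)\<^sup>2)"
    using assms(3) by (intro integral_cong_AE) (auto elim!: eventually_mono simp: abs_eq_iff)
  then show ?thesis by (simp add: L2_norm_def)
qed

lemma L2_cmult: "f \<in> L2 m \<Longrightarrow> (\<lambda>x. c * f x) \<in> L2 m"
  by (auto simp: L2_def power_mult_distrib)

lemma L2_add:
  assumes "f \<in> L2 m" "g \<in> L2 m"
  shows "(\<lambda>x. f x + g x) \<in> L2 m"
proof -
  note [measurable] = L2_measurable[OF assms(1)] L2_measurable[OF assms(2)]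
  have "integrable m (\<lambda>x. (f x)\<^sup>2 + (g x)\<^sup>2 + 2 * (f x * g x))"
    using assms L2_mult_integrable[OF assms] by (auto simp: L2_def)
  then have "integrable m (\<lambda>x. (f x + g x)\<^sup>2)" by (simp add: power2_sum algebra_simps)
  then show ?thesis by (simp add: L2_def)
qed

lemma L2_diff: "f \<in> L2 m \<Longrightarrow> g \<in> L2 m \<Longrightarrow> (\<lambda>x. f x - g x) \<in> L2 m"
  using L2_add[of f m "\<lambda>x. - 1 * g x"] L2_cmult[of g m "- 1"] by simp

lemma L2_abs: "f \<in> L2 m \<Longrightarrow> (\<lambda>x. \<bar>f x\<bar>) \<in> L2 m"
  by (auto simp: L2_def)

lemma L2_zero [simp]: "(\<lambda>x. 0) \<in> L2 m"
  by (simp add: L2_def)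

lemma L2_norm_zero [simp]: "L2_norm m (\<lambda>x. 0) = 0"
  by (simp add: L2_norm_def)

lemma L2_norm_abs [simp]: "L2_norm m (\<lambda>x. \<bar>f x\<bar>) = L2_norm m f"
  by (simp add: L2_norm_def)

lemma L2_norm_cmult: "L2_norm m (\<lambda>x. c * f x) = \<bar>c\<bar> * L2_norm m f"
  by (simp add: L2_norm_def power_mult_distrib real_sqrt_mult)

lemma L2_norm_minus_commute: "L2_norm m (\<lambda>x. f x - g x) = L2_norm m (\<lambda>x. g x - f x)"
  by (simp add: L2_norm_def power2_commute)

lemma L2_cauchy_schwarz:
  assumes f: "f \<in> L2 m" and g: "g \<in> L2 m"
  shows "(LINT x|m. f x * g x) \<le> L2_norm m f * L2_norm m g"
proof -
  let ?a = "LINT x|m. (f x)\<^sup>2" and ?b = "LINT x|m. f x * g x" and ?c = "LINT x|m. (g x)\<^sup>2"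
  have ab: "0 \<le> s\<^sup>2 * ?a - 2 * s * t * ?b + t\<^sup>2 * ?c" for s t :: real
  proof -
    have "0 \<le> (LINT x|m. (s * f x - t * g x)\<^sup>2)" by simp
    also have "\<dots> = (LINT x|m. s\<^sup>2 * (f x)\<^sup>2 - 2 * s * t * (f x * g x) + t\<^sup>2 * (g x)\<^sup>2)"
      by (intro Bochner_Integration.integral_cong) (auto simp: power2_diff power_mult_distrib algebra_simps)
    also have "\<dots> = s\<^sup>2 * ?a - 2 * s * t * ?b + t\<^sup>2 * ?c"
      using L2_integrable_square[OF f] L2_integrable_square[OF g] L2_mult_integrable[OF f g] by simp
    finally show ?thesis .
  qed
  have "0 \<le> ?a" and c0: "0 \<le> ?c" by simp_all
  have "?b\<^sup>2 \<le> ?a * ?c"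
  proof (cases "?c = 0")
    case True
    have "0 \<le> ?a - 2 * t * ?b" for t using ab[of 1 t] True by simp
    from this[of "(?a + 1) / (2 * ?b)"] have "?b = 0" by (cases "?b = 0") auto
    then show ?thesis using True by simp
  next
    case False
    \<comment> \<open>The quadratic form is evaluated at its minimizing ratio, with
      \<open>s = ?c\<close> and \<open>t = ?b\<close>.\<close>
    have "0 \<le> ?c * (?a * ?c - ?b\<^sup>2)"
      using ab[of ?c ?b] by (simp add: power2_eq_square algebra_simps)
    then show ?thesis using False c0 by (simp add: zero_le_mult_iff less_le)
  qed
  then have "\<bar>?b\<bar> \<le> sqrt (?a * ?c)" by (simp add: real_le_rsqrt)
  then show ?thesis by (simp add: L2_norm_def real_sqrt_mult)
qed

lemma L2_norm_triangle:
  assumes f: "f \<in> L2 m" and g: "g \<in> L2 m"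
  shows "L2_norm m (\<lambda>x. f x + g x) \<le> L2_norm m f + L2_norm m g"
proof (rule power2_le_imp_le)
  have "(L2_norm m (\<lambda>x. f x + g x))\<^sup>2 = (LINT x|m. (f x)\<^sup>2 + (g x)\<^sup>2 + 2 * (f x * g x))"
    unfolding L2_norm_square by (intro Bochner_Integration.integral_cong) (auto simp: power2_sum)
  also have "\<dots> = (L2_norm m f)\<^sup>2 + (L2_norm m g)\<^sup>2 + 2 * (LINT x|m. f x * g x)"
    using L2_integrable_square[OF f] L2_integrable_square[OF g] L2_mult_integrable[OF f g]
    by (simp add: L2_norm_square)
  also have "\<dots> \<le> (L2_norm m f + L2_norm m g)\<^sup>2"
    using L2_cauchy_schwarz[OF f g] by (simp add: power2_sum)
  finally show "(L2_norm m (\<lambda>x. f x + g x))\<^sup>2 \<le> (L2_norm m f + L2_norm m g)\<^sup>2" .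
qed simp

lemma L2_norm_triangle_diff:
  assumes "f \<in> L2 m" "g \<in> L2 m" "h \<in> L2 m"
  shows "L2_norm m (\<lambda>x. f x - h x) \<le> L2_norm m (\<lambda>x. f x - g x) + L2_norm m (\<lambda>x. g x - h x)"
  using L2_norm_triangle[OF L2_diff[OF assms(1,2)] L2_diff[OF assms(2,3)]] by simp

lemma L2_norm_diff_bound:
  assumes "f \<in> L2 m" "g \<in> L2 m"
  shows "\<bar>L2_norm m f - L2_norm m g\<bar> \<le> L2_norm m (\<lambda>x. f x - g x)"
  using L2_norm_triangle[OF L2_diff[OF assms] assms(2)] L2_norm_triangle[OF L2_diff[OF assms(2,1)] assms(1)]
    L2_norm_minus_commute[of m f g] by simp

lemma L2_norm_eq_0_AE:
  assumes "f \<in> L2 m" "L2_norm m f = 0"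
  shows "AE x in m. f x = 0"
proof -
  have "(LINT x|m. (f x)\<^sup>2) = 0" using assms(2) L2_norm_square[of m f] by simp
  then have "AE x in m. (f x)\<^sup>2 = 0"
    using integral_nonneg_eq_0_iff_AE[OF L2_integrable_square[OF assms(1)]] by simp
  then show ?thesis by simp
qed

lemma L2_parallelogram:
  assumes f: "f \<in> L2 m" and g: "g \<in> L2 m"
  shows "(L2_norm m (\<lambda>x. f x + g x))\<^sup>2 + (L2_norm m (\<lambda>x. f x - g x))\<^sup>2
    = 2 * (L2_norm m f)\<^sup>2 + 2 * (L2_norm m g)\<^sup>2"
proof -
  have "(L2_norm m (\<lambda>x. f x + g x))\<^sup>2 + (L2_norm m (\<lambda>x. f x - g x))\<^sup>2
    = (LINT x|m. (f x + g x)\<^sup>2 + (f x - g x)\<^sup>2)"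
    unfolding L2_norm_square
    using L2_integrable_square[OF L2_add[OF f g]] L2_integrable_square[OF L2_diff[OF f g]] by simp
  also have "\<dots> = (LINT x|m. 2 * (f x)\<^sup>2 + 2 * (g x)\<^sup>2)"
    by (intro Bochner_Integration.integral_cong) (auto simp: power2_sum power2_diff)
  finally show ?thesis
    unfolding L2_norm_square using L2_integrable_square[OF f] L2_integrable_square[OF g] by simp
qed

section \<open>Convergence in L2\<close>

lemma L2_limD: "L2_lim m F f \<Longrightarrow> F n \<in> L2 m" "L2_lim m F f \<Longrightarrow> f \<in> L2 m"
  "L2_lim m F f \<Longrightarrow> (\<lambda>n. L2_norm m (\<lambda>x. F n x - f x)) \<longlonglongrightarrow> 0"
  by (simp_all add: L2_lim_def)

lemma L2_lim_squeeze:
  assumes "\<And>n. F n \<in> L2 m" "f \<in> L2 m" "\<And>n. L2_norm m (\<lambda>x. F n x - f x) \<le> e n" "e \<longlonglongrightarrow> 0"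
  shows "L2_lim m F f"
  unfolding L2_lim_def using assms tendsto_sandwich[of "\<lambda>_. 0" _ sequentially e 0] by simp

lemma L2_lim_add:
  assumes "L2_lim m F f" "L2_lim m G g"
  shows "L2_lim m (\<lambda>n x. F n x + G n x) (\<lambda>x. f x + g x)"
proof (rule L2_lim_squeeze)
  note D = L2_limD[OF assms(1)] L2_limD[OF assms(2)]
  show "L2_norm m (\<lambda>x. F n x + G n x - (f x + g x))
    \<le> L2_norm m (\<lambda>x. F n x - f x) + L2_norm m (\<lambda>x. G n x - g x)" for n
    using L2_norm_triangle[OF L2_diff[OF D(1,2)] L2_diff[OF D(4,5)]] by (simp add: algebra_simps)
  show "(\<lambda>n. L2_norm m (\<lambda>x. F n x - f x) + L2_norm m (\<lambda>x. G n x - g x)) \<longlonglongrightarrow> 0"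
    using tendsto_add[OF D(3,6)] by simp
qed (use L2_limD[OF assms(1)] L2_limD[OF assms(2)] in \<open>auto intro: L2_add\<close>)

lemma L2_lim_cmult:
  assumes "L2_lim m F f"
  shows "L2_lim m (\<lambda>n x. c * F n x) (\<lambda>x. c * f x)"
proof (rule L2_lim_squeeze)
  show "L2_norm m (\<lambda>x. c * F n x - c * f x) \<le> \<bar>c\<bar> * L2_norm m (\<lambda>x. F n x - f x)" for n
    using L2_norm_cmult[of m c "\<lambda>x. F n x - f x"] by (simp add: right_diff_distrib)
  show "(\<lambda>n. \<bar>c\<bar> * L2_norm m (\<lambda>x. F n x - f x)) \<longlonglongrightarrow> 0"
    using tendsto_mult_left[OF L2_limD(3)[OF assms], of "\<bar>c\<bar>"] by simp
qed (use L2_limD[OF assms] in \<open>auto intro: L2_cmult\<close>)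

lemma L2_lim_diff:
  assumes "L2_lim m F f" "L2_lim m G g"
  shows "L2_lim m (\<lambda>n x. F n x - G n x) (\<lambda>x. f x - g x)"
  using L2_lim_add[OF assms(1) L2_lim_cmult[OF assms(2), of "- 1"]] by simp

lemma L2_lim_unique:
  assumes "L2_lim m F f" "L2_lim m F g"
  shows "AE x in m. f x = g x"
proof -
  note D = L2_limD[OF assms(1)] L2_limD[OF assms(2)]
  have "L2_norm m (\<lambda>x. f x - g x) \<le> L2_norm m (\<lambda>x. F n x - f x) + L2_norm m (\<lambda>x. F n x - g x)" for n
    using L2_norm_triangle_diff[OF D(2) D(1)[of n] D(5)] L2_norm_minus_commute[of m f "F n"] by simp
  moreover have "(\<lambda>n. L2_norm m (\<lambda>x. F n x - f x) + L2_norm m (\<lambda>x. F n x - g x)) \<longlonglongrightarrow> 0"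
    using tendsto_add[OF D(3,6)] by simp
  ultimately have "L2_norm m (\<lambda>x. f x - g x) \<le> 0"
    by (intro LIMSEQ_le_const) auto
  then have "L2_norm m (\<lambda>x. f x - g x) = 0" using L2_norm_nonneg[of m "\<lambda>x. f x - g x"] by linarith
  from L2_norm_eq_0_AE[OF L2_diff[OF D(2,5)] this] show ?thesis by simp
qed

lemma L2_lim_norm:
  assumes "L2_lim m F f"
  shows "(\<lambda>n. L2_norm m (F n)) \<longlonglongrightarrow> L2_norm m f"
proof (rule LIM_zero_cancel, rule tendsto_0_le[where K = 1])
  show "(\<lambda>n. L2_norm m (\<lambda>x. F n x - f x)) \<longlonglongrightarrow> 0" by (rule L2_limD(3)[OF assms])
  show "\<forall>\<^sub>F n in sequentially. norm (L2_norm m (F n) - L2_norm m f) \<le> norm (L2_norm m (\<lambda>x. F n x - f x)) * 1"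
    using L2_norm_diff_bound[OF L2_limD(1)[OF assms] L2_limD(2)[OF assms]] by simp
qed

lemma L2_lim_subseq:
  assumes "L2_lim m F f" "strict_mono r"
  shows "L2_lim m (\<lambda>n. F (r n)) f"
  using assms LIMSEQ_subseq_LIMSEQ[of "\<lambda>n. L2_norm m (\<lambda>x. F n x - f x)" 0 r]
  by (auto simp: L2_lim_def o_def)

lemma L2_lim_AE_subseq:
  assumes "L2_lim m F f"
  obtains r :: "nat \<Rightarrow> nat" where "strict_mono r" "AE x in m. (\<lambda>n. F (r n) x) \<longlonglongrightarrow> f x"
proof -
  note D = L2_limD[OF assms]
  have lim: "(\<lambda>n. LINT x|m. norm ((F n x - f x)\<^sup>2)) \<longlonglongrightarrow> 0"
    using tendsto_power[OF D(3), of 2] by (simp add: L2_norm_square)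
  have int: "integrable m (\<lambda>x. (F n x - f x)\<^sup>2)" for n
    using L2_integrable_square[OF L2_diff[OF D(1,2)]] .
  obtain r :: "nat \<Rightarrow> nat" where r: "strict_mono r" "AE x in m. (\<lambda>n. (F (r n) x - f x)\<^sup>2) \<longlonglongrightarrow> 0"
    using tendsto_L1_AE_subseq[of m "\<lambda>n x. (F n x - f x)\<^sup>2", OF int lim] by blast
  from r(2) have "AE x in m. (\<lambda>n. F (r n) x) \<longlonglongrightarrow> f x"
  proof eventually_elim
    case (elim x)
    then have "(\<lambda>n. \<bar>F (r n) x - f x\<bar>) \<longlonglongrightarrow> 0"
      using tendsto_real_sqrt[OF elim] by simp
    then show ?case by (rule LIM_zero_cancel[OF tendsto_rabs_zero_cancel])
  qed
  with r(1) show thesis by (rule that)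
qed

lemma L2_lim_dominated:
  assumes F: "\<And>n. F n \<in> borel_measurable m" and f: "f \<in> borel_measurable m" and G: "G \<in> L2 m"
    and bound: "\<And>n. AE x in m. \<bar>F n x\<bar> \<le> \<bar>G x\<bar>" and lim: "AE x in m. (\<lambda>n. F n x) \<longlonglongrightarrow> f x"
  shows "L2_lim m F f"
proof -
  note [measurable] = F f
  have fb: "AE x in m. \<bar>f x\<bar> \<le> \<bar>G x\<bar>"
  proof -
    have "AE x in m. \<forall>n. \<bar>F n x\<bar> \<le> \<bar>G x\<bar>" using bound by (simp add: AE_all_countable)
    with lim show ?thesis
    proof eventually_elim
      case (elim x)
      show ?case by (rule Lim_bounded[OF tendsto_rabs[OF elim(1)], of 0]) (use elim(2) in auto)
    qed
  qed
  have F2: "F n \<in> L2 m" for n by (rule L2_bounded[OF F G bound])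
  have f2: "f \<in> L2 m" by (rule L2_bounded[OF f G fb])
  have "(\<lambda>n. LINT x|m. (F n x - f x)\<^sup>2) \<longlonglongrightarrow> (LINT x|m. 0)"
  proof (rule integral_dominated_convergence[where w = "\<lambda>x. 4 * (G x)\<^sup>2"])
    show "integrable m (\<lambda>x. 4 * (G x)\<^sup>2)" using L2_integrable_square[OF G] by simp
    show "AE x in m. (\<lambda>n. (F n x - f x)\<^sup>2) \<longlonglongrightarrow> 0"
      using lim
    proof eventually_elim
      case (elim x)
      show ?case using tendsto_power[OF LIM_zero[OF elim], of 2] by simp
    qed
    show "AE x in m. norm ((F n x - f x)\<^sup>2) \<le> 4 * (G x)\<^sup>2" for n
      using bound[of n] fb
    proof eventually_elim
      case (elim x)
      then have "\<bar>F n x - f x\<bar> \<le> \<bar>2 * G x\<bar>" by linarith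
      then have "(F n x - f x)\<^sup>2 \<le> (2 * G x)\<^sup>2" by (simp only: abs_le_square_iff)
      then show ?case by (simp add: power_mult_distrib)
    qed
  qed auto
  then have "(\<lambda>n. sqrt (LINT x|m. (F n x - f x)\<^sup>2)) \<longlonglongrightarrow> 0"
    using tendsto_real_sqrt by fastforce
  then show ?thesis using F2 f2 by (simp add: L2_lim_def L2_norm_def)
qed

lemma fast_subseq_exists:
  fixes P :: "nat \<Rightarrow> nat \<Rightarrow> nat \<Rightarrow> bool"
  assumes "\<And>k. \<exists>N. \<forall>n\<ge>N. \<forall>l\<ge>N. P k n l"
  shows "\<exists>r :: nat \<Rightarrow> nat. strict_mono r \<and> (\<forall>k. \<forall>n\<ge>r k. P k (r k) n)"
proof -
  have "\<exists>r. \<forall>k. (\<forall>n\<ge>r k. P k (r k) n) \<and> r k < r (Suc k)"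
  proof (rule dependent_nat_choice)
    show "\<exists>x. \<forall>n\<ge>x. P 0 x n" using assms[of 0] by blast
    fix x k
    obtain N where N: "\<forall>n\<ge>N. \<forall>l\<ge>N. P (Suc k) n l" using assms by blast
    show "\<exists>y. (\<forall>n\<ge>y. P (Suc k) y n) \<and> x < y"
      by (rule exI[of _ "max N (Suc x)"]) (use N in auto)
  qed
  then show ?thesis by (auto simp: strict_mono_Suc_iff)
qed

text \<open>Riesz-Fischer. Along a subsequence with steps at most \<open>(1/2)^k\<close> the sums of
  absolute increments stay bounded in L2, so by monotone convergence the telescoping series
  converges almost everywhere; Fatou's lemma then controls the distance of the whole sequence from
  the limit.\<close>

lemma L2_complete:
  assumes F: "\<And>n. F n \<in> L2 m"
    and cauchy: "\<And>e. 0 < e \<Longrightarrow> \<exists>N. \<forall>n\<ge>N. \<forall>k\<ge>N. L2_norm m (\<lambda>x. F n x - F k x) < e"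
  shows "\<exists>f. L2_lim m F f"
proof -
  note [measurable] = L2_measurable[OF F]
  have "\<exists>N. \<forall>n\<ge>N. \<forall>l\<ge>N. L2_norm m (\<lambda>x. F n x - F l x) < (1/2)^k" for k :: nat
    using cauchy[of "(1/2)^k"] by simp
  from fast_subseq_exists[of "\<lambda>k n l. L2_norm m (\<lambda>x. F n x - F l x) < (1/2)^k", OF this] obtain r :: "nat \<Rightarrow> nat" where r: "strict_mono r"
    "\<And>k n. r k \<le> n \<Longrightarrow> L2_norm m (\<lambda>x. F (r k) x - F n x) < (1/2)^k" by blast
  define D where "D k x = \<bar>F (r (Suc k)) x - F (r k) x\<bar>" for k x
  have D2: "D k \<in> L2 m" for k unfolding D_def by (intro L2_abs L2_diff F)
  have Dn: "L2_norm m (D k) \<le> (1/2)^k" for k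
    using r(2)[of k "r (Suc k)"] r(1) L2_norm_minus_commute[of m "F (r (Suc k))" "F (r k)"]
    by (simp add: D_def[abs_def] strict_mono_less_eq less_imp_le)
  have S2: "(\<lambda>x. \<Sum>k<K. D k x) \<in> L2 m \<and> L2_norm m (\<lambda>x. \<Sum>k<K. D k x) \<le> (\<Sum>k<K. (1/2)^k)" for K
  proof (induction K)
    case (Suc K)
    then show ?case
      using L2_norm_triangle[of "\<lambda>x. \<Sum>k<K. D k x" m "D K"] Dn[of K] D2[of K]
      by (auto intro: L2_add)
  qed simp
  have geo: "(\<Sum>k<K. (1/2)^k) \<le> (2::real)" for K
    using sum_le_suminf[of "\<lambda>k. (1/2::real)^k" "{..<K}"] suminf_geometric[of "1/2::real"] by simp
  note [measurable] = L2_measurable[OF D2]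
  have "(\<integral>\<^sup>+x. (SUP K. ennreal ((\<Sum>k<K. D k x)\<^sup>2)) \<partial>m) = (SUP K. \<integral>\<^sup>+x. ennreal ((\<Sum>k<K. D k x)\<^sup>2) \<partial>m)"
  proof (rule nn_integral_monotone_convergence_SUP)
    show "incseq (\<lambda>K x. ennreal ((\<Sum>k<K. D k x)\<^sup>2))"
      by (intro monoI le_funI ennreal_leI power_mono sum_mono2 sum_nonneg) (auto simp: D_def)
  qed simp
  also have "\<dots> \<le> ennreal 4"
  proof (rule SUP_least)
    fix K
    have "L2_norm m (\<lambda>x. \<Sum>k<K. D k x) \<le> 2" using S2[of K] geo[of K] by linarith
    then have "(L2_norm m (\<lambda>x. \<Sum>k<K. D k x))\<^sup>2 \<le> 2\<^sup>2" by (intro power_mono) auto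
    then have "(LINT x|m. (\<Sum>k<K. D k x)\<^sup>2) \<le> 4" by (simp add: L2_norm_square)
    moreover have "(\<integral>\<^sup>+x. ennreal ((\<Sum>k<K. D k x)\<^sup>2) \<partial>m) = ennreal (LINT x|m. (\<Sum>k<K. D k x)\<^sup>2)"
      using S2[of K] by (intro nn_integral_eq_integral) (auto simp: L2_def)
    ultimately show "(\<integral>\<^sup>+x. ennreal ((\<Sum>k<K. D k x)\<^sup>2) \<partial>m) \<le> ennreal 4" using ennreal_leI by metis
  qed
  finally have "(\<integral>\<^sup>+x. (SUP K. ennreal ((\<Sum>k<K. D k x)\<^sup>2)) \<partial>m) \<noteq> \<infinity>"
    by (auto simp: top_unique)
  then have fin: "AE x in m. (SUP K. ennreal ((\<Sum>k<K. D k x)\<^sup>2)) \<noteq> \<infinity>"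
    by (intro nn_integral_noteq_infinite) auto
  have conv: "AE x in m. convergent (\<lambda>k. F (r k) x)"
    using fin
  proof eventually_elim
    case (elim x)
    then obtain c where c: "c \<ge> 0" "(SUP K. ennreal ((\<Sum>k<K. D k x)\<^sup>2)) = ennreal c"
      by (metis ennreal_cases infinity_ennreal_def)
    have "(\<Sum>k<K. D k x) \<le> sqrt c" for K
    proof -
      have "ennreal ((\<Sum>k<K. D k x)\<^sup>2) \<le> ennreal c" unfolding c(2)[symmetric] by (rule SUP_upper) simp
      then show ?thesis using c(1) by (intro real_le_rsqrt) (simp add: ennreal_le_iff)
    qed
    then have "summable (\<lambda>k. D k x)" by (intro summableI_nonneg_bounded) (auto simp: D_def)
    then have "summable (\<lambda>k. F (r (Suc k)) x - F (r k) x)"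
      unfolding D_def by (rule summable_rabs_cancel)
    then have "convergent (\<lambda>n. \<Sum>k<n. F (r (Suc k)) x - F (r k) x)"
      by (simp add: summable_iff_convergent)
    then have "convergent (\<lambda>n. F (r n) x - F (r 0) x)"
      using sum_lessThan_telescope[of "\<lambda>k. F (r k) x"] by simp
    then show ?case by (simp add: convergent_diff_const_right_iff)
  qed
  define f where "f x = lim (\<lambda>k. F (r k) x)" for x
  have fm [measurable]: "f \<in> borel_measurable m" unfolding f_def by (rule borel_measurable_lim_metric) measurable
  have lim: "AE x in m. (\<lambda>k. F (r k) x) \<longlonglongrightarrow> f x"
    using conv by eventually_elim (simp add: f_def convergent_LIMSEQ_iff)
  have key: "(\<integral>\<^sup>+x. ennreal ((F n x - f x)\<^sup>2) \<partial>m) \<le> ennreal (e\<^sup>2)"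
    if e: "0 < e" and N: "\<And>k. N \<le> k \<Longrightarrow> L2_norm m (\<lambda>x. F n x - F k x) < e" for e n N
  proof -
    have "(\<integral>\<^sup>+x. ennreal ((F n x - f x)\<^sup>2) \<partial>m) = (\<integral>\<^sup>+x. liminf (\<lambda>k. ennreal ((F n x - F (r k) x)\<^sup>2)) \<partial>m)"
      using lim
    proof (intro nn_integral_cong_AE, eventually_elim)
      case (elim x)
      have "(\<lambda>k. ennreal ((F n x - F (r k) x)\<^sup>2)) \<longlonglongrightarrow> ennreal ((F n x - f x)\<^sup>2)"
        by (intro tendsto_ennrealI tendsto_intros elim)
      from lim_imp_Liminf[OF sequentially_bot this] show ?case by (rule sym)
    qed
    also have "\<dots> \<le> liminf (\<lambda>k. \<integral>\<^sup>+x. ennreal ((F n x - F (r k) x)\<^sup>2) \<partial>m)"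
      by (rule nn_integral_liminf) measurable
    also have "\<dots> \<le> ennreal (e\<^sup>2)"
    proof (rule Liminf_le)
      show "\<forall>\<^sub>F k in sequentially. (\<integral>\<^sup>+x. ennreal ((F n x - F (r k) x)\<^sup>2) \<partial>m) \<le> ennreal (e\<^sup>2)"
        unfolding eventually_sequentially
      proof (intro exI[of _ N] allI impI)
        fix k assume "N \<le> k"
        then have "L2_norm m (\<lambda>x. F n x - F (r k) x) < e" using seq_suble[OF r(1), of k] by (intro N) simp
        then have "(L2_norm m (\<lambda>x. F n x - F (r k) x))\<^sup>2 \<le> e\<^sup>2" by (intro power_mono) auto
        then show "(\<integral>\<^sup>+x. ennreal ((F n x - F (r k) x)\<^sup>2) \<partial>m) \<le> ennreal (e\<^sup>2)"
          using L2_integrable_square[OF L2_diff[OF F[of n] F[of "r k"]]]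
          by (simp add: nn_integral_eq_integral L2_norm_square ennreal_leI)
      qed
    qed simp
    finally show ?thesis .
  qed
  have diff2: "(\<lambda>x. F n x - f x) \<in> L2 m \<and> L2_norm m (\<lambda>x. F n x - f x) \<le> e"
    if e: "0 < e" and N: "\<And>k. N \<le> k \<Longrightarrow> L2_norm m (\<lambda>x. F n x - F k x) < e" for e n N
  proof -
    have "(\<integral>\<^sup>+x. ennreal ((F n x - f x)\<^sup>2) \<partial>m) < \<infinity>" using key[OF e N] by (rule le_less_trans) auto
    then have i: "integrable m (\<lambda>x. (F n x - f x)\<^sup>2)" by (intro integrableI_nonneg) auto
    have "ennreal (LINT x|m. (F n x - f x)\<^sup>2) \<le> ennreal (e\<^sup>2)"
      using key[OF e N] nn_integral_eq_integral[OF i] by simp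
    then have "L2_norm m (\<lambda>x. F n x - f x) \<le> e"
      using e unfolding L2_norm_def by (intro real_le_lsqrt) (auto simp: ennreal_le_iff)
    then show ?thesis using i by (simp add: L2_def)
  qed
  have f2: "f \<in> L2 m"
  proof -
    obtain N where N: "\<forall>n\<ge>N. \<forall>k\<ge>N. L2_norm m (\<lambda>x. F n x - F k x) < 1" using cauchy[of 1] by auto
    have "(\<lambda>x. F N x - f x) \<in> L2 m" using diff2[of 1 N N] N by auto
    from L2_diff[OF F[of N] this] show ?thesis by simp
  qed
  have "(\<lambda>n. L2_norm m (\<lambda>x. F n x - f x)) \<longlonglongrightarrow> 0"
  proof (rule LIMSEQ_I)
    fix e :: real assume e: "0 < e"
    obtain N where N: "\<forall>n\<ge>N. \<forall>k\<ge>N. L2_norm m (\<lambda>x. F n x - F k x) < e / 2" using cauchy[of "e / 2"] e by auto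
    have "L2_norm m (\<lambda>x. F n x - f x) < e" if "N \<le> n" for n
      using diff2[of "e / 2" N n] N that e by fastforce
    then show "\<exists>N. \<forall>n\<ge>N. norm (L2_norm m (\<lambda>x. F n x - f x) - 0) < e" by auto
  qed
  then show ?thesis using F f2 by (auto simp: L2_lim_def)
qed

text \<open>Pointwise inner products are quadratic in the pointwise norms, so L2 convergence of
  norms yields L1 convergence of inner products.\<close>

lemma L2_lim_mult_L1:
  assumes "L2_lim m F f" "L2_lim m G g"
  shows "(\<lambda>n. LINT x|m. \<bar>F n x * G n x - f x * g x\<bar>) \<longlonglongrightarrow> 0"
proof -
  note D = L2_limD[OF assms(1)] L2_limD[OF assms(2)]
  have le: "(LINT x|m. \<bar>F n x * G n x - f x * g x\<bar>) \<le>
      L2_norm m (\<lambda>x. F n x - f x) * L2_norm m (G n) + L2_norm m f * L2_norm m (\<lambda>x. G n x - g x)" for n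
  proof -
    have i: "integrable m (\<lambda>x. \<bar>F n x - f x\<bar> * \<bar>G n x\<bar>)" "integrable m (\<lambda>x. \<bar>f x\<bar> * \<bar>G n x - g x\<bar>)"
      using D by (auto intro!: L2_mult_integrable L2_abs L2_diff)
    have "(LINT x|m. \<bar>F n x * G n x - f x * g x\<bar>) \<le> (LINT x|m. \<bar>F n x - f x\<bar> * \<bar>G n x\<bar> + \<bar>f x\<bar> * \<bar>G n x - g x\<bar>)"
    proof (rule integral_mono)
      show "integrable m (\<lambda>x. \<bar>F n x * G n x - f x * g x\<bar>)"
        using D by (intro integrable_abs Bochner_Integration.integrable_diff L2_mult_integrable)
      show "integrable m (\<lambda>x. \<bar>F n x - f x\<bar> * \<bar>G n x\<bar> + \<bar>f x\<bar> * \<bar>G n x - g x\<bar>)"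
        using i by simp
      fix x
      have "F n x * G n x - f x * g x = (F n x - f x) * G n x + f x * (G n x - g x)"
        by (simp add: algebra_simps)
      then show "\<bar>F n x * G n x - f x * g x\<bar> \<le> \<bar>F n x - f x\<bar> * \<bar>G n x\<bar> + \<bar>f x\<bar> * \<bar>G n x - g x\<bar>"
        by (metis abs_mult abs_triangle_ineq)
    qed
    also have "\<dots> = (LINT x|m. \<bar>F n x - f x\<bar> * \<bar>G n x\<bar>) + (LINT x|m. \<bar>f x\<bar> * \<bar>G n x - g x\<bar>)"
      using i by simp
    also have "\<dots> \<le> L2_norm m (\<lambda>x. \<bar>F n x - f x\<bar>) * L2_norm m (\<lambda>x. \<bar>G n x\<bar>)
        + L2_norm m (\<lambda>x. \<bar>f x\<bar>) * L2_norm m (\<lambda>x. \<bar>G n x - g x\<bar>)"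
      using D by (intro add_mono L2_cauchy_schwarz L2_abs L2_diff)
    finally show ?thesis by simp
  qed
  have "(\<lambda>n. L2_norm m (\<lambda>x. F n x - f x) * L2_norm m (G n) + L2_norm m f * L2_norm m (\<lambda>x. G n x - g x))
      \<longlonglongrightarrow> 0 * L2_norm m g + L2_norm m f * 0"
    by (intro tendsto_intros D L2_lim_norm[OF assms(2)])
  then have "(\<lambda>n. L2_norm m (\<lambda>x. F n x - f x) * L2_norm m (G n) + L2_norm m f * L2_norm m (\<lambda>x. G n x - g x))
      \<longlonglongrightarrow> 0" by simp
  then show ?thesis
    by (rule tendsto_sandwich[OF _ _ tendsto_const, rotated 2]) (use le in auto)
qed

section \<open>Slopes under a conformal change\<close>

lemma eventually_punctured_nhds:
  "eventually P (punctured_nhds d x) \<longleftrightarrow> (\<exists>r>0. \<forall>y. y \<noteq> x \<and> d x y < r \<longrightarrow> P y)"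
proof -
  have "eventually P (punctured_nhds d x) \<longleftrightarrow>
      (\<exists>r\<in>{0<..}. eventually P (principal {y. y \<noteq> x \<and> d x y < r}))"
    unfolding punctured_nhds_def
  proof (rule eventually_INF_base)
    fix a b :: real assume "a \<in> {0<..}" "b \<in> {0<..}"
    then show "\<exists>r\<in>{0<..}. principal {y. y \<noteq> x \<and> d x y < r}
        \<le> inf (principal {y. y \<noteq> x \<and> d x y < a}) (principal {y. y \<noteq> x \<and> d x y < b})"
      by (intro bexI[of _ "min a b"]) auto
  qed auto
  then show ?thesis by (auto simp: eventually_principal)
qed

lemma punctured_nhds_dist: "punctured_nhds dist x = at x"
  by (rule filter_eqI) (simp add: eventually_punctured_nhds eventually_at dist_commute)

text \<open>Removes division and extended reals: the Lipschitz assumption keeps the limsup finite,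
  so \<open>enn2real\<close> loses nothing. The distance enters only through positivity off the
  diagonal, which lets the criterion apply to \<open>conformal_dist\<close> as well.\<close>

lemma lip_le_iff:
  assumes pos: "\<And>y. y \<noteq> x \<Longrightarrow> 0 < d x y" and L: "lipschitz_wrt d f" and c: "0 \<le> c"
  shows "lip d f x \<le> c \<longleftrightarrow>
    (\<forall>e>0. \<forall>\<^sub>F y in punctured_nhds d x. \<bar>f y - f x\<bar> \<le> (c + e) * d x y)"
proof -
  let ?Q = "\<lambda>y. ennreal (\<bar>f y - f x\<bar> / d x y)" and ?F = "punctured_nhds d x"
  have ne: "\<forall>\<^sub>F y in ?F. y \<noteq> x" by (auto simp: eventually_punctured_nhds intro: exI[of _ 1])
  obtain K where K: "K \<ge> 0" "\<And>y. \<bar>f x - f y\<bar> \<le> K * d x y"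
    using L by (auto simp: lipschitz_wrt_def)
  have "\<forall>\<^sub>F y in ?F. ?Q y \<le> ennreal K"
    using ne
  proof eventually_elim
    case (elim y)
    then show ?case using K(2)[of y] pos[of y]
      by (intro ennreal_leI) (simp add: divide_le_eq abs_minus_commute)
  qed
  then have "Limsup ?F ?Q \<le> ennreal K" by (rule Limsup_bounded)
  then have fin: "Limsup ?F ?Q < top" by (rule le_less_trans) simp
  then obtain l where l: "l \<ge> 0" "Limsup ?F ?Q = ennreal l"
    by (cases "Limsup ?F ?Q") auto
  have "lip d f x \<le> c \<longleftrightarrow> Limsup ?F ?Q \<le> ennreal c"
    using c l by (simp add: lip_def ennreal_le_iff)
  also have "\<dots> \<longleftrightarrow> (\<forall>y>ennreal c. \<forall>\<^sub>F z in ?F. ?Q z < y)"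
    by (rule Limsup_le_iff)
  also have "\<dots> \<longleftrightarrow> (\<forall>e>0. \<forall>\<^sub>F y in ?F. \<bar>f y - f x\<bar> \<le> (c + e) * d x y)" (is "?l \<longleftrightarrow> ?r")
  proof
    assume l: ?l
    show ?r
    proof (intro allI impI)
      fix e :: real assume e: "0 < e"
      have "ennreal c < ennreal (c + e)" using c e by (simp add: ennreal_less_iff)
      with l have "\<forall>\<^sub>F z in ?F. ?Q z < ennreal (c + e)" by blast
      with ne show "\<forall>\<^sub>F y in ?F. \<bar>f y - f x\<bar> \<le> (c + e) * d x y"
      proof eventually_elim
        case (elim y)
        then have "\<bar>f y - f x\<bar> / d x y < c + e"
          using pos[of y] by (subst (asm) ennreal_less_iff) auto
        then show ?case using pos[of y] elim(1) by (simp add: divide_less_eq)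
      qed
    qed
  next
    assume r: ?r
    show ?l
    proof (intro allI impI)
      fix y assume y: "ennreal c < y"
      obtain c' where c': "ennreal c < c'" "c' < y" using dense[OF y] by blast
      then obtain s where s: "c' = ennreal s" "s \<ge> 0" using c'(2) by (cases c') auto
      have "c < s" using c'(1) c s by (simp add: ennreal_less_iff)
      then have "0 < s - c" by simp
      with r have "\<forall>\<^sub>F y in ?F. \<bar>f y - f x\<bar> \<le> (c + (s - c)) * d x y" by blast
      with ne show "\<forall>\<^sub>F z in ?F. ?Q z < y"
      proof eventually_elim
        case (elim z)
        then have "\<bar>f z - f x\<bar> / d x z \<le> s" using pos[of z] by (simp add: divide_le_eq)
        then have "?Q z \<le> c'" unfolding s(1) by (rule ennreal_leI)
        then show ?case using c'(2) by (rule le_less_trans)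
      qed
    qed
  qed
  finally show ?thesis .
qed

lemma lip_nonneg [simp]: "0 \<le> lip d f x"
  by (simp add: lip_def)

section \<open>Calculus of slopes of Lipschitz functions\<close>

lemma lipschitz_wrt_dist_iff: "lipschitz_wrt dist f \<longleftrightarrow> (\<exists>L. L-lipschitz_on UNIV f)"
  by (auto simp: lipschitz_wrt_def lipschitz_on_def dist_real_def)

lemma lipschitz_wrt_continuous:
  fixes f :: "'a::metric_space \<Rightarrow> real"
  assumes "lipschitz_wrt dist f"
  shows "continuous_on UNIV f"
  using assms lipschitz_on_continuous_on unfolding lipschitz_wrt_dist_iff by blast

lemma lipschitz_wrt_tendsto:
  fixes f :: "'a::metric_space \<Rightarrow> real"
  assumes "lipschitz_wrt dist f"
  shows "(f \<longlongrightarrow> f x) (at x)"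
  using lipschitz_wrt_continuous[OF assms] by (simp add: continuous_on_def)

lemma lip_dist_le_iff:
  fixes f :: "'a::metric_space \<Rightarrow> real"
  assumes "lipschitz_wrt dist f" "0 \<le> c"
  shows "lip dist f x \<le> c \<longleftrightarrow> (\<forall>e>0. \<forall>\<^sub>F y in at x. \<bar>f y - f x\<bar> \<le> (c + e) * dist x y)"
  using lip_le_iff[of x dist f c] assms by (simp add: punctured_nhds_dist)

lemma lip_eventually:
  fixes f :: "'a::metric_space \<Rightarrow> real"
  assumes "lipschitz_wrt dist f" "0 < e"
  shows "\<forall>\<^sub>F y in at x. \<bar>f y - f x\<bar> \<le> (lip dist f x + e) * dist x y"
  using lip_dist_le_iff[OF assms(1), of "lip dist f x" x] assms(2) by simp

lemma lip_le_lipschitz_constant: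
  fixes f :: "'a::metric_space \<Rightarrow> real"
  assumes "0 \<le> L" "\<And>x y. \<bar>f x - f y\<bar> \<le> L * dist x y"
  shows "lip dist f x \<le> L"
proof -
  have f: "lipschitz_wrt dist f" using assms by (auto simp: lipschitz_wrt_def)
  have "\<bar>f y - f x\<bar> \<le> (L + e) * dist x y" if "0 < e" for e y
    using assms(2)[of x y] that mult_right_mono[of L "L + e" "dist x y"] by (simp add: abs_minus_commute)
  then show ?thesis by (subst lip_dist_le_iff[OF f assms(1)]) simp
qed

text \<open>Replaces explicit epsilon management: an error bound built from perturbed factors is
  compared with its limit for vanishing perturbation.\<close>

lemma exists_small_positive:
  fixes f :: "real \<Rightarrow> real"
  assumes "(f \<longlongrightarrow> l) (at_right 0)" "l < c"
  obtains \<delta> where "0 < \<delta>" "f \<delta> < c"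
proof -
  have "\<forall>\<^sub>F \<delta> in at_right 0. f \<delta> < c" using assms by (rule order_tendstoD)
  moreover have "\<forall>\<^sub>F \<delta> in at_right (0::real). 0 < \<delta>" by (simp add: eventually_at_right_less)
  ultimately have "\<forall>\<^sub>F \<delta> in at_right 0. 0 < \<delta> \<and> f \<delta> < c" by eventually_elim simp
  then show thesis using that eventually_happens trivial_limit_at_right_real by blast
qed

text \<open>Common source of the estimates for sums, multiples, cutoffs and products. The weights
  \<open>a\<close> and \<open>b\<close> are taken at the moving point \<open>y\<close>, so they must
  converge at \<open>x\<close>; the factor \<open>c\<close> of the cutoff increment is frozen at
  \<open>x\<close> and may depend on it.\<close>

lemma lip_le_combination:
  fixes u F H \<phi> a b :: "'a::metric_space \<Rightarrow> real"
  assumes lips: "lipschitz_wrt dist u" "lipschitz_wrt dist F" "lipschitz_wrt dist H" "lipschitz_wrt dist \<phi>"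
    and a: "(a \<longlongrightarrow> a x) (at x)" "0 \<le> a x" and b: "(b \<longlongrightarrow> b x) (at x)" "0 \<le> b x" and c: "0 \<le> c"
    and le: "\<And>y. \<bar>u y - u x\<bar> \<le> a y * \<bar>F y - F x\<bar> + b y * \<bar>H y - H x\<bar> + c * \<bar>\<phi> y - \<phi> x\<bar>"
  shows "lip dist u x \<le> a x * lip dist F x + b x * lip dist H x + c * lip dist \<phi> x" (is "_ \<le> ?R")
proof -
  have R: "0 \<le> ?R" using a b c by simp
  show ?thesis
    unfolding lip_dist_le_iff[OF lips(1) R]
  proof (intro allI impI)
    fix e :: real assume e: "0 < e"
    let ?f = "\<lambda>\<delta>. (a x + \<delta>) * (lip dist F x + \<delta>) + (b x + \<delta>) * (lip dist H x + \<delta>) + c * (lip dist \<phi> x + \<delta>)"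
    have "(?f \<longlongrightarrow> ?R) (at_right 0)" by (auto intro!: tendsto_eq_intros)
    then obtain \<delta> where \<delta>: "0 < \<delta>" "?f \<delta> < ?R + e" using exists_small_positive[of ?f ?R "?R + e"] e by auto
    have "\<forall>\<^sub>F y in at x. a y < a x + \<delta>" "\<forall>\<^sub>F y in at x. b y < b x + \<delta>"
      using \<delta> by (auto intro!: order_tendstoD(2)[OF a(1)] order_tendstoD(2)[OF b(1)])
    with lip_eventually[OF lips(2) \<delta>(1)] lip_eventually[OF lips(3) \<delta>(1)] lip_eventually[OF lips(4) \<delta>(1)]
    show "\<forall>\<^sub>F y in at x. \<bar>u y - u x\<bar> \<le> (?R + e) * dist x y"
    proof eventually_elim
      case (elim y)
      have "\<bar>u y - u x\<bar> \<le> a y * \<bar>F y - F x\<bar> + b y * \<bar>H y - H x\<bar> + c * \<bar>\<phi> y - \<phi> x\<bar>" by (rule le)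
      also have "\<dots> \<le> (a x + \<delta>) * ((lip dist F x + \<delta>) * dist x y)
          + (b x + \<delta>) * ((lip dist H x + \<delta>) * dist x y) + c * ((lip dist \<phi> x + \<delta>) * dist x y)"
        using elim a(2) b(2) c \<delta>(1) by (intro add_mono mult_mono) auto
      also have "\<dots> = ?f \<delta> * dist x y" by (simp add: algebra_simps)
      also have "\<dots> \<le> (?R + e) * dist x y" using \<delta>(2) by (intro mult_right_mono) auto
      finally show ?case .
    qed
  qed
qed

lemma lipschitz_wrt_const [simp]: "lipschitz_wrt dist (\<lambda>x. c)"
  by (auto simp: lipschitz_wrt_def)

lemma lip_const [simp]: "lip dist (\<lambda>x::'a::metric_space. c) x = 0"
proof -
  have "lip dist (\<lambda>x::'a. c) x \<le> 0" by (rule lip_le_lipschitz_constant) auto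
  then show ?thesis by (intro antisym) auto
qed

lemma lipschitz_wrt_add:
  fixes f g :: "'a::metric_space \<Rightarrow> real"
  assumes "lipschitz_wrt dist f" "lipschitz_wrt dist g"
  shows "lipschitz_wrt dist (\<lambda>x. f x + g x)"
  using assms lipschitz_on_add unfolding lipschitz_wrt_dist_iff by blast

lemma lipschitz_wrt_cmult:
  fixes f :: "'a::metric_space \<Rightarrow> real"
  assumes "lipschitz_wrt dist f"
  shows "lipschitz_wrt dist (\<lambda>x. c * f x)"
  using assms lipschitz_on_cmult_real unfolding lipschitz_wrt_dist_iff by blast

lemma lipschitz_wrt_compose:
  fixes f :: "'a::metric_space \<Rightarrow> real" and \<psi> :: "real \<Rightarrow> real"
  assumes "lipschitz_wrt dist f" "lipschitz_wrt dist \<psi>"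
  shows "lipschitz_wrt dist (\<lambda>x. \<psi> (f x))"
  using assms lipschitz_on_compose2[where ?g = \<psi> and ?f = f] lipschitz_on_subset[OF _ subset_UNIV]
  unfolding lipschitz_wrt_dist_iff by metis

lemma lipschitz_wrt_mult:
  fixes f g :: "'a::metric_space \<Rightarrow> real"
  assumes "lipschitz_wrt dist f" "lipschitz_wrt dist g" and f: "\<And>x. \<bar>f x\<bar> \<le> A" and g: "\<And>x. \<bar>g x\<bar> \<le> B"
  shows "lipschitz_wrt dist (\<lambda>x. f x * g x)"
proof -
  obtain K where K: "K \<ge> 0" "\<And>x y. \<bar>f x - f y\<bar> \<le> K * dist x y"
    using assms(1) by (auto simp: lipschitz_wrt_def)
  obtain L where L: "L \<ge> 0" "\<And>x y. \<bar>g x - g y\<bar> \<le> L * dist x y"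
    using assms(2) by (auto simp: lipschitz_wrt_def)
  have A: "0 \<le> A" using f[of undefined] by linarith
  have B: "0 \<le> B" using g[of undefined] by linarith
  have "\<bar>f x * g x - f y * g y\<bar> \<le> (A * L + B * K) * dist x y" for x y
  proof -
    have "f x * g x - f y * g y = f x * (g x - g y) + g y * (f x - f y)" by (simp add: algebra_simps)
    then have "\<bar>f x * g x - f y * g y\<bar> \<le> \<bar>f x\<bar> * \<bar>g x - g y\<bar> + \<bar>g y\<bar> * \<bar>f x - f y\<bar>"
      by (metis abs_mult abs_triangle_ineq)
    also have "\<dots> \<le> A * (L * dist x y) + B * (K * dist x y)"
      using f g K L A B by (intro add_mono mult_mono) auto
    finally show ?thesis by (simp add: algebra_simps)
  qed
  then show ?thesis unfolding lipschitz_wrt_def using A B K(1) L(1) by (intro exI[of _ "A * L + B * K"]) auto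
qed

lemma lip_add_le:
  fixes f g :: "'a::metric_space \<Rightarrow> real"
  assumes "lipschitz_wrt dist f" "lipschitz_wrt dist g"
  shows "lip dist (\<lambda>x. f x + g x) x \<le> lip dist f x + lip dist g x"
  using lip_le_combination[of "\<lambda>x. f x + g x" f g "\<lambda>x. 0" "\<lambda>x. 1" x "\<lambda>x. 1" 0] assms
  by (simp add: lipschitz_wrt_add)

lemma lip_cmult_le:
  fixes f :: "'a::metric_space \<Rightarrow> real"
  assumes "lipschitz_wrt dist f"
  shows "lip dist (\<lambda>x. c * f x) x \<le> \<bar>c\<bar> * lip dist f x"
  using lip_le_combination[of "\<lambda>x. c * f x" f "\<lambda>x. 0" "\<lambda>x. 0" "\<lambda>x. \<bar>c\<bar>" x "\<lambda>x. 0" 0] assms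
  by (simp add: lipschitz_wrt_cmult right_diff_distrib[symmetric] abs_mult)

lemma lip_compose_le:
  fixes F :: "'a::metric_space \<Rightarrow> real" and \<psi> :: "real \<Rightarrow> real"
  assumes F: "lipschitz_wrt dist F" and \<psi>: "lipschitz_wrt dist \<psi>" and k: "0 \<le> k"
    and loc: "\<And>e. 0 < e \<Longrightarrow> \<forall>\<^sub>F s in nhds (F x). \<bar>\<psi> s - \<psi> (F x)\<bar> \<le> (k + e) * \<bar>s - F x\<bar>"
  shows "lip dist (\<lambda>x. \<psi> (F x)) x \<le> k * lip dist F x"
proof -
  have R: "0 \<le> k * lip dist F x" using k by simp
  show ?thesis
    unfolding lip_dist_le_iff[OF lipschitz_wrt_compose[OF F \<psi>] R]
  proof (intro allI impI)
    fix e :: real assume e: "0 < e"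
    let ?f = "\<lambda>\<delta>. (k + \<delta>) * (lip dist F x + \<delta>)"
    have "(?f \<longlongrightarrow> k * lip dist F x) (at_right 0)" by (auto intro!: tendsto_eq_intros)
    then obtain \<delta> where \<delta>: "0 < \<delta>" "?f \<delta> < k * lip dist F x + e"
      using exists_small_positive[of ?f "k * lip dist F x" "k * lip dist F x + e"] e by auto
    have "\<forall>\<^sub>F y in at x. \<bar>\<psi> (F y) - \<psi> (F x)\<bar> \<le> (k + \<delta>) * \<bar>F y - F x\<bar>"
      using loc[OF \<delta>(1)] lipschitz_wrt_tendsto[OF F, of x] by (rule eventually_compose_filterlim)
    with lip_eventually[OF F \<delta>(1)]
    show "\<forall>\<^sub>F y in at x. \<bar>\<psi> (F y) - \<psi> (F x)\<bar> \<le> (k * lip dist F x + e) * dist x y"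
    proof eventually_elim
      case (elim y)
      have "\<bar>\<psi> (F y) - \<psi> (F x)\<bar> \<le> (k + \<delta>) * ((lip dist F x + \<delta>) * dist x y)"
        using elim k \<delta>(1) by (meson add_nonneg_pos less_imp_le mult_left_mono order_trans)
      also have "\<dots> \<le> (k * lip dist F x + e) * dist x y"
        using \<delta>(2) by (subst mult.assoc[symmetric], intro mult_right_mono) auto
      finally show ?case .
    qed
  qed
qed

text \<open>For fixed \<open>k\<close>, \<open>n\<close> and \<open>y\<close> the condition on
  \<open>x\<close> is closed, so even the uncountable intersection over \<open>y\<close> is closed;
  only the precision \<open>k\<close> and the radius \<open>1 / Suc n\<close> remain, and they are
  countable.\<close>

lemma lip_measurable:
  fixes f :: "'a::metric_space \<Rightarrow> real"
  assumes f: "lipschitz_wrt dist f"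
  shows "lip dist f \<in> borel_measurable borel"
proof (rule borel_measurableI_le)
  fix c :: real
  show "{x \<in> space borel. lip dist f x \<le> c} \<in> sets borel"
  proof (cases "0 \<le> c")
    case False
    then have "{x \<in> space borel. lip dist f x \<le> c} = {}"
      using lip_nonneg[of dist f] by (auto simp: not_le intro: order.strict_trans2)
    then show ?thesis by simp
  next
    case True
    let ?A = "\<lambda>k n y. {x. 1 / real (Suc n) \<le> dist x y} \<union> {x. \<bar>f y - f x\<bar> \<le> (c + 1 / real (Suc k)) * dist x y}"
    have cont: "continuous_on UNIV f" by (rule lipschitz_wrt_continuous[OF f])
    have "closed (?A k n y)" for k n y
      by (intro closed_Un closed_Collect_le continuous_intros cont)
    then have closed: "closed (\<Inter>y. ?A k n y)" for k n by blast
    have mem: "x \<in> (\<Inter>k. \<Union>n. \<Inter>y. ?A k n y) \<longleftrightarrow> (\<forall>k. \<exists>n. \<forall>y. x \<in> ?A k n y)" for x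
      by (simp only: INT_iff UN_iff ball_UNIV bex_UNIV)
    have "{x \<in> space borel. lip dist f x \<le> c} = (\<Inter>k. \<Union>n. \<Inter>y. ?A k n y)"
    proof (intro equalityI subsetI)
      fix x assume "x \<in> {x \<in> space borel. lip dist f x \<le> c}"
      then have x: "\<forall>e>0. \<forall>\<^sub>F y in at x. \<bar>f y - f x\<bar> \<le> (c + e) * dist x y"
        using lip_dist_le_iff[OF f True] by simp
      have "\<exists>n. \<forall>y. x \<in> ?A k n y" for k
      proof -
        have "\<forall>\<^sub>F y in at x. \<bar>f y - f x\<bar> \<le> (c + 1 / real (Suc k)) * dist x y" using x by simp
        then obtain r where r: "r > 0"
            "\<And>y. y \<noteq> x \<Longrightarrow> dist y x < r \<Longrightarrow> \<bar>f y - f x\<bar> \<le> (c + 1 / real (Suc k)) * dist x y"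
          unfolding eventually_at by blast
        obtain n where n: "1 / real (Suc n) < r" using r(1) nat_approx_posE by (metis of_nat_Suc)
        have "x \<in> ?A k n y" for y
        proof (cases "y = x \<or> 1 / real (Suc n) \<le> dist x y")
          case False
          then have "dist y x < r" using n by (simp only: dist_commute[of y x]) linarith
          then show ?thesis using r(2)[of y] False by blast
        qed auto
        then show ?thesis by blast
      qed
      then show "x \<in> (\<Inter>k. \<Union>n. \<Inter>y. ?A k n y)" unfolding mem by (rule allI)
    next
      fix x assume x: "x \<in> (\<Inter>k. \<Union>n. \<Inter>y. ?A k n y)"
      have "lip dist f x \<le> c"
        unfolding lip_dist_le_iff[OF f True]
      proof (intro allI impI)
        fix e :: real assume "0 < e"
        then obtain k where k: "1 / real (Suc k) < e" using nat_approx_posE by (metis of_nat_Suc)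
        obtain n where n: "\<And>y. x \<in> ?A k n y" using x unfolding mem by metis
        have "\<bar>f y - f x\<bar> \<le> (c + e) * dist x y" if "dist y x < 1 / real (Suc n)" for y
        proof -
          have "\<bar>f y - f x\<bar> \<le> (c + 1 / real (Suc k)) * dist x y"
            using n[of y] that by (auto simp: dist_commute)
          also have "\<dots> \<le> (c + e) * dist x y" using k by (intro mult_right_mono) auto
          finally show ?thesis .
        qed
        then show "\<forall>\<^sub>F y in at x. \<bar>f y - f x\<bar> \<le> (c + e) * dist x y"
          unfolding eventually_at
          by (intro exI[of _ "1 / real (Suc n)"] conjI ballI impI) (simp, elim conjE, blast)
      qed
      then show "x \<in> {x \<in> space borel. lip dist f x \<le> c}" by simp
    qed
    also have "\<dots> \<in> sets borel"
      using closed by (intro sets.countable_INT'' sets.countable_UN) auto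
    finally show ?thesis .
  qed
qed

lemma L2_bounded_mult:
  assumes "u \<in> borel_measurable m" "\<And>x. \<bar>u x\<bar> \<le> K" "f \<in> L2 m"
  shows "(\<lambda>x. u x * f x) \<in> L2 m" "L2_norm m (\<lambda>x. u x * f x) \<le> K * L2_norm m f"
proof -
  note [measurable] = assms(1) L2_measurable[OF assms(3)]
  have K: "0 \<le> K" using assms(2)[of undefined] by linarith
  have le: "AE x in m. \<bar>u x * f x\<bar> \<le> \<bar>K * f x\<bar>"
    using assms(2) K by (auto simp: abs_mult intro!: mult_right_mono)
  show "(\<lambda>x. u x * f x) \<in> L2 m"
    by (rule L2_bounded[OF _ L2_cmult[OF assms(3)] le]) measurable
  show "L2_norm m (\<lambda>x. u x * f x) \<le> K * L2_norm m f"
    using L2_norm_mono[OF _ L2_cmult[OF assms(3)] le] K by (simp add: L2_norm_cmult)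
qed

lemma L2_lim_bounded_mult:
  assumes "u \<in> borel_measurable m" "\<And>x. \<bar>u x\<bar> \<le> K" "L2_lim m F f"
  shows "L2_lim m (\<lambda>n x. u x * F n x) (\<lambda>x. u x * f x)"
proof (rule L2_lim_squeeze)
  note D = L2_limD[OF assms(3)]
  show "L2_norm m (\<lambda>x. u x * F n x - u x * f x) \<le> K * L2_norm m (\<lambda>x. F n x - f x)" for n
    using L2_bounded_mult(2)[OF assms(1,2) L2_diff[OF D(1,2)]] by (simp add: right_diff_distrib)
  show "(\<lambda>n. K * L2_norm m (\<lambda>x. F n x - f x)) \<longlonglongrightarrow> 0"
    using tendsto_mult_left[OF D(3), of K] by simp
qed (use L2_bounded_mult(1)[OF assms(1,2)] L2_limD[OF assms(3)] in auto)

text \<open>The property under the \<open>SOME\<close> in \<open>min_slope\<close>. As a predicate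
  it can be transported to the conformal space independently of which function is chosen.\<close>

definition is_min_slope :: "('a \<Rightarrow> 'a \<Rightarrow> real) \<Rightarrow> 'a measure \<Rightarrow> ('a \<Rightarrow> real) \<Rightarrow> ('a \<Rightarrow> real) \<Rightarrow> bool" where
  "is_min_slope d m f G \<longleftrightarrow> relaxed_slope d m f G \<and> (\<forall>H. relaxed_slope d m f H \<longrightarrow> (AE x in m. G x \<le> H x))"

lemma is_min_slope_min_slope: "is_min_slope d m f G \<Longrightarrow> is_min_slope d m f (min_slope d m f)"
proof -
  have "min_slope d m f = (SOME G. is_min_slope d m f G)"
    by (simp add: min_slope_def is_min_slope_def)
  then show "is_min_slope d m f G \<Longrightarrow> is_min_slope d m f (min_slope d m f)"
    by (metis someI)
qed

lemma is_min_slope_unique: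
  assumes "is_min_slope d m f G" "is_min_slope d m f H"
  shows "AE x in m. G x = H x"
proof -
  have "AE x in m. G x \<le> H x" "AE x in m. H x \<le> G x" using assms by (auto simp: is_min_slope_def)
  then show ?thesis by eventually_elim auto
qed

locale mm_space =
  fixes m :: "'a::polish_space measure"
  assumes mms: "metric_measure_space m"
begin

lemma geodesic: "geodesic_distance (dist :: 'a \<Rightarrow> 'a \<Rightarrow> real)"
  using mms by (simp add: metric_measure_space_def)

lemma sets_m [measurable_cong]: "sets m = sets borel"
  using mms by (simp add: metric_measure_space_def)

lemma space_m [simp]: "space m = UNIV"
  using sets_eq_imp_space_eq[OF sets_m] by simp

end

section \<open>Transport of measure, distance and slopes to the conformal space\<close>

locale conformal = mm_space m for m :: "'a::polish_space measure" +
  fixes v w :: "'a \<Rightarrow> real"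
  assumes v_cont: "continuous_on UNIV v" and v_bdd: "bounded (range v)"
    and w_cont: "continuous_on UNIV w" and w_bdd: "bounded (range w)"
begin

abbreviation "d' \<equiv> conformal_dist dist w"
abbreviation "m' \<equiv> conformal_measure m v"

lemma v_bound: obtains V where "\<And>x. \<bar>v x\<bar> \<le> V"
  using v_bdd by (auto simp: bounded_iff)

lemma w_bound: obtains W where "\<And>x. \<bar>w x\<bar> \<le> W"
  using w_bdd by (auto simp: bounded_iff)

lemma v_measurable [measurable]: "v \<in> borel_measurable m"
  using borel_measurable_continuous_onI[OF v_cont] measurable_cong_sets[OF sets_m refl] by blast

lemma w_measurable [measurable]: "w \<in> borel_measurable m"
  using borel_measurable_continuous_onI[OF w_cont] measurable_cong_sets[OF sets_m refl] by blast

lemma exp_w_bound: obtains K where "\<And>x. \<bar>exp (c * w x)\<bar> \<le> K"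
proof -
  obtain W where W: "\<And>x. \<bar>w x\<bar> \<le> W" using w_bound by blast
  have "c * w x \<le> \<bar>c\<bar> * W" for x
  proof -
    have "c * w x \<le> \<bar>c\<bar> * \<bar>w x\<bar>" by (metis abs_ge_self abs_mult)
    also have "\<dots> \<le> \<bar>c\<bar> * W" using W by (intro mult_left_mono) auto
    finally show ?thesis .
  qed
  then show thesis by (intro that[of "exp (\<bar>c\<bar> * W)"]) simp
qed

lemma sets_m' [measurable_cong]: "sets m' = sets m"
  by (simp add: conformal_measure_def)

lemma space_m' [simp]: "space m' = UNIV"
  by (simp add: conformal_measure_def)

lemma borel_measurable_m': "borel_measurable m' = borel_measurable m"
  by (rule measurable_cong_sets) (simp_all add: sets_m')

lemma AE_m': "(AE x in m'. P x) \<longleftrightarrow> (AE x in m. P x)"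
  unfolding conformal_measure_def by (subst AE_density) auto

lemma exp_v_bounds: obtains K where "1 \<le> K" "\<And>x. exp (v x) \<le> K" "\<And>x. 1 \<le> K * exp (v x)"
proof -
  obtain V where V: "\<And>x. \<bar>v x\<bar> \<le> V" using v_bound by blast
  have V0: "0 \<le> V" using V[of undefined] by linarith
  have "v x \<le> V" "0 \<le> V + v x" for x using V[of x] by linarith+
  then show thesis using V0 by (intro that[of "exp V"]) (auto simp: exp_add[symmetric])
qed

lemma integrable_m': "integrable m' f \<longleftrightarrow> integrable m (f :: 'a \<Rightarrow> real)"
proof (cases "f \<in> borel_measurable m")
  case False
  then show ?thesis using borel_measurable_m' borel_measurable_integrable by metis
next
  case True
  note [measurable] = True
  obtain K where K: "1 \<le> K" "\<And>x. exp (v x) \<le> K" "\<And>x. 1 \<le> K * exp (v x)" using exp_v_bounds by blast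
  have "integrable m' f \<longleftrightarrow> integrable m (\<lambda>x. exp (v x) *\<^sub>R f x)"
    unfolding conformal_measure_def by (rule integrable_density) auto
  also have "\<dots> \<longleftrightarrow> integrable m f"
  proof
    assume "integrable m (\<lambda>x. exp (v x) *\<^sub>R f x)"
    then have "integrable m (\<lambda>x. K * (exp (v x) * f x))" by simp
    then show "integrable m f"
    proof (rule Bochner_Integration.integrable_bound)
      show "AE x in m. norm (f x) \<le> norm (K * (exp (v x) * f x))"
        using mult_right_mono[OF K(3), of "\<bar>f _\<bar>"] K(1) by (auto simp: abs_mult mult.assoc)
    qed simp
  next
    assume "integrable m f"
    then have "integrable m (\<lambda>x. K * f x)" by simp
    then show "integrable m (\<lambda>x. exp (v x) *\<^sub>R f x)"
    proof (rule Bochner_Integration.integrable_bound)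
      show "AE x in m. norm (exp (v x) *\<^sub>R f x) \<le> norm (K * f x)"
        using mult_right_mono[OF K(2), of "\<bar>f _\<bar>"] K(1) by (auto simp: abs_mult)
    qed simp
  qed
  finally show ?thesis .
qed

lemma integral_m': "f \<in> borel_measurable m \<Longrightarrow> (LINT x|m'. f x) = (LINT x|m. exp (v x) * (f x :: real))"
  unfolding conformal_measure_def by (subst integral_density) auto

lemma L2_m': "L2 m' = L2 m"
  by (auto simp: L2_def integrable_m' borel_measurable_m')

lemma L2_norm_m'_bounds:
  obtains K where "1 \<le> K" "\<And>f. f \<in> L2 m \<Longrightarrow> L2_norm m' f \<le> K * L2_norm m f"
    "\<And>f. f \<in> L2 m \<Longrightarrow> L2_norm m f \<le> K * L2_norm m' f"
proof -
  obtain K where K: "1 \<le> K" "\<And>x. exp (v x) \<le> K" "\<And>x. 1 \<le> K * exp (v x)" using exp_v_bounds by blast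
  have *: "(LINT x|m'. (f x)\<^sup>2) \<le> K * (LINT x|m. (f x)\<^sup>2)" "(LINT x|m. (f x)\<^sup>2) \<le> K * (LINT x|m'. (f x)\<^sup>2)"
    if f: "f \<in> L2 m" for f
  proof -
    note [measurable] = L2_measurable[OF f]
    have i: "integrable m (\<lambda>x. (f x)\<^sup>2)" using f by (rule L2_integrable_square)
    have i': "integrable m (\<lambda>x. exp (v x) * (f x)\<^sup>2)"
      using i integrable_m'[of "\<lambda>x. (f x)\<^sup>2"] unfolding conformal_measure_def
      by (subst (asm) integrable_density) auto
    have "(LINT x|m'. (f x)\<^sup>2) = (LINT x|m. exp (v x) * (f x)\<^sup>2)" by (rule integral_m') measurable
    moreover have "(LINT x|m. exp (v x) * (f x)\<^sup>2) \<le> (LINT x|m. K * (f x)\<^sup>2)"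
      using i i' K(2) by (intro integral_mono mult_right_mono) auto
    moreover have "(LINT x|m. (f x)\<^sup>2) \<le> (LINT x|m. K * (exp (v x) * (f x)\<^sup>2))"
      using i i' mult_right_mono[OF K(3), of "(f _)\<^sup>2"] by (intro integral_mono) (auto simp: mult.assoc)
    ultimately show "(LINT x|m'. (f x)\<^sup>2) \<le> K * (LINT x|m. (f x)\<^sup>2)"
      "(LINT x|m. (f x)\<^sup>2) \<le> K * (LINT x|m'. (f x)\<^sup>2)" by simp_all
  qed
  show thesis
  proof (rule that[of "sqrt K"])
    show "1 \<le> sqrt K" using K(1) by simp
    show "L2_norm m' f \<le> sqrt K * L2_norm m f" if "f \<in> L2 m" for f
      using *(1)[OF that] by (simp add: L2_norm_def real_sqrt_mult[symmetric])
    show "L2_norm m f \<le> sqrt K * L2_norm m' f" if "f \<in> L2 m" for f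
      using *(2)[OF that] by (simp add: L2_norm_def real_sqrt_mult[symmetric])
  qed
qed

lemma L2_lim_m': "L2_lim m' F f \<longleftrightarrow> L2_lim m F f"
proof -
  obtain K where K: "1 \<le> K" "\<And>f. f \<in> L2 m \<Longrightarrow> L2_norm m' f \<le> K * L2_norm m f"
    "\<And>f. f \<in> L2 m \<Longrightarrow> L2_norm m f \<le> K * L2_norm m' f" using L2_norm_m'_bounds by blast
  show ?thesis
  proof
    assume a: "L2_lim m' F f"
    note D = L2_limD[OF a]
    note D' = D(1,2)[unfolded L2_m']
    show "L2_lim m F f"
      by (rule L2_lim_squeeze[OF D' K(3)[OF L2_diff[OF D']]])
        (use tendsto_mult_left[OF D(3), of K] in simp)
  next
    assume a: "L2_lim m F f"
    note D = L2_limD[OF a]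
    note D' = D(1,2)[folded L2_m']
    show "L2_lim m' F f"
      by (rule L2_lim_squeeze[OF D' K(2)[OF L2_diff[OF D(1,2)]]])
        (use tendsto_mult_left[OF D(3), of K] in simp)
  qed
qed

lemma conformal_dist_comparable:
  obtains K where "1 \<le> K" "\<And>x y. d' x y \<le> K * dist x y" "\<And>x y. dist x y \<le> K * d' x y"
proof -
  obtain W where W: "\<And>x. \<bar>w x\<bar> \<le> W" using w_bound by blast
  have W': "w x \<le> W" "- W \<le> w x" for x using W[of x] by linarith+
  have W0: "0 \<le> W" using W[of undefined] by linarith
  show thesis
  proof (rule that[of "exp W"])
    show "1 \<le> exp W" using W0 by simp
    show "d' x y \<le> exp W * dist x y" for x y by (rule conformal_dist_upper[OF geodesic W'(1)])
    have "exp (- W) * dist x y \<le> d' x y" for x y by (rule conformal_dist_ge_exp[OF geodesic w_bdd W'(2)])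
    then show "dist x y \<le> exp W * d' x y" for x y by (simp add: exp_minus field_simps)
  qed
qed

lemma conformal_dist_pos: "y \<noteq> x \<Longrightarrow> 0 < d' x y"
proof -
  assume "y \<noteq> x"
  obtain K where K: "1 \<le> K" "\<And>x y. dist x y \<le> K * d' x y" using conformal_dist_comparable by metis
  have "0 < K * d' x y" using K(2)[of x y] \<open>y \<noteq> x\<close> by (intro less_le_trans[OF _ K(2)]) simp
  then show ?thesis using K(1) by (simp add: zero_less_mult_iff)
qed

lemma lipschitz_conformal: "lipschitz_wrt d' f \<longleftrightarrow> lipschitz_wrt dist f"
proof -
  obtain K where K: "1 \<le> K" "\<And>x y. d' x y \<le> K * dist x y" "\<And>x y. dist x y \<le> K * d' x y"
    using conformal_dist_comparable by blast
  show ?thesis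
  proof
    assume "lipschitz_wrt d' f"
    then obtain L where L: "0 \<le> L" "\<And>x y. \<bar>f x - f y\<bar> \<le> L * d' x y" by (auto simp: lipschitz_wrt_def)
    have "\<bar>f x - f y\<bar> \<le> (L * K) * dist x y" for x y
      using L(2)[of x y] mult_left_mono[OF K(2)[of x y] L(1)] by (simp add: mult.assoc)
    then show "lipschitz_wrt dist f" unfolding lipschitz_wrt_def using L(1) K(1)
      by (intro exI[of _ "L * K"]) auto
  next
    assume "lipschitz_wrt dist f"
    then obtain L where L: "0 \<le> L" "\<And>x y. \<bar>f x - f y\<bar> \<le> L * dist x y" by (auto simp: lipschitz_wrt_def)
    have "\<bar>f x - f y\<bar> \<le> (L * K) * d' x y" for x y
      using L(2)[of x y] mult_left_mono[OF K(3)[of x y] L(1)] by (simp add: mult.assoc)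
    then show "lipschitz_wrt d' f" unfolding lipschitz_wrt_def using L(1) K(1)
      by (intro exI[of _ "L * K"]) auto
  qed
qed

lemma punctured_nhds_conformal: "punctured_nhds d' x = at x"
proof (rule filter_eqI)
  obtain K where K: "1 \<le> K" "\<And>x y. d' x y \<le> K * dist x y" "\<And>x y. dist x y \<le> K * d' x y"
    using conformal_dist_comparable by blast
  fix P
  show "eventually P (punctured_nhds d' x) \<longleftrightarrow> eventually P (at x)"
    unfolding punctured_nhds_dist[symmetric] eventually_punctured_nhds
  proof
    assume "\<exists>r>0. \<forall>y. y \<noteq> x \<and> d' x y < r \<longrightarrow> P y"
    then obtain r where r: "r > 0" "\<And>y. y \<noteq> x \<Longrightarrow> d' x y < r \<Longrightarrow> P y" by blast
    show "\<exists>r>0. \<forall>y. y \<noteq> x \<and> dist x y < r \<longrightarrow> P y"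
    proof (intro exI[of _ "r / K"] conjI allI impI)
      show "0 < r / K" using r(1) K(1) by simp
      fix y assume y: "y \<noteq> x \<and> dist x y < r / K"
      then have "K * dist x y < r" using K(1) by (simp add: field_simps)
      then show "P y" using r(2)[of y] y K(2)[of x y] by simp
    qed
  next
    assume "\<exists>r>0. \<forall>y. y \<noteq> x \<and> dist x y < r \<longrightarrow> P y"
    then obtain r where r: "r > 0" "\<And>y. y \<noteq> x \<Longrightarrow> dist x y < r \<Longrightarrow> P y" by blast
    show "\<exists>r>0. \<forall>y. y \<noteq> x \<and> d' x y < r \<longrightarrow> P y"
    proof (intro exI[of _ "r / K"] conjI allI impI)
      show "0 < r / K" using r(1) K(1) by simp
      fix y assume y: "y \<noteq> x \<and> d' x y < r / K"
      then have "K * d' x y < r" using K(1) by (simp add: field_simps)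
      then show "P y" using r(2)[of y] y K(3)[of x y] by simp
    qed
  qed
qed

text \<open>Both slopes are read through \<open>lip_le_iff\<close> along the same filter
  \<open>at x\<close>. Near \<open>x\<close> the ratio of the distances lies between
  \<open>exp (w x - \<delta>)\<close> and \<open>exp (w x + \<delta>)\<close>, and letting
  \<open>\<delta>\<close> vanish absorbs this into the error \<open>e\<close>.\<close>

lemma lip_conformal_le_iff:
  assumes f: "lipschitz_wrt dist f" and c: "0 \<le> c"
  shows "lip d' f x \<le> c \<longleftrightarrow> lip dist f x \<le> exp (w x) * c"
proof -
  have f': "lipschitz_wrt d' f" using f by (simp add: lipschitz_conformal)
  have near: "\<forall>\<^sub>F y in at x. d' x y \<le> exp (w x + \<delta>) * dist x y \<and> exp (w x - \<delta>) * dist x y \<le> d' x y"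
    if \<delta>: "0 < \<delta>" for \<delta>
  proof -
    obtain r where "0 < r" "\<And>y. dist x y < r \<Longrightarrow> d' x y \<le> exp (w x + \<delta>) * dist x y"
      "\<And>y. dist x y < r \<Longrightarrow> exp (w x - \<delta>) * dist x y \<le> d' x y"
      using conformal_dist_local[OF geodesic w_cont w_bdd \<delta>] by blast
    then show ?thesis unfolding eventually_at by (metis dist_commute)
  qed
  have c': "0 \<le> exp (w x) * c" using c by simp
  have "lip d' f x \<le> c \<longleftrightarrow> (\<forall>e>0. \<forall>\<^sub>F y in at x. \<bar>f y - f x\<bar> \<le> (c + e) * d' x y)"
    by (subst lip_le_iff) (simp_all add: conformal_dist_pos f' c punctured_nhds_conformal)
  moreover have "lip dist f x \<le> exp (w x) * c \<longleftrightarrow>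
      (\<forall>e>0. \<forall>\<^sub>F y in at x. \<bar>f y - f x\<bar> \<le> (exp (w x) * c + e) * dist x y)"
    by (rule lip_dist_le_iff[OF f c'])
  moreover have "(\<forall>e>0. \<forall>\<^sub>F y in at x. \<bar>f y - f x\<bar> \<le> (c + e) * d' x y) \<longleftrightarrow>
      (\<forall>e>0. \<forall>\<^sub>F y in at x. \<bar>f y - f x\<bar> \<le> (exp (w x) * c + e) * dist x y)"
  proof (intro iffI allI impI)
    fix e :: real assume L: "\<forall>e>0. \<forall>\<^sub>F y in at x. \<bar>f y - f x\<bar> \<le> (c + e) * d' x y" and e: "0 < e"
    let ?g = "\<lambda>\<delta>. (c + \<delta>) * exp (w x + \<delta>)"
    have "(?g \<longlongrightarrow> c * exp (w x)) (at_right 0)" by (auto intro!: tendsto_eq_intros)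
    then obtain \<delta> where \<delta>: "0 < \<delta>" "?g \<delta> < c * exp (w x) + e"
      using exists_small_positive[of ?g "c * exp (w x)" "c * exp (w x) + e"] e by auto
    from L \<delta>(1) have "\<forall>\<^sub>F y in at x. \<bar>f y - f x\<bar> \<le> (c + \<delta>) * d' x y" by blast
    with near[OF \<delta>(1)] show "\<forall>\<^sub>F y in at x. \<bar>f y - f x\<bar> \<le> (exp (w x) * c + e) * dist x y"
    proof eventually_elim
      case (elim y)
      have "\<bar>f y - f x\<bar> \<le> (c + \<delta>) * (exp (w x + \<delta>) * dist x y)"
        using elim c \<delta>(1) by (meson add_nonneg_pos less_imp_le mult_left_mono order_trans)
      also have "\<dots> = ?g \<delta> * dist x y" by simp
      also have "\<dots> \<le> (c * exp (w x) + e) * dist x y" using \<delta>(2) by (intro mult_right_mono) auto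
      finally show ?case by (simp add: mult.commute)
    qed
  next
    fix e :: real
    assume L: "\<forall>e>0. \<forall>\<^sub>F y in at x. \<bar>f y - f x\<bar> \<le> (exp (w x) * c + e) * dist x y" and e: "0 < e"
    let ?g = "\<lambda>\<delta>. (exp (w x) * c + \<delta>) - (c + e) * exp (w x - \<delta>)"
    have "(?g \<longlongrightarrow> exp (w x) * c - (c + e) * exp (w x)) (at_right 0)" by (auto intro!: tendsto_eq_intros)
    moreover have "exp (w x) * c - (c + e) * exp (w x) < 0" using e by (simp add: algebra_simps)
    ultimately obtain \<delta> where \<delta>: "0 < \<delta>" "?g \<delta> < 0"
      using exists_small_positive[of ?g _ 0] by blast
    from L \<delta>(1) have "\<forall>\<^sub>F y in at x. \<bar>f y - f x\<bar> \<le> (exp (w x) * c + \<delta>) * dist x y" by blast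
    with near[OF \<delta>(1)] show "\<forall>\<^sub>F y in at x. \<bar>f y - f x\<bar> \<le> (c + e) * d' x y"
    proof eventually_elim
      case (elim y)
      have "\<bar>f y - f x\<bar> \<le> (exp (w x) * c + \<delta>) * dist x y" by (rule elim(2))
      also have "\<dots> \<le> ((c + e) * exp (w x - \<delta>)) * dist x y" using \<delta>(2) by (intro mult_right_mono) auto
      also have "\<dots> \<le> (c + e) * d' x y"
        using elim(1) c e by (subst mult.assoc, intro mult_left_mono) auto
      finally show ?case .
    qed
  qed
  ultimately show ?thesis by blast
qed

lemma exp_cancel: "exp a * (exp (- a) * b) = b" "exp (- a) * (exp a * b) = b" for a b :: real
  by (simp_all add: mult.assoc[symmetric] exp_add[symmetric])

lemma lip_conformal:
  assumes f: "lipschitz_wrt dist f"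
  shows "lip d' f x = exp (- w x) * lip dist f x"
proof (rule antisym)
  show "lip d' f x \<le> exp (- w x) * lip dist f x"
    by (subst lip_conformal_le_iff[OF f]) (auto simp: exp_cancel)
  have "lip dist f x \<le> exp (w x) * lip d' f x"
    by (subst lip_conformal_le_iff[OF f, symmetric]) auto
  then show "exp (- w x) * lip dist f x \<le> lip d' f x"
    by (simp add: exp_minus field_simps)
qed

lemma L2_lim_exp_w: "L2_lim m F f \<Longrightarrow> L2_lim m (\<lambda>n x. exp (c * w x) * F n x) (\<lambda>x. exp (c * w x) * f x)"
proof -
  obtain K where K: "\<And>x. \<bar>exp (c * w x)\<bar> \<le> K" using exp_w_bound[of c] by blast
  show "L2_lim m F f \<Longrightarrow> L2_lim m (\<lambda>n x. exp (c * w x) * F n x) (\<lambda>x. exp (c * w x) * f x)"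
    by (rule L2_lim_bounded_mult[OF _ K]) measurable
qed

text \<open>The same Lipschitz sequences compete on both sides; multiplication by the bounded
  weights \<open>exp (w x)\<close> and \<open>exp (- w x)\<close> is continuous in L2, and
  convergence in L2 means the same for both measures.\<close>

lemma relaxed_slope_conformal:
  "relaxed_slope d' m' f G \<longleftrightarrow> relaxed_slope dist m f (\<lambda>x. exp (w x) * G x)"
proof -
  have "L2_lim m (\<lambda>n. lip d' (F n)) G \<longleftrightarrow> L2_lim m (\<lambda>n. lip dist (F n)) (\<lambda>x. exp (w x) * G x)"
    if F: "\<forall>n. lipschitz_wrt dist (F n)" for F
  proof -
    have eq: "lip d' (F n) = (\<lambda>x. exp (- w x) * lip dist (F n) x)" for n
      using F lip_conformal by blast
    show ?thesis
      unfolding eq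
      using L2_lim_exp_w[of "\<lambda>n x. exp (- w x) * lip dist (F n) x" G 1]
        L2_lim_exp_w[of "\<lambda>n. lip dist (F n)" "\<lambda>x. exp (w x) * G x" "-1"]
      by (auto simp: exp_cancel)
  qed
  then show ?thesis unfolding relaxed_slope_def lipschitz_conformal L2_lim_m' by blast
qed

lemma relaxed_slope_conformal':
  "relaxed_slope dist m f G \<longleftrightarrow> relaxed_slope d' m' f (\<lambda>x. exp (- w x) * G x)"
  unfolding relaxed_slope_conformal by (simp add: exp_cancel)

lemma sobolev_conformal: "sobolev d' m' = sobolev dist m"
  unfolding sobolev_def L2_m' using relaxed_slope_conformal relaxed_slope_conformal' by blast

lemma is_min_slope_conformal:
  assumes "is_min_slope dist m f G"
  shows "is_min_slope d' m' f (\<lambda>x. exp (- w x) * G x)"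
  unfolding is_min_slope_def AE_m'
proof (intro conjI allI impI)
  show "relaxed_slope d' m' f (\<lambda>x. exp (- w x) * G x)"
    using assms by (simp add: is_min_slope_def relaxed_slope_conformal'[symmetric])
  fix H assume "relaxed_slope d' m' f H"
  then have "AE x in m. G x \<le> exp (w x) * H x"
    using assms by (simp add: is_min_slope_def relaxed_slope_conformal)
  then show "AE x in m. exp (- w x) * G x \<le> H x"
    by eventually_elim (simp add: exp_minus field_simps)
qed

lemma min_slope_conformal:
  assumes "is_min_slope dist m f (min_slope dist m f)"
  shows "AE x in m. min_slope d' m' f x = exp (- w x) * min_slope dist m f x"
  using is_min_slope_unique[OF is_min_slope_min_slope is_min_slope_conformal[OF assms],
      OF is_min_slope_conformal[OF assms]] by (simp add: AE_m')

end

section \<open>Minimal relaxed slopes\<close>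

text \<open>Slopes survive multiplication by Lipschitz cutoffs but not by indicators, so statements
  about a compact set are reached as limits of statements about cutoffs.\<close>

lemma compact_indicator_approx:
  fixes K :: "'a::metric_space set"
  assumes K: "compact K"
  obtains \<phi> :: "nat \<Rightarrow> 'a \<Rightarrow> real" and L :: "nat \<Rightarrow> real" where
    "\<And>n x. 0 \<le> \<phi> n x" "\<And>n x. \<phi> n x \<le> 1" "\<And>n. 0 \<le> L n"
    "\<And>n x y. \<bar>\<phi> n x - \<phi> n y\<bar> \<le> L n * dist x y" "\<And>x. (\<lambda>n. \<phi> n x) \<longlonglongrightarrow> indicator K x"
proof (cases "K = {}")
  case True
  then show thesis by (intro that[of "\<lambda>n x. 0" "\<lambda>n. 0"]) auto
next
  case False
  define \<phi> where "\<phi> n x = max 0 (1 - real n * infdist x K)" for n :: nat and x :: 'a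
  show thesis
  proof (rule that[of \<phi> real])
    show "\<bar>\<phi> n x - \<phi> n y\<bar> \<le> real n * dist x y" for n x y
    proof -
      have "\<bar>\<phi> n x - \<phi> n y\<bar> \<le> \<bar>real n * infdist x K - real n * infdist y K\<bar>"
        unfolding \<phi>_def by linarith
      also have "\<dots> = real n * \<bar>infdist x K - infdist y K\<bar>"
        by (simp add: right_diff_distrib[symmetric] abs_mult)
      also have "\<dots> \<le> real n * dist x y"
        by (intro mult_left_mono infdist_triangle_abs) auto
      finally show ?thesis .
    qed
    show "(\<lambda>n. \<phi> n x) \<longlonglongrightarrow> indicator K x" for x
    proof (cases "x \<in> K")
      case True
      then show ?thesis by (simp add: \<phi>_def)
    next
      case out: False
      have "infdist x K \<noteq> 0"
        using in_closed_iff_infdist_zero[OF compact_imp_closed[OF K] False, of x] out by simp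
      then have pos: "0 < infdist x K" using infdist_nonneg[of x K] by simp
      have "\<forall>\<^sub>F n in sequentially. \<phi> n x = 0"
      proof -
        obtain n0 :: nat where n0: "1 / infdist x K < real n0" using reals_Archimedean2 by blast
        have "\<phi> n x = 0" if "n0 \<le> n" for n
        proof -
          have "1 / infdist x K < real n" using n0 that by linarith
          then have "1 < real n * infdist x K" using pos by (simp add: divide_less_eq)
          then show ?thesis by (simp add: \<phi>_def)
        qed
        then show ?thesis unfolding eventually_sequentially by blast
      qed
      then show ?thesis using out by (simp add: tendsto_eventually)
    qed
  qed (auto simp: \<phi>_def intro!: mult_nonneg_nonneg infdist_nonneg)
qed

text \<open>Inner regularity is applied to the finite measure with density
  \<open>\<bar>q\<bar>\<close>, since \<open>m\<close> itself may have infinite mass. On a compact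
  subset of \<open>{x. 0 < q x}\<close> the integral of \<open>q\<close> is both nonnegative and
  nonpositive, so that subset is null for the weighted measure.\<close>

lemma AE_nonpos_of_compact_integrals:
  fixes m :: "'a::polish_space measure" and q :: "'a \<Rightarrow> real"
  assumes sets: "sets m = sets borel" and q: "integrable m q"
    and le: "\<And>K. compact K \<Longrightarrow> (LINT x|m. indicator K x * q x) \<le> 0"
  shows "AE x in m. q x \<le> 0"
proof -
  note [measurable] = borel_measurable_integrable[OF q]
  have space: "space m = UNIV" using sets_eq_imp_space_eq[OF sets] by simp
  define \<mu> where "\<mu> = density m (\<lambda>x. ennreal \<bar>q x\<bar>)"
  have sets\<mu>: "sets \<mu> = sets borel" by (simp add: \<mu>_def sets)
  have em: "emeasure \<mu> B = (\<integral>\<^sup>+x. ennreal \<bar>q x\<bar> * indicator B x \<partial>m)" if "B \<in> sets m" for B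
    unfolding \<mu>_def using that by (intro emeasure_density) auto
  define A where "A = {x. 0 < q x}"
  have A: "A \<in> sets m"
  proof -
    have "{x \<in> space m. 0 < q x} \<in> sets m" by measurable
    then show ?thesis by (simp add: A_def space)
  qed
  have "emeasure \<mu> (space \<mu>) = (\<integral>\<^sup>+x. ennreal \<bar>q x\<bar> \<partial>m)"
    using em[of UNIV] sets.top[of m] by (simp add: \<mu>_def space)
  also have "\<dots> < \<infinity>" using q by (simp add: integrable_iff_bounded)
  finally have fin: "emeasure \<mu> (space \<mu>) \<noteq> \<infinity>" by simp
  have "emeasure \<mu> A = (SUP K \<in> {K. K \<subseteq> A \<and> compact K}. emeasure \<mu> K)"
    using A sets by (intro inner_regular sets\<mu> fin) simp
  also have "\<dots> \<le> 0"
  proof (rule SUP_least)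
    fix K assume "K \<in> {K. K \<subseteq> A \<and> compact K}"
    then have K: "K \<subseteq> A" "compact K" by auto
    have Km [measurable]: "K \<in> sets m" using K(2) by (simp add: sets borel_compact)
    have i: "integrable m (\<lambda>x. indicator K x * q x)"
      using integrable_mult_indicator[OF Km q] by simp
    have nn: "0 \<le> indicator K x * q x" for x using K(1) by (auto simp: A_def indicator_def less_imp_le)
    have "(LINT x|m. indicator K x * q x) = 0" using le[OF K(2)] nn by (intro antisym) auto
    then have "AE x in m. indicator K x * q x = 0"
      using integral_nonneg_eq_0_iff_AE[OF i] nn by simp
    then have "AE x in m. ennreal \<bar>q x\<bar> * indicator K x = 0"
      by eventually_elim (auto simp: indicator_def)
    then have "(\<integral>\<^sup>+x. ennreal \<bar>q x\<bar> * indicator K x \<partial>m) = 0"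
      by (subst nn_integral_0_iff_AE) auto
    then show "emeasure \<mu> K \<le> 0" using em[OF Km] by simp
  qed
  finally have "(\<integral>\<^sup>+x. ennreal \<bar>q x\<bar> * indicator A x \<partial>m) = 0" using em[OF A] by simp
  then have "AE x in m. ennreal \<bar>q x\<bar> * indicator A x = 0"
    using A by (subst (asm) nn_integral_0_iff_AE) auto
  then show ?thesis by eventually_elim (auto simp: A_def indicator_def split: if_splits)
qed

context mm_space
begin

lemma borel_measurable_m: "borel_measurable m = borel_measurable borel"
  by (rule measurable_cong_sets[OF sets_m refl])

lemma lipschitz_measurable: "lipschitz_wrt dist f \<Longrightarrow> f \<in> borel_measurable m"
  unfolding borel_measurable_m by (intro borel_measurable_continuous_onI lipschitz_wrt_continuous)

lemma lip_measurable_m: "lipschitz_wrt dist f \<Longrightarrow> lip dist f \<in> borel_measurable m"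
  unfolding borel_measurable_m by (rule lip_measurable)

text \<open>\<open>K\<close> is a majorant of the slope and not the slope itself, because sums,
  products and cutoffs yield estimates for \<open>lip\<close> rather than equalities.\<close>

definition admissible :: "('a \<Rightarrow> real) \<Rightarrow> ('a \<Rightarrow> real) \<Rightarrow> bool" where
  "admissible F K \<longleftrightarrow> lipschitz_wrt dist F \<and> (\<exists>B. \<forall>x. \<bar>F x\<bar> \<le> B) \<and> F \<in> L2 m \<and> K \<in> L2 m \<and>
    (AE x in m. lip dist F x \<le> K x)"

text \<open>Boundedness of the approximating Lipschitz functions makes products with Lipschitz cutoffs
  Lipschitz again. It costs nothing, since truncation does not increase \<open>lip\<close>.\<close>

definition weak_slope :: "('a \<Rightarrow> real) \<Rightarrow> ('a \<Rightarrow> real) \<Rightarrow> bool" where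
  "weak_slope f H \<longleftrightarrow> f \<in> L2 m \<and> H \<in> L2 m \<and> (\<forall>e>0. \<exists>F K. admissible F K \<and>
    L2_norm m (\<lambda>x. F x - f x) < e \<and> L2_norm m (\<lambda>x. K x - H x) < e)"

lemma admissibleD:
  assumes "admissible F K"
  shows "lipschitz_wrt dist F" "\<exists>B. \<forall>x. \<bar>F x\<bar> \<le> B" "F \<in> L2 m" "K \<in> L2 m" "AE x in m. lip dist F x \<le> K x"
  using assms by (auto simp: admissible_def)

lemma admissible_lip:
  assumes "admissible F K"
  shows "admissible F (lip dist F)" "lip dist F \<in> L2 m" "L2_norm m (lip dist F) \<le> L2_norm m K"
proof -
  note A = admissibleD[OF assms]
  have le: "AE x in m. \<bar>lip dist F x\<bar> \<le> \<bar>K x\<bar>"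
    using A(5) by eventually_elim auto
  show l: "lip dist F \<in> L2 m" by (rule L2_bounded[OF lip_measurable_m[OF A(1)] A(4) le])
  then show "admissible F (lip dist F)" using A by (auto simp: admissible_def)
  show "L2_norm m (lip dist F) \<le> L2_norm m K" by (rule L2_norm_mono[OF lip_measurable_m[OF A(1)] A(4) le])
qed

lemma weak_slopeD: "weak_slope f H \<Longrightarrow> f \<in> L2 m" "weak_slope f H \<Longrightarrow> H \<in> L2 m"
  by (simp_all add: weak_slope_def)

lemma weak_slopeI:
  assumes "\<And>n. admissible (F n) (K n)" "L2_lim m F f" "L2_lim m K H"
  shows "weak_slope f H"
  unfolding weak_slope_def
proof (intro conjI allI impI)
  fix e :: real assume e: "0 < e"
  have "\<forall>\<^sub>F n in sequentially. L2_norm m (\<lambda>x. F n x - f x) < e \<and> L2_norm m (\<lambda>x. K n x - H x) < e"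
    using order_tendstoD(2)[OF L2_limD(3)[OF assms(2)] e] order_tendstoD(2)[OF L2_limD(3)[OF assms(3)] e]
    by eventually_elim simp
  then obtain n where "L2_norm m (\<lambda>x. F n x - f x) < e \<and> L2_norm m (\<lambda>x. K n x - H x) < e"
    by (auto simp: eventually_sequentially)
  then show "\<exists>F K. admissible F K \<and> L2_norm m (\<lambda>x. F x - f x) < e \<and> L2_norm m (\<lambda>x. K x - H x) < e"
    using assms(1) by blast
qed (use L2_limD[OF assms(2)] L2_limD[OF assms(3)] in auto)

lemma weak_slope_sequence:
  assumes "weak_slope f H"
  shows "\<exists>F K. (\<forall>n. admissible (F n) (K n)) \<and> L2_lim m F f \<and> L2_lim m K H"
proof -
  have "\<exists>F K. admissible F K \<and> L2_norm m (\<lambda>x. F x - f x) < inverse (real (Suc n)) \<and>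
      L2_norm m (\<lambda>x. K x - H x) < inverse (real (Suc n))" for n
    using assms unfolding weak_slope_def by (simp del: of_nat_Suc)
  then obtain F K where FK: "\<And>n. admissible (F n) (K n)"
    "\<And>n. L2_norm m (\<lambda>x. F n x - f x) < inverse (real (Suc n))"
    "\<And>n. L2_norm m (\<lambda>x. K n x - H x) < inverse (real (Suc n))" by metis
  have "L2_lim m F f" "L2_lim m K H"
    using admissibleD(3,4)[OF FK(1)] weak_slopeD[OF assms] FK(2,3)
    by (auto intro!: L2_lim_squeeze[OF _ _ _ LIMSEQ_inverse_real_of_nat] less_imp_le)
  then show ?thesis using FK(1) by blast
qed

text \<open>Since \<open>weak_slope\<close> asks for one approximant per \<open>e\<close>, the
  diagonal argument reduces to two triangle inequalities.\<close>

lemma weak_slope_closed: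
  assumes w: "\<And>n. weak_slope (f n) (H n)" and f: "L2_lim m f g" and H: "L2_lim m H J"
  shows "weak_slope g J"
  unfolding weak_slope_def
proof (intro conjI allI impI)
  fix e :: real assume e: "0 < e"
  then have e2: "0 < e / 2" by simp
  have "\<forall>\<^sub>F n in sequentially. L2_norm m (\<lambda>x. f n x - g x) < e / 2 \<and> L2_norm m (\<lambda>x. H n x - J x) < e / 2"
    using order_tendstoD(2)[OF L2_limD(3)[OF f] e2] order_tendstoD(2)[OF L2_limD(3)[OF H] e2]
    by eventually_elim simp
  then obtain n where n: "L2_norm m (\<lambda>x. f n x - g x) < e / 2" "L2_norm m (\<lambda>x. H n x - J x) < e / 2"
    by (auto simp: eventually_sequentially)
  obtain F K where FK: "admissible F K" "L2_norm m (\<lambda>x. F x - f n x) < e / 2" "L2_norm m (\<lambda>x. K x - H n x) < e / 2"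
    using w[of n] e2 unfolding weak_slope_def by blast
  have "L2_norm m (\<lambda>x. F x - g x) < e"
    using L2_norm_triangle_diff[OF admissibleD(3)[OF FK(1)] L2_limD(1,2)[OF f], of n] FK(2) n(1) by simp
  moreover have "L2_norm m (\<lambda>x. K x - J x) < e"
    using L2_norm_triangle_diff[OF admissibleD(4)[OF FK(1)] L2_limD(1,2)[OF H], of n] FK(3) n(2) by simp
  ultimately show "\<exists>F K. admissible F K \<and> L2_norm m (\<lambda>x. F x - g x) < e \<and> L2_norm m (\<lambda>x. K x - J x) < e"
    using FK(1) by blast
qed (use L2_limD[OF f] L2_limD[OF H] in auto)

lemma weak_slope_nonneg:
  assumes "weak_slope f H"
  shows "AE x in m. 0 \<le> H x"
proof -
  obtain F K where FK: "\<forall>n. admissible (F n) (K n)" "L2_lim m F f" "L2_lim m K H"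
    using weak_slope_sequence[OF assms] by blast
  obtain r :: "nat \<Rightarrow> nat" where r: "AE x in m. (\<lambda>n. K (r n) x) \<longlonglongrightarrow> H x"
    using L2_lim_AE_subseq[OF FK(3)] by blast
  have "AE x in m. 0 \<le> K n x" for n
    using admissibleD(5)[OF FK(1)[rule_format], of n] by eventually_elim (auto intro: order_trans[OF lip_nonneg])
  then have "AE x in m. \<forall>n. 0 \<le> K n x" by (simp add: AE_all_countable)
  with r show ?thesis by eventually_elim (auto intro: LIMSEQ_le_const)
qed

lemma relaxed_slope_imp_weak_slope:
  assumes "relaxed_slope dist m f G"
  shows "weak_slope f G"
  unfolding weak_slope_def
proof (intro conjI allI impI)
  obtain F where F: "\<And>n. lipschitz_wrt dist (F n)" "L2_lim m F f" "L2_lim m (\<lambda>n. lip dist (F n)) G"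
    using assms unfolding relaxed_slope_def by blast
  show "f \<in> L2 m" "G \<in> L2 m" using L2_limD F(2,3) by blast+
  fix e :: real assume e: "0 < e"
  then have e2: "0 < e / 2" by simp
  have "\<forall>\<^sub>F n in sequentially. L2_norm m (\<lambda>x. F n x - f x) < e / 2 \<and> L2_norm m (\<lambda>x. lip dist (F n) x - G x) < e"
    using order_tendstoD(2)[OF L2_limD(3)[OF F(2)] e2] order_tendstoD(2)[OF L2_limD(3)[OF F(3)] e]
    by eventually_elim simp
  then obtain n where n: "L2_norm m (\<lambda>x. F n x - f x) < e / 2" "L2_norm m (\<lambda>x. lip dist (F n) x - G x) < e"
    by (auto simp: eventually_sequentially)
  define T where "T N t = max (- real N) (min (real N) t)" for N :: nat and t :: real
  have T1: "\<bar>T N s - T N t\<bar> \<le> \<bar>s - t\<bar>" for N s t unfolding T_def by linarith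
  have T2: "\<bar>T N t\<bar> \<le> \<bar>t\<bar>" "\<bar>T N t\<bar> \<le> real N" for N t unfolding T_def by linarith+
  have Tl: "lipschitz_wrt dist (T N)" for N
    unfolding lipschitz_wrt_def using T1 by (intro exI[of _ 1]) (auto simp: dist_real_def)
  have TF: "lipschitz_wrt dist (\<lambda>x. T N (F n x))" for N by (rule lipschitz_wrt_compose[OF F(1) Tl])
  have lim: "L2_lim m (\<lambda>N x. T N (F n x)) (F n)"
  proof (rule L2_lim_dominated[OF _ _ L2_limD(1)[OF F(2), of n]])
    show "(\<lambda>x. T N (F n x)) \<in> borel_measurable m" for N using TF by (rule lipschitz_measurable)
    show "F n \<in> borel_measurable m" using F(1) by (rule lipschitz_measurable)
    have "(\<lambda>N. T N t) \<longlonglongrightarrow> t" for t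
    proof (rule tendsto_eventually)
      obtain N0 :: nat where "\<bar>t\<bar> < real N0" using reals_Archimedean2 by blast
      then have "T N t = t" if "N0 \<le> N" for N
      proof -
        have "real N0 \<le> real N" using that by simp
        then show ?thesis using \<open>\<bar>t\<bar> < real N0\<close> unfolding T_def by linarith
      qed
      then show "\<forall>\<^sub>F N in sequentially. T N t = t" unfolding eventually_sequentially by blast
    qed
    then show "AE x in m. (\<lambda>N. T N (F n x)) \<longlonglongrightarrow> F n x" by simp
  qed (use T2 in auto)
  obtain N where N: "L2_norm m (\<lambda>x. T N (F n x) - F n x) < e / 2"
    using order_tendstoD(2)[OF L2_limD(3)[OF lim] e2] by (auto simp: eventually_sequentially)
  have "lip dist (\<lambda>x. T N (F n x)) x \<le> 1 * lip dist (F n) x" for x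
  proof (rule lip_compose_le[OF F(1) Tl])
    fix e :: real assume "0 < e"
    then have "\<bar>T N s - T N t\<bar> \<le> (1 + e) * \<bar>s - t\<bar>" for s t
      using T1[of N s t] mult_right_mono[of 1 "1 + e" "\<bar>s - t\<bar>"] by simp
    then show "\<forall>\<^sub>F s in nhds (F n x). \<bar>T N s - T N (F n x)\<bar> \<le> (1 + e) * \<bar>s - F n x\<bar>" by simp
  qed simp
  then have "admissible (\<lambda>x. T N (F n x)) (lip dist (F n))"
    unfolding admissible_def using TF T2(2) L2_limD(1)[OF lim] L2_limD(1)[OF F(3)]
    by (intro conjI exI[of _ "real N"]) auto
  moreover have "L2_norm m (\<lambda>x. T N (F n x) - f x) < e"
    using L2_norm_triangle_diff[OF L2_limD(1,2)[OF lim] L2_limD(2)[OF F(2)], of N] N n(1) by simp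
  ultimately show "\<exists>F K. admissible F K \<and> L2_norm m (\<lambda>x. F x - f x) < e \<and> L2_norm m (\<lambda>x. K x - G x) < e"
    using n(2) by blast
qed

lemma admissible_add:
  assumes "admissible F K" "admissible F' K'"
  shows "admissible (\<lambda>x. F x + F' x) (\<lambda>x. K x + K' x)"
proof -
  note A = admissibleD[OF assms(1)] and A' = admissibleD[OF assms(2)]
  obtain B B' where "\<And>x. \<bar>F x\<bar> \<le> B" "\<And>x. \<bar>F' x\<bar> \<le> B'" using A(2) A'(2) by blast
  then have "\<bar>F x + F' x\<bar> \<le> B + B'" for x by (meson abs_triangle_ineq add_mono order_trans)
  moreover have "AE x in m. lip dist (\<lambda>x. F x + F' x) x \<le> K x + K' x"
    using A(5) A'(5)
  proof eventually_elim
    case (elim x)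
    then show ?case using lip_add_le[OF A(1) A'(1), of x] by linarith
  qed
  ultimately show ?thesis
    using A A' by (auto simp: admissible_def intro!: lipschitz_wrt_add L2_add)
qed

lemma admissible_cmult:
  assumes "admissible F K"
  shows "admissible (\<lambda>x. c * F x) (\<lambda>x. \<bar>c\<bar> * K x)"
proof -
  note A = admissibleD[OF assms]
  obtain B where "\<And>x. \<bar>F x\<bar> \<le> B" using A(2) by blast
  then have "\<bar>c * F x\<bar> \<le> \<bar>c\<bar> * B" for x by (simp add: abs_mult mult_left_mono)
  moreover have "AE x in m. lip dist (\<lambda>x. c * F x) x \<le> \<bar>c\<bar> * K x"
    using A(5)
  proof eventually_elim
    case (elim x)
    then show ?case using lip_cmult_le[OF A(1), of c x] mult_left_mono[OF elim, of "\<bar>c\<bar>"] by simp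
  qed
  ultimately show ?thesis
    using A by (auto simp: admissible_def intro!: lipschitz_wrt_cmult L2_cmult)
qed

lemma weak_slope_add:
  assumes "weak_slope f H" "weak_slope g J"
  shows "weak_slope (\<lambda>x. f x + g x) (\<lambda>x. H x + J x)"
proof -
  obtain F K where FK: "\<forall>n. admissible (F n) (K n)" "L2_lim m F f" "L2_lim m K H"
    using weak_slope_sequence[OF assms(1)] by blast
  obtain F' K' where FK': "\<forall>n. admissible (F' n) (K' n)" "L2_lim m F' g" "L2_lim m K' J"
    using weak_slope_sequence[OF assms(2)] by blast
  show ?thesis
    by (rule weak_slopeI[OF _ L2_lim_add[OF FK(2) FK'(2)] L2_lim_add[OF FK(3) FK'(3)]])
      (use FK(1) FK'(1) in \<open>auto intro: admissible_add\<close>)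
qed

lemma weak_slope_cmult:
  assumes "weak_slope f H"
  shows "weak_slope (\<lambda>x. c * f x) (\<lambda>x. \<bar>c\<bar> * H x)"
proof -
  obtain F K where FK: "\<forall>n. admissible (F n) (K n)" "L2_lim m F f" "L2_lim m K H"
    using weak_slope_sequence[OF assms] by blast
  show ?thesis
    by (rule weak_slopeI[OF _ L2_lim_cmult[OF FK(2)] L2_lim_cmult[OF FK(3)]])
      (use FK(1) in \<open>auto intro: admissible_cmult\<close>)
qed

text \<open>The approximants are pasted as \<open>\<phi> * F n + (1 - \<phi>) * F' n\<close>. The
  Leibniz term is at most \<open>L * \<bar>F n - F' n\<bar>\<close> and disappears in the limit
  because both sequences approach the same \<open>f\<close>.\<close>

lemma weak_slope_cutoff:
  assumes "weak_slope f H" "weak_slope f J"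
    and \<phi>: "\<And>x. 0 \<le> \<phi> x" "\<And>x. \<phi> x \<le> 1" and L: "0 \<le> L" "\<And>x y. \<bar>\<phi> x - \<phi> y\<bar> \<le> L * dist x y"
  shows "weak_slope f (\<lambda>x. \<phi> x * H x + (1 - \<phi> x) * J x)"
proof -
  have \<phi>l: "lipschitz_wrt dist \<phi>" using L by (auto simp: lipschitz_wrt_def)
  have \<phi>l': "lipschitz_wrt dist (\<lambda>x. 1 + (- 1) * \<phi> x)"
    by (intro lipschitz_wrt_add lipschitz_wrt_cmult \<phi>l lipschitz_wrt_const)
  then have \<phi>l': "lipschitz_wrt dist (\<lambda>x. 1 - \<phi> x)" by simp
  note \<phi>m [measurable] = lipschitz_measurable[OF \<phi>l]
  have \<phi>b: "\<bar>\<phi> x\<bar> \<le> 1" "\<bar>1 - \<phi> x\<bar> \<le> 1" for x using \<phi>[of x] by auto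
  obtain F K where FK: "\<forall>n. admissible (F n) (K n)" "L2_lim m F f" "L2_lim m K H"
    using weak_slope_sequence[OF assms(1)] by blast
  obtain F' K' where FK': "\<forall>n. admissible (F' n) (K' n)" "L2_lim m F' f" "L2_lim m K' J"
    using weak_slope_sequence[OF assms(2)] by blast
  let ?u = "\<lambda>n x. \<phi> x * F n x + (1 - \<phi> x) * F' n x"
  let ?k = "\<lambda>n x. (\<phi> x * K n x + (1 - \<phi> x) * K' n x) + L * \<bar>F n x - F' n x\<bar>"
  have lim: "L2_lim m ?u (\<lambda>x. \<phi> x * f x + (1 - \<phi> x) * f x)"
    by (intro L2_lim_add L2_lim_bounded_mult[where K = 1] FK(2) FK'(2) \<phi>b) measurable
  have lim_abs: "L2_lim m (\<lambda>n x. \<bar>F n x - F' n x\<bar>) (\<lambda>x. 0)"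
  proof -
    have "L2_lim m (\<lambda>n x. F n x - F' n x) (\<lambda>x. f x - f x)" by (rule L2_lim_diff[OF FK(2) FK'(2)])
    then show ?thesis by (auto simp: L2_lim_def intro: L2_abs)
  qed
  have lim2: "L2_lim m ?k (\<lambda>x. (\<phi> x * H x + (1 - \<phi> x) * J x) + L * 0)"
    by (intro L2_lim_add L2_lim_bounded_mult[where K = 1] L2_lim_cmult[OF lim_abs] FK(3) FK'(3) \<phi>b) measurable
  have "admissible (?u n) (?k n)" for n
  proof -
    note A = admissibleD[OF FK(1)[rule_format, of n]] and A' = admissibleD[OF FK'(1)[rule_format, of n]]
    obtain B B' where B: "\<And>x. \<bar>F n x\<bar> \<le> B" "\<And>x. \<bar>F' n x\<bar> \<le> B'" using A(2) A'(2) by blast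
    have ul: "lipschitz_wrt dist (?u n)"
      by (intro lipschitz_wrt_add lipschitz_wrt_mult[OF \<phi>l A(1) \<phi>b(1) B(1)] lipschitz_wrt_mult[OF \<phi>l' A'(1) \<phi>b(2) B(2)])
    have ub: "\<bar>?u n x\<bar> \<le> B + B'" for x
    proof -
      have "\<bar>?u n x\<bar> \<le> \<bar>\<phi> x\<bar> * \<bar>F n x\<bar> + \<bar>1 - \<phi> x\<bar> * \<bar>F' n x\<bar>" by (metis abs_mult abs_triangle_ineq)
      also have "\<dots> \<le> 1 * B + 1 * B'" using B \<phi>b by (intro add_mono mult_mono) auto
      finally show ?thesis by simp
    qed
    have "AE x in m. lip dist (?u n) x \<le> ?k n x"
      using A(5) A'(5)
    proof eventually_elim
      case (elim x)
      have "lip dist (?u n) x \<le> \<phi> x * lip dist (F n) x + (1 - \<phi> x) * lip dist (F' n) x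
          + \<bar>F n x - F' n x\<bar> * lip dist \<phi> x"
      proof (rule lip_le_combination[where a = \<phi> and b = "\<lambda>x. 1 - \<phi> x", OF ul A(1) A'(1) \<phi>l])
        fix y
        have "?u n y - ?u n x = \<phi> y * (F n y - F n x) + (1 - \<phi> y) * (F' n y - F' n x)
            + (F n x - F' n x) * (\<phi> y - \<phi> x)"
          by (simp add: algebra_simps)
        then have "\<bar>?u n y - ?u n x\<bar> \<le> \<bar>\<phi> y * (F n y - F n x)\<bar> + \<bar>(1 - \<phi> y) * (F' n y - F' n x)\<bar>
            + \<bar>(F n x - F' n x) * (\<phi> y - \<phi> x)\<bar>" by linarith
        then show "\<bar>?u n y - ?u n x\<bar> \<le> \<phi> y * \<bar>F n y - F n x\<bar> + (1 - \<phi> y) * \<bar>F' n y - F' n x\<bar>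
            + \<bar>F n x - F' n x\<bar> * \<bar>\<phi> y - \<phi> x\<bar>"
          using \<phi>[of y] by (simp add: abs_mult)
      qed (use \<phi> lipschitz_wrt_tendsto[OF \<phi>l] lipschitz_wrt_tendsto[OF \<phi>l'] in auto)
      also have "\<dots> \<le> \<phi> x * K n x + (1 - \<phi> x) * K' n x + \<bar>F n x - F' n x\<bar> * L"
        using elim \<phi>[of x] lip_le_lipschitz_constant[OF L]
        by (intro add_mono mult_left_mono) auto
      finally show ?case by (simp add: mult.commute)
    qed
    then show ?thesis
      unfolding admissible_def using ul ub L2_limD(1)[OF lim] L2_limD(1)[OF lim2] by blast
  qed
  from weak_slopeI[OF this lim lim2] show ?thesis by (simp add: algebra_simps)
qed

text \<open>A minimizing sequence of Lipschitz approximations has Cauchy slopes by the parallelogram law,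
  so the least relaxed energy is attained by a strong limit.\<close>

lemma exists_norm_minimal_slope:
  assumes w: "weak_slope f H0"
  shows "\<exists>G. relaxed_slope dist m f G \<and> (\<forall>H. weak_slope f H \<longrightarrow> L2_norm m G \<le> L2_norm m H)"
proof -
  \<comment> \<open>Slope norms of the competitors within \<open>\<delta>\<close> of
    \<open>f\<close>. The infima \<open>c n\<close> increase as the competitors are forced closer to
    \<open>f\<close>, and their limit \<open>C\<close> turns out to be the norm of the minimal
    slope.\<close>
  define E where "E \<delta> = {L2_norm m K |F K. admissible F K \<and> L2_norm m (\<lambda>x. F x - f x) < \<delta>}" for \<delta> :: real
  define i where "i n = inverse (real (Suc n))" for n
  have i_pos: "0 < i n" for n by (simp add: i_def)
  have i_mono: "i k \<le> i n" if "n \<le> k" for n k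
    unfolding i_def using that by (intro le_imp_inverse_le) auto
  have i_lim: "i \<longlonglongrightarrow> 0" unfolding i_def by (rule LIMSEQ_inverse_real_of_nat)
  define c where "c n = Inf (E (i n))" for n
  have f2: "f \<in> L2 m" using weak_slopeD(1)[OF w] .
  have bdd: "bdd_below (E \<delta>)" for \<delta> by (intro bdd_belowI[of _ 0]) (auto simp: E_def)
  have inE: "L2_norm m K \<in> E \<delta>" if "admissible F K" "L2_norm m (\<lambda>x. F x - f x) < \<delta>" for F K \<delta>
    using that by (auto simp: E_def)
  have ne: "E \<delta> \<noteq> {}" if "0 < \<delta>" for \<delta>
    using w that unfolding weak_slope_def E_def by blast
  have mono: "c n \<le> c k" if "n \<le> k" for n k
  proof -
    have "E (i k) \<subseteq> E (i n)"
      unfolding E_def using i_mono[OF that] by (blast intro: less_le_trans)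
    then show ?thesis unfolding c_def by (intro cInf_superset_mono bdd ne i_pos)
  qed
  have c_le: "c n \<le> L2_norm m H" if H: "weak_slope f H" for n H
  proof (rule field_le_epsilon)
    fix e :: real assume e: "0 < e"
    define \<delta> where "\<delta> = min e (i n)"
    have "0 < \<delta>" using e i_pos by (simp add: \<delta>_def)
    then obtain F K where FK: "admissible F K" "L2_norm m (\<lambda>x. F x - f x) < \<delta>" "L2_norm m (\<lambda>x. K x - H x) < \<delta>"
      using H unfolding weak_slope_def by blast
    have "c n \<le> L2_norm m K"
      unfolding c_def using FK(1,2) by (intro cInf_lower inE bdd) (auto simp: \<delta>_def)
    also have "\<dots> \<le> L2_norm m H + e"
    proof -
      have "\<delta> \<le> e" by (simp add: \<delta>_def)
      then show ?thesis
        using L2_norm_diff_bound[OF admissibleD(4)[OF FK(1)] weak_slopeD(2)[OF H]] FK(3) by linarith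
    qed
    finally show "c n \<le> L2_norm m H + e" .
  qed
  have c0: "0 \<le> c n" for n
    unfolding c_def by (rule cInf_greatest[OF ne[OF i_pos]]) (auto simp: E_def)
  have bc: "bdd_above (range c)" using c_le[OF w] by (intro bdd_aboveI[of _ "L2_norm m H0"]) auto
  define C where "C = (SUP n. c n)"
  have cC: "c n \<le> C" for n unfolding C_def by (rule cSUP_upper[OF _ bc]) simp
  have c_lim: "c \<longlonglongrightarrow> C"
    unfolding C_def by (rule LIMSEQ_incseq_SUP[OF bc]) (use mono in \<open>auto simp: incseq_def\<close>)
  have "\<exists>F. admissible F (lip dist F) \<and> L2_norm m (\<lambda>x. F x - f x) < i n \<and>
      L2_norm m (lip dist F) < C + i n" for n
  proof -
    have "c n < C + i n" using cC[of n] i_pos[of n] by linarith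
    then obtain t where t: "t \<in> E (i n)" "t < C + i n"
      unfolding c_def using cInf_lessD[OF ne[OF i_pos]] by blast
    then obtain F K where "admissible F K" "L2_norm m (\<lambda>x. F x - f x) < i n" "t = L2_norm m K"
      by (auto simp: E_def)
    then show ?thesis using t(2) admissible_lip[of F K] by (intro exI[of _ F]) auto
  qed
  then obtain F where F: "\<And>n. admissible (F n) (lip dist (F n))"
      "\<And>n. L2_norm m (\<lambda>x. F n x - f x) < i n"
      "\<And>n. L2_norm m (lip dist (F n)) < C + i n" by metis
  note A = admissibleD[OF F(1)]
  \<comment> \<open>The midpoint of two late competitors is itself a competitor at scale
    \<open>i N\<close>, so its slope bound has norm at least \<open>c N\<close>; the parallelogram
    law in L2 then bounds the difference of the two slopes.\<close>
  have par: "(L2_norm m (\<lambda>x. lip dist (F n) x - lip dist (F k) x))\<^sup>2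
      \<le> 4 * (C + i N)\<^sup>2 - 4 * (c N)\<^sup>2" if nk: "N \<le> n" "N \<le> k" for N n k
  proof -
    let ?F = "\<lambda>x. 1/2 * (F n x + F k x)" and ?K = "\<lambda>x. \<bar>1/2\<bar> * (lip dist (F n) x + lip dist (F k) x)"
    note inv = i_mono[OF nk(1)] i_mono[OF nk(2)]
    have adm: "admissible ?F ?K" by (intro admissible_cmult admissible_add F)
    have "L2_norm m (\<lambda>x. ?F x - f x) = L2_norm m (\<lambda>x. 1/2 * ((F n x - f x) + (F k x - f x)))"
      by (intro arg_cong[of _ _ "L2_norm m"] ext) (simp add: field_simps)
    also have "\<dots> \<le> 1/2 * (L2_norm m (\<lambda>x. F n x - f x) + L2_norm m (\<lambda>x. F k x - f x))"
      unfolding L2_norm_cmult using L2_norm_triangle[OF L2_diff[OF A(3) f2] L2_diff[OF A(3) f2]] by simp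
    also have "\<dots> < 1/2 * (i N + i N)"
      by (intro mult_strict_left_mono add_strict_mono less_le_trans[OF F(2)] inv) simp
    also have "\<dots> = i N" by simp
    finally have "L2_norm m (\<lambda>x. ?F x - f x) < i N" .
    then have "c N \<le> L2_norm m ?K" unfolding c_def by (intro cInf_lower[OF inE[OF adm] bdd])
    also have "\<dots> = 1/2 * L2_norm m (\<lambda>x. lip dist (F n) x + lip dist (F k) x)"
      by (subst L2_norm_cmult) simp
    finally have "2 * c N \<le> L2_norm m (\<lambda>x. lip dist (F n) x + lip dist (F k) x)" by simp
    then have dbl: "(2 * c N)\<^sup>2 \<le> (L2_norm m (\<lambda>x. lip dist (F n) x + lip dist (F k) x))\<^sup>2"
      using c0[of N] by (intro power_mono) auto
    have "(L2_norm m (lip dist (F l)))\<^sup>2 \<le> (C + i N)\<^sup>2" if "l = n \<or> l = k" for l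
      using F(3)[of l] inv that by (intro power_mono) auto
    from this[of n] this[of k] have "(L2_norm m (lip dist (F n)))\<^sup>2 \<le> (C + i N)\<^sup>2"
      "(L2_norm m (lip dist (F k)))\<^sup>2 \<le> (C + i N)\<^sup>2" by auto
    moreover have "(2 * c N)\<^sup>2 = 4 * (c N)\<^sup>2" by (simp add: power_mult_distrib)
    ultimately show ?thesis
      using dbl L2_parallelogram[OF A(4)[of n] A(4)[of k]] by linarith
  qed
  have "(\<lambda>N. 4 * (C + i N)\<^sup>2 - 4 * (c N)\<^sup>2) \<longlonglongrightarrow> 4 * (C + 0)\<^sup>2 - 4 * C\<^sup>2"
    by (intro tendsto_intros c_lim i_lim)
  then have par_lim: "(\<lambda>N. 4 * (C + i N)\<^sup>2 - 4 * (c N)\<^sup>2) \<longlonglongrightarrow> 0" by simp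
  have "\<exists>G. L2_lim m (\<lambda>n. lip dist (F n)) G"
  proof (rule L2_complete[OF A(4)])
    fix e :: real assume e: "0 < e"
    then have "0 < e\<^sup>2" by simp
    from order_tendstoD(2)[OF par_lim this] obtain N where
      N: "4 * (C + i N)\<^sup>2 - 4 * (c N)\<^sup>2 < e\<^sup>2" by (auto simp: eventually_sequentially)
    have "L2_norm m (\<lambda>x. lip dist (F n) x - lip dist (F k) x) < e" if "N \<le> n" "N \<le> k" for n k
      using par[OF that] N e by (intro power2_less_imp_less[of _ e]) auto
    then show "\<exists>N. \<forall>n\<ge>N. \<forall>k\<ge>N. L2_norm m (\<lambda>x. lip dist (F n) x - lip dist (F k) x) < e" by blast
  qed
  then obtain G where G: "L2_lim m (\<lambda>n. lip dist (F n)) G" by blast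
  have "L2_lim m F f"
    using A(3) f2 F(2) by (intro L2_lim_squeeze[OF _ _ _ i_lim]) (auto intro: less_imp_le)
  then have rel: "relaxed_slope dist m f G" using A(1) G by (auto simp: relaxed_slope_def)
  have "L2_norm m G \<le> C"
  proof (rule LIMSEQ_le[OF L2_lim_norm[OF G]])
    show "(\<lambda>n. C + i n) \<longlonglongrightarrow> C"
      using tendsto_add[OF tendsto_const[of C] i_lim] by simp
  qed (use F(3) less_imp_le in blast)
  moreover have "C \<le> L2_norm m H" if "weak_slope f H" for H
    unfolding C_def using c_le[OF that] by (intro cSUP_least) auto
  ultimately show ?thesis using rel by force
qed

text \<open>Cutoffs paste \<open>H\<close> on a compact \<open>K\<close> and \<open>G\<close>
  elsewhere, as a limit of weak slopes. Minimality of the norm of \<open>G\<close> therefore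
  compares the integrals of the squares over every compact set, and this localizes to a pointwise
  inequality.\<close>

lemma norm_minimal_slope_le:
  assumes G: "weak_slope f G" and min: "\<And>H. weak_slope f H \<Longrightarrow> L2_norm m G \<le> L2_norm m H"
    and H: "weak_slope f H"
  shows "AE x in m. G x \<le> H x"
proof -
  note G2 = weak_slopeD(2)[OF G] and H2 = weak_slopeD(2)[OF H]
  note [measurable] = L2_measurable[OF G2] L2_measurable[OF H2]
  note iG = L2_integrable_square[OF G2] and iH = L2_integrable_square[OF H2]
  have "AE x in m. (G x)\<^sup>2 - (H x)\<^sup>2 \<le> 0"
  proof (rule AE_nonpos_of_compact_integrals[OF sets_m])
    show "integrable m (\<lambda>x. (G x)\<^sup>2 - (H x)\<^sup>2)" using iG iH by simp
    fix K :: "'a set" assume K: "compact K"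
    have Km [measurable]: "K \<in> sets m" using K by (simp add: sets_m borel_compact)
    obtain \<phi> :: "nat \<Rightarrow> 'a \<Rightarrow> real" and L :: "nat \<Rightarrow> real" where \<phi>: 
      "\<And>n x. 0 \<le> \<phi> n x" "\<And>n x. \<phi> n x \<le> 1" "\<And>n. 0 \<le> L n"
      "\<And>n x y. \<bar>\<phi> n x - \<phi> n y\<bar> \<le> L n * dist x y" "\<And>x. (\<lambda>n. \<phi> n x) \<longlonglongrightarrow> indicator K x"
      using compact_indicator_approx[OF K] by blast
    let ?M = "\<lambda>n x. \<phi> n x * H x + (1 - \<phi> n x) * G x"
    let ?I = "\<lambda>x. indicator K x * H x + (1 - indicator K x) * G x"
    have "lipschitz_wrt dist (\<phi> n)" for n unfolding lipschitz_wrt_def using \<phi>(3,4) by blast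
    note [measurable] = lipschitz_measurable[OF this]
    have "L2_lim m ?M ?I"
    proof (rule L2_lim_dominated[where G = "\<lambda>x. \<bar>H x\<bar> + \<bar>G x\<bar>"])
      show "(\<lambda>x. \<bar>H x\<bar> + \<bar>G x\<bar>) \<in> L2 m" by (intro L2_add L2_abs G2 H2)
      show "AE x in m. \<bar>?M n x\<bar> \<le> \<bar>\<bar>H x\<bar> + \<bar>G x\<bar>\<bar>" for n
      proof (rule AE_I2)
        fix x
        have "\<bar>?M n x\<bar> \<le> \<bar>\<phi> n x\<bar> * \<bar>H x\<bar> + \<bar>1 - \<phi> n x\<bar> * \<bar>G x\<bar>" by (metis abs_mult abs_triangle_ineq)
        also have "\<dots> \<le> 1 * \<bar>H x\<bar> + 1 * \<bar>G x\<bar>"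
          using \<phi>(1,2)[of n x] by (intro add_mono mult_right_mono) auto
        finally show "\<bar>?M n x\<bar> \<le> \<bar>\<bar>H x\<bar> + \<bar>G x\<bar>\<bar>" by simp
      qed
      show "AE x in m. (\<lambda>n. ?M n x) \<longlonglongrightarrow> ?I x" by (intro AE_I2 tendsto_intros \<phi>(5))
    qed measurable
    then have "(\<lambda>n. L2_norm m (?M n)) \<longlonglongrightarrow> L2_norm m ?I" by (rule L2_lim_norm)
    moreover have "L2_norm m G \<le> L2_norm m (?M n)" for n
      by (intro min weak_slope_cutoff[OF H G, of "\<phi> n" "L n"] \<phi>)
    ultimately have "L2_norm m G \<le> L2_norm m ?I" by (intro LIMSEQ_le_const) auto
    then have "(L2_norm m G)\<^sup>2 \<le> (L2_norm m ?I)\<^sup>2" by (intro power_mono) auto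
    then have "(LINT x|m. (G x)\<^sup>2) \<le> (LINT x|m. (?I x)\<^sup>2)" by (simp add: L2_norm_square)
    also have "(LINT x|m. (?I x)\<^sup>2) = (LINT x|m. (G x)\<^sup>2 - indicator K x * ((G x)\<^sup>2 - (H x)\<^sup>2))"
      by (intro Bochner_Integration.integral_cong) (auto simp: indicator_def)
    also have "\<dots> = (LINT x|m. (G x)\<^sup>2) - (LINT x|m. indicator K x * ((G x)\<^sup>2 - (H x)\<^sup>2))"
      using iG integrable_mult_indicator[OF Km Bochner_Integration.integrable_diff[OF iG iH]]
      by (intro Bochner_Integration.integral_diff) auto
    finally show "(LINT x|m. indicator K x * ((G x)\<^sup>2 - (H x)\<^sup>2)) \<le> 0" by simp
  qed
  with weak_slope_nonneg[OF H] show ?thesis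
    by eventually_elim (auto intro: power2_le_imp_le)
qed

lemma is_min_slope_exists:
  assumes "weak_slope f H0"
  shows "is_min_slope dist m f (min_slope dist m f)"
    and "\<And>H. weak_slope f H \<Longrightarrow> AE x in m. min_slope dist m f x \<le> H x"
proof -
  obtain G where G: "relaxed_slope dist m f G" "\<And>H. weak_slope f H \<Longrightarrow> L2_norm m G \<le> L2_norm m H"
    using exists_norm_minimal_slope[OF assms] by blast
  have le: "AE x in m. G x \<le> H x" if "weak_slope f H" for H
    using relaxed_slope_imp_weak_slope[OF G(1)] G(2) that by (rule norm_minimal_slope_le)
  have "is_min_slope dist m f G"
    unfolding is_min_slope_def using G(1) le relaxed_slope_imp_weak_slope by blast
  then show m: "is_min_slope dist m f (min_slope dist m f)" by (rule is_min_slope_min_slope)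
  then have eq: "AE x in m. min_slope dist m f x = G x"
    using \<open>is_min_slope dist m f G\<close> by (rule is_min_slope_unique)
  show "AE x in m. min_slope dist m f x \<le> H x" if "weak_slope f H" for H
    using eq le[OF that] by eventually_elim simp
qed

section \<open>Calculus of the minimal slope\<close>

abbreviation "S \<equiv> sobolev dist m"
abbreviation "N \<equiv> min_slope dist m"

text \<open>Any weak slope at all certifies membership, because it sets off the minimization that
  produces a relaxed slope. Sums, products and compositions are handled through this
  criterion.\<close>

lemma sobolev_iff_weak_slope: "f \<in> S \<longleftrightarrow> (\<exists>H. weak_slope f H)"
proof
  assume "f \<in> S"
  then show "\<exists>H. weak_slope f H" using relaxed_slope_imp_weak_slope by (auto simp: sobolev_def)
next
  assume "\<exists>H. weak_slope f H"
  then obtain H where H: "weak_slope f H" by blast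
  show "f \<in> S" using is_min_slope_exists(1)[OF H] weak_slopeD(1)[OF H]
    by (auto simp: sobolev_def is_min_slope_def)
qed

lemma is_min_slope_N: "f \<in> S \<Longrightarrow> is_min_slope dist m f (N f)"
  using sobolev_iff_weak_slope is_min_slope_exists(1) by blast

lemma weak_slope_N: "f \<in> S \<Longrightarrow> weak_slope f (N f)"
  using is_min_slope_N relaxed_slope_imp_weak_slope by (auto simp: is_min_slope_def)

lemma N_le: "weak_slope f H \<Longrightarrow> AE x in m. N f x \<le> H x"
  using is_min_slope_exists(2) by blast

lemma sobolev_L2: "f \<in> S \<Longrightarrow> f \<in> L2 m"
  using weak_slope_N weak_slopeD by blast

lemma N_L2: "f \<in> S \<Longrightarrow> N f \<in> L2 m"
  using weak_slope_N weak_slopeD by blast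

lemma N_nonneg: "f \<in> S \<Longrightarrow> AE x in m. 0 \<le> N f x"
  using weak_slope_N weak_slope_nonneg by blast

lemma sobolev_add: "f \<in> S \<Longrightarrow> g \<in> S \<Longrightarrow> (\<lambda>x. f x + g x) \<in> S"
  using weak_slope_add sobolev_iff_weak_slope by blast

lemma sobolev_cmult: "f \<in> S \<Longrightarrow> (\<lambda>x. c * f x) \<in> S"
  using weak_slope_cmult sobolev_iff_weak_slope by blast

lemma sobolev_diff: "f \<in> S \<Longrightarrow> g \<in> S \<Longrightarrow> (\<lambda>x. f x - g x) \<in> S"
  using sobolev_add[of f "\<lambda>x. - 1 * g x"] sobolev_cmult[of g "- 1"] by simp

lemma N_add: "f \<in> S \<Longrightarrow> g \<in> S \<Longrightarrow> AE x in m. N (\<lambda>x. f x + g x) x \<le> N f x + N g x"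
  by (intro N_le weak_slope_add weak_slope_N)

lemma weak_slope_zero: "weak_slope (\<lambda>x. 0) (\<lambda>x. 0)"
  by (rule weak_slopeI[of "\<lambda>_ _. 0" "\<lambda>_ _. 0"]) (auto simp: admissible_def L2_lim_def)

text \<open>The reverse inequality is the direct one for \<open>inverse c\<close> applied to
  \<open>c * f\<close>.\<close>

lemma N_cmult:
  assumes "f \<in> S"
  shows "AE x in m. N (\<lambda>x. c * f x) x = \<bar>c\<bar> * N f x"
proof -
  have le: "AE x in m. N (\<lambda>x. c * f x) x \<le> \<bar>c\<bar> * N f x" if "f \<in> S" for c f
    using that by (intro N_le weak_slope_cmult weak_slope_N)
  show ?thesis
  proof (cases "c = 0")
    case True
    have "(\<lambda>x::'a. 0) \<in> S" using weak_slope_zero sobolev_iff_weak_slope by blast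
    then show ?thesis using N_nonneg[of "\<lambda>x. 0"] N_le[OF weak_slope_zero] True by auto
  next
    case False
    have "AE x in m. N (\<lambda>x. inverse c * (c * f x)) x \<le> \<bar>inverse c\<bar> * N (\<lambda>x. c * f x) x"
      by (rule le[OF sobolev_cmult[OF assms]])
    with le[OF assms, of c] show ?thesis
    proof eventually_elim
      case (elim x)
      have "(\<lambda>x. inverse c * (c * f x)) = f" using False by (intro ext) simp
      then have "N f x \<le> inverse \<bar>c\<bar> * N (\<lambda>x. c * f x) x" using elim(2) by simp
      then have "\<bar>c\<bar> * N f x \<le> N (\<lambda>x. c * f x) x" using False by (simp add: field_simps)
      then show ?case using elim(1) by simp
    qed
  qed
qed

text \<open>\<open>\<eta>\<close> bounds the local Lipschitz constant of \<open>\<psi>\<close>. Its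
  continuity lets \<open>\<eta> (F n x)\<close> converge once \<open>F n\<close> is passed to an
  almost everywhere convergent subsequence, so the chain rule goes over from the approximants to
  \<open>f\<close>.\<close>

lemma weak_slope_compose:
  assumes w: "weak_slope f H" and \<psi>0: "\<psi> 0 = (0::real)"
    and \<psi>: "0 \<le> L" "\<And>s t. \<bar>\<psi> s - \<psi> t\<bar> \<le> L * \<bar>s - t\<bar>"
    and \<eta>: "continuous_on UNIV \<eta>" "\<And>t. 0 \<le> \<eta> t" "\<And>t. \<eta> t \<le> B"
    and loc: "\<And>t e. 0 < e \<Longrightarrow> \<forall>\<^sub>F s in nhds t. \<bar>\<psi> s - \<psi> t\<bar> \<le> (\<eta> t + e) * \<bar>s - t\<bar>"
  shows "weak_slope (\<lambda>x. \<psi> (f x)) (\<lambda>x. \<eta> (f x) * H x)"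
proof -
  have \<psi>l: "lipschitz_wrt dist \<psi>" unfolding lipschitz_wrt_def dist_real_def using \<psi> by blast
  have [measurable]: "\<eta> \<in> borel_measurable borel" using \<eta>(1) by (rule borel_measurable_continuous_onI)
  have [measurable]: "\<psi> \<in> borel_measurable borel"
    using lipschitz_wrt_continuous[OF \<psi>l] by (rule borel_measurable_continuous_onI)
  note f2 = weak_slopeD(1)[OF w] and H2 = weak_slopeD(2)[OF w]
  note [measurable] = L2_measurable[OF f2] L2_measurable[OF H2]
  have \<psi>b: "\<bar>\<psi> t\<bar> \<le> \<bar>L * t\<bar>" for t using \<psi>(2)[of t 0] \<psi>0 \<psi>(1) by (simp add: abs_mult)
  have \<psi>2: "(\<lambda>x. \<psi> (g x)) \<in> L2 m" if g: "g \<in> L2 m" for g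
  proof -
    note [measurable] = L2_measurable[OF g]
    show ?thesis by (rule L2_bounded[OF _ L2_cmult[OF g, of L]]) (use \<psi>b in auto)
  qed
  have B: "0 \<le> B" using \<eta>(2,3)[of 0] by linarith
  have \<eta>b: "\<bar>\<eta> t\<bar> \<le> B" for t using \<eta>(2,3)[of t] by simp
  obtain F0 K0 where FK0: "\<forall>n. admissible (F0 n) (K0 n)" "L2_lim m F0 f" "L2_lim m K0 H"
    using weak_slope_sequence[OF w] by blast
  obtain r :: "nat \<Rightarrow> nat" where r: "strict_mono r" "AE x in m. (\<lambda>n. F0 (r n) x) \<longlonglongrightarrow> f x"
    using L2_lim_AE_subseq[OF FK0(2)] by blast
  define F where "F n = F0 (r n)" for n
  define K where "K n = K0 (r n)" for n
  have F: "admissible (F n) (K n)" for n using FK0(1) by (simp add: F_def K_def)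
  have Ff: "L2_lim m F f" and KH: "L2_lim m K H"
    unfolding F_def K_def by (intro L2_lim_subseq[OF _ r(1)] FK0)+
  have ae: "AE x in m. (\<lambda>n. F n x) \<longlonglongrightarrow> f x" using r(2) by (simp add: F_def)
  note A = admissibleD[OF F]
  note [measurable] = L2_measurable[OF A(3)] L2_measurable[OF A(4)]
  have lim1: "L2_lim m (\<lambda>n x. \<psi> (F n x)) (\<lambda>x. \<psi> (f x))"
  proof (rule L2_lim_squeeze[OF \<psi>2[OF A(3)] \<psi>2[OF f2]])
    show "L2_norm m (\<lambda>x. \<psi> (F n x) - \<psi> (f x)) \<le> L * L2_norm m (\<lambda>x. F n x - f x)" for n
    proof -
      have "L2_norm m (\<lambda>x. \<psi> (F n x) - \<psi> (f x)) \<le> L2_norm m (\<lambda>x. L * (F n x - f x))"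
        using \<psi> by (intro L2_norm_mono L2_cmult L2_diff A f2) (auto simp: abs_mult)
      then show ?thesis using \<psi>(1) by (simp add: L2_norm_cmult)
    qed
    show "(\<lambda>n. L * L2_norm m (\<lambda>x. F n x - f x)) \<longlonglongrightarrow> 0"
      using tendsto_mult_left[OF L2_limD(3)[OF Ff], of L] by simp
  qed
  \<comment> \<open>Split so that the first term is small in norm because \<open>\<eta>\<close> is
    bounded, while the second has the fixed dominating function \<open>B * H\<close>.\<close>
  have lim2: "L2_lim m (\<lambda>n x. \<eta> (F n x) * (K n x - H x) + \<eta> (F n x) * H x) (\<lambda>x. 0 + \<eta> (f x) * H x)"
  proof (rule L2_lim_add)
    note D = L2_limD[OF KH]
    show "L2_lim m (\<lambda>n x. \<eta> (F n x) * (K n x - H x)) (\<lambda>x. 0)"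
    proof (rule L2_lim_squeeze)
      show "(\<lambda>x. \<eta> (F n x) * (K n x - H x)) \<in> L2 m" for n
        by (rule L2_bounded_mult(1)[OF _ \<eta>b L2_diff[OF D(1,2)]]) measurable
      show "L2_norm m (\<lambda>x. \<eta> (F n x) * (K n x - H x) - 0) \<le> B * L2_norm m (\<lambda>x. K n x - H x)" for n
        using L2_bounded_mult(2)[OF _ \<eta>b L2_diff[OF D(1,2)], of "F n"] by simp
      show "(\<lambda>n. B * L2_norm m (\<lambda>x. K n x - H x)) \<longlonglongrightarrow> 0"
        using tendsto_mult_left[OF D(3), of B] by simp
    qed simp
    show "L2_lim m (\<lambda>n x. \<eta> (F n x) * H x) (\<lambda>x. \<eta> (f x) * H x)"
    proof (rule L2_lim_dominated[where G = "\<lambda>x. B * H x"])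
      show "(\<lambda>x. B * H x) \<in> L2 m" by (rule L2_cmult[OF H2])
      show "AE x in m. \<bar>\<eta> (F n x) * H x\<bar> \<le> \<bar>B * H x\<bar>" for n
        using \<eta>b B by (auto simp: abs_mult intro!: mult_right_mono)
      show "AE x in m. (\<lambda>n. \<eta> (F n x) * H x) \<longlonglongrightarrow> \<eta> (f x) * H x"
        using ae
      proof eventually_elim
        case (elim x)
        have "(\<lambda>n. \<eta> (F n x)) \<longlonglongrightarrow> \<eta> (f x)"
          using \<eta>(1) elim by (metis UNIV_I continuous_on_eq_continuous_at isCont_tendsto_compose open_UNIV)
        then show ?case by (intro tendsto_intros)
      qed
    qed measurable
  qed
  then have lim2: "L2_lim m (\<lambda>n x. \<eta> (F n x) * K n x) (\<lambda>x. \<eta> (f x) * H x)"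
    by (simp add: algebra_simps)
  have "admissible (\<lambda>x. \<psi> (F n x)) (\<lambda>x. \<eta> (F n x) * K n x)" for n
    unfolding admissible_def
  proof (intro conjI)
    obtain C where C: "\<And>x. \<bar>F n x\<bar> \<le> C" using A(2)[of n] by blast
    have "\<bar>\<psi> (F n x)\<bar> \<le> L * C" for x
      using \<psi>b[of "F n x"] mult_left_mono[OF C[of x] \<psi>(1)] \<psi>(1) by (simp add: abs_mult)
    then show "\<exists>B. \<forall>x. \<bar>\<psi> (F n x)\<bar> \<le> B" by blast
    show "AE x in m. lip dist (\<lambda>x. \<psi> (F n x)) x \<le> \<eta> (F n x) * K n x"
      using A(5)[of n]
    proof eventually_elim
      case (elim x)
      have "lip dist (\<lambda>x. \<psi> (F n x)) x \<le> \<eta> (F n x) * lip dist (F n) x"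
        by (rule lip_compose_le[OF A(1) \<psi>l \<eta>(2) loc])
      then show ?case using mult_left_mono[OF elim \<eta>(2)[of "F n x"]] by linarith
    qed
  qed (use lipschitz_wrt_compose[OF A(1) \<psi>l] L2_limD(1)[OF lim1] L2_limD(1)[OF lim2] in auto)
  then show ?thesis by (rule weak_slopeI[OF _ lim1 lim2])
qed

lemma weak_slope_contraction:
  assumes w: "weak_slope f H" and \<psi>: "\<psi> 0 = (0::real)" "\<And>s t. \<bar>\<psi> s - \<psi> t\<bar> \<le> \<bar>s - t\<bar>"
  shows "weak_slope (\<lambda>x. \<psi> (f x)) H"
proof -
  have "\<bar>\<psi> s - \<psi> t\<bar> \<le> (1 + e) * \<bar>s - t\<bar>" if "0 < e" for s t e :: real
    using \<psi>(2)[of s t] mult_right_mono[of 1 "1 + e" "\<bar>s - t\<bar>"] that by simp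
  then have "weak_slope (\<lambda>x. \<psi> (f x)) (\<lambda>x. 1 * H x)"
    using \<psi> by (intro weak_slope_compose[OF w, where L = 1 and B = 1 and \<eta> = "\<lambda>_. 1"]) auto
  then show ?thesis by simp
qed

text \<open>Locality. The function \<open>t - \<delta> (arctan ((t - c) / \<delta>) - arctan (- c / \<delta>))\<close> is close to the
  identity, and its derivative \<open>(t - c)\<^sup>2 / ((t - c)\<^sup>2 + \<delta>\<^sup>2)\<close> vanishes at \<open>c\<close>.\<close>

lemma N_zero_on_level_set:
  assumes f: "f \<in> S"
  shows "AE x in m. f x = c \<longrightarrow> N f x = 0"
proof -
  define \<delta> where "\<delta> n = inverse (real (Suc n))" for n
  have \<delta>: "0 < \<delta> n" for n by (simp add: \<delta>_def)
  have \<delta>_lim: "\<delta> \<longlonglongrightarrow> 0" unfolding \<delta>_def by (rule LIMSEQ_inverse_real_of_nat)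
  define \<psi> where "\<psi> n t = t - \<delta> n * (arctan ((t - c) / \<delta> n) - arctan (- c / \<delta> n))" for n t
  define \<eta> where "\<eta> n t = (t - c)\<^sup>2 / ((t - c)\<^sup>2 + (\<delta> n)\<^sup>2)" for n t
  have den: "0 < (t - c)\<^sup>2 + (\<delta> n)\<^sup>2" for n t using \<delta>[of n] by (simp add: add_nonneg_pos)
  have \<psi>0: "\<psi> n 0 = 0" for n by (simp add: \<psi>_def)
  have \<eta>01: "0 \<le> \<eta> n t" "\<eta> n t \<le> 1" for n t
    using den[of t n] by (auto simp: \<eta>_def divide_le_eq)
  have deriv: "(\<psi> n has_real_derivative \<eta> n t) (at t)" for n t
  proof -
    have "(\<psi> n has_real_derivative (1 - \<delta> n * (inverse (1 + ((t - c) / \<delta> n)\<^sup>2) * (1 / \<delta> n)))) (at t)"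
      unfolding \<psi>_def[abs_def] using \<delta>[of n] by (auto intro!: derivative_eq_intros)
    moreover have "1 - \<delta> n * (inverse (1 + ((t - c) / \<delta> n)\<^sup>2) * (1 / \<delta> n)) = \<eta> n t"
      using \<delta>[of n] den[of t n] unfolding \<eta>_def by (simp add: field_simps power2_eq_square)
    ultimately show ?thesis by simp
  qed
  have \<psi>1: "\<bar>\<psi> n s - \<psi> n t\<bar> \<le> 1 * \<bar>s - t\<bar>" for n s t
  proof -
    have "norm (\<psi> n s - \<psi> n t) \<le> 1 * norm (s - t)"
      by (rule field_differentiable_bound[of UNIV "\<psi> n" "\<eta> n"])
        (use deriv \<eta>01 in \<open>auto intro: has_field_derivative_at_within\<close>)
    then show ?thesis by simp
  qed
  have loc: "\<forall>\<^sub>F s in nhds t. \<bar>\<psi> n s - \<psi> n t\<bar> \<le> (\<eta> n t + e) * \<bar>s - t\<bar>" if e: "0 < e" for n t e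
  proof -
    have "((\<lambda>s. \<bar>(\<psi> n s - \<psi> n t) / (s - t)\<bar>) \<longlongrightarrow> \<bar>\<eta> n t\<bar>) (at t)"
      using deriv[of n t] by (intro tendsto_rabs) (simp add: has_field_derivative_iff)
    moreover have "\<bar>\<eta> n t\<bar> < \<eta> n t + e" using e \<eta>01(1)[of n t] by simp
    ultimately have "\<forall>\<^sub>F s in at t. \<bar>(\<psi> n s - \<psi> n t) / (s - t)\<bar> < \<eta> n t + e"
      by (rule order_tendstoD)
    then have "\<forall>\<^sub>F s in nhds t. s \<noteq> t \<longrightarrow> \<bar>(\<psi> n s - \<psi> n t) / (s - t)\<bar> < \<eta> n t + e"
      by (simp add: eventually_at_filter)
    then show ?thesis
    proof eventually_elim
      case (elim s)
      show ?case
      proof (cases "s = t")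
        case False
        then have "\<bar>\<psi> n s - \<psi> n t\<bar> / \<bar>s - t\<bar> < \<eta> n t + e" using elim by (simp add: abs_divide)
        then show ?thesis using False by (simp add: divide_less_eq)
      qed simp
    qed
  qed
  have \<eta>c: "continuous_on UNIV (\<eta> n)" for n
    unfolding \<eta>_def[abs_def] using den[of _ n] by (intro continuous_intros) (auto simp: less_le)
  have w: "weak_slope (\<lambda>x. \<psi> n (f x)) (\<lambda>x. \<eta> n (f x) * N f x)" for n
    by (rule weak_slope_compose[OF weak_slope_N[OF f] \<psi>0 _ \<psi>1 \<eta>c \<eta>01 loc]) simp_all
  note f2 = sobolev_L2[OF f] and N2 = N_L2[OF f]
  note [measurable] = L2_measurable[OF f2] L2_measurable[OF N2]
  have [measurable]: "\<eta> n \<in> borel_measurable borel" for n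
    using \<eta>c by (rule borel_measurable_continuous_onI)
  have [measurable]: "\<psi> n \<in> borel_measurable borel" for n
    unfolding \<psi>_def[abs_def] by (intro borel_measurable_continuous_onI continuous_intros) (use \<delta>[of n] in auto)
  have lim1: "L2_lim m (\<lambda>n x. \<psi> n (f x)) f"
  proof (rule L2_lim_dominated[OF _ _ f2])
    show "AE x in m. \<bar>\<psi> n (f x)\<bar> \<le> \<bar>f x\<bar>" for n using \<psi>1[of n _ 0] \<psi>0[of n] by simp
    have "(\<lambda>n. \<psi> n t) \<longlonglongrightarrow> t" for t
    proof -
      have "(\<lambda>n. \<delta> n * (arctan ((t - c) / \<delta> n) - arctan (- c / \<delta> n))) \<longlonglongrightarrow> 0"
      proof (rule tendsto_0_le[OF \<delta>_lim, where K = pi])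
        have "\<bar>arctan a - arctan b\<bar> \<le> pi" for a b
          using arctan_bounded[of a] arctan_bounded[of b] by (auto simp: abs_le_iff)
        then show "\<forall>\<^sub>F n in sequentially. norm (\<delta> n * (arctan ((t - c) / \<delta> n) - arctan (- c / \<delta> n))) \<le> norm (\<delta> n) * pi"
          unfolding real_norm_def abs_mult by (intro always_eventually allI mult_left_mono) auto
      qed
      then show ?thesis unfolding \<psi>_def using tendsto_diff[OF tendsto_const[of t]] by fastforce
    qed
    then show "AE x in m. (\<lambda>n. \<psi> n (f x)) \<longlonglongrightarrow> f x" by simp
  qed measurable
  \<comment> \<open>The composed functions return to \<open>f\<close> while their weak slopes vanish
    in the limit on exactly the level set; minimality of \<open>N f\<close> then forces it to vanish
    there.\<close>
  have lim2: "L2_lim m (\<lambda>n x. \<eta> n (f x) * N f x) (\<lambda>x. (if f x = c then 0 else 1) * N f x)"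
  proof (rule L2_lim_dominated[OF _ _ N2])
    show "AE x in m. \<bar>\<eta> n (f x) * N f x\<bar> \<le> \<bar>N f x\<bar>" for n
      using \<eta>01[of n] by (auto simp: abs_mult intro!: mult_left_le_one_le)
    have "(\<lambda>n. \<eta> n t) \<longlonglongrightarrow> (if t = c then 0 else 1)" for t
    proof (cases "t = c")
      case False
      have "(\<lambda>n. \<eta> n t) \<longlonglongrightarrow> (t - c)\<^sup>2 / ((t - c)\<^sup>2 + 0\<^sup>2)"
        unfolding \<eta>_def using False by (intro tendsto_intros \<delta>_lim) auto
      then show ?thesis using False by simp
    qed (simp add: \<eta>_def)
    then show "AE x in m. (\<lambda>n. \<eta> n (f x) * N f x) \<longlonglongrightarrow> (if f x = c then 0 else 1) * N f x"
      by (intro AE_I2 tendsto_mult tendsto_const)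
  qed measurable
  have "AE x in m. N f x \<le> (if f x = c then 0 else 1) * N f x"
    by (rule N_le[OF weak_slope_closed[OF w lim1 lim2]])
  with N_nonneg[OF f] show ?thesis by eventually_elim (auto split: if_splits)
qed

lemma weak_slope_mult:
  assumes w: "weak_slope f H" and \<phi>: "\<And>x. \<bar>\<phi> x\<bar> \<le> B" and L: "0 \<le> L" "\<And>x y. \<bar>\<phi> x - \<phi> y\<bar> \<le> L * dist x y"
  shows "weak_slope (\<lambda>x. \<phi> x * f x) (\<lambda>x. \<bar>\<phi> x\<bar> * H x + L * \<bar>f x\<bar>)"
proof -
  have \<phi>l: "lipschitz_wrt dist \<phi>" using L by (auto simp: lipschitz_wrt_def)
  note \<phi>m [measurable] = lipschitz_measurable[OF \<phi>l]
  obtain F K where FK: "\<forall>n. admissible (F n) (K n)" "L2_lim m F f" "L2_lim m K H"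
    using weak_slope_sequence[OF w] by blast
  note A = admissibleD[OF FK(1)[rule_format]]
  let ?u = "\<lambda>n x. \<phi> x * F n x" and ?k = "\<lambda>n x. \<bar>\<phi> x\<bar> * K n x + L * \<bar>F n x\<bar>"
  have lim1: "L2_lim m ?u (\<lambda>x. \<phi> x * f x)" by (rule L2_lim_bounded_mult[OF \<phi>m \<phi> FK(2)])
  have lim_abs: "L2_lim m (\<lambda>n x. \<bar>F n x\<bar>) (\<lambda>x. \<bar>f x\<bar>)"
  proof (rule L2_lim_squeeze[OF _ _ _ L2_limD(3)[OF FK(2)]])
    show "L2_norm m (\<lambda>x. \<bar>F n x\<bar> - \<bar>f x\<bar>) \<le> L2_norm m (\<lambda>x. F n x - f x)" for n
    proof (rule L2_norm_mono)
      show "(\<lambda>x. \<bar>F n x\<bar> - \<bar>f x\<bar>) \<in> borel_measurable m"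
        using L2_measurable[OF A(3)[of n]] L2_measurable[OF L2_limD(2)[OF FK(2)]] by measurable
    qed (use L2_diff[OF A(3) L2_limD(2)[OF FK(2)]] in auto)
  qed (use A(3) L2_limD(2)[OF FK(2)] in \<open>auto intro: L2_abs\<close>)
  have lim2: "L2_lim m ?k (\<lambda>x. \<bar>\<phi> x\<bar> * H x + L * \<bar>f x\<bar>)"
    by (intro L2_lim_add L2_lim_bounded_mult[where K = B] FK(3) L2_lim_cmult[OF lim_abs]) (use \<phi> in auto)
  have "admissible (?u n) (?k n)" for n
    unfolding admissible_def
  proof (intro conjI)
    obtain C where C: "\<And>x. \<bar>F n x\<bar> \<le> C" using A(2)[of n] by blast
    show ul: "lipschitz_wrt dist (?u n)" by (rule lipschitz_wrt_mult[OF \<phi>l A(1) \<phi> C])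
    have "\<bar>?u n x\<bar> \<le> B * C" for x
      using \<phi>[of x] C[of x] unfolding abs_mult by (intro mult_mono) auto
    then show "\<exists>B. \<forall>x. \<bar>?u n x\<bar> \<le> B" by blast
    show "AE x in m. lip dist (?u n) x \<le> ?k n x"
      using A(5)[of n]
    proof eventually_elim
      case (elim x)
      have "lip dist (?u n) x \<le> \<bar>\<phi> x\<bar> * lip dist (F n) x + 0 * lip dist (F n) x + \<bar>F n x\<bar> * lip dist \<phi> x"
      proof (rule lip_le_combination[where a = "\<lambda>x. \<bar>\<phi> x\<bar>" and b = "\<lambda>x. 0", OF ul A(1) A(1) \<phi>l])
        fix y
        have "?u n y - ?u n x = \<phi> y * (F n y - F n x) + F n x * (\<phi> y - \<phi> x)" by (simp add: algebra_simps)
        then have "\<bar>?u n y - ?u n x\<bar> \<le> \<bar>\<phi> y\<bar> * \<bar>F n y - F n x\<bar> + \<bar>F n x\<bar> * \<bar>\<phi> y - \<phi> x\<bar>"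
          by (metis abs_mult abs_triangle_ineq)
        then show "\<bar>?u n y - ?u n x\<bar> \<le> \<bar>\<phi> y\<bar> * \<bar>F n y - F n x\<bar> + 0 * \<bar>F n y - F n x\<bar> + \<bar>F n x\<bar> * \<bar>\<phi> y - \<phi> x\<bar>"
          by simp
      qed (use lipschitz_wrt_tendsto[OF \<phi>l] in \<open>auto intro: tendsto_rabs\<close>)
      also have "\<dots> \<le> \<bar>\<phi> x\<bar> * K n x + 0 * lip dist (F n) x + \<bar>F n x\<bar> * L"
        using elim lip_le_lipschitz_constant[OF L] by (intro add_mono mult_left_mono) auto
      finally show ?case by (simp add: mult.commute)
    qed
    show "?u n \<in> L2 m" "?k n \<in> L2 m" using L2_limD(1)[OF lim1] L2_limD(1)[OF lim2] by auto
  qed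
  then show ?thesis by (rule weak_slopeI[OF _ lim1 lim2])
qed

text \<open>The upper estimate is the Leibniz rule; the lower one is the same rule for the inverse
  factor applied to \<open>\<phi> * f\<close>. Keeping \<open>\<phi>\<close> above 1 makes the
  inverse bounded by 1 and again \<open>L\<close>-Lipschitz, and \<open>\<phi> x \<le> 2\<close>
  gives the constant 4.\<close>

lemma N_mult_bound:
  assumes f: "f \<in> S" and \<phi>: "\<And>x. 1 \<le> \<phi> x" "\<And>x. \<phi> x \<le> 2" and L: "0 \<le> L" "\<And>x y. \<bar>\<phi> x - \<phi> y\<bar> \<le> L * dist x y"
  shows "(\<lambda>x. \<phi> x * f x) \<in> S" "AE x in m. \<bar>N (\<lambda>x. \<phi> x * f x) x - \<phi> x * N f x\<bar> \<le> 4 * L * \<bar>f x\<bar>"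
proof -
  have \<phi>b: "\<bar>\<phi> x\<bar> \<le> 2" for x using \<phi>[of x] by simp
  have w: "weak_slope (\<lambda>x. \<phi> x * f x) (\<lambda>x. \<bar>\<phi> x\<bar> * N f x + L * \<bar>f x\<bar>)"
    by (rule weak_slope_mult[OF weak_slope_N[OF f] \<phi>b L])
  then show s: "(\<lambda>x. \<phi> x * f x) \<in> S" using sobolev_iff_weak_slope by blast
  have up: "AE x in m. N (\<lambda>x. \<phi> x * f x) x \<le> \<bar>\<phi> x\<bar> * N f x + L * \<bar>f x\<bar>" by (rule N_le[OF w])
  have inv1: "\<bar>inverse (\<phi> x)\<bar> \<le> 1" for x using \<phi>(1)[of x] by (simp add: inverse_le_1_iff)
  have inv2: "\<bar>inverse (\<phi> x) - inverse (\<phi> y)\<bar> \<le> L * dist x y" for x y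
  proof -
    have "inverse (\<phi> x) - inverse (\<phi> y) = (\<phi> y - \<phi> x) * (inverse (\<phi> x) * inverse (\<phi> y))"
      using \<phi>(1)[of x] \<phi>(1)[of y] by (simp add: field_simps)
    then have "\<bar>inverse (\<phi> x) - inverse (\<phi> y)\<bar> = \<bar>\<phi> y - \<phi> x\<bar> * (\<bar>inverse (\<phi> x)\<bar> * \<bar>inverse (\<phi> y)\<bar>)"
      by (simp only: abs_mult)
    also have "\<dots> \<le> \<bar>\<phi> y - \<phi> x\<bar> * (1 * 1)" using inv1 by (intro mult_left_mono mult_mono) auto
    also have "\<dots> \<le> L * dist x y" using L(2)[of x y] by (simp add: abs_minus_commute)
    finally show ?thesis .
  qed
  have "weak_slope (\<lambda>x. inverse (\<phi> x) * (\<phi> x * f x))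
      (\<lambda>x. \<bar>inverse (\<phi> x)\<bar> * N (\<lambda>x. \<phi> x * f x) x + L * \<bar>\<phi> x * f x\<bar>)"
    by (rule weak_slope_mult[OF weak_slope_N[OF s] inv1 L(1) inv2])
  moreover have "(\<lambda>x. inverse (\<phi> x) * (\<phi> x * f x)) = f"
  proof
    fix x show "inverse (\<phi> x) * (\<phi> x * f x) = f x" using \<phi>(1)[of x] by simp
  qed
  ultimately have lo: "AE x in m. N f x \<le> \<bar>inverse (\<phi> x)\<bar> * N (\<lambda>x. \<phi> x * f x) x + L * \<bar>\<phi> x * f x\<bar>"
    using N_le by simp
  from up lo show "AE x in m. \<bar>N (\<lambda>x. \<phi> x * f x) x - \<phi> x * N f x\<bar> \<le> 4 * L * \<bar>f x\<bar>"
  proof eventually_elim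
    case (elim x)
    have p: "0 < \<phi> x" "\<bar>\<phi> x\<bar> = \<phi> x" using \<phi>(1)[of x] by auto
    have "\<phi> x * N f x \<le> \<phi> x * (inverse (\<phi> x) * N (\<lambda>x. \<phi> x * f x) x + L * (\<phi> x * \<bar>f x\<bar>))"
      using elim(2) p by (intro mult_left_mono) (auto simp: abs_mult)
    also have "\<dots> = N (\<lambda>x. \<phi> x * f x) x + (\<phi> x * \<phi> x) * (L * \<bar>f x\<bar>)"
      using p by (simp add: distrib_left)
    also have "\<dots> \<le> N (\<lambda>x. \<phi> x * f x) x + (2 * 2) * (L * \<bar>f x\<bar>)"
      using p \<phi>(2)[of x] L(1) by (intro add_left_mono mult_right_mono mult_mono) auto
    finally have a: "\<phi> x * N f x - N (\<lambda>x. \<phi> x * f x) x \<le> 4 * L * \<bar>f x\<bar>" by simp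
    have "0 \<le> L * \<bar>f x\<bar>" using L(1) by simp
    then show ?case using a elim(1) p by (simp add: abs_le_iff)
  qed
qed

lemma N_diff_le:
  assumes "f \<in> S" "g \<in> S"
  shows "AE x in m. \<bar>N f x - N g x\<bar> \<le> N (\<lambda>x. f x - g x) x"
proof -
  have "AE x in m. N (\<lambda>x. (f x - g x) + g x) x \<le> N (\<lambda>x. f x - g x) x + N g x"
    by (rule N_add[OF sobolev_diff[OF assms] assms(2)])
  moreover have "AE x in m. N (\<lambda>x. -1 * (f x - g x) + f x) x \<le> N (\<lambda>x. -1 * (f x - g x)) x + N f x"
    by (rule N_add[OF sobolev_cmult[OF sobolev_diff[OF assms]] assms(1)])
  moreover have "AE x in m. N (\<lambda>x. -1 * (f x - g x)) x = \<bar>-1\<bar> * N (\<lambda>x. f x - g x) x"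
    by (rule N_cmult[OF sobolev_diff[OF assms]])
  ultimately show ?thesis by eventually_elim simp
qed

section \<open>The pointwise parallelogram law\<close>

text \<open>For positive \<open>e\<close> the distance of \<open>t\<close> from the lattice of
  multiples of \<open>2 * e\<close>: a zigzag between 0 and \<open>e\<close> with slopes of modulus
  1.\<close>

definition saw :: "real \<Rightarrow> real \<Rightarrow> real" where
  "saw e t = \<bar>t - 2 * e * of_int (round (t / (2 * e)))\<bar>"

lemma saw_le:
  assumes "0 < e"
  shows "saw e t \<le> \<bar>t - 2 * e * of_int k\<bar>"
proof -
  have "\<bar>t / (2 * e) - of_int (round (t / (2 * e)))\<bar> \<le> \<bar>t / (2 * e) - of_int k\<bar>"
    by (rule round_diff_minimal)
  then have "2 * e * \<bar>t / (2 * e) - of_int (round (t / (2 * e)))\<bar> \<le> 2 * e * \<bar>t / (2 * e) - of_int k\<bar>"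
    using assms by (intro mult_left_mono) auto
  moreover have "2 * e * \<bar>t / (2 * e) - of_int j\<bar> = \<bar>t - 2 * e * of_int j\<bar>" for j
  proof -
    have "2 * e * \<bar>t / (2 * e) - of_int j\<bar> = \<bar>2 * e * (t / (2 * e) - of_int j)\<bar>"
      using assms by (simp add: abs_mult)
    also have "2 * e * (t / (2 * e) - of_int j) = t - 2 * e * of_int j"
      using assms by (simp add: right_diff_distrib)
    finally show ?thesis .
  qed
  ultimately show ?thesis by (simp add: saw_def)
qed

lemma saw_contraction:
  assumes "0 < e"
  shows "\<bar>saw e s - saw e t\<bar> \<le> \<bar>s - t\<bar>"
proof -
  have "saw e s \<le> \<bar>s - t\<bar> + saw e t" for s t
  proof -
    have "saw e s \<le> \<bar>s - 2 * e * of_int (round (t / (2 * e)))\<bar>" by (rule saw_le[OF assms])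
    also have "\<dots> \<le> \<bar>s - t\<bar> + \<bar>t - 2 * e * of_int (round (t / (2 * e)))\<bar>" by linarith
    finally show ?thesis by (simp add: saw_def)
  qed
  from this[of s t] this[of t s] show ?thesis by linarith
qed

lemma saw_bounds:
  assumes "0 < e"
  shows "saw e 0 = 0" "0 \<le> saw e t" "saw e t \<le> \<bar>t\<bar>" "saw e t \<le> e"
proof -
  show "saw e 0 = 0" "0 \<le> saw e t" by (auto simp: saw_def)
  show "saw e t \<le> \<bar>t\<bar>" using saw_le[OF assms, of t 0] by simp
  have "\<bar>of_int (round (t / (2 * e))) - t / (2 * e)\<bar> \<le> 1 / 2" by (rule of_int_round_abs_le)
  then have "2 * e * \<bar>t / (2 * e) - of_int (round (t / (2 * e)))\<bar> \<le> 2 * e * (1 / 2)"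
    using assms by (intro mult_left_mono) (auto simp: abs_minus_commute)
  moreover have "2 * e * \<bar>t / (2 * e) - of_int (round (t / (2 * e)))\<bar> = \<bar>2 * e * (t / (2 * e) - of_int (round (t / (2 * e))))\<bar>"
    using assms by (simp add: abs_mult)
  moreover have "2 * e * (t / (2 * e) - of_int (round (t / (2 * e)))) = t - 2 * e * of_int (round (t / (2 * e)))"
    using assms by (simp add: right_diff_distrib)
  ultimately show "saw e t \<le> e" by (simp add: saw_def)
qed

lemma saw_sobolev: "0 < e \<Longrightarrow> f \<in> S \<Longrightarrow> (\<lambda>x. saw e (f x)) \<in> S"
  using weak_slope_contraction[OF weak_slope_N saw_bounds(1) saw_contraction] sobolev_iff_weak_slope by blast

text \<open>By locality, because each tooth differs from \<open>\<plusminus>f\<close> by a constant.\<close>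

lemma saw_slope:
  assumes e: "0 < e" and f: "f \<in> S"
  shows "AE x in m. N (\<lambda>x. saw e (f x) - 1 * f x) x = 0 \<or> N (\<lambda>x. saw e (f x) - (- 1) * f x) x = 0"
proof -
  have s: "(\<lambda>x. saw e (f x) - \<sigma> * f x) \<in> S" for \<sigma>
    by (rule sobolev_diff[OF saw_sobolev[OF e f] sobolev_cmult[OF f]])
  have "AE x in m. \<forall>k::int. (saw e (f x) - 1 * f x = 2 * e * of_int k \<longrightarrow> N (\<lambda>x. saw e (f x) - 1 * f x) x = 0)
      \<and> (saw e (f x) - (- 1) * f x = 2 * e * of_int k \<longrightarrow> N (\<lambda>x. saw e (f x) - (- 1) * f x) x = 0)"
    unfolding AE_all_countable AE_conj_iff
    by (intro allI conjI N_zero_on_level_set[OF s])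
  then show ?thesis
  proof eventually_elim
    case (elim x)
    let ?k = "round (f x / (2 * e))"
    have "saw e (f x) - 1 * f x = 2 * e * of_int (- ?k) \<or> saw e (f x) - (- 1) * f x = 2 * e * of_int ?k"
      unfolding saw_def by (simp add: abs_if)
    then show ?case using elim by blast
  qed
qed

text \<open>Up to terms with vanishing slope the sawtooth functions are \<open>\<sigma> * f\<close>
  and \<open>\<tau> * g\<close>, with signs that depend on the point. Opposite signs only exchange
  the slopes of sum and difference, which leaves the sum of their squares unchanged.\<close>

lemma saw_parallelogram_invariant:
  assumes e: "0 < e" and f: "f \<in> S" and g: "g \<in> S"
  shows "AE x in m. (N (\<lambda>x. saw e (f x) + saw e (g x)) x)\<^sup>2 + (N (\<lambda>x. saw e (f x) - saw e (g x)) x)\<^sup>2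
      = (N (\<lambda>x. f x + g x) x)\<^sup>2 + (N (\<lambda>x. f x - g x) x)\<^sup>2 \<and>
    N (\<lambda>x. saw e (f x)) x = N f x \<and> N (\<lambda>x. saw e (g x)) x = N g x"
proof -
  let ?u = "\<lambda>x. saw e (f x)" and ?w = "\<lambda>x. saw e (g x)"
  note u = saw_sobolev[OF e f] and w = saw_sobolev[OF e g]
  have pm: "AE x in m. (N (\<lambda>x. ?u x - \<sigma> * f x) x = 0 \<and> N (\<lambda>x. ?w x - \<tau> * g x) x = 0) \<longrightarrow>
      N (\<lambda>x. ?u x + ?w x) x = N (\<lambda>x. \<sigma> * f x + \<tau> * g x) x \<and>
      N (\<lambda>x. ?u x - ?w x) x = N (\<lambda>x. \<sigma> * f x - \<tau> * g x) x \<and>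
      N ?u x = \<bar>\<sigma>\<bar> * N f x \<and> N ?w x = \<bar>\<tau>\<bar> * N g x" for \<sigma> \<tau>
  proof -
    note sf = sobolev_cmult[OF f, of \<sigma>] and tg = sobolev_cmult[OF g, of \<tau>]
    note us = sobolev_diff[OF u sf] and wt = sobolev_diff[OF w tg]
    have "(\<lambda>x. (?u x + ?w x) - (\<sigma> * f x + \<tau> * g x)) = (\<lambda>x. (?u x - \<sigma> * f x) + (?w x - \<tau> * g x))"
      by (intro ext) simp
    then have 1: "AE x in m. \<bar>N (\<lambda>x. ?u x + ?w x) x - N (\<lambda>x. \<sigma> * f x + \<tau> * g x) x\<bar>
        \<le> N (\<lambda>x. (?u x - \<sigma> * f x) + (?w x - \<tau> * g x)) x"
      using N_diff_le[OF sobolev_add[OF u w] sobolev_add[OF sf tg]] by simp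
    have "(\<lambda>x. (?u x - ?w x) - (\<sigma> * f x - \<tau> * g x)) = (\<lambda>x. (?u x - \<sigma> * f x) + - 1 * (?w x - \<tau> * g x))"
      by (intro ext) simp
    then have 2: "AE x in m. \<bar>N (\<lambda>x. ?u x - ?w x) x - N (\<lambda>x. \<sigma> * f x - \<tau> * g x) x\<bar>
        \<le> N (\<lambda>x. (?u x - \<sigma> * f x) + - 1 * (?w x - \<tau> * g x)) x"
      using N_diff_le[OF sobolev_diff[OF u w] sobolev_diff[OF sf tg]] by simp
    from 1 2 N_add[OF us wt] N_add[OF us sobolev_cmult[OF wt, of "- 1"]] N_cmult[OF wt, of "- 1"]
      N_diff_le[OF u sf] N_diff_le[OF w tg] N_cmult[OF f, of \<sigma>] N_cmult[OF g, of \<tau>]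
    show ?thesis by eventually_elim auto
  qed
  have sym: "AE x in m. N (\<lambda>x. - 1 * f x + - 1 * g x) x = N (\<lambda>x. f x + g x) x"
      "AE x in m. N (\<lambda>x. - 1 * f x - - 1 * g x) x = N (\<lambda>x. f x - g x) x"
  proof -
    have "(\<lambda>x. - 1 * f x + - 1 * g x) = (\<lambda>x. - 1 * (f x + g x))"
        "(\<lambda>x. - 1 * f x - - 1 * g x) = (\<lambda>x. - 1 * (f x - g x))" by (auto simp: algebra_simps)
    then show "AE x in m. N (\<lambda>x. - 1 * f x + - 1 * g x) x = N (\<lambda>x. f x + g x) x"
        "AE x in m. N (\<lambda>x. - 1 * f x - - 1 * g x) x = N (\<lambda>x. f x - g x) x"
      using N_cmult[OF sobolev_add[OF f g], of "- 1"] N_cmult[OF sobolev_diff[OF f g], of "- 1"] by simp_all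
  qed
  have sym2: "AE x in m. N (\<lambda>x. - 1 * f x + 1 * g x) x = N (\<lambda>x. f x - g x) x"
      "AE x in m. N (\<lambda>x. - 1 * f x - 1 * g x) x = N (\<lambda>x. f x + g x) x"
  proof -
    have "(\<lambda>x. - 1 * f x + 1 * g x) = (\<lambda>x. - 1 * (f x - g x))"
        "(\<lambda>x. - 1 * f x - 1 * g x) = (\<lambda>x. - 1 * (f x + g x))" by (auto simp: algebra_simps)
    then show "AE x in m. N (\<lambda>x. - 1 * f x + 1 * g x) x = N (\<lambda>x. f x - g x) x"
        "AE x in m. N (\<lambda>x. - 1 * f x - 1 * g x) x = N (\<lambda>x. f x + g x) x"
      using N_cmult[OF sobolev_add[OF f g], of "- 1"] N_cmult[OF sobolev_diff[OF f g], of "- 1"] by simp_all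
  qed
  have pp: "(\<lambda>x. 1 * f x + - 1 * g x) = (\<lambda>x. f x - g x)" "(\<lambda>x. 1 * f x - - 1 * g x) = (\<lambda>x. f x + g x)"
    "(\<lambda>x. 1 * f x + 1 * g x) = (\<lambda>x. f x + g x)" "(\<lambda>x. 1 * f x - 1 * g x) = (\<lambda>x. f x - g x)" by auto
  from saw_slope[OF e f] saw_slope[OF e g] pm[of 1 1, unfolded pp] pm[of 1 "- 1", unfolded pp] pm[of "- 1" 1] pm[of "- 1" "- 1"] sym sym2
  show ?thesis
  proof eventually_elim
    case (elim x)
    from elim(1) show ?case
    proof
      assume a: "N (\<lambda>x. saw e (f x) - 1 * f x) x = 0"
      from elim(2) show ?thesis
      proof
        assume b: "N (\<lambda>x. saw e (g x) - 1 * g x) x = 0"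
        show ?thesis using mp[OF elim(3) conjI[OF a b]] by simp
      next
        assume b: "N (\<lambda>x. saw e (g x) - - 1 * g x) x = 0"
        show ?thesis using mp[OF elim(4) conjI[OF a b]] by simp
      qed
    next
      assume a: "N (\<lambda>x. saw e (f x) - - 1 * f x) x = 0"
      from elim(2) show ?thesis
      proof
        assume b: "N (\<lambda>x. saw e (g x) - 1 * g x) x = 0"
        show ?thesis using mp[OF elim(5) conjI[OF a b]] elim(9,10) by simp
      next
        assume b: "N (\<lambda>x. saw e (g x) - - 1 * g x) x = 0"
        show ?thesis using mp[OF elim(6) conjI[OF a b]] elim(7,8) by simp
      qed
    qed
  qed
qed

end

section \<open>Localizing the integrated parallelogram law\<close>

locale hilbertian = mm_space m for m :: "'a::polish_space measure" +
  assumes hilbert: "infinitesimally_hilbertian dist m"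
begin

text \<open>The Sobolev norm and the L2 norm both obey the law, hence so does the difference of
  their squares.\<close>

lemma energy_parallelogram:
  assumes f: "f \<in> S" and g: "g \<in> S"
  shows "(L2_norm m (N (\<lambda>x. f x + g x)))\<^sup>2 + (L2_norm m (N (\<lambda>x. f x - g x)))\<^sup>2
    = 2 * (L2_norm m (N f))\<^sup>2 + 2 * (L2_norm m (N g))\<^sup>2"
proof -
  obtain B :: "('a \<Rightarrow> real) \<Rightarrow> ('a \<Rightarrow> real) \<Rightarrow> real" where
    "\<forall>f\<in>S. \<forall>g\<in>S. B f g = B g f"
    "\<forall>f\<in>S. \<forall>g\<in>S. \<forall>h\<in>S. B (\<lambda>x. f x + g x) h = B f h + B g h"
    "\<forall>c. \<forall>f\<in>S. \<forall>g\<in>S. B (\<lambda>x. c * f x) g = c * B f g"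
    "\<forall>f\<in>S. B f f = (sobolev_norm dist m f)\<^sup>2"
    using hilbert unfolding infinitesimally_hilbertian_def by (elim conjE exE) (rule that)
  note sym = this(1)[rule_format] and add = this(2)[rule_format] and mult = this(3)[rule_format]
    and norm = this(4)[rule_format]
  have nrm: "B f f = (L2_norm m f)\<^sup>2 + (L2_norm m (N f))\<^sup>2" if "f \<in> S" for f
    unfolding norm[OF that] sobolev_norm_def by simp
  let ?s = "\<lambda>x. f x + g x" and ?g = "\<lambda>x. - 1 * g x"
  let ?d = "\<lambda>x. f x + ?g x"
  have gS: "?g \<in> S" by (rule sobolev_cmult[OF g])
  have sS: "?s \<in> S" and dS: "?d \<in> S" by (rule sobolev_add[OF f g] sobolev_add[OF f gS])+
  have "B ?s ?s = B f f + 2 * B f g + B g g"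
    using add[OF f g sS] add[OF f g f] add[OF f g g] sym[OF f sS] sym[OF g sS] sym[OF f g] by simp
  moreover have "B ?d ?d = B f f - 2 * B f g + B g g"
    using add[OF f gS dS] add[OF f gS f] add[OF f gS g] sym[OF f dS] sym[OF g dS] sym[OF f g] mult[OF g f, of "- 1"]
      mult[OF g g, of "- 1"] mult[OF g dS, of "- 1"] by simp
  ultimately have "B ?s ?s + B ?d ?d = 2 * B f f + 2 * B g g" by simp
  then show ?thesis
    using nrm[OF sS] nrm[OF dS] nrm[OF f] nrm[OF g] L2_parallelogram[OF sobolev_L2[OF f] sobolev_L2[OF g]]
    by simp
qed

text \<open>Replacing \<open>f\<close> and \<open>g\<close> by uniformly small sawtooth functions with the same slopes makes the
  error terms of the Leibniz rule disappear, so that the parallelogram law localizes.\<close>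

lemma weighted_parallelogram:
  assumes f: "f \<in> S" and g: "g \<in> S"
    and \<phi>: "\<And>x. 1 \<le> \<phi> x" "\<And>x. \<phi> x \<le> 2" and L: "0 \<le> L" "\<And>x y. \<bar>\<phi> x - \<phi> y\<bar> \<le> L * dist x y"
  shows "(LINT x|m. (\<phi> x)\<^sup>2 * ((N (\<lambda>x. f x + g x) x)\<^sup>2 + (N (\<lambda>x. f x - g x) x)\<^sup>2))
    = (LINT x|m. (\<phi> x)\<^sup>2 * (2 * (N f x)\<^sup>2 + 2 * (N g x)\<^sup>2))"
proof -
  have \<phi>l: "lipschitz_wrt dist \<phi>" using L by (auto simp: lipschitz_wrt_def)
  note \<phi>m [measurable] = lipschitz_measurable[OF \<phi>l]
  have \<phi>b: "\<bar>\<phi> x\<bar> \<le> 2" for x using \<phi>[of x] by simp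
  define e where "e n = inverse (real (Suc n))" for n
  have e: "0 < e n" for n by (simp add: e_def)
  have e_lim: "e \<longlonglongrightarrow> 0" unfolding e_def by (rule LIMSEQ_inverse_real_of_nat)
  define u where "u n x = saw (e n) (f x)" for n x
  define w where "w n x = saw (e n) (g x)" for n x
  have uS: "u n \<in> S" and wS: "w n \<in> S" for n
    unfolding u_def[abs_def] w_def[abs_def] using saw_sobolev[OF e] f g by auto
  have lim0: "L2_lim m (\<lambda>n x. saw (e n) (h x)) (\<lambda>x. 0)" if h: "h \<in> S" for h
  proof (rule L2_lim_dominated[OF _ _ sobolev_L2[OF h]])
    show "(\<lambda>x. saw (e n) (h x)) \<in> borel_measurable m" for n
      using L2_measurable[OF sobolev_L2[OF saw_sobolev[OF e h]]] .
    show "AE x in m. \<bar>saw (e n) (h x)\<bar> \<le> \<bar>h x\<bar>" for n using saw_bounds(2,3)[OF e] by simp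
    have "(\<lambda>n. saw (e n) t) \<longlonglongrightarrow> 0" for t
      by (rule tendsto_sandwich[OF _ _ tendsto_const e_lim]) (use saw_bounds[OF e] in auto)
    then show "AE x in m. (\<lambda>n. saw (e n) (h x)) \<longlonglongrightarrow> 0" by simp
  qed simp
  have ulim: "L2_lim m u (\<lambda>x. 0)" and wlim: "L2_lim m w (\<lambda>x. 0)"
    unfolding u_def[abs_def] w_def[abs_def] using lim0 f g by auto
  \<comment> \<open>\<open>P\<close> is the slope norm of the product, \<open>Q\<close> the weighted
    slope norm without the derivative of \<open>\<phi>\<close>. They differ by at most
    \<open>4 * L\<close> times the L2 norm of the function, which tends to 0 along the sawtooth
    functions.\<close>
  define P where "P h = L2_norm m (N (\<lambda>x. \<phi> x * h x))" for h
  define Q where "Q h = L2_norm m (\<lambda>x. \<phi> x * N h x)" for h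
  have \<phi>N2: "(\<lambda>x. \<phi> x * N h x) \<in> L2 m" if "h \<in> S" for h
    by (rule L2_bounded_mult(1)[OF \<phi>m \<phi>b N_L2[OF that]])
  have PQ: "\<bar>P h - Q h\<bar> \<le> 4 * L * L2_norm m h" if h: "h \<in> S" for h
  proof -
    note M = N_mult_bound[OF h \<phi> L]
    have "\<bar>P h - Q h\<bar> \<le> L2_norm m (\<lambda>x. N (\<lambda>x. \<phi> x * h x) x - \<phi> x * N h x)"
      unfolding P_def Q_def by (rule L2_norm_diff_bound[OF N_L2[OF M(1)] \<phi>N2[OF h]])
    also have "\<dots> \<le> L2_norm m (\<lambda>x. 4 * L * h x)"
    proof (rule L2_norm_mono[OF _ L2_cmult[OF sobolev_L2[OF h]]])
      show "(\<lambda>x. N (\<lambda>x. \<phi> x * h x) x - \<phi> x * N h x) \<in> borel_measurable m"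
        using L2_measurable[OF L2_diff[OF N_L2[OF M(1)] \<phi>N2[OF h]]] .
      show "AE x in m. \<bar>N (\<lambda>x. \<phi> x * h x) x - \<phi> x * N h x\<bar> \<le> \<bar>4 * L * h x\<bar>"
        using M(2)
      proof eventually_elim
        case (elim x)
        have "\<bar>4 * L * h x\<bar> = 4 * L * \<bar>h x\<bar>" using L(1) by (simp add: abs_mult)
        then show ?case using elim by (simp only:)
      qed
    qed
    also have "\<dots> = 4 * L * L2_norm m h" using L(1) by (simp add: L2_norm_cmult)
    finally show ?thesis .
  qed
  have Q_bound: "Q h \<le> 2 * L2_norm m (N h)" if "h \<in> S" for h
    unfolding Q_def by (rule L2_bounded_mult(2)[OF \<phi>m \<phi>b N_L2[OF that]])
  have sq: "(\<lambda>n. (P (h n))\<^sup>2 - (Q (h n))\<^sup>2) \<longlonglongrightarrow> 0"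
    if hS: "\<And>n. h n \<in> S" and lim: "L2_lim m h (\<lambda>x. 0)" and C: "\<And>n. Q (h n) \<le> C" for h C
  proof (rule tendsto_0_le[where K = "1"])
    have z: "(\<lambda>n. L2_norm m (h n)) \<longlonglongrightarrow> 0" using L2_limD(3)[OF lim] by simp
    have "(\<lambda>n. 4 * L * L2_norm m (h n) * (2 * C + 4 * L * L2_norm m (h n))) \<longlonglongrightarrow> 4 * L * 0 * (2 * C + 4 * L * 0)"
      by (intro tendsto_intros z)
    then show "(\<lambda>n. 4 * L * L2_norm m (h n) * (2 * C + 4 * L * L2_norm m (h n))) \<longlonglongrightarrow> 0" by simp
    have "\<bar>(P (h n))\<^sup>2 - (Q (h n))\<^sup>2\<bar> \<le> 4 * L * L2_norm m (h n) * (2 * C + 4 * L * L2_norm m (h n))" for n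
    proof -
      have nn: "0 \<le> P (h n)" "0 \<le> Q (h n)" by (simp_all add: P_def Q_def)
      have "(P (h n))\<^sup>2 - (Q (h n))\<^sup>2 = (P (h n) - Q (h n)) * (P (h n) + Q (h n))"
        by (simp add: power2_eq_square algebra_simps)
      then have "\<bar>(P (h n))\<^sup>2 - (Q (h n))\<^sup>2\<bar> = \<bar>P (h n) - Q (h n)\<bar> * (P (h n) + Q (h n))"
        using nn by (simp add: abs_mult)
      also have "\<dots> \<le> (4 * L * L2_norm m (h n)) * (2 * C + 4 * L * L2_norm m (h n))"
        using PQ[OF hS, of n] C[of n] nn L(1) by (intro mult_mono) auto
      finally show ?thesis .
    qed
    then show "\<forall>\<^sub>F n in sequentially. norm ((P (h n))\<^sup>2 - (Q (h n))\<^sup>2)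
        \<le> norm (4 * L * L2_norm m (h n) * (2 * C + 4 * L * L2_norm m (h n))) * 1"
      by (intro always_eventually allI) (auto intro: order_trans[OF _ abs_ge_self])
  qed
  define s where "s n x = u n x + w n x" for n x
  define d where "d n x = u n x - w n x" for n x
  have sS: "s n \<in> S" and dS: "d n \<in> S" for n
    unfolding s_def[abs_def] d_def[abs_def] by (rule sobolev_add[OF uS wS] sobolev_diff[OF uS wS])+
  have slim: "L2_lim m s (\<lambda>x. 0)" and dlim: "L2_lim m d (\<lambda>x. 0)"
    using L2_lim_add[OF ulim wlim] L2_lim_diff[OF ulim wlim] by (simp_all add: s_def[abs_def] d_def[abs_def])
  have inv: "AE x in m. (N (s n) x)\<^sup>2 + (N (d n) x)\<^sup>2 = (N (\<lambda>x. f x + g x) x)\<^sup>2 + (N (\<lambda>x. f x - g x) x)\<^sup>2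
      \<and> N (u n) x = N f x \<and> N (w n) x = N g x" for n
    using saw_parallelogram_invariant[OF e f g, of n]
    by (simp add: s_def[abs_def] d_def[abs_def] u_def[abs_def] w_def[abs_def])
  have Nu: "L2_norm m (N (u n)) = L2_norm m (N f)" "L2_norm m (N (w n)) = L2_norm m (N g)" for n
    using inv[of n] L2_measurable[OF N_L2] uS wS f g by (auto intro!: L2_norm_cong_AE)
  define a where "a = L2_norm m (N f)"
  define b where "b = L2_norm m (N g)"
  \<comment> \<open>A common bound for all four weighted norms: a factor 2 from
    \<open>\<phi>\<close>, and \<open>2 * (a + b)\<close> from the parallelogram law for the sums
    and differences.\<close>
  define C where "C = 2 * (2 * (a + b))"
  have ab: "0 \<le> a" "0 \<le> b" by (simp_all add: a_def b_def)
  have Cs: "Q (s n) \<le> C" "Q (d n) \<le> C" "Q (u n) \<le> C" "Q (w n) \<le> C" for n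
  proof -
    have par: "(L2_norm m (N (s n)))\<^sup>2 + (L2_norm m (N (d n)))\<^sup>2 = 2 * a\<^sup>2 + 2 * b\<^sup>2"
      using energy_parallelogram[OF uS wS, of n n] by (simp add: s_def[abs_def] d_def[abs_def] Nu a_def b_def)
    have "0 \<le> a * b" using ab by simp
    then have big: "2 * a\<^sup>2 + 2 * b\<^sup>2 \<le> (2 * (a + b))\<^sup>2"
      using zero_le_power2[of a] zero_le_power2[of b] by (simp add: power_mult_distrib power2_sum)
    have "L2_norm m (N (s n)) \<le> 2 * (a + b)"
    proof (rule power2_le_imp_le)
      show "(L2_norm m (N (s n)))\<^sup>2 \<le> (2 * (a + b))\<^sup>2"
        using order_trans[OF _ big, of "(L2_norm m (N (s n)))\<^sup>2"] unfolding par[symmetric] by simp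
    qed (use ab in simp)
    moreover have "L2_norm m (N (d n)) \<le> 2 * (a + b)"
    proof (rule power2_le_imp_le)
      show "(L2_norm m (N (d n)))\<^sup>2 \<le> (2 * (a + b))\<^sup>2"
        using order_trans[OF _ big, of "(L2_norm m (N (d n)))\<^sup>2"] unfolding par[symmetric] by simp
    qed (use ab in simp)
    moreover have "Q (u n) \<le> 2 * a" "Q (w n) \<le> 2 * b"
      using Q_bound[OF uS, of n] Q_bound[OF wS, of n] by (simp_all add: Nu a_def b_def)
    ultimately show "Q (s n) \<le> C" "Q (d n) \<le> C" "Q (u n) \<le> C" "Q (w n) \<le> C"
      using Q_bound[OF sS, of n] Q_bound[OF dS, of n] ab unfolding C_def by argo+
  qed
  have Qsq: "(Q h)\<^sup>2 = (LINT x|m. (\<phi> x)\<^sup>2 * (N h x)\<^sup>2)" "integrable m (\<lambda>x. (\<phi> x)\<^sup>2 * (N h x)\<^sup>2)" if "h \<in> S" for h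
    using L2_integrable_square[OF \<phi>N2[OF that]] by (simp_all add: Q_def L2_norm_square power_mult_distrib)
  note [measurable] = L2_measurable[OF N_L2]
  have sum_meas: "N (\<lambda>x. f x + g x) \<in> borel_measurable m" "N (\<lambda>x. f x - g x) \<in> borel_measurable m"
    "N f \<in> borel_measurable m" "N g \<in> borel_measurable m"
    using L2_measurable[OF N_L2] sobolev_add[OF f g] sobolev_diff[OF f g] f g by auto
  note [measurable] = sum_meas
  have snd: "N (s n) \<in> borel_measurable m" "N (d n) \<in> borel_measurable m" "N (u n) \<in> borel_measurable m" "N (w n) \<in> borel_measurable m" for n
    using L2_measurable[OF N_L2] sS dS uS wS by auto
  note [measurable] = snd
  define A where "A = (LINT x|m. (\<phi> x)\<^sup>2 * ((N (\<lambda>x. f x + g x) x)\<^sup>2 + (N (\<lambda>x. f x - g x) x)\<^sup>2))"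
  define B where "B = (LINT x|m. (\<phi> x)\<^sup>2 * (2 * (N f x)\<^sup>2 + 2 * (N g x)\<^sup>2))"
  have QA: "(Q (s n))\<^sup>2 + (Q (d n))\<^sup>2 = A" for n
  proof -
    have "(Q (s n))\<^sup>2 + (Q (d n))\<^sup>2 = (LINT x|m. (\<phi> x)\<^sup>2 * (N (s n) x)\<^sup>2 + (\<phi> x)\<^sup>2 * (N (d n) x)\<^sup>2)"
      using Qsq[OF sS, of n] Qsq[OF dS, of n] by simp
    also have "\<dots> = A"
      unfolding A_def using inv[of n] by (intro integral_cong_AE) (auto elim!: eventually_mono simp: distrib_left[symmetric])
    finally show ?thesis .
  qed
  have QB: "2 * (Q (u n))\<^sup>2 + 2 * (Q (w n))\<^sup>2 = B" for n
  proof -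
    have "2 * (Q (u n))\<^sup>2 + 2 * (Q (w n))\<^sup>2 = (LINT x|m. 2 * ((\<phi> x)\<^sup>2 * (N (u n) x)\<^sup>2) + 2 * ((\<phi> x)\<^sup>2 * (N (w n) x)\<^sup>2))"
      using Qsq[OF uS, of n] Qsq[OF wS, of n] by simp
    also have "\<dots> = B"
      unfolding B_def
    proof (rule integral_cong_AE)
      show "AE x in m. 2 * ((\<phi> x)\<^sup>2 * (N (u n) x)\<^sup>2) + 2 * ((\<phi> x)\<^sup>2 * (N (w n) x)\<^sup>2)
          = (\<phi> x)\<^sup>2 * (2 * (N f x)\<^sup>2 + 2 * (N g x)\<^sup>2)"
        using inv[of n]
      proof eventually_elim
        case (elim x)
        then have "N (u n) x = N f x" "N (w n) x = N g x" by simp_all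
        then show ?case by (simp add: algebra_simps)
      qed
    qed measurable
    finally show ?thesis .
  qed
  have par: "(P (s n))\<^sup>2 + (P (d n))\<^sup>2 = 2 * (P (u n))\<^sup>2 + 2 * (P (w n))\<^sup>2" for n
    using energy_parallelogram[OF N_mult_bound(1)[OF uS \<phi> L] N_mult_bound(1)[OF wS \<phi> L], of n n]
    unfolding P_def s_def d_def by (simp only: distrib_left right_diff_distrib)
  \<comment> \<open>The law holds exactly for \<open>P\<close>, the two combinations of squares of
    \<open>Q\<close> are constant in \<open>n\<close> by the sawtooth invariance, and the squares of
    \<open>P\<close> and \<open>Q\<close> approach each other.\<close>
  have "(\<lambda>n. ((P (s n))\<^sup>2 - (Q (s n))\<^sup>2) + ((P (d n))\<^sup>2 - (Q (d n))\<^sup>2)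
      - 2 * ((P (u n))\<^sup>2 - (Q (u n))\<^sup>2) - 2 * ((P (w n))\<^sup>2 - (Q (w n))\<^sup>2)) \<longlonglongrightarrow> 0 + 0 - 2 * 0 - 2 * 0"
    by (intro tendsto_intros sq[OF sS slim Cs(1)] sq[OF dS dlim Cs(2)] sq[OF uS ulim Cs(3)] sq[OF wS wlim Cs(4)])
  moreover have "((P (s n))\<^sup>2 - (Q (s n))\<^sup>2) + ((P (d n))\<^sup>2 - (Q (d n))\<^sup>2)
      - 2 * ((P (u n))\<^sup>2 - (Q (u n))\<^sup>2) - 2 * ((P (w n))\<^sup>2 - (Q (w n))\<^sup>2) = B - A" for n
    using par[of n] QA[of n] QB[of n] by argo
  ultimately have "(\<lambda>n::nat. B - A) \<longlonglongrightarrow> 0" by simp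
  then have "B - A = 0" using LIMSEQ_unique[OF tendsto_const] by blast
  then show ?thesis by (simp add: A_def B_def)
qed

lemma parallelogram_AE:
  assumes f: "f \<in> S" and g: "g \<in> S"
  shows "AE x in m. (N (\<lambda>x. f x + g x) x)\<^sup>2 + (N (\<lambda>x. f x - g x) x)\<^sup>2 = 2 * (N f x)\<^sup>2 + 2 * (N g x)\<^sup>2"
proof -
  define q where "q x = ((N (\<lambda>x. f x + g x) x)\<^sup>2 + (N (\<lambda>x. f x - g x) x)\<^sup>2) - (2 * (N f x)\<^sup>2 + 2 * (N g x)\<^sup>2)" for x
  have i1: "integrable m (\<lambda>x. (N (\<lambda>x. f x + g x) x)\<^sup>2 + (N (\<lambda>x. f x - g x) x)\<^sup>2)"
    using L2_integrable_square[OF N_L2[OF sobolev_add[OF f g]]] L2_integrable_square[OF N_L2[OF sobolev_diff[OF f g]]] by simp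
  have i2: "integrable m (\<lambda>x. 2 * (N f x)\<^sup>2 + 2 * (N g x)\<^sup>2)"
    using L2_integrable_square[OF N_L2[OF f]] L2_integrable_square[OF N_L2[OF g]] by simp
  have q: "integrable m q" unfolding q_def using i1 i2 by simp
  note [measurable] = borel_measurable_integrable[OF q]
  have bi: "integrable m (\<lambda>x. b x * h x)"
    if "b \<in> borel_measurable m" "\<And>x. \<bar>b x\<bar> \<le> 4" "integrable m h" for b h :: "'a \<Rightarrow> real"
  proof (rule Bochner_Integration.integrable_bound)
    show "integrable m (\<lambda>x. 4 * h x)" using that(3) by simp
    show "(\<lambda>x. b x * h x) \<in> borel_measurable m" using that borel_measurable_integrable[OF that(3)] by measurable
    show "AE x in m. norm (b x * h x) \<le> norm (4 * h x)" using that(2) by (auto simp: abs_mult intro!: mult_right_mono)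
  qed
  have zero: "(LINT x|m. (\<phi> x)\<^sup>2 * q x) = 0"
    if \<phi>: "\<And>x. 1 \<le> \<phi> x" "\<And>x. \<phi> x \<le> 2" and L: "0 \<le> L" "\<And>x y. \<bar>\<phi> x - \<phi> y\<bar> \<le> L * dist x y" for \<phi> L
  proof -
    have \<phi>l: "lipschitz_wrt dist \<phi>" using L by (auto simp: lipschitz_wrt_def)
    note [measurable] = lipschitz_measurable[OF \<phi>l]
    have b: "\<bar>(\<phi> x)\<^sup>2\<bar> \<le> 4" for x
      using power_mono[of "\<phi> x" 2 2] \<phi>[of x] by simp
    have "(LINT x|m. (\<phi> x)\<^sup>2 * q x) = (LINT x|m. (\<phi> x)\<^sup>2 * ((N (\<lambda>x. f x + g x) x)\<^sup>2 + (N (\<lambda>x. f x - g x) x)\<^sup>2)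
        - (\<phi> x)\<^sup>2 * (2 * (N f x)\<^sup>2 + 2 * (N g x)\<^sup>2))"
      unfolding q_def by (simp only: right_diff_distrib)
    also have "\<dots> = 0"
      using weighted_parallelogram[OF f g \<phi> L] bi[OF _ b i1] bi[OF _ b i2]
      by (subst Bochner_Integration.integral_diff) auto
    finally show ?thesis .
  qed
  have K0: "(LINT x|m. indicator K x * q x) = 0" if K: "compact K" for K
  proof -
    have Km [measurable]: "K \<in> sets m" using K by (simp add: sets_m borel_compact)
    obtain \<phi> :: "nat \<Rightarrow> 'a \<Rightarrow> real" and L :: "nat \<Rightarrow> real" where \<phi>:
      "\<And>n x. 0 \<le> \<phi> n x" "\<And>n x. \<phi> n x \<le> 1" "\<And>n. 0 \<le> L n"
      "\<And>n x y. \<bar>\<phi> n x - \<phi> n y\<bar> \<le> L n * dist x y" "\<And>x. (\<lambda>n. \<phi> n x) \<longlonglongrightarrow> indicator K x"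
      using compact_indicator_approx[OF K] by blast
    have "lipschitz_wrt dist (\<phi> n)" for n unfolding lipschitz_wrt_def using \<phi>(3,4) by blast
    note [measurable] = lipschitz_measurable[OF this]
    \<comment> \<open>The weights in \<open>weighted_parallelogram\<close> stay between 1 and 2. The
      square of \<open>1 + indicator K x\<close> is \<open>1 + 3 * indicator K x\<close>, and the
      weight 1 removes the constant part.\<close>
    have "(\<lambda>n. LINT x|m. (1 + \<phi> n x)\<^sup>2 * q x) \<longlonglongrightarrow> (LINT x|m. (1 + indicator K x)\<^sup>2 * q x)"
    proof (rule integral_dominated_convergence[where w = "\<lambda>x. 4 * \<bar>q x\<bar>"])
      show "integrable m (\<lambda>x. 4 * \<bar>q x\<bar>)" using q by simp
      show "AE x in m. (\<lambda>n. (1 + \<phi> n x)\<^sup>2 * q x) \<longlonglongrightarrow> (1 + indicator K x)\<^sup>2 * q x"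
        by (intro AE_I2 tendsto_intros \<phi>(5))
      show "AE x in m. norm ((1 + \<phi> n x)\<^sup>2 * q x) \<le> 4 * \<bar>q x\<bar>" for n
      proof (rule AE_I2)
        fix x
        have "(1 + \<phi> n x)\<^sup>2 \<le> 2\<^sup>2" using \<phi>(1,2)[of n x] by (intro power_mono) auto
        then show "norm ((1 + \<phi> n x)\<^sup>2 * q x) \<le> 4 * \<bar>q x\<bar>" by (auto simp: abs_mult intro!: mult_right_mono)
      qed
    qed measurable
    moreover have "(LINT x|m. (1 + \<phi> n x)\<^sup>2 * q x) = 0" for n
      using \<phi> by (intro zero[of _ "L n"]) auto
    ultimately have "(LINT x|m. (1 + indicator K x)\<^sup>2 * q x) = 0"
      using LIMSEQ_unique[OF _ tendsto_const[of "0::real"]] by simp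
    also have "(LINT x|m. (1 + indicator K x)\<^sup>2 * q x) = (LINT x|m. q x + 3 * (indicator K x * q x))"
      by (intro Bochner_Integration.integral_cong) (auto simp: indicator_def)
    also have "\<dots> = (LINT x|m. q x) + 3 * (LINT x|m. indicator K x * q x)"
      using q integrable_mult_indicator[OF Km q] by simp
    also have "(LINT x|m. q x) = 0" using zero[of "\<lambda>_. 1" 0] by simp
    finally show ?thesis by simp
  qed
  have "AE x in m. q x \<le> 0"
    by (rule AE_nonpos_of_compact_integrals[OF sets_m q]) (simp add: K0)
  moreover have "AE x in m. - q x \<le> 0"
    by (rule AE_nonpos_of_compact_integrals[OF sets_m]) (use q K0 in auto)
  ultimately show ?thesis by eventually_elim (simp add: q_def)
qed

section \<open>Bilinearity of the carre du champ\<close>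

abbreviation "\<Gamma> \<equiv> carre_du_champ dist m"

lemma N_combination:
  assumes f: "f \<in> S" and g: "g \<in> S"
  shows "AE x in m. N (\<lambda>y. a * f y + b * g y) x \<le> \<bar>a\<bar> * N f x + \<bar>b\<bar> * N g x"
  using N_add[OF sobolev_cmult[OF f, of a] sobolev_cmult[OF g, of b]] N_cmult[OF f, of a] N_cmult[OF g, of b]
  by eventually_elim simp

lemma N_diff_commute:
  assumes f: "f \<in> S" and g: "g \<in> S"
  shows "AE x in m. N (\<lambda>y. g y - f y) x = N (\<lambda>y. f y - g y) x"
proof -
  have "(\<lambda>y. - 1 * (f y - g y)) = (\<lambda>y. g y - f y)" by (intro ext) simp
  then show ?thesis using N_cmult[OF sobolev_diff[OF f g], of "- 1"] by simp
qed

lemma N_zero: "AE x in m. N (\<lambda>y. 0) x = 0"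
proof -
  have z: "(\<lambda>x::'a. 0) \<in> S" using weak_slope_zero sobolev_iff_weak_slope by blast
  show ?thesis using N_cmult[OF z, of 0] by simp
qed

lemma \<Gamma>_sym:
  assumes f: "f \<in> S" and g: "g \<in> S"
  shows "AE x in m. \<Gamma> f g x = \<Gamma> g f x"
  using N_diff_commute[OF f g] by eventually_elim (simp add: carre_du_champ_def add.commute)

text \<open>Jordan-von Neumann: in the alternating sum of the laws for \<open>f + h\<close> and
  \<open>f - h\<close> against \<open>g\<close>, and for \<open>g + h\<close> and
  \<open>g - h\<close> against \<open>f\<close>, the terms containing \<open>f - g\<close>
  cancel.\<close>

lemma \<Gamma>_add:
  assumes f: "f \<in> S" and g: "g \<in> S" and h: "h \<in> S"
  shows "AE x in m. \<Gamma> (\<lambda>y. f y + g y) h x = \<Gamma> f h x + \<Gamma> g h x"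
proof -
  have e: "(\<lambda>y. f y + h y + g y) = (\<lambda>y. f y + g y + h y)" "(\<lambda>y. f y + h y - g y) = (\<lambda>y. f y - g y + h y)"
    "(\<lambda>y. f y - h y + g y) = (\<lambda>y. f y + g y - h y)" "(\<lambda>y. f y - h y - g y) = (\<lambda>y. f y - g y - h y)"
    "(\<lambda>y. g y + h y + f y) = (\<lambda>y. f y + g y + h y)" "(\<lambda>y. g y + h y - f y) = (\<lambda>y. h y - (f y - g y))"
    "(\<lambda>y. g y - h y + f y) = (\<lambda>y. f y + g y - h y)" "(\<lambda>y. g y - h y - f y) = (\<lambda>y. - 1 * (f y - g y + h y))"
    by (auto simp: algebra_simps)
  note fg = sobolev_diff[OF f g]
  from parallelogram_AE[OF sobolev_add[OF f h] g, unfolded e]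
    parallelogram_AE[OF sobolev_diff[OF f h] g, unfolded e]
    parallelogram_AE[OF sobolev_add[OF g h] f, unfolded e]
    parallelogram_AE[OF sobolev_diff[OF g h] f, unfolded e]
    N_diff_commute[OF fg h] N_cmult[OF sobolev_add[OF fg h], of "- 1"]
  show ?thesis
  proof eventually_elim
    case (elim x)
    have "N (\<lambda>y. - 1 * (f y - g y + h y)) x = N (\<lambda>y. f y - g y + h y) x" using elim(6) by simp
    with elim(1-5) show ?case unfolding carre_du_champ_def by algebra
  qed
qed

text \<open>A substitute for the Cauchy-Schwarz inequality that is available before homogeneity: the
  difference of squares is factored. The factor \<open>N g x\<close> suffices for continuity in
  \<open>g\<close>.\<close>

lemma \<Gamma>_bound:
  assumes f: "f \<in> S" and g: "g \<in> S"
  shows "AE x in m. \<bar>\<Gamma> f g x\<bar> \<le> N g x * (N f x + N g x)"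
proof -
  have "(\<lambda>y. (f y + g y) - (f y - g y)) = (\<lambda>y. 2 * g y)" by (intro ext) simp
  then have "AE x in m. \<bar>N (\<lambda>y. f y + g y) x - N (\<lambda>y. f y - g y) x\<bar> \<le> N (\<lambda>y. 2 * g y) x"
    using N_diff_le[OF sobolev_add[OF f g] sobolev_diff[OF f g]] by simp
  moreover have "AE x in m. N (\<lambda>y. f y - g y) x \<le> N f x + N g x"
    using N_combination[OF f g, of 1 "- 1"] by simp
  ultimately show ?thesis
    using N_add[OF f g] N_cmult[OF g, of 2] N_nonneg[OF sobolev_add[OF f g]] N_nonneg[OF sobolev_diff[OF f g]]
      N_nonneg[OF g]
  proof eventually_elim
    case (elim x)
    let ?s = "N (\<lambda>y. f y + g y) x" and ?d = "N (\<lambda>y. f y - g y) x"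
    have "?s\<^sup>2 - ?d\<^sup>2 = (?s - ?d) * (?s + ?d)" by (simp add: power2_eq_square algebra_simps)
    then have "\<bar>?s\<^sup>2 - ?d\<^sup>2\<bar> = \<bar>?s - ?d\<bar> * (?s + ?d)" using elim by (simp add: abs_mult)
    also have "\<dots> \<le> (2 * N g x) * (2 * (N f x + N g x))"
      using elim by (intro mult_mono) auto
    finally have "\<bar>?s\<^sup>2 - ?d\<^sup>2\<bar> \<le> 4 * (N g x * (N f x + N g x))" by (simp only: mult.assoc mult.left_commute)
    then show ?case by (simp add: carre_du_champ_def)
  qed
qed

lemma \<Gamma>_zero:
  assumes f: "f \<in> S"
  shows "AE x in m. \<Gamma> (\<lambda>y. 0) f x = 0"
  using N_cmult[OF f, of "- 1"] by eventually_elim (simp add: carre_du_champ_def)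

lemma \<Gamma>_of_nat:
  assumes f: "f \<in> S" and g: "g \<in> S"
  shows "AE x in m. \<Gamma> (\<lambda>y. real n * f y) g x = real n * \<Gamma> f g x"
proof (induction n)
  case 0
  then show ?case using \<Gamma>_zero[OF g] by simp
next
  case (Suc n)
  have "(\<lambda>y. real (Suc n) * f y) = (\<lambda>y. real n * f y + f y)" by (intro ext) (simp add: algebra_simps)
  then show ?case
    using Suc \<Gamma>_add[OF sobolev_cmult[OF f, of "real n"] f g]
    by (auto elim!: eventually_rev_mp simp: algebra_simps)
qed

lemma \<Gamma>_of_int:
  assumes f: "f \<in> S" and g: "g \<in> S"
  shows "AE x in m. \<Gamma> (\<lambda>y. of_int k * f y) g x = of_int k * \<Gamma> f g x"
proof (cases "0 \<le> k")
  case True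
  then show ?thesis using \<Gamma>_of_nat[OF f g, of "nat k"] by simp
next
  case False
  then have k: "real (nat (- k)) = - of_int k" by simp
  have "(\<lambda>y. of_int k * f y + real (nat (- k)) * f y) = (\<lambda>y. 0)" by (intro ext) (simp add: k)
  then show ?thesis
    using \<Gamma>_of_nat[OF f g, of "nat (- k)"] \<Gamma>_zero[OF g]
      \<Gamma>_add[OF sobolev_cmult[OF f, of "of_int k"] sobolev_cmult[OF f, of "real (nat (- k))"] g]
    by (auto elim!: eventually_rev_mp simp: k)
qed

lemma dyadic_approx: "0 \<le> c - of_int \<lfloor>2 ^ n * c\<rfloor> / 2 ^ n" "c - of_int \<lfloor>2 ^ n * c\<rfloor> / 2 ^ n \<le> (1/2) ^ n"
  for c :: real
proof -
  define k :: real where "k = of_int \<lfloor>2 ^ n * c\<rfloor>"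
  have k: "k \<le> 2 ^ n * c" "2 ^ n * c \<le> k + 1" unfolding k_def by linarith+
  have "c = 2 ^ n * c / 2 ^ n" by simp
  moreover have "k / 2 ^ n \<le> 2 ^ n * c / 2 ^ n" using k(1) by (intro divide_right_mono) auto
  moreover have "2 ^ n * c / 2 ^ n \<le> (k + 1) / 2 ^ n" using k(2) by (intro divide_right_mono) auto
  moreover have "(k + 1) / 2 ^ n = k / 2 ^ n + (1/2) ^ n" by (simp add: add_divide_distrib power_one_over)
  ultimately show "0 \<le> c - of_int \<lfloor>2 ^ n * c\<rfloor> / 2 ^ n" "c - of_int \<lfloor>2 ^ n * c\<rfloor> / 2 ^ n \<le> (1/2) ^ n"
    unfolding k_def[symmetric] by linarith+
qed

lemma dyadic_approx_abs: "\<bar>c - of_int \<lfloor>2 ^ n * c\<rfloor> / 2 ^ n\<bar> \<le> (1/2) ^ n" for c :: real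
  using dyadic_approx[of c n] by simp

lemma dyadic_approx_lim: "(\<lambda>n. of_int \<lfloor>2 ^ n * c\<rfloor> / 2 ^ n) \<longlonglongrightarrow> (c::real)"
proof (rule LIM_zero_cancel, rule tendsto_0_le[where K = 1])
  show "(\<lambda>n. (1/2::real) ^ n) \<longlonglongrightarrow> 0" by (intro LIMSEQ_power_zero) simp
  show "\<forall>\<^sub>F n in sequentially. norm (of_int \<lfloor>2 ^ n * c\<rfloor> / 2 ^ n - c) \<le> norm ((1/2::real) ^ n) * 1"
    using dyadic_approx_abs[of c] by (intro always_eventually allI) (simp add: abs_minus_commute)
qed

text \<open>Additivity yields integer and then dyadic factors. The remainder
  \<open>(c - r n) * f\<close> is controlled pointwise by \<open>\<Gamma>_bound\<close>, and only
  countably many null sets are collected on the way to the limit.\<close>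

lemma \<Gamma>_cmult:
  assumes f: "f \<in> S" and g: "g \<in> S"
  shows "AE x in m. \<Gamma> (\<lambda>y. c * f y) g x = c * \<Gamma> f g x"
proof -
  define r where "r n = of_int \<lfloor>2 ^ n * c\<rfloor> / (2 ^ n :: real)" for n
  have dyadic: "AE x in m. \<Gamma> (\<lambda>y. r n * f y) g x = r n * \<Gamma> f g x" for n
  proof -
    have e: "(\<lambda>y. real (2 ^ n) * (r n * f y)) = (\<lambda>y. of_int \<lfloor>2 ^ n * c\<rfloor> * f y)"
      by (intro ext) (simp add: r_def)
    have "AE x in m. \<Gamma> (\<lambda>y. real (2 ^ n) * (r n * f y)) g x = real (2 ^ n) * \<Gamma> (\<lambda>y. r n * f y) g x"
      by (rule \<Gamma>_of_nat[OF sobolev_cmult[OF f] g])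
    then show ?thesis
      unfolding e using \<Gamma>_of_int[OF f g, of "\<lfloor>2 ^ n * c\<rfloor>"]
    proof eventually_elim
      case (elim x)
      then have "2 ^ n * \<Gamma> (\<lambda>y. r n * f y) g x = of_int \<lfloor>2 ^ n * c\<rfloor> * \<Gamma> f g x" by simp
      then show ?case by (simp add: r_def field_simps)
    qed
  qed
  have rest: "AE x in m. \<bar>\<Gamma> (\<lambda>y. c * f y) g x - r n * \<Gamma> f g x\<bar> \<le> \<bar>c - r n\<bar> * N f x * (N g x + \<bar>c - r n\<bar> * N f x)" for n
  proof -
    note rf = sobolev_cmult[OF f, of "r n"] and cf = sobolev_cmult[OF f, of "c - r n"]
    have e: "(\<lambda>y. c * f y) = (\<lambda>y. r n * f y + (c - r n) * f y)" by (intro ext) (simp add: algebra_simps)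
    from dyadic[of n] \<Gamma>_add[OF rf cf g] \<Gamma>_bound[OF g cf] \<Gamma>_sym[OF g cf] N_cmult[OF f, of "c - r n"]
    show ?thesis
      unfolding e by eventually_elim (simp add: mult.assoc)
  qed
  have lim: "r \<longlonglongrightarrow> c" unfolding r_def by (rule dyadic_approx_lim)
  have "AE x in m. \<forall>n. \<bar>\<Gamma> (\<lambda>y. c * f y) g x - r n * \<Gamma> f g x\<bar> \<le> \<bar>c - r n\<bar> * N f x * (N g x + \<bar>c - r n\<bar> * N f x)"
    using rest by (simp add: AE_all_countable)
  then show ?thesis
  proof eventually_elim
    case (elim x)
    have "(\<lambda>n. \<bar>\<Gamma> (\<lambda>y. c * f y) g x - r n * \<Gamma> f g x\<bar>) \<longlonglongrightarrow> \<bar>\<Gamma> (\<lambda>y. c * f y) g x - c * \<Gamma> f g x\<bar>"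
      by (intro tendsto_intros lim)
    moreover have "(\<lambda>n. \<bar>c - r n\<bar> * N f x * (N g x + \<bar>c - r n\<bar> * N f x)) \<longlonglongrightarrow> \<bar>c - c\<bar> * N f x * (N g x + \<bar>c - c\<bar> * N f x)"
      by (intro tendsto_intros lim)
    ultimately have "\<bar>\<Gamma> (\<lambda>y. c * f y) g x - c * \<Gamma> f g x\<bar> \<le> \<bar>c - c\<bar> * N f x * (N g x + \<bar>c - c\<bar> * N f x)"
      by (rule LIMSEQ_le) (use elim in auto)
    then show ?case by simp
  qed
qed

section \<open>Preforms\<close>

abbreviation "PF \<equiv> preforms dist m"
abbreviation "pn \<equiv> preform_norm dist m"

text \<open>Separates the partition structure from the finite energy condition, which becomes
  \<open>pn p \<in> L2 m\<close> in \<open>preforms_iff\<close> and is verified for the operations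
  by domination.\<close>

definition partitioned :: "'a preform \<Rightarrow> bool" where
  "partitioned p \<longleftrightarrow> (\<forall>i. fst (p i) \<in> sets m) \<and> disjoint_family (\<lambda>i. fst (p i)) \<and>
     (\<Union>i. fst (p i)) = UNIV \<and> (\<forall>i. snd (p i) \<in> S)"

text \<open>At a given point a disjoint partition leaves a single index, so a preform behaves there
  like the function \<open>f\<close>, and operations on common refinements become operations on
  functions.\<close>

definition rep :: "'a preform \<Rightarrow> 'a \<Rightarrow> ('a \<Rightarrow> real) \<Rightarrow> bool" where
  "rep p x f \<longleftrightarrow> (\<exists>i. x \<in> fst (p i) \<and> snd (p i) = f)"

lemma rep_exists: "partitioned p \<Longrightarrow> \<exists>i. x \<in> fst (p i)"
  unfolding partitioned_def by blast

lemma rep_add: "rep p x f \<Longrightarrow> rep q x g \<Longrightarrow> rep (preform_add p q) x (\<lambda>y. f y + g y)"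
proof -
  assume "rep p x f" "rep q x g"
  then obtain i j where "x \<in> fst (p i)" "snd (p i) = f" "x \<in> fst (q j)" "snd (q j) = g"
    by (auto simp: rep_def)
  then show ?thesis
    unfolding rep_def by (intro exI[of _ "prod_encode (i, j)"]) (simp add: preform_add_def)
qed

lemma rep_diff: "rep p x f \<Longrightarrow> rep q x g \<Longrightarrow> rep (preform_diff p q) x (\<lambda>y. f y - g y)"
proof -
  assume "rep p x f" "rep q x g"
  then obtain i j where "x \<in> fst (p i)" "snd (p i) = f" "x \<in> fst (q j)" "snd (q j) = g"
    by (auto simp: rep_def)
  then show ?thesis
    unfolding rep_def by (intro exI[of _ "prod_encode (i, j)"]) (simp add: preform_diff_def)
qed

lemma rep_mult:
  "rep p x f \<Longrightarrow> rep (preform_dyadic_mult n h p) x (\<lambda>y. of_int \<lfloor>2 ^ n * h x\<rfloor> / 2 ^ n * f y)"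
proof -
  assume "rep p x f"
  then obtain i where "x \<in> fst (p i)" "snd (p i) = f" by (auto simp: rep_def)
  then show ?thesis
    unfolding rep_def by (intro exI[of _ "prod_encode (i, int_encode \<lfloor>2 ^ n * h x\<rfloor>)"])
      (simp add: preform_dyadic_mult_def)
qed

lemma pn_rep:
  assumes p: "partitioned p" and x: "rep p x f"
  shows "pn p x = N f x"
proof -
  obtain i where i: "x \<in> fst (p i)" "snd (p i) = f" using x by (auto simp: rep_def)
  have "x \<notin> fst (p j)" if "j \<noteq> i" for j
    using p i(1) that unfolding partitioned_def disjoint_family_on_def by blast
  then have "(\<lambda>j. indicator (fst (p j)) x * N (snd (p j)) x) sums (indicator (fst (p i)) x * N (snd (p i)) x)"
    using sums_single[of i "\<lambda>j. indicator (fst (p j)) x * N (snd (p j)) x"]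
    by (subst sums_cong[of _ "\<lambda>r. if r = i then indicator (fst (p r)) x * N (snd (p r)) x else 0"]) auto
  then show ?thesis using i by (simp add: preform_norm_def sums_iff)
qed

text \<open>The common refinement as a sequence; sums, differences and dyadic products all enumerate
  their pieces in this way.\<close>

lemma prod_decode_family:
  assumes A: "disjoint_family A" "(\<Union>i. A i) = UNIV" and B: "disjoint_family B" "(\<Union>i. B i) = UNIV"
  shows "disjoint_family (\<lambda>n. case prod_decode n of (i, j) \<Rightarrow> A i \<inter> B j)"
    and "(\<Union>n. case prod_decode n of (i, j) \<Rightarrow> A i \<inter> B j) = UNIV"
proof -
  show "disjoint_family (\<lambda>n. case prod_decode n of (i, j) \<Rightarrow> A i \<inter> B j)"
    unfolding disjoint_family_on_def
  proof (intro ballI impI)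
    fix n k :: nat assume nk: "n \<noteq> k"
    obtain i j i' j' where e: "prod_decode n = (i, j)" "prod_decode k = (i', j')" by (metis surj_pair)
    then have "(i, j) \<noteq> (i', j')" using nk by (metis prod_decode_inverse)
    then have "A i \<inter> A i' = {} \<or> B j \<inter> B j' = {}"
    proof (cases "i = i'")
      case True
      then have "j \<noteq> j'" using \<open>(i, j) \<noteq> (i', j')\<close> by simp
      then show ?thesis using B(1) unfolding disjoint_family_on_def by blast
    next
      case False
      then show ?thesis using A(1) unfolding disjoint_family_on_def by blast
    qed
    then show "(case prod_decode n of (i, j) \<Rightarrow> A i \<inter> B j) \<inter> (case prod_decode k of (i, j) \<Rightarrow> A i \<inter> B j) = {}"
      using e by auto
  qed
  show "(\<Union>n. case prod_decode n of (i, j) \<Rightarrow> A i \<inter> B j) = UNIV"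
  proof (intro equalityI subsetI)
    fix x
    have "x \<in> (\<Union>i. A i)" "x \<in> (\<Union>i. B i)" unfolding A(2) B(2) by simp_all
    then obtain i j where "x \<in> A i" "x \<in> B j" by (elim UN_E)
    then have "x \<in> (case prod_decode (prod_encode (i, j)) of (i, j) \<Rightarrow> A i \<inter> B j)" by simp
    then show "x \<in> (\<Union>n. case prod_decode n of (i, j) \<Rightarrow> A i \<inter> B j)" by (rule UN_I[OF UNIV_I])
  qed auto
qed

lemma partitioned_add:
  assumes p: "partitioned p" and q: "partitioned q"
  shows "partitioned (preform_add p q)"
proof -
  have f: "(\<lambda>n. fst (preform_add p q n)) = (\<lambda>n. case prod_decode n of (i, j) \<Rightarrow> fst (p i) \<inter> fst (q j))"
    by (auto simp: preform_add_def split: prod.split)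
  have "snd (preform_add p q n) \<in> S" "fst (preform_add p q n) \<in> sets m" for n
    using p q by (auto simp: partitioned_def preform_add_def intro: sobolev_add split: prod.split)
  then show ?thesis
    using prod_decode_family[of "\<lambda>i. fst (p i)" "\<lambda>i. fst (q i)"] p q unfolding partitioned_def f by blast
qed

lemma partitioned_diff:
  assumes p: "partitioned p" and q: "partitioned q"
  shows "partitioned (preform_diff p q)"
proof -
  have f: "(\<lambda>n. fst (preform_diff p q n)) = (\<lambda>n. case prod_decode n of (i, j) \<Rightarrow> fst (p i) \<inter> fst (q j))"
    by (auto simp: preform_diff_def split: prod.split)
  have "snd (preform_diff p q n) \<in> S" "fst (preform_diff p q n) \<in> sets m" for n
    using p q by (auto simp: partitioned_def preform_diff_def intro: sobolev_diff split: prod.split)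
  then show ?thesis
    using prod_decode_family[of "\<lambda>i. fst (p i)" "\<lambda>i. fst (q i)"] p q unfolding partitioned_def f by blast
qed

lemma partitioned_mult:
  assumes p: "partitioned p" and h [measurable]: "h \<in> borel_measurable m"
  shows "partitioned (preform_dyadic_mult k h p)"
proof -
  let ?B = "\<lambda>j. {x. \<lfloor>2 ^ k * h x\<rfloor> = int_decode j}"
  have f: "(\<lambda>n. fst (preform_dyadic_mult k h p n)) = (\<lambda>n. case prod_decode n of (i, j) \<Rightarrow> fst (p i) \<inter> ?B j)"
    by (auto simp: preform_dyadic_mult_def split: prod.split)
  have Bm: "?B j \<in> sets m" for j
  proof -
    have "{x \<in> space m. \<lfloor>2 ^ k * h x\<rfloor> = int_decode j} \<in> sets m" by measurable
    then show ?thesis by simp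
  qed
  have "snd (preform_dyadic_mult k h p n) \<in> S" for n
    using p sobolev_cmult[of "snd (p _)" "of_int (int_decode _) / 2 ^ k"]
    by (simp add: partitioned_def preform_dyadic_mult_def split: prod.split)
  moreover have "fst (preform_dyadic_mult k h p n) \<in> sets m" for n
    using p Bm by (auto simp: partitioned_def preform_dyadic_mult_def intro!: sets.Int split: prod.split)
  moreover have "disjoint_family ?B"
    unfolding disjoint_family_on_def using int_decode_eq by fastforce
  moreover have "(\<Union>j. ?B j) = UNIV"
  proof (intro equalityI subsetI)
    fix x
    have "x \<in> ?B (int_encode \<lfloor>2 ^ k * h x\<rfloor>)" by simp
    then show "x \<in> (\<Union>j. ?B j)" by blast
  qed auto
  ultimately show ?thesis
    using prod_decode_family[of "\<lambda>i. fst (p i)" ?B] p unfolding partitioned_def f by blast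
qed

lemma pn_measurable:
  assumes "partitioned p"
  shows "pn p \<in> borel_measurable m"
proof -
  have "(\<lambda>x. \<Sum>i. indicator (fst (p i)) x * N (snd (p i)) x) \<in> borel_measurable m"
    using assms L2_measurable[OF N_L2]
    by (intro borel_measurable_suminf borel_measurable_times borel_measurable_indicator) (auto simp: partitioned_def)
  then show ?thesis by (simp add: preform_norm_def[abs_def])
qed

text \<open>At each point only one piece contributes, so the sum of the piecewise energies is the
  energy of the pointwise norm.\<close>

lemma preforms_iff: "p \<in> PF \<longleftrightarrow> partitioned p \<and> pn p \<in> L2 m"
proof (cases "partitioned p")
  case False
  then show ?thesis by (auto simp: preforms_def partitioned_def)
next
  case True
  have [measurable]: "fst (p i) \<in> sets m" "N (snd (p i)) \<in> borel_measurable m" for i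
    using True L2_measurable[OF N_L2] by (auto simp: partitioned_def)
  note [measurable] = pn_measurable[OF True]
  have "(\<Sum>i. ennreal ((N (snd (p i)) x)\<^sup>2) * indicator (fst (p i)) x) = ennreal ((pn p x)\<^sup>2)" for x
  proof -
    obtain i where i: "x \<in> fst (p i)" using rep_exists[OF True] by blast
    then have "rep p x (snd (p i))" by (auto simp: rep_def)
    then have e: "pn p x = N (snd (p i)) x" by (rule pn_rep[OF True])
    have "x \<notin> fst (p j)" if "j \<noteq> i" for j
      using True i that unfolding partitioned_def disjoint_family_on_def by blast
    then have "(\<Sum>j. ennreal ((N (snd (p j)) x)\<^sup>2) * indicator (fst (p j)) x)
        = (\<Sum>j\<in>{i}. ennreal ((N (snd (p j)) x)\<^sup>2) * indicator (fst (p j)) x)"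
      by (intro suminf_finite) auto
    then show ?thesis using i e by simp
  qed
  then have "(\<Sum>i. \<integral>\<^sup>+x\<in>fst (p i). ennreal ((N (snd (p i)) x)\<^sup>2) \<partial>m) = (\<integral>\<^sup>+x. ennreal ((pn p x)\<^sup>2) \<partial>m)"
    by (subst nn_integral_suminf[symmetric]) auto
  moreover have "pn p \<in> L2 m \<longleftrightarrow> (\<integral>\<^sup>+x. ennreal ((pn p x)\<^sup>2) \<partial>m) < \<infinity>"
    by (simp add: L2_def integrable_iff_bounded)
  ultimately show ?thesis using True by (simp add: preforms_def partitioned_def)
qed

lemma preformsD: "p \<in> PF \<Longrightarrow> partitioned p" "p \<in> PF \<Longrightarrow> pn p \<in> L2 m"
  by (simp_all add: preforms_iff)

text \<open>Identities for Sobolev functions hold for preforms, because only countably many functions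
  are involved.\<close>

lemma AE_rep1:
  assumes p: "partitioned p" and P: "\<forall>f\<in>S. AE x in m. P f x"
  shows "AE x in m. \<exists>f. rep p x f \<and> P f x"
proof -
  have "AE x in m. \<forall>i. P (snd (p i)) x"
    unfolding AE_all_countable using p P by (auto simp: partitioned_def)
  then show ?thesis
  proof eventually_elim
    case (elim x)
    obtain i where "x \<in> fst (p i)" using rep_exists[OF p] by blast
    then show ?case using elim unfolding rep_def by blast
  qed
qed

lemma AE_rep2:
  assumes p: "partitioned p" and q: "partitioned q"
    and P: "\<forall>f\<in>S. \<forall>g\<in>S. AE x in m. P f g x"
  shows "AE x in m. \<exists>f g. rep p x f \<and> rep q x g \<and> P f g x"
proof -
  have "AE x in m. \<forall>i j. P (snd (p i)) (snd (q j)) x"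
    unfolding AE_all_countable using p q P by (auto simp: partitioned_def)
  then show ?thesis
  proof eventually_elim
    case (elim x)
    obtain i j where "x \<in> fst (p i)" "x \<in> fst (q j)" using rep_exists[OF p] rep_exists[OF q] by blast
    then show ?case using elim unfolding rep_def by blast
  qed
qed

lemma AE_rep3:
  assumes p: "partitioned p" and q: "partitioned q" and r: "partitioned r"
    and P: "\<forall>f\<in>S. \<forall>g\<in>S. \<forall>h\<in>S. AE x in m. P f g h x"
  shows "AE x in m. \<exists>f g h. rep p x f \<and> rep q x g \<and> rep r x h \<and> P f g h x"
proof -
  have "AE x in m. \<forall>i j k. P (snd (p i)) (snd (q j)) (snd (r k)) x"
    unfolding AE_all_countable using p q r P by (auto simp: partitioned_def)
  then show ?thesis
  proof eventually_elim
    case (elim x)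
    obtain i j k where "x \<in> fst (p i)" "x \<in> fst (q j)" "x \<in> fst (r k)"
      using rep_exists[OF p] rep_exists[OF q] rep_exists[OF r] by blast
    then show ?case using elim unfolding rep_def by blast
  qed
qed

lemma AE_rep4:
  assumes p: "partitioned p" and q: "partitioned q" and r: "partitioned r" and s: "partitioned s"
    and P: "\<forall>f\<in>S. \<forall>g\<in>S. \<forall>h\<in>S. \<forall>k\<in>S. AE x in m. P f g h k x"
  shows "AE x in m. \<exists>f g h k. rep p x f \<and> rep q x g \<and> rep r x h \<and> rep s x k \<and> P f g h k x"
proof -
  have "AE x in m. \<forall>i j k l. P (snd (p i)) (snd (q j)) (snd (r k)) (snd (s l)) x"
    unfolding AE_all_countable using p q r s P by (auto simp: partitioned_def)
  then show ?thesis
  proof eventually_elim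
    case (elim x)
    obtain i j k l where "x \<in> fst (p i)" "x \<in> fst (q j)" "x \<in> fst (r k)" "x \<in> fst (s l)"
      using rep_exists[OF p] rep_exists[OF q] rep_exists[OF r] rep_exists[OF s] by blast
    then show ?case using elim unfolding rep_def by blast
  qed
qed

section \<open>Pointwise norm and inner product of preforms\<close>

lemma pn_nonneg: "partitioned p \<Longrightarrow> AE x in m. 0 \<le> pn p x"
proof -
  assume p: "partitioned p"
  have "\<forall>f\<in>S. AE x in m. 0 \<le> N f x" by (intro ballI N_nonneg)
  from AE_rep1[OF p this] show ?thesis
    by eventually_elim (auto simp: pn_rep[OF p])
qed

lemma pn_add_le:
  assumes p: "partitioned p" and q: "partitioned q"
  shows "AE x in m. pn (preform_add p q) x \<le> pn p x + pn q x"
proof -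
  have "\<forall>f\<in>S. \<forall>g\<in>S. AE x in m. N (\<lambda>y. f y + g y) x \<le> N f x + N g x" by (intro ballI N_add)
  from AE_rep2[OF p q this] show ?thesis
    by eventually_elim (auto simp: pn_rep[OF p] pn_rep[OF q] pn_rep[OF partitioned_add[OF p q] rep_add])
qed

lemma pn_diff_le:
  assumes p: "partitioned p" and q: "partitioned q"
  shows "AE x in m. pn (preform_diff p q) x \<le> pn p x + pn q x"
proof -
  have "\<forall>f\<in>S. \<forall>g\<in>S. AE x in m. N (\<lambda>y. f y - g y) x \<le> N f x + N g x"
  proof (intro ballI)
    fix f g assume that: "f \<in> S" "g \<in> S" 
    show "AE x in m. N (\<lambda>y. f y - g y) x \<le> N f x + N g x"
    using N_combination[OF that, of 1 "- 1"] by simp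
  qed
  from AE_rep2[OF p q this] show ?thesis
    by eventually_elim (auto simp: pn_rep[OF p] pn_rep[OF q] pn_rep[OF partitioned_diff[OF p q] rep_diff])
qed

lemma pn_abs_diff:
  assumes p: "partitioned p" and q: "partitioned q"
  shows "AE x in m. \<bar>pn p x - pn q x\<bar> \<le> pn (preform_diff p q) x"
proof -
  have "\<forall>f\<in>S. \<forall>g\<in>S. AE x in m. \<bar>N f x - N g x\<bar> \<le> N (\<lambda>y. f y - g y) x" by (intro ballI N_diff_le)
  from AE_rep2[OF p q this] show ?thesis
    by eventually_elim (auto simp: pn_rep[OF p] pn_rep[OF q] pn_rep[OF partitioned_diff[OF p q] rep_diff])
qed

lemma pn_diff_self:
  assumes p: "partitioned p"
  shows "AE x in m. pn (preform_diff p p) x = 0"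
proof -
  have "\<forall>f\<in>S. AE x in m. N (\<lambda>y. f y - f y) x = 0" using N_zero by simp
  from AE_rep1[OF p this] show ?thesis
    by eventually_elim (auto simp: pn_rep[OF partitioned_diff[OF p p] rep_diff])
qed

text \<open>The factor varies with the point, so all integer numerators are treated at once, outside
  a single null set.\<close>

lemma pn_mult:
  assumes p: "partitioned p" and h: "h \<in> borel_measurable m"
  shows "AE x in m. pn (preform_dyadic_mult n h p) x = \<bar>of_int \<lfloor>2 ^ n * h x\<rfloor> / 2 ^ n\<bar> * pn p x"
proof -
  have "\<forall>f\<in>S. AE x in m. \<forall>k::int. N (\<lambda>y. of_int k / 2 ^ n * f y) x = \<bar>of_int k / 2 ^ n\<bar> * N f x"
  proof (intro ballI)
    fix f assume that: "f \<in> S" 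
    show "AE x in m. \<forall>k::int. N (\<lambda>y. of_int k / 2 ^ n * f y) x = \<bar>of_int k / 2 ^ n\<bar> * N f x"
    unfolding AE_all_countable using N_cmult[OF that] by blast
  qed
  from AE_rep1[OF p this] show ?thesis
  proof eventually_elim
    case (elim x)
    then obtain f where f: "rep p x f" "\<And>k::int. N (\<lambda>y. of_int k / 2 ^ n * f y) x = \<bar>of_int k / 2 ^ n\<bar> * N f x" by blast
    show ?case
      using pn_rep[OF partitioned_mult[OF p h] rep_mult[OF f(1)]] pn_rep[OF p f(1)] f(2) by simp
  qed
qed

lemma pn_diff_add_add:
  assumes p: "partitioned p" and q: "partitioned q" and r: "partitioned r" and s: "partitioned s"
  shows "AE x in m. pn (preform_diff (preform_add p q) (preform_add r s)) x
    \<le> pn (preform_diff p r) x + pn (preform_diff q s) x"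
proof -
  have "\<forall>f\<in>S. \<forall>g\<in>S. \<forall>h\<in>S. \<forall>k\<in>S. AE x in m. N (\<lambda>y. (f y + g y) - (h y + k y)) x \<le> N (\<lambda>y. f y - h y) x + N (\<lambda>y. g y - k y) x"
  proof (intro ballI)
    fix f g h k assume that: "f \<in> S" "g \<in> S" "h \<in> S" "k \<in> S" 
    show "AE x in m. N (\<lambda>y. (f y + g y) - (h y + k y)) x \<le> N (\<lambda>y. f y - h y) x + N (\<lambda>y. g y - k y) x"
  proof -
    have "(\<lambda>y. (f y + g y) - (h y + k y)) = (\<lambda>y. (f y - h y) + (g y - k y))" by (intro ext) simp
    then show ?thesis using N_add[OF sobolev_diff[OF that(1,3)] sobolev_diff[OF that(2,4)]] by simp
  qed
  qed
  from AE_rep4[OF p q r s this] show ?thesis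
    by eventually_elim (auto simp: pn_rep[OF partitioned_diff[OF p r] rep_diff] pn_rep[OF partitioned_diff[OF q s] rep_diff]
      pn_rep[OF partitioned_diff[OF partitioned_add[OF p q] partitioned_add[OF r s]] rep_diff[OF rep_add rep_add]])
qed

lemma pn_diff_diff_diff:
  assumes p: "partitioned p" and q: "partitioned q" and r: "partitioned r" and s: "partitioned s"
  shows "AE x in m. pn (preform_diff (preform_diff p q) (preform_diff r s)) x
    \<le> pn (preform_diff p r) x + pn (preform_diff q s) x"
proof -
  have "\<forall>f\<in>S. \<forall>g\<in>S. \<forall>h\<in>S. \<forall>k\<in>S. AE x in m. N (\<lambda>y. (f y - g y) - (h y - k y)) x \<le> N (\<lambda>y. f y - h y) x + N (\<lambda>y. g y - k y) x"
  proof (intro ballI)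
    fix f g h k assume that: "f \<in> S" "g \<in> S" "h \<in> S" "k \<in> S" 
    show "AE x in m. N (\<lambda>y. (f y - g y) - (h y - k y)) x \<le> N (\<lambda>y. f y - h y) x + N (\<lambda>y. g y - k y) x"
  proof -
    have "(\<lambda>y. (f y - g y) - (h y - k y)) = (\<lambda>y. 1 * (f y - h y) + - 1 * (g y - k y))" by (intro ext) simp
    then show ?thesis
      using N_combination[OF sobolev_diff[OF that(1,3)] sobolev_diff[OF that(2,4)], of 1 "- 1"] by simp
  qed
  qed
  from AE_rep4[OF p q r s this] show ?thesis
    by eventually_elim (auto simp: pn_rep[OF partitioned_diff[OF p r] rep_diff] pn_rep[OF partitioned_diff[OF q s] rep_diff]
      pn_rep[OF partitioned_diff[OF partitioned_diff[OF p q] partitioned_diff[OF r s]] rep_diff[OF rep_diff rep_diff]])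
qed

text \<open>From \<open>a * u - b * v = a * (u - v) + (a - b) * v\<close>: the first term carries
  the distance of the preforms, the second the change of the dyadic level.\<close>

lemma pn_diff_mult_mult:
  assumes p: "partitioned p" and q: "partitioned q" and h: "h \<in> borel_measurable m"
  shows "AE x in m. pn (preform_diff (preform_dyadic_mult n h p) (preform_dyadic_mult k h q)) x
    \<le> \<bar>of_int \<lfloor>2 ^ n * h x\<rfloor> / 2 ^ n\<bar> * pn (preform_diff p q) x
      + \<bar>of_int \<lfloor>2 ^ n * h x\<rfloor> / 2 ^ n - of_int \<lfloor>2 ^ k * h x\<rfloor> / 2 ^ k\<bar> * pn q x"
proof -
  have "\<forall>f\<in>S. \<forall>g\<in>S. AE x in m. \<forall>i j::int. N (\<lambda>y. of_int i / 2 ^ n * f y - of_int j / 2 ^ k * g y) x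
      \<le> \<bar>of_int i / 2 ^ n\<bar> * N (\<lambda>y. f y - g y) x + \<bar>of_int i / 2 ^ n - of_int j / 2 ^ k\<bar> * N g x"
  proof (intro ballI)
    fix f g assume that: "f \<in> S" "g \<in> S" 
    show "AE x in m. \<forall>i j::int. N (\<lambda>y. of_int i / 2 ^ n * f y - of_int j / 2 ^ k * g y) x
      \<le> \<bar>of_int i / 2 ^ n\<bar> * N (\<lambda>y. f y - g y) x + \<bar>of_int i / 2 ^ n - of_int j / 2 ^ k\<bar> * N g x"
    unfolding AE_all_countable
  proof (intro allI)
    fix i j :: int
    have "(\<lambda>y. of_int i / 2 ^ n * f y - of_int j / 2 ^ k * g y)
        = (\<lambda>y. of_int i / 2 ^ n * (f y - g y) + (of_int i / 2 ^ n - of_int j / 2 ^ k) * g y)"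
    proof
      have "a * u - b * v = a * (u - v) + (a - b) * v" for a b u v :: real by (simp add: algebra_simps)
      then show "of_int i / 2 ^ n * f y - of_int j / 2 ^ k * g y
          = of_int i / 2 ^ n * (f y - g y) + (of_int i / 2 ^ n - of_int j / 2 ^ k) * g y" for y .
    qed
    then show "AE x in m. N (\<lambda>y. of_int i / 2 ^ n * f y - of_int j / 2 ^ k * g y) x
      \<le> \<bar>of_int i / 2 ^ n\<bar> * N (\<lambda>y. f y - g y) x + \<bar>of_int i / 2 ^ n - of_int j / 2 ^ k\<bar> * N g x"
      using N_combination[OF sobolev_diff[OF that] that(2), of "of_int i / 2 ^ n" "of_int i / 2 ^ n - of_int j / 2 ^ k"]
      by simp
  qed
  qed
  from AE_rep2[OF p q this] show ?thesis
  proof eventually_elim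
    case (elim x)
    then obtain f g where fg: "rep p x f" "rep q x g" and
      le: "\<And>i j::int. N (\<lambda>y. of_int i / 2 ^ n * f y - of_int j / 2 ^ k * g y) x
      \<le> \<bar>of_int i / 2 ^ n\<bar> * N (\<lambda>y. f y - g y) x + \<bar>of_int i / 2 ^ n - of_int j / 2 ^ k\<bar> * N g x" by blast
    show ?case
      using pn_rep[OF partitioned_diff[OF partitioned_mult[OF p h] partitioned_mult[OF q h]]
          rep_diff[OF rep_mult[OF fg(1)] rep_mult[OF fg(2)]], of n k]
        pn_rep[OF partitioned_diff[OF p q] rep_diff[OF fg]] pn_rep[OF q fg(2)] le by simp
  qed
qed

text \<open>Polarization on preforms; \<open>form_inner\<close> is its limit in L1, and on
  representatives it is the carre du champ.\<close>

definition pg :: "'a preform \<Rightarrow> 'a preform \<Rightarrow> 'a \<Rightarrow> real" where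
  "pg p q x = ((pn (preform_add p q) x)\<^sup>2 - (pn (preform_diff p q) x)\<^sup>2) / 4"

lemma pg_rep:
  assumes p: "partitioned p" and q: "partitioned q" and "rep p x f" "rep q x g"
  shows "pg p q x = \<Gamma> f g x"
  unfolding pg_def carre_du_champ_def
  using pn_rep[OF partitioned_add[OF p q] rep_add[OF assms(3,4)]] pn_rep[OF partitioned_diff[OF p q] rep_diff[OF assms(3,4)]]
  by simp

lemma pg_sym:
  assumes p: "partitioned p" and q: "partitioned q"
  shows "AE x in m. pg p q x = pg q p x"
proof -
  have "\<forall>f\<in>S. \<forall>g\<in>S. AE x in m. \<Gamma> f g x = \<Gamma> g f x" by (intro ballI \<Gamma>_sym)
  from AE_rep2[OF p q this] show ?thesis
    by eventually_elim (auto simp: pg_rep[OF p q] pg_rep[OF q p])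
qed

lemma pg_add:
  assumes p: "partitioned p" and q: "partitioned q" and r: "partitioned r"
  shows "AE x in m. pg (preform_add p q) r x = pg p r x + pg q r x"
proof -
  have "\<forall>f\<in>S. \<forall>g\<in>S. \<forall>h\<in>S. AE x in m. \<Gamma> (\<lambda>y. f y + g y) h x = \<Gamma> f h x + \<Gamma> g h x" by (intro ballI \<Gamma>_add)
  from AE_rep3[OF p q r this] show ?thesis
    by eventually_elim (auto simp: pg_rep[OF p r] pg_rep[OF q r] pg_rep[OF partitioned_add[OF p q] r rep_add])
qed

lemma pg_mult:
  assumes p: "partitioned p" and q: "partitioned q" and h: "h \<in> borel_measurable m"
  shows "AE x in m. pg (preform_dyadic_mult n h p) q x = of_int \<lfloor>2 ^ n * h x\<rfloor> / 2 ^ n * pg p q x"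
proof -
  have "\<forall>f\<in>S. \<forall>g\<in>S. AE x in m. \<forall>k::int. \<Gamma> (\<lambda>y. of_int k / 2 ^ n * f y) g x = of_int k / 2 ^ n * \<Gamma> f g x"
  proof (intro ballI)
    fix f g assume that: "f \<in> S" "g \<in> S" 
    show "AE x in m. \<forall>k::int. \<Gamma> (\<lambda>y. of_int k / 2 ^ n * f y) g x = of_int k / 2 ^ n * \<Gamma> f g x"
    unfolding AE_all_countable using \<Gamma>_cmult[OF that] by blast
  qed
  from AE_rep2[OF p q this] show ?thesis
  proof eventually_elim
    case (elim x)
    then obtain f g where fg: "rep p x f" "rep q x g"
      "\<And>k::int. \<Gamma> (\<lambda>y. of_int k / 2 ^ n * f y) g x = of_int k / 2 ^ n * \<Gamma> f g x" by blast
    show ?case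
      using pg_rep[OF partitioned_mult[OF p h] q rep_mult[OF fg(1)] fg(2)] pg_rep[OF p q fg(1,2)] fg(3) by simp
  qed
qed

lemma pg_bound:
  assumes p: "partitioned p" and q: "partitioned q"
  shows "AE x in m. \<bar>pg p q x\<bar> \<le> pn q x * (pn p x + pn q x)"
proof -
  have "\<forall>f\<in>S. \<forall>g\<in>S. AE x in m. \<bar>\<Gamma> f g x\<bar> \<le> N g x * (N f x + N g x)" by (intro ballI \<Gamma>_bound)
  from AE_rep2[OF p q this] show ?thesis
    by eventually_elim (auto simp: pg_rep[OF p q] pn_rep[OF p] pn_rep[OF q])
qed

lemma preforms_add: "p \<in> PF \<Longrightarrow> q \<in> PF \<Longrightarrow> preform_add p q \<in> PF"
proof -
  assume a: "p \<in> PF" "q \<in> PF"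
  note P = preformsD[OF a(1)] and Q = preformsD[OF a(2)]
  have "AE x in m. \<bar>pn (preform_add p q) x\<bar> \<le> \<bar>pn p x + pn q x\<bar>"
    using pn_add_le[OF P(1) Q(1)] pn_nonneg[OF partitioned_add[OF P(1) Q(1)]] by eventually_elim simp
  from L2_bounded[OF pn_measurable[OF partitioned_add[OF P(1) Q(1)]] L2_add[OF P(2) Q(2)] this]
  show ?thesis using partitioned_add[OF P(1) Q(1)] by (simp add: preforms_iff)
qed

lemma preforms_diff: "p \<in> PF \<Longrightarrow> q \<in> PF \<Longrightarrow> preform_diff p q \<in> PF"
proof -
  assume a: "p \<in> PF" "q \<in> PF"
  note P = preformsD[OF a(1)] and Q = preformsD[OF a(2)]
  have "AE x in m. \<bar>pn (preform_diff p q) x\<bar> \<le> \<bar>pn p x + pn q x\<bar>"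
    using pn_diff_le[OF P(1) Q(1)] pn_nonneg[OF partitioned_diff[OF P(1) Q(1)]] by eventually_elim simp
  from L2_bounded[OF pn_measurable[OF partitioned_diff[OF P(1) Q(1)]] L2_add[OF P(2) Q(2)] this]
  show ?thesis using partitioned_diff[OF P(1) Q(1)] by (simp add: preforms_iff)
qed

lemma dyadic_bound: "\<bar>of_int \<lfloor>2 ^ n * c\<rfloor> / 2 ^ n\<bar> \<le> \<bar>c\<bar> + (1::real)"
proof -
  have "(1/2::real) ^ n \<le> 1" by (intro power_le_one) auto
  then show ?thesis using dyadic_approx[of c n] by linarith
qed

lemma preforms_mult: "p \<in> PF \<Longrightarrow> h \<in> Linf m \<Longrightarrow> preform_dyadic_mult n h p \<in> PF"
proof -
  assume a: "p \<in> PF" "h \<in> Linf m"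
  note P = preformsD[OF a(1)]
  obtain K where h: "h \<in> borel_measurable m" "AE x in m. \<bar>h x\<bar> \<le> K" using a(2) by (auto simp: Linf_def)
  have "AE x in m. \<bar>pn (preform_dyadic_mult n h p) x\<bar> \<le> \<bar>(K + 1) * pn p x\<bar>"
    using pn_mult[OF P(1) h(1), of n] h(2)
  proof eventually_elim
    case (elim x)
    have "\<bar>of_int \<lfloor>2 ^ n * h x\<rfloor> / 2 ^ n\<bar> \<le> \<bar>K + 1\<bar>" using dyadic_bound[of n "h x"] elim(2) by linarith
    then show ?case unfolding elim(1) abs_mult by (intro mult_right_mono) auto
  qed
  from L2_bounded[OF pn_measurable[OF partitioned_mult[OF P(1) h(1)]] L2_cmult[OF P(2)] this]
  show ?thesis using partitioned_mult[OF P(1) h(1)] by (simp add: preforms_iff)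
qed

end

section \<open>The cotangent and tangent modules\<close>

definition L1_lim :: "'a measure \<Rightarrow> (nat \<Rightarrow> 'a \<Rightarrow> real) \<Rightarrow> ('a \<Rightarrow> real) \<Rightarrow> bool" where
  "L1_lim m F f \<longleftrightarrow> (\<forall>n. integrable m (F n)) \<and> integrable m f \<and> (\<lambda>n. LINT x|m. \<bar>F n x - f x\<bar>) \<longlonglongrightarrow> 0"

lemma L1_limD:
  assumes "L1_lim m F f"
  shows "integrable m (F n)" "integrable m f" "(\<lambda>n. LINT x|m. \<bar>F n x - f x\<bar>) \<longlonglongrightarrow> 0"
  using assms by (auto simp: L1_lim_def)

lemma L1_lim_squeeze:
  assumes "\<And>n. integrable m (F n)" "integrable m f" "\<And>n. (LINT x|m. \<bar>F n x - f x\<bar>) \<le> e n" "e \<longlonglongrightarrow> 0"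
  shows "L1_lim m F f"
  unfolding L1_lim_def using assms tendsto_sandwich[of "\<lambda>_. 0" _ sequentially e 0] by simp

lemma L1_lim_unique:
  assumes "L1_lim m F f" "L1_lim m F g"
  shows "AE x in m. f x = g x"
proof -
  note D = L1_limD[OF assms(1)] L1_limD[OF assms(2)]
  have "(LINT x|m. \<bar>f x - g x\<bar>) \<le> (LINT x|m. \<bar>F n x - f x\<bar>) + (LINT x|m. \<bar>F n x - g x\<bar>)" for n
  proof -
    have "(LINT x|m. \<bar>f x - g x\<bar>) \<le> (LINT x|m. \<bar>F n x - f x\<bar> + \<bar>F n x - g x\<bar>)"
      using D by (intro integral_mono) auto
    then show ?thesis using D by simp
  qed
  moreover have "(\<lambda>n. (LINT x|m. \<bar>F n x - f x\<bar>) + (LINT x|m. \<bar>F n x - g x\<bar>)) \<longlonglongrightarrow> 0"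
    using tendsto_add[OF D(3,6)] by simp
  ultimately have "(LINT x|m. \<bar>f x - g x\<bar>) \<le> 0" by (intro LIMSEQ_le_const) auto
  moreover have "0 \<le> (LINT x|m. \<bar>f x - g x\<bar>)" by simp
  ultimately have "(LINT x|m. \<bar>f x - g x\<bar>) = 0" by linarith
  then have "AE x in m. \<bar>f x - g x\<bar> = 0"
    using D by (subst (asm) integral_nonneg_eq_0_iff_AE) auto
  then show ?thesis by simp
qed

lemma L1_lim_add:
  assumes "L1_lim m F f" "L1_lim m G g"
  shows "L1_lim m (\<lambda>n x. F n x + G n x) (\<lambda>x. f x + g x)"
proof (rule L1_lim_squeeze)
  note D = L1_limD[OF assms(1)] L1_limD[OF assms(2)]
  show "(LINT x|m. \<bar>F n x + G n x - (f x + g x)\<bar>) \<le> (LINT x|m. \<bar>F n x - f x\<bar>) + (LINT x|m. \<bar>G n x - g x\<bar>)" for n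
  proof -
    have "(LINT x|m. \<bar>F n x + G n x - (f x + g x)\<bar>) \<le> (LINT x|m. \<bar>F n x - f x\<bar> + \<bar>G n x - g x\<bar>)"
      using D by (intro integral_mono) auto
    then show ?thesis using D by simp
  qed
  show "(\<lambda>n. (LINT x|m. \<bar>F n x - f x\<bar>) + (LINT x|m. \<bar>G n x - g x\<bar>)) \<longlonglongrightarrow> 0"
    using tendsto_add[OF D(3,6)] by simp
qed (use L1_limD[OF assms(1)] L1_limD[OF assms(2)] in auto)

lemma L1_lim_cmult:
  assumes "L1_lim m F f"
  shows "L1_lim m (\<lambda>n x. c * F n x) (\<lambda>x. c * f x)"
proof (rule L1_lim_squeeze)
  show "(LINT x|m. \<bar>c * F n x - c * f x\<bar>) \<le> \<bar>c\<bar> * (LINT x|m. \<bar>F n x - f x\<bar>)" for n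
    by (simp add: right_diff_distrib[symmetric] abs_mult)
  show "(\<lambda>n. \<bar>c\<bar> * (LINT x|m. \<bar>F n x - f x\<bar>)) \<longlonglongrightarrow> 0"
    using tendsto_mult_left[OF L1_limD(3)[OF assms], of "\<bar>c\<bar>"] by simp
qed (use L1_limD[OF assms] in auto)

lemma L1_lim_cong:
  assumes "L1_lim m F f" "\<And>n. G n \<in> borel_measurable m" "\<And>n. AE x in m. F n x = G n x"
  shows "L1_lim m G f"
  unfolding L1_lim_def
proof (intro conjI allI)
  note D = L1_limD[OF assms(1)]
  note [measurable] = borel_measurable_integrable[OF D(1)] borel_measurable_integrable[OF D(2)] assms(2)
  show "integrable m (G n)" for n
    using D(1)[of n] integrable_cong_AE[OF _ assms(2) assms(3)] by auto
  have "(LINT x|m. \<bar>G n x - f x\<bar>) = (LINT x|m. \<bar>F n x - f x\<bar>)" for n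
    using assms(3)[of n] by (intro integral_cong_AE) (auto elim!: eventually_mono)
  then show "(\<lambda>n. LINT x|m. \<bar>G n x - f x\<bar>) \<longlonglongrightarrow> 0" using D(3) by simp
  show "integrable m f" by (rule D(2))
qed

lemma L1_lim_integral:
  assumes "L1_lim m F f"
  shows "(\<lambda>n. LINT x|m. F n x) \<longlonglongrightarrow> (LINT x|m. f x)"
proof (rule LIM_zero_cancel, rule tendsto_0_le[where K = 1])
  note D = L1_limD[OF assms]
  show "(\<lambda>n. LINT x|m. \<bar>F n x - f x\<bar>) \<longlonglongrightarrow> 0" by (rule D(3))
  have "\<bar>(LINT x|m. F n x) - (LINT x|m. f x)\<bar> \<le> (LINT x|m. \<bar>F n x - f x\<bar>)" for n
    using D(1)[of n] D(2) integral_abs_bound[of m "\<lambda>x. F n x - f x"] by simp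
  then show "\<forall>\<^sub>F n in sequentially. norm ((LINT x|m. F n x) - (LINT x|m. f x)) \<le> norm (LINT x|m. \<bar>F n x - f x\<bar>) * 1"
    by (intro always_eventually allI) simp
qed

lemma L1_lim_abs:
  assumes "L1_lim m F f"
  shows "L1_lim m (\<lambda>n x. \<bar>F n x\<bar>) (\<lambda>x. \<bar>f x\<bar>)"
proof (rule L1_lim_squeeze[OF _ _ _ L1_limD(3)[OF assms]])
  note D = L1_limD[OF assms]
  show "(LINT x|m. \<bar>\<bar>F n x\<bar> - \<bar>f x\<bar>\<bar>) \<le> (LINT x|m. \<bar>F n x - f x\<bar>)" for n
    using D by (intro integral_mono) auto
qed (use L1_limD[OF assms] in auto)

text \<open>Fits \<open>form_mult\<close>, whose multiplier at index \<open>n\<close> is within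
  \<open>(1/2) ^ n\<close> of \<open>h\<close>. The error splits into a bounded factor times an
  L1-small one and a uniformly small factor times an integrable one.\<close>

lemma L1_lim_mult_uniform:
  assumes F: "L1_lim m F f" and meas: "\<And>n. c n \<in> borel_measurable m" "h \<in> borel_measurable m"
    and K: "AE x in m. \<bar>h x\<bar> \<le> K" and unif: "\<And>n x. \<bar>c n x - h x\<bar> \<le> (1/2) ^ n"
  shows "L1_lim m (\<lambda>n x. c n x * F n x) (\<lambda>x. h x * f x)"
proof (rule L1_lim_squeeze)
  note D = L1_limD[OF F]
  note [measurable] = meas borel_measurable_integrable[OF D(1)] borel_measurable_integrable[OF D(2)]
  have unif1: "\<bar>c n x - h x\<bar> \<le> 1" for n x
    using unif[of n x] power_le_one[of "1/2::real" n] by linarith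
  have bd: "integrable m (\<lambda>x. b x * g x)"
    if "b \<in> borel_measurable m" "AE x in m. \<bar>b x\<bar> \<le> C" "integrable m g" for b g :: "'a \<Rightarrow> real" and C
  proof (rule Bochner_Integration.integrable_bound)
    show "integrable m (\<lambda>x. C * g x)" using that by simp
    show "(\<lambda>x. b x * g x) \<in> borel_measurable m" using that borel_measurable_integrable[OF that(3)] by measurable
    show "AE x in m. norm (b x * g x) \<le> norm (C * g x)"
      using that(2) by eventually_elim (auto simp: abs_mult intro!: mult_right_mono)
  qed
  have cK: "AE x in m. \<bar>c n x\<bar> \<le> K + 1" for n
    using K
  proof eventually_elim
    case (elim x)
    then show ?case using unif1[of n x] by linarith
  qed
  show i1: "integrable m (\<lambda>x. c n x * F n x)" for n by (rule bd[OF _ cK D(1)]) measurable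
  show i2: "integrable m (\<lambda>x. h x * f x)" by (rule bd[OF _ K D(2)]) measurable
  show "(LINT x|m. \<bar>c n x * F n x - h x * f x\<bar>)
      \<le> (K + 1) * (LINT x|m. \<bar>F n x - f x\<bar>) + (1/2) ^ n * (LINT x|m. \<bar>f x\<bar>)" for n
  proof -
    have "(LINT x|m. \<bar>c n x * F n x - h x * f x\<bar>) \<le> (LINT x|m. (K + 1) * \<bar>F n x - f x\<bar> + (1/2) ^ n * \<bar>f x\<bar>)"
    proof (rule integral_mono_AE)
      show "integrable m (\<lambda>x. \<bar>c n x * F n x - h x * f x\<bar>)" using i1 i2 by simp
      show "integrable m (\<lambda>x. (K + 1) * \<bar>F n x - f x\<bar> + (1/2) ^ n * \<bar>f x\<bar>)" using D by simp
      show "AE x in m. \<bar>c n x * F n x - h x * f x\<bar> \<le> (K + 1) * \<bar>F n x - f x\<bar> + (1/2) ^ n * \<bar>f x\<bar>"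
        using cK[of n]
      proof eventually_elim
        case (elim x)
        have "c n x * F n x - h x * f x = c n x * (F n x - f x) + (c n x - h x) * f x"
          by (simp add: algebra_simps)
        then have "\<bar>c n x * F n x - h x * f x\<bar> \<le> \<bar>c n x\<bar> * \<bar>F n x - f x\<bar> + \<bar>c n x - h x\<bar> * \<bar>f x\<bar>"
          by (metis abs_mult abs_triangle_ineq)
        also have "\<dots> \<le> (K + 1) * \<bar>F n x - f x\<bar> + (1/2) ^ n * \<bar>f x\<bar>"
          using elim unif[of n x] by (intro add_mono mult_right_mono) auto
        finally show ?case .
      qed
    qed
    then show ?thesis using D by simp
  qed
  have "(\<lambda>n. (K + 1) * (LINT x|m. \<bar>F n x - f x\<bar>) + (1/2) ^ n * (LINT x|m. \<bar>f x\<bar>)) \<longlonglongrightarrow> (K + 1) * 0 + 0 * (LINT x|m. \<bar>f x\<bar>)"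
    by (intro tendsto_intros D LIMSEQ_power_zero) simp
  then show "(\<lambda>n. (K + 1) * (LINT x|m. \<bar>F n x - f x\<bar>) + (1/2) ^ n * (LINT x|m. \<bar>f x\<bar>)) \<longlonglongrightarrow> 0" by simp
qed

context hilbertian
begin

section \<open>Forms as Cauchy sequences of preforms\<close>

abbreviation "CT \<equiv> cotangent dist m"
abbreviation "nf \<equiv> form_norm dist m"
abbreviation "fi \<equiv> form_inner dist m"
abbreviation "TM \<equiv> tangent dist m"
abbreviation "nn \<omega> \<equiv> L2_norm m (nf \<omega>)"

lemma cotangentD:
  assumes "\<omega> \<in> CT"
  shows "\<omega> n \<in> PF" "partitioned (\<omega> n)" "pn (\<omega> n) \<in> L2 m"
    "0 < e \<Longrightarrow> \<exists>N. \<forall>n\<ge>N. \<forall>k\<ge>N. L2_norm m (pn (preform_diff (\<omega> n) (\<omega> k))) < e"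
  using assms preformsD by (auto simp: cotangent_def)

lemma pn_diff_L2: "p \<in> PF \<Longrightarrow> q \<in> PF \<Longrightarrow> pn (preform_diff p q) \<in> L2 m"
  using preforms_diff preformsD by blast

lemma L2_norm_abs_mono:
  assumes "f \<in> L2 m" "g \<in> L2 m" "AE x in m. 0 \<le> f x" "AE x in m. f x \<le> g x"
  shows "L2_norm m f \<le> L2_norm m g"
proof -
  have "AE x in m. \<bar>f x\<bar> \<le> \<bar>g x\<bar>" using assms(3,4) by eventually_elim simp
  then show ?thesis by (rule L2_norm_mono[OF L2_measurable[OF assms(1)] assms(2)])
qed

text \<open>The pointwise norm is 1-Lipschitz, so along a form the norms are Cauchy in L2;
  completeness provides the limit that the \<open>SOME\<close> in \<open>form_norm\<close> refers
  to.\<close>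

lemma form_norm_lim:
  assumes "\<omega> \<in> CT"
  shows "L2_lim m (\<lambda>n. pn (\<omega> n)) (nf \<omega>)"
proof -
  note D = cotangentD[OF assms]
  have le: "L2_norm m (\<lambda>x. pn (\<omega> n) x - pn (\<omega> k) x) \<le> L2_norm m (pn (preform_diff (\<omega> n) (\<omega> k)))" for n k
  proof (rule L2_norm_mono)
    show "(\<lambda>x. pn (\<omega> n) x - pn (\<omega> k) x) \<in> borel_measurable m"
      using L2_measurable[OF L2_diff[OF D(3) D(3)]] .
    show "AE x in m. \<bar>pn (\<omega> n) x - pn (\<omega> k) x\<bar> \<le> \<bar>pn (preform_diff (\<omega> n) (\<omega> k)) x\<bar>"
      using pn_abs_diff[OF D(2) D(2), of n k] by eventually_elim simp
  qed (rule pn_diff_L2[OF D(1) D(1)])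
  have "\<exists>G. L2_lim m (\<lambda>n. pn (\<omega> n)) G"
  proof (rule L2_complete[OF D(3)])
    fix e :: real assume "0 < e"
    from D(4)[OF this] obtain N where "\<forall>n\<ge>N. \<forall>k\<ge>N. L2_norm m (pn (preform_diff (\<omega> n) (\<omega> k))) < e" by blast
    then show "\<exists>N. \<forall>n\<ge>N. \<forall>k\<ge>N. L2_norm m (\<lambda>x. pn (\<omega> n) x - pn (\<omega> k) x) < e"
      using le by (meson le_less_trans)
  qed
  then show ?thesis unfolding form_norm_def by (rule someI_ex)
qed

lemma nn_lim: "\<omega> \<in> CT \<Longrightarrow> (\<lambda>n. L2_norm m (pn (\<omega> n))) \<longlonglongrightarrow> nn \<omega>"
  using form_norm_lim L2_lim_norm by blast

lemma nf_L2: "\<omega> \<in> CT \<Longrightarrow> nf \<omega> \<in> L2 m"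
  using form_norm_lim L2_limD by blast

lemma cotangent_add:
  assumes \<omega>: "\<omega> \<in> CT" and \<eta>: "\<eta> \<in> CT"
  shows "form_add \<omega> \<eta> \<in> CT"
  unfolding cotangent_def
proof (intro CollectI conjI allI impI)
  note D = cotangentD[OF \<omega>] and E = cotangentD[OF \<eta>]
  show "form_add \<omega> \<eta> n \<in> PF" for n unfolding form_add_def by (rule preforms_add[OF D(1) E(1)])
  have le: "L2_norm m (pn (preform_diff (form_add \<omega> \<eta> n) (form_add \<omega> \<eta> k)))
      \<le> L2_norm m (pn (preform_diff (\<omega> n) (\<omega> k))) + L2_norm m (pn (preform_diff (\<eta> n) (\<eta> k)))" for n k
  proof -
    note L = pn_diff_L2[OF D(1)[of n] D(1)[of k]] pn_diff_L2[OF E(1)[of n] E(1)[of k]]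
    have "L2_norm m (pn (preform_diff (form_add \<omega> \<eta> n) (form_add \<omega> \<eta> k)))
        \<le> L2_norm m (\<lambda>x. pn (preform_diff (\<omega> n) (\<omega> k)) x + pn (preform_diff (\<eta> n) (\<eta> k)) x)"
      unfolding form_add_def using D(1,2) E(1,2)
      by (intro L2_norm_abs_mono L2_add L pn_diff_L2 preforms_add pn_nonneg partitioned_diff partitioned_add pn_diff_add_add)
    also have "\<dots> \<le> L2_norm m (pn (preform_diff (\<omega> n) (\<omega> k))) + L2_norm m (pn (preform_diff (\<eta> n) (\<eta> k)))"
      by (rule L2_norm_triangle[OF L])
    finally show ?thesis .
  qed
  fix e :: real assume "0 < e"
  then have e2: "0 < e / 2" by simp
  obtain N1 where N1: "\<forall>n\<ge>N1. \<forall>k\<ge>N1. L2_norm m (pn (preform_diff (\<omega> n) (\<omega> k))) < e / 2" using D(4)[OF e2] by blast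
  obtain N2 where N2: "\<forall>n\<ge>N2. \<forall>k\<ge>N2. L2_norm m (pn (preform_diff (\<eta> n) (\<eta> k))) < e / 2" using E(4)[OF e2] by blast
  show "\<exists>N. \<forall>n\<ge>N. \<forall>k\<ge>N. L2_norm m (pn (preform_diff (form_add \<omega> \<eta> n) (form_add \<omega> \<eta> k))) < e"
  proof (intro exI[of _ "max N1 N2"] allI impI)
    fix n k assume "max N1 N2 \<le> n" "max N1 N2 \<le> k"
    then have "L2_norm m (pn (preform_diff (\<omega> n) (\<omega> k))) < e / 2" "L2_norm m (pn (preform_diff (\<eta> n) (\<eta> k))) < e / 2"
      using N1 N2 by auto
    then show "L2_norm m (pn (preform_diff (form_add \<omega> \<eta> n) (form_add \<omega> \<eta> k))) < e" using le[of n k] by linarith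
  qed
qed

lemma cotangent_diff:
  assumes \<omega>: "\<omega> \<in> CT" and \<eta>: "\<eta> \<in> CT"
  shows "form_diff \<omega> \<eta> \<in> CT"
  unfolding cotangent_def
proof (intro CollectI conjI allI impI)
  note D = cotangentD[OF \<omega>] and E = cotangentD[OF \<eta>]
  show "form_diff \<omega> \<eta> n \<in> PF" for n unfolding form_diff_def by (rule preforms_diff[OF D(1) E(1)])
  have le: "L2_norm m (pn (preform_diff (form_diff \<omega> \<eta> n) (form_diff \<omega> \<eta> k)))
      \<le> L2_norm m (pn (preform_diff (\<omega> n) (\<omega> k))) + L2_norm m (pn (preform_diff (\<eta> n) (\<eta> k)))" for n k
  proof -
    note L = pn_diff_L2[OF D(1)[of n] D(1)[of k]] pn_diff_L2[OF E(1)[of n] E(1)[of k]]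
    have "L2_norm m (pn (preform_diff (form_diff \<omega> \<eta> n) (form_diff \<omega> \<eta> k)))
        \<le> L2_norm m (\<lambda>x. pn (preform_diff (\<omega> n) (\<omega> k)) x + pn (preform_diff (\<eta> n) (\<eta> k)) x)"
      unfolding form_diff_def using D(1,2) E(1,2)
      by (intro L2_norm_abs_mono L2_add L pn_diff_L2 preforms_diff pn_nonneg partitioned_diff pn_diff_diff_diff)
    also have "\<dots> \<le> L2_norm m (pn (preform_diff (\<omega> n) (\<omega> k))) + L2_norm m (pn (preform_diff (\<eta> n) (\<eta> k)))"
      by (rule L2_norm_triangle[OF L])
    finally show ?thesis .
  qed
  fix e :: real assume "0 < e"
  then have e2: "0 < e / 2" by simp
  obtain N1 where N1: "\<forall>n\<ge>N1. \<forall>k\<ge>N1. L2_norm m (pn (preform_diff (\<omega> n) (\<omega> k))) < e / 2" using D(4)[OF e2] by blast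
  obtain N2 where N2: "\<forall>n\<ge>N2. \<forall>k\<ge>N2. L2_norm m (pn (preform_diff (\<eta> n) (\<eta> k))) < e / 2" using E(4)[OF e2] by blast
  show "\<exists>N. \<forall>n\<ge>N. \<forall>k\<ge>N. L2_norm m (pn (preform_diff (form_diff \<omega> \<eta> n) (form_diff \<omega> \<eta> k))) < e"
  proof (intro exI[of _ "max N1 N2"] allI impI)
    fix n k assume "max N1 N2 \<le> n" "max N1 N2 \<le> k"
    then have "L2_norm m (pn (preform_diff (\<omega> n) (\<omega> k))) < e / 2" "L2_norm m (pn (preform_diff (\<eta> n) (\<eta> k))) < e / 2"
      using N1 N2 by auto
    then show "L2_norm m (pn (preform_diff (form_diff \<omega> \<eta> n) (form_diff \<omega> \<eta> k))) < e" using le[of n k] by linarith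
  qed
qed

lemma cotangent_mult:
  assumes \<omega>: "\<omega> \<in> CT" and h: "h \<in> Linf m"
  shows "form_mult h \<omega> \<in> CT"
  unfolding cotangent_def
proof (intro CollectI conjI allI impI)
  note D = cotangentD[OF \<omega>]
  obtain K0 where K0: "h \<in> borel_measurable m" "AE x in m. \<bar>h x\<bar> \<le> K0" using h by (auto simp: Linf_def)
  define K where "K = max K0 0"
  have K: "AE x in m. \<bar>h x\<bar> \<le> K" "0 \<le> K" using K0(2) by (auto simp: K_def elim!: eventually_mono)
  show "form_mult h \<omega> n \<in> PF" for n unfolding form_mult_def by (rule preforms_mult[OF D(1) h])
  \<comment> \<open>Changing the dyadic level multiplies a whole pointwise norm and not a
    difference, so the norms along the Cauchy sequence must be bounded.\<close>
  have "Bseq (\<lambda>n. L2_norm m (pn (\<omega> n)))" using convergentI[OF nn_lim[OF \<omega>]] by (rule convergent_imp_Bseq)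
  then obtain M where M: "0 < M" "\<And>n. L2_norm m (pn (\<omega> n)) \<le> M" by (auto simp: Bseq_def)
  have le: "L2_norm m (pn (preform_diff (form_mult h \<omega> n) (form_mult h \<omega> k)))
      \<le> (K + 1) * L2_norm m (pn (preform_diff (\<omega> n) (\<omega> k))) + ((1/2) ^ n + (1/2) ^ k) * M" for n k
  proof -
    note L = pn_diff_L2[OF D(1)[of n] D(1)[of k]]
    let ?c = "(1/2::real) ^ n + (1/2) ^ k"
    have "L2_norm m (pn (preform_diff (form_mult h \<omega> n) (form_mult h \<omega> k)))
        \<le> L2_norm m (\<lambda>x. (K + 1) * pn (preform_diff (\<omega> n) (\<omega> k)) x + ?c * pn (\<omega> k) x)"
    proof (rule L2_norm_abs_mono)
      show "pn (preform_diff (form_mult h \<omega> n) (form_mult h \<omega> k)) \<in> L2 m"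
        unfolding form_mult_def by (intro pn_diff_L2 preforms_mult D h)
      show "(\<lambda>x. (K + 1) * pn (preform_diff (\<omega> n) (\<omega> k)) x + ?c * pn (\<omega> k) x) \<in> L2 m"
        by (intro L2_add L2_cmult L D)
      show "AE x in m. 0 \<le> pn (preform_diff (form_mult h \<omega> n) (form_mult h \<omega> k)) x"
        unfolding form_mult_def by (intro pn_nonneg partitioned_diff partitioned_mult D K0)
      show "AE x in m. pn (preform_diff (form_mult h \<omega> n) (form_mult h \<omega> k)) x
          \<le> (K + 1) * pn (preform_diff (\<omega> n) (\<omega> k)) x + ?c * pn (\<omega> k) x"
        unfolding form_mult_def
        using pn_diff_mult_mult[OF D(2)[of n] D(2)[of k] K0(1), of n k] K(1) pn_nonneg[OF partitioned_diff[OF D(2)[of n] D(2)[of k]]]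
          pn_nonneg[OF D(2)[of k]]
      proof eventually_elim
        case (elim x)
        let ?a = "of_int \<lfloor>2 ^ n * h x\<rfloor> / 2 ^ n :: real" and ?b = "of_int \<lfloor>2 ^ k * h x\<rfloor> / 2 ^ k :: real"
        have "\<bar>?a\<bar> \<le> K + 1" using dyadic_bound[of n "h x"] elim(2) by linarith
        moreover have "\<bar>?a - ?b\<bar> \<le> ?c"
          using dyadic_approx_abs[of "h x" n] dyadic_approx_abs[of "h x" k] by linarith
        ultimately have "\<bar>?a\<bar> * pn (preform_diff (\<omega> n) (\<omega> k)) x + \<bar>?a - ?b\<bar> * pn (\<omega> k) x
            \<le> (K + 1) * pn (preform_diff (\<omega> n) (\<omega> k)) x + ?c * pn (\<omega> k) x"
          using elim by (intro add_mono mult_right_mono) auto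
        then show ?case using elim(1) by linarith
      qed
    qed
    also have "\<dots> \<le> L2_norm m (\<lambda>x. (K + 1) * pn (preform_diff (\<omega> n) (\<omega> k)) x) + L2_norm m (\<lambda>x. ?c * pn (\<omega> k) x)"
      by (intro L2_norm_triangle L2_cmult L D)
    also have "\<dots> \<le> (K + 1) * L2_norm m (pn (preform_diff (\<omega> n) (\<omega> k))) + ?c * M"
      unfolding L2_norm_cmult using K(2) M(2)[of k] by (auto intro!: mult_left_mono)
    finally show ?thesis .
  qed
  fix e :: real assume e: "0 < e"
  then have "0 < e / (3 * (K + 1))" using K(2) by simp
  from D(4)[OF this] obtain N1 where
    N1: "\<forall>n\<ge>N1. \<forall>k\<ge>N1. L2_norm m (pn (preform_diff (\<omega> n) (\<omega> k))) < e / (3 * (K + 1))" by blast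
  have "0 < e / (3 * M)" using e M(1) by simp
  moreover have "(\<lambda>n. (1/2::real) ^ n) \<longlonglongrightarrow> 0" by (intro LIMSEQ_power_zero) simp
  ultimately have "\<forall>\<^sub>F n in sequentially. (1/2::real) ^ n < e / (3 * M)" by (metis order_tendstoD(2))
  then obtain N2 where N2: "\<And>n. N2 \<le> n \<Longrightarrow> (1/2::real) ^ n < e / (3 * M)" by (auto simp: eventually_sequentially)
  show "\<exists>N. \<forall>n\<ge>N. \<forall>k\<ge>N. L2_norm m (pn (preform_diff (form_mult h \<omega> n) (form_mult h \<omega> k))) < e"
  proof (intro exI[of _ "max N1 N2"] allI impI)
    fix n k assume nk: "max N1 N2 \<le> n" "max N1 N2 \<le> k"
    have "L2_norm m (pn (preform_diff (\<omega> n) (\<omega> k))) < e / (3 * (K + 1))" using N1 nk by auto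
    then have a: "(K + 1) * L2_norm m (pn (preform_diff (\<omega> n) (\<omega> k))) < e / 3"
      using K(2) by (simp add: field_simps)
    have "(1/2) ^ n + (1/2) ^ k < e / (3 * M) + e / (3 * M)" using N2[of n] N2[of k] nk by (intro add_strict_mono) auto
    then have "((1/2) ^ n + (1/2) ^ k) * M < (e / (3 * M) + e / (3 * M)) * M" using M(1) by (rule mult_strict_right_mono)
    also have "\<dots> = e / 3 + e / 3" using M(1) by (simp add: field_simps)
    finally show "L2_norm m (pn (preform_diff (form_mult h \<omega> n) (form_mult h \<omega> k))) < e"
      using a le[of n k] by linarith
  qed
qed

lemma L2_norm_AE_zero:
  assumes "f \<in> borel_measurable m" "AE x in m. f x = 0"
  shows "L2_norm m f = 0"
  using L2_norm_cong_AE[OF assms(1), of "\<lambda>x. 0"] assms(2) by simp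

lemma cotangent_const:
  assumes p: "p \<in> PF"
  shows "(\<lambda>_. p) \<in> CT"
proof -
  note P = preformsD[OF p]
  have "L2_norm m (pn (preform_diff p p)) = 0"
    by (rule L2_norm_AE_zero[OF pn_measurable[OF partitioned_diff[OF P(1) P(1)]] pn_diff_self[OF P(1)]])
  then show ?thesis using p by (simp add: cotangent_def)
qed

lemma nf_const:
  assumes p: "p \<in> PF"
  shows "AE x in m. nf (\<lambda>_. p) x = pn p x"
proof -
  have "L2_lim m (\<lambda>_. pn p) (pn p)" using preformsD(2)[OF p] by (simp add: L2_lim_def)
  from L2_lim_unique[OF form_norm_lim[OF cotangent_const[OF p]] this] show ?thesis .
qed

lemma nn_const: "p \<in> PF \<Longrightarrow> nn (\<lambda>_. p) = L2_norm m (pn p)"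
  using nf_const[of p] preformsD(2)[of p] nf_L2[OF cotangent_const[of p]]
  by (intro L2_norm_cong_AE) (auto dest: L2_measurable)

text \<open>Bridge from preforms to forms: each algebraic law of \<open>pg\<close> passes to
  \<open>fi\<close> by uniqueness of L1 limits.\<close>

lemma fi_lim:
  assumes \<omega>: "\<omega> \<in> CT" and \<eta>: "\<eta> \<in> CT"
  shows "L1_lim m (\<lambda>n. pg (\<omega> n) (\<eta> n)) (fi \<omega> \<eta>)"
proof -
  have sq: "L1_lim m (\<lambda>n x. (pn (\<zeta> n) x)\<^sup>2) (\<lambda>x. (nf \<zeta> x)\<^sup>2)" if \<zeta>: "\<zeta> \<in> CT" for \<zeta>
    using L2_lim_mult_L1[OF form_norm_lim[OF \<zeta>] form_norm_lim[OF \<zeta>]]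
      L2_integrable_square[OF cotangentD(3)[OF \<zeta>]] L2_integrable_square[OF nf_L2[OF \<zeta>]]
    by (simp add: L1_lim_def power2_eq_square)
  have "L1_lim m (\<lambda>n x. 1/4 * ((pn (form_add \<omega> \<eta> n) x)\<^sup>2 + - 1 * (pn (form_diff \<omega> \<eta> n) x)\<^sup>2))
      (\<lambda>x. 1/4 * ((nf (form_add \<omega> \<eta>) x)\<^sup>2 + - 1 * (nf (form_diff \<omega> \<eta>) x)\<^sup>2))"
    by (intro L1_lim_cmult L1_lim_add sq cotangent_add cotangent_diff \<omega> \<eta>)
  then show ?thesis by (simp add: pg_def[abs_def] form_inner_def[abs_def] form_add_def form_diff_def)
qed

lemma fi_integrable: "\<omega> \<in> CT \<Longrightarrow> \<eta> \<in> CT \<Longrightarrow> integrable m (fi \<omega> \<eta>)"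
  using fi_lim L1_limD(2) by blast

lemma pg_measurable:
  assumes "partitioned p" "partitioned q"
  shows "pg p q \<in> borel_measurable m"
proof -
  note [measurable] = pn_measurable[OF partitioned_add[OF assms]] pn_measurable[OF partitioned_diff[OF assms]]
  show ?thesis unfolding pg_def[abs_def] by measurable
qed

lemma fi_sym:
  assumes \<omega>: "\<omega> \<in> CT" and \<eta>: "\<eta> \<in> CT"
  shows "AE x in m. fi \<omega> \<eta> x = fi \<eta> \<omega> x"
proof (rule L1_lim_unique)
  note D = cotangentD[OF \<omega>] and E = cotangentD[OF \<eta>]
  show "L1_lim m (\<lambda>n. pg (\<omega> n) (\<eta> n)) (fi \<omega> \<eta>)" by (rule fi_lim[OF \<omega> \<eta>])
  show "L1_lim m (\<lambda>n. pg (\<omega> n) (\<eta> n)) (fi \<eta> \<omega>)"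
    by (rule L1_lim_cong[OF fi_lim[OF \<eta> \<omega>] pg_measurable[OF D(2) E(2)] pg_sym[OF E(2) D(2)]])
qed

lemma fi_add:
  assumes \<omega>: "\<omega> \<in> CT" and \<zeta>: "\<zeta> \<in> CT" and \<eta>: "\<eta> \<in> CT"
  shows "AE x in m. fi (form_add \<omega> \<zeta>) \<eta> x = fi \<omega> \<eta> x + fi \<zeta> \<eta> x"
proof (rule L1_lim_unique)
  note D = cotangentD[OF \<omega>] and Z = cotangentD[OF \<zeta>] and E = cotangentD[OF \<eta>]
  note M = L1_lim_add[OF fi_lim[OF \<omega> \<eta>] fi_lim[OF \<zeta> \<eta>]]
  show "L1_lim m (\<lambda>n x. pg (\<omega> n) (\<eta> n) x + pg (\<zeta> n) (\<eta> n) x) (\<lambda>x. fi \<omega> \<eta> x + fi \<zeta> \<eta> x)" by (rule M)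
  show "L1_lim m (\<lambda>n x. pg (\<omega> n) (\<eta> n) x + pg (\<zeta> n) (\<eta> n) x) (fi (form_add \<omega> \<zeta>) \<eta>)"
  proof (rule L1_lim_cong[OF fi_lim[OF cotangent_add[OF \<omega> \<zeta>] \<eta>]])
    show "(\<lambda>x. pg (\<omega> n) (\<eta> n) x + pg (\<zeta> n) (\<eta> n) x) \<in> borel_measurable m" for n
      using L1_limD(1)[OF M] borel_measurable_integrable by blast
    show "AE x in m. pg (form_add \<omega> \<zeta> n) (\<eta> n) x = pg (\<omega> n) (\<eta> n) x + pg (\<zeta> n) (\<eta> n) x" for n
      unfolding form_add_def by (rule pg_add[OF D(2) Z(2) E(2)])
  qed
qed

lemma pg_diff:
  assumes p: "partitioned p" and q: "partitioned q" and r: "partitioned r"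
  shows "AE x in m. pg (preform_diff p q) r x = pg p r x + - 1 * pg q r x"
proof -
  have "\<forall>f\<in>S. \<forall>g\<in>S. \<forall>h\<in>S. AE x in m. \<Gamma> (\<lambda>y. f y - g y) h x = \<Gamma> f h x + - 1 * \<Gamma> g h x"
  proof (intro ballI)
    fix f g h assume *: "f \<in> S" "g \<in> S" "h \<in> S"
    have "(\<lambda>y. f y - g y) = (\<lambda>y. f y + - 1 * g y)" by (intro ext) simp
    then show "AE x in m. \<Gamma> (\<lambda>y. f y - g y) h x = \<Gamma> f h x + - 1 * \<Gamma> g h x"
      using \<Gamma>_add[OF *(1) sobolev_cmult[OF *(2), of "- 1"] *(3)] \<Gamma>_cmult[OF *(2,3), of "- 1"]
      by (auto elim!: eventually_rev_mp)
  qed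
  from AE_rep3[OF p q r this] show ?thesis
    by eventually_elim (auto simp: pg_rep[OF p r] pg_rep[OF q r] pg_rep[OF partitioned_diff[OF p q] r rep_diff])
qed

lemma fi_diff:
  assumes \<omega>: "\<omega> \<in> CT" and \<zeta>: "\<zeta> \<in> CT" and \<eta>: "\<eta> \<in> CT"
  shows "AE x in m. fi (form_diff \<omega> \<zeta>) \<eta> x = fi \<omega> \<eta> x + - 1 * fi \<zeta> \<eta> x"
proof (rule L1_lim_unique)
  note D = cotangentD[OF \<omega>] and Z = cotangentD[OF \<zeta>] and E = cotangentD[OF \<eta>]
  note M = L1_lim_add[OF fi_lim[OF \<omega> \<eta>] L1_lim_cmult[OF fi_lim[OF \<zeta> \<eta>], of "- 1"]]
  show "L1_lim m (\<lambda>n x. pg (\<omega> n) (\<eta> n) x + - 1 * pg (\<zeta> n) (\<eta> n) x) (\<lambda>x. fi \<omega> \<eta> x + - 1 * fi \<zeta> \<eta> x)" by (rule M)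
  show "L1_lim m (\<lambda>n x. pg (\<omega> n) (\<eta> n) x + - 1 * pg (\<zeta> n) (\<eta> n) x) (fi (form_diff \<omega> \<zeta>) \<eta>)"
  proof (rule L1_lim_cong[OF fi_lim[OF cotangent_diff[OF \<omega> \<zeta>] \<eta>]])
    show "(\<lambda>x. pg (\<omega> n) (\<eta> n) x + - 1 * pg (\<zeta> n) (\<eta> n) x) \<in> borel_measurable m" for n
      using L1_limD(1)[OF M] borel_measurable_integrable by blast
    show "AE x in m. pg (form_diff \<omega> \<zeta> n) (\<eta> n) x = pg (\<omega> n) (\<eta> n) x + - 1 * pg (\<zeta> n) (\<eta> n) x" for n
      unfolding form_diff_def by (rule pg_diff[OF D(2) Z(2) E(2)])
  qed
qed

lemma fi_mult:
  assumes \<omega>: "\<omega> \<in> CT" and \<eta>: "\<eta> \<in> CT" and h: "h \<in> Linf m"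
  shows "AE x in m. fi (form_mult h \<omega>) \<eta> x = h x * fi \<omega> \<eta> x"
proof (rule L1_lim_unique)
  note D = cotangentD[OF \<omega>] and E = cotangentD[OF \<eta>]
  obtain K where K: "h \<in> borel_measurable m" "AE x in m. \<bar>h x\<bar> \<le> K" using h by (auto simp: Linf_def)
  note [measurable] = K(1)
  let ?c = "\<lambda>n x. of_int \<lfloor>2 ^ n * h x\<rfloor> / 2 ^ n :: real"
  have M: "L1_lim m (\<lambda>n x. ?c n x * pg (\<omega> n) (\<eta> n) x) (\<lambda>x. h x * fi \<omega> \<eta> x)"
  proof (rule L1_lim_mult_uniform[OF fi_lim[OF \<omega> \<eta>] _ K(1) K(2)])
    show "?c n \<in> borel_measurable m" for n by measurable
    show "\<bar>?c n x - h x\<bar> \<le> (1/2) ^ n" for n x using dyadic_approx_abs[of "h x" n] by (simp add: abs_minus_commute)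
  qed
  then show "L1_lim m (\<lambda>n x. ?c n x * pg (\<omega> n) (\<eta> n) x) (\<lambda>x. h x * fi \<omega> \<eta> x)" .
  show "L1_lim m (\<lambda>n x. ?c n x * pg (\<omega> n) (\<eta> n) x) (fi (form_mult h \<omega>) \<eta>)"
  proof (rule L1_lim_cong[OF fi_lim[OF cotangent_mult[OF \<omega> h] \<eta>]])
    show "(\<lambda>x. ?c n x * pg (\<omega> n) (\<eta> n) x) \<in> borel_measurable m" for n
      using L1_limD(1)[OF M] borel_measurable_integrable by blast
    show "AE x in m. pg (form_mult h \<omega> n) (\<eta> n) x = ?c n x * pg (\<omega> n) (\<eta> n) x" for n
      unfolding form_mult_def by (rule pg_mult[OF D(2) E(2) K(1)])
  qed
qed

lemma fi_bound:
  assumes \<omega>: "\<omega> \<in> CT" and \<eta>: "\<eta> \<in> CT"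
  shows "(LINT x|m. \<bar>fi \<omega> \<eta> x\<bar>) \<le> nn \<eta> * (nn \<omega> + nn \<eta>)"
proof (rule LIMSEQ_le)
  note D = cotangentD[OF \<omega>] and E = cotangentD[OF \<eta>]
  show "(\<lambda>n. LINT x|m. \<bar>pg (\<omega> n) (\<eta> n) x\<bar>) \<longlonglongrightarrow> (LINT x|m. \<bar>fi \<omega> \<eta> x\<bar>)"
    by (rule L1_lim_integral[OF L1_lim_abs[OF fi_lim[OF \<omega> \<eta>]]])
  show "(\<lambda>n. L2_norm m (pn (\<eta> n)) * (L2_norm m (pn (\<omega> n)) + L2_norm m (pn (\<eta> n)))) \<longlonglongrightarrow> nn \<eta> * (nn \<omega> + nn \<eta>)"
    by (intro tendsto_intros nn_lim \<omega> \<eta>)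
  have "(LINT x|m. \<bar>pg (\<omega> n) (\<eta> n) x\<bar>) \<le> L2_norm m (pn (\<eta> n)) * (L2_norm m (pn (\<omega> n)) + L2_norm m (pn (\<eta> n)))" for n
  proof -
    have "(LINT x|m. \<bar>pg (\<omega> n) (\<eta> n) x\<bar>) \<le> (LINT x|m. pn (\<eta> n) x * (pn (\<omega> n) x + pn (\<eta> n) x))"
      using L1_limD(1)[OF fi_lim[OF \<omega> \<eta>], of n]
      by (intro integral_mono_AE pg_bound D(2) E(2) L2_mult_integrable L2_add D(3) E(3)) simp
    also have "\<dots> \<le> L2_norm m (pn (\<eta> n)) * L2_norm m (\<lambda>x. pn (\<omega> n) x + pn (\<eta> n) x)"
      by (intro L2_cauchy_schwarz L2_add D(3) E(3))
    also have "\<dots> \<le> L2_norm m (pn (\<eta> n)) * (L2_norm m (pn (\<omega> n)) + L2_norm m (pn (\<eta> n)))"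
      by (intro mult_left_mono L2_norm_triangle D(3) E(3)) simp
    finally show ?thesis .
  qed
  then show "\<exists>N. \<forall>n\<ge>N. (LINT x|m. \<bar>pg (\<omega> n) (\<eta> n) x\<bar>) \<le> L2_norm m (pn (\<eta> n)) * (L2_norm m (pn (\<omega> n)) + L2_norm m (pn (\<eta> n)))"
    by blast
qed

section \<open>Vector fields as functionals on forms\<close>

lemma tangentD:
  assumes "T \<in> TM"
  shows "\<omega> \<in> CT \<Longrightarrow> integrable m (T \<omega>)"
    "\<omega> \<in> CT \<Longrightarrow> \<eta> \<in> CT \<Longrightarrow> AE x in m. T (form_add \<omega> \<eta>) x = T \<omega> x + T \<eta> x"
    "h \<in> Linf m \<Longrightarrow> \<omega> \<in> CT \<Longrightarrow> AE x in m. T (form_mult h \<omega>) x = h x * T \<omega> x"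
    "\<omega> \<in> CT \<Longrightarrow> (\<And>n. W n \<in> CT) \<Longrightarrow> (\<lambda>n. nn (form_diff (W n) \<omega>)) \<longlonglongrightarrow> 0 \<Longrightarrow> L1_lim m (\<lambda>n. T (W n)) (T \<omega>)"
  using assms unfolding tangent_def L1_lim_def by blast+

lemma fi_tangent:
  assumes \<omega>: "\<omega> \<in> CT"
  shows "fi \<omega> \<in> TM"
  unfolding tangent_def
proof (intro CollectI conjI allI ballI impI)
  show "integrable m (fi \<omega> \<eta>)" if "\<eta> \<in> CT" for \<eta> by (rule fi_integrable[OF \<omega> that])
  show "AE x in m. fi \<omega> (form_add \<eta> \<zeta>) x = fi \<omega> \<eta> x + fi \<omega> \<zeta> x" if "\<eta> \<in> CT" "\<zeta> \<in> CT" for \<eta> \<zeta>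
    using fi_add[OF that \<omega>] fi_sym[OF \<omega> cotangent_add[OF that]] fi_sym[OF \<omega> that(1)] fi_sym[OF \<omega> that(2)]
    by eventually_elim simp
  show "AE x in m. fi \<omega> (form_mult h \<eta>) x = h x * fi \<omega> \<eta> x" if "h \<in> Linf m" "\<eta> \<in> CT" for h \<eta>
    using fi_mult[OF that(2) \<omega> that(1)] fi_sym[OF \<omega> cotangent_mult[OF that(2,1)]] fi_sym[OF \<omega> that(2)]
    by eventually_elim simp
  fix W \<eta> assume \<eta>: "\<eta> \<in> CT"
    and "(\<forall>n. W n \<in> CT) \<and> (\<lambda>n. nn (form_diff (W n) \<eta>)) \<longlonglongrightarrow> 0"
  then have W: "W n \<in> CT" and lim: "(\<lambda>n. nn (form_diff (W n) \<eta>)) \<longlonglongrightarrow> 0" for n by auto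
  have le: "(LINT x|m. \<bar>fi \<omega> (W n) x - fi \<omega> \<eta> x\<bar>) \<le> nn (form_diff (W n) \<eta>) * (nn \<omega> + nn (form_diff (W n) \<eta>))" for n
  proof -
    note d = cotangent_diff[OF W[of n] \<eta>]
    have "AE x in m. \<bar>fi \<omega> (W n) x - fi \<omega> \<eta> x\<bar> = \<bar>fi \<omega> (form_diff (W n) \<eta>) x\<bar>"
      using fi_diff[OF W[of n] \<eta> \<omega>] fi_sym[OF \<omega> d] fi_sym[OF \<omega> W[of n]] fi_sym[OF \<omega> \<eta>]
      by eventually_elim simp
    then have "(LINT x|m. \<bar>fi \<omega> (W n) x - fi \<omega> \<eta> x\<bar>) = (LINT x|m. \<bar>fi \<omega> (form_diff (W n) \<eta>) x\<bar>)"
      using fi_integrable[OF \<omega> W[of n]] fi_integrable[OF \<omega> \<eta>] fi_integrable[OF \<omega> d]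
      by (intro integral_cong_AE) auto
    then show ?thesis using fi_bound[OF \<omega> d] by simp
  qed
  have "(\<lambda>n. nn (form_diff (W n) \<eta>) * (nn \<omega> + nn (form_diff (W n) \<eta>))) \<longlonglongrightarrow> 0 * (nn \<omega> + 0)"
    by (intro tendsto_intros lim)
  then have "(\<lambda>n. nn (form_diff (W n) \<eta>) * (nn \<omega> + nn (form_diff (W n) \<eta>))) \<longlonglongrightarrow> 0" by simp
  then show "(\<lambda>n. LINT x|m. \<bar>fi \<omega> (W n) x - fi \<omega> \<eta> x\<bar>) \<longlonglongrightarrow> 0"
    by (rule tendsto_sandwich[OF _ _ tendsto_const, rotated 2]) (use le in auto)
qed

text \<open>Two forms at distance zero: the constant sequence \<open>\<omega>\<close> converges to
  \<open>\<eta>\<close>, and continuity of \<open>T\<close> does the rest. In this way vector fields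
  respect equality of the represented forms.\<close>

lemma tangent_equiv:
  assumes T: "T \<in> TM" and \<omega>: "\<omega> \<in> CT" and \<eta>: "\<eta> \<in> CT"
    and z: "(\<lambda>n. L2_norm m (pn (preform_diff (\<omega> n) (\<eta> n)))) \<longlonglongrightarrow> 0"
  shows "AE x in m. T \<omega> x = T \<eta> x"
proof -
  have "(\<lambda>n. L2_norm m (pn (form_diff \<omega> \<eta> n))) \<longlonglongrightarrow> 0" using z by (simp add: form_diff_def)
  then have "nn (form_diff \<omega> \<eta>) = 0" using nn_lim[OF cotangent_diff[OF \<omega> \<eta>]] LIMSEQ_unique by blast
  then have "L1_lim m (\<lambda>n. T \<omega>) (T \<eta>)" using tangentD(4)[OF T \<eta>, of "\<lambda>_. \<omega>"] \<omega> by simp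
  moreover have "L1_lim m (\<lambda>n. T \<omega>) (T \<omega>)" using tangentD(1)[OF T \<omega>] by (simp add: L1_lim_def)
  ultimately show ?thesis by (rule L1_lim_unique[rotated])
qed

text \<open>Density of preforms in the completion: a form is the limit of its own members, each
  viewed as a constant sequence.\<close>

lemma const_approx:
  assumes \<omega>: "\<omega> \<in> CT"
  shows "(\<lambda>n. nn (form_diff (\<lambda>_. \<omega> n) \<omega>)) \<longlonglongrightarrow> 0"
proof (rule LIMSEQ_I)
  note D = cotangentD[OF \<omega>]
  fix e :: real assume e: "0 < e"
  then have "0 < e / 2" by simp
  from D(4)[OF this] obtain N where N: "\<forall>n\<ge>N. \<forall>k\<ge>N. L2_norm m (pn (preform_diff (\<omega> n) (\<omega> k))) < e / 2" by blast
  have "nn (form_diff (\<lambda>_. \<omega> n) \<omega>) \<le> e / 2" if n: "N \<le> n" for n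
  proof (rule Lim_bounded[OF nn_lim[OF cotangent_diff[OF cotangent_const[OF D(1)[of n]] \<omega>]], of N])
    show "\<forall>k\<ge>N. L2_norm m (pn (form_diff (\<lambda>_. \<omega> n) \<omega> k)) \<le> e / 2"
      using N n less_imp_le by (auto simp: form_diff_def)
  qed
  then show "\<exists>N. \<forall>n\<ge>N. norm (nn (form_diff (\<lambda>_. \<omega> n) \<omega>) - 0) < e"
    using e by (intro exI[of _ N]) force
qed

lemma tangent_const_lim:
  assumes T: "T \<in> TM" and \<omega>: "\<omega> \<in> CT"
  shows "L1_lim m (\<lambda>n. T (\<lambda>_. \<omega> n)) (T \<omega>)"
  by (rule tangentD(4)[OF T \<omega> cotangent_const[OF cotangentD(1)[OF \<omega>]] const_approx[OF \<omega>]])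

definition single :: "('a \<Rightarrow> real) \<Rightarrow> 'a preform" where
  "single f = (\<lambda>i. (if i = 0 then UNIV else {}, f))"

lemma differential_single: "differential m f = (\<lambda>_. single f)"
  by (simp add: differential_def single_def cong: if_cong)

lemma partitioned_single: "f \<in> S \<Longrightarrow> partitioned (single f)"
  using sets.top[of m] by (auto simp: partitioned_def single_def disjoint_family_on_def)

lemma rep_single: "rep (single f) x f"
  by (auto simp: rep_def single_def intro: exI[of _ 0])

lemma preforms_single: "f \<in> S \<Longrightarrow> single f \<in> PF"
proof -
  assume f: "f \<in> S"
  have "pn (single f) = N f" using pn_rep[OF partitioned_single[OF f] rep_single] by (intro ext)
  then show ?thesis using N_L2[OF f] partitioned_single[OF f] by (simp add: preforms_iff)
qed

lemma indicator_Linf: "A \<in> sets m \<Longrightarrow> indicator A \<in> Linf m"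
  by (auto simp: Linf_def intro!: exI[of _ 1] AE_I2 split: split_indicator)

lemma const_Linf: "(\<lambda>x. c) \<in> Linf m"
  by (auto simp: Linf_def)

text \<open>Multiplying by the indicator of a piece turns a preform into a multiple of the
  differential of the function on that piece, so linearity over bounded functions settles preforms
  piece by piece; density extends this to all forms.\<close>

lemma tangent_eqI:
  assumes T: "T \<in> TM" and U: "U \<in> TM"
    and eq: "\<And>f. f \<in> S \<Longrightarrow> AE x in m. T (differential m f) x = U (differential m f) x"
    and \<omega>: "\<omega> \<in> CT"
  shows "AE x in m. T \<omega> x = U \<omega> x"
proof -
  have const: "AE x in m. T (\<lambda>_. p) x = U (\<lambda>_. p) x" if p: "p \<in> PF" for p
  proof -
    note P = preformsD[OF p]
    have "AE x in m. x \<in> fst (p i) \<longrightarrow> T (\<lambda>_. p) x = U (\<lambda>_. p) x" for i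
    proof -
      let ?h = "indicator (fst (p i)) :: 'a \<Rightarrow> real" and ?f = "snd (p i)"
      have Bm: "fst (p i) \<in> sets m" and f: "?f \<in> S" using P(1) by (auto simp: partitioned_def)
      note h = indicator_Linf[OF Bm]
      have hm: "?h \<in> borel_measurable m" using h by (simp add: Linf_def)
      note c1 = cotangent_const[OF p] and c2 = cotangent_const[OF preforms_single[OF f]]
      have part: "partitioned (preform_diff (preform_dyadic_mult n ?h p) (preform_dyadic_mult n ?h (single ?f)))" for n
        by (intro partitioned_diff partitioned_mult P(1) partitioned_single f hm)
      \<comment> \<open>On the piece both preforms carry the same function, elsewhere both dyadic
        factors are 0; so after the cut their difference has pointwise norm zero.\<close>
      have "AE x in m. pn (preform_diff (preform_dyadic_mult n ?h p) (preform_dyadic_mult n ?h (single ?f))) x = 0" for n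
        using N_zero
      proof eventually_elim
        case (elim x)
        obtain j where j: "x \<in> fst (p j)" using rep_exists[OF P(1)] by blast
        then have r: "rep p x (snd (p j))" by (auto simp: rep_def)
        have "(\<lambda>y. of_int \<lfloor>2 ^ n * ?h x\<rfloor> / 2 ^ n * snd (p j) y - of_int \<lfloor>2 ^ n * ?h x\<rfloor> / 2 ^ n * ?f y) = (\<lambda>y. 0)"
        proof (cases "j = i")
          case False
          then have "x \<notin> fst (p i)" using P(1) j unfolding partitioned_def disjoint_family_on_def by blast
          then show ?thesis by simp
        qed simp
        then show ?case using pn_rep[OF part rep_diff[OF rep_mult[OF r] rep_mult[OF rep_single]]] elim by simp
      qed
      from L2_norm_AE_zero[OF pn_measurable[OF part] this]
      have z: "(\<lambda>n. L2_norm m (pn (preform_diff (form_mult ?h (\<lambda>_. p) n) (form_mult ?h (\<lambda>_. single ?f) n)))) \<longlonglongrightarrow> 0"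
        by (simp add: form_mult_def)
      note E = tangent_equiv[OF _ cotangent_mult[OF c1 h] cotangent_mult[OF c2 h] z]
      from E[OF T] E[OF U] tangentD(3)[OF T h c1] tangentD(3)[OF T h c2] tangentD(3)[OF U h c1] tangentD(3)[OF U h c2]
        eq[OF f, unfolded differential_single]
      show ?thesis by eventually_elim auto
    qed
    then have "AE x in m. \<forall>i. x \<in> fst (p i) \<longrightarrow> T (\<lambda>_. p) x = U (\<lambda>_. p) x"
      unfolding AE_all_countable by blast
    then show ?thesis by eventually_elim (use rep_exists[OF P(1)] in blast)
  qed
  have "L1_lim m (\<lambda>n. T (\<lambda>_. \<omega> n)) (U \<omega>)"
    using borel_measurable_integrable[OF tangentD(1)[OF T cotangent_const[OF cotangentD(1)[OF \<omega>]]]]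
      AE_symmetric[OF const[OF cotangentD(1)[OF \<omega>]]]
    by (intro L1_lim_cong[OF tangent_const_lim[OF U \<omega>]])
  from L1_lim_unique[OF tangent_const_lim[OF T \<omega>] this] show ?thesis .
qed

lemma gradient_exists:
  assumes f: "f \<in> S"
  shows "\<exists>T. T \<in> TM \<and> (\<forall>g\<in>S. AE x in m. T (differential m g) x = \<Gamma> f g x)"
proof (intro exI[of _ "fi (differential m f)"] conjI ballI)
  note c = cotangent_const[OF preforms_single]
  show "fi (differential m f) \<in> TM" unfolding differential_single by (rule fi_tangent[OF c[OF f]])
  fix g assume g: "g \<in> S"
  note pf = partitioned_single[OF f] and pg' = partitioned_single[OF g]
  have "pg (single f) (single g) = \<Gamma> f g"
    using pg_rep[OF pf pg' rep_single rep_single] by (intro ext)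
  moreover have "L1_lim m (\<lambda>n. pg (single f) (single g)) (fi (\<lambda>_. single f) (\<lambda>_. single g))"
    by (rule fi_lim[OF c[OF f] c[OF g]])
  ultimately show "AE x in m. fi (differential m f) (differential m g) x = \<Gamma> f g x"
    unfolding differential_single
    by (intro L1_lim_unique[of m "\<lambda>n. \<Gamma> f g"]) (auto simp: L1_lim_def)
qed

lemma gradient_tangent:
  assumes f: "f \<in> S"
  shows "gradient dist m f \<in> TM" "\<And>g. g \<in> S \<Longrightarrow> AE x in m. gradient dist m f (differential m g) x = \<Gamma> f g x"
  using someI_ex[OF gradient_exists[OF f]] unfolding gradient_def by blast+

section \<open>Riesz representation\<close>

definition scale :: "real \<Rightarrow> 'a preform \<Rightarrow> 'a preform" where
  "scale t p = (\<lambda>i. (fst (p i), \<lambda>y. t * snd (p i) y))"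

lemma rep_scale: "rep p x f \<Longrightarrow> rep (scale t p) x (\<lambda>y. t * f y)"
  by (auto simp: rep_def scale_def)

lemma partitioned_scale: "partitioned p \<Longrightarrow> partitioned (scale t p)"
  by (auto simp: partitioned_def scale_def intro: sobolev_cmult)

lemma pn_scale:
  assumes p: "partitioned p"
  shows "AE x in m. pn (scale t p) x = \<bar>t\<bar> * pn p x"
proof -
  have "\<forall>f\<in>S. AE x in m. N (\<lambda>y. t * f y) x = \<bar>t\<bar> * N f x" by (intro ballI N_cmult)
  from AE_rep1[OF p this] show ?thesis
    by eventually_elim (auto simp: pn_rep[OF p] pn_rep[OF partitioned_scale[OF p] rep_scale])
qed

lemma preforms_scale:
  assumes p: "p \<in> PF"
  shows "scale t p \<in> PF" "L2_norm m (pn (scale t p)) = \<bar>t\<bar> * L2_norm m (pn p)"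
proof -
  note P = preformsD[OF p]
  note meas = pn_measurable[OF partitioned_scale[OF P(1)], of t]
  have ae: "AE x in m. \<bar>pn (scale t p) x\<bar> = \<bar>t * pn p x\<bar>"
    using pn_scale[OF P(1), of t] by eventually_elim (simp add: abs_mult)
  have "pn (scale t p) \<in> L2 m"
    by (rule L2_bounded[OF meas L2_cmult[OF P(2), of t]]) (use ae in \<open>auto elim!: eventually_mono\<close>)
  then show "scale t p \<in> PF" using partitioned_scale[OF P(1)] by (simp add: preforms_iff)
  have "L2_norm m (pn (scale t p)) = L2_norm m (\<lambda>x. t * pn p x)"
    using L2_norm_cong_AE[OF meas L2_measurable[OF L2_cmult[OF P(2), of t]] ae] .
  then show "L2_norm m (pn (scale t p)) = \<bar>t\<bar> * L2_norm m (pn p)" by (simp add: L2_norm_cmult)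
qed

lemma pn_parallelogram:
  assumes p: "p \<in> PF" and q: "q \<in> PF"
  shows "(L2_norm m (pn (preform_add p q)))\<^sup>2 + (L2_norm m (pn (preform_diff p q)))\<^sup>2
    = 2 * (L2_norm m (pn p))\<^sup>2 + 2 * (L2_norm m (pn q))\<^sup>2"
    and "(L2_norm m (pn (preform_add p q)))\<^sup>2
    = (L2_norm m (pn p))\<^sup>2 + 2 * (LINT x|m. pg p q x) + (L2_norm m (pn q))\<^sup>2"
proof -
  note P = preformsD[OF p] and Q = preformsD[OF q]
  note A = preformsD[OF preforms_add[OF p q]] and D = preformsD[OF preforms_diff[OF p q]]
  note I = L2_integrable_square[OF P(2)] L2_integrable_square[OF Q(2)] L2_integrable_square[OF A(2)] L2_integrable_square[OF D(2)]
  have "\<forall>f\<in>S. \<forall>g\<in>S. AE x in m. (N (\<lambda>y. f y + g y) x)\<^sup>2 + (N (\<lambda>y. f y - g y) x)\<^sup>2 = 2 * (N f x)\<^sup>2 + 2 * (N g x)\<^sup>2"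
    by (intro ballI parallelogram_AE)
  from AE_rep2[OF P(1) Q(1) this]
  have "AE x in m. (pn (preform_add p q) x)\<^sup>2 + (pn (preform_diff p q) x)\<^sup>2 = 2 * (pn p x)\<^sup>2 + 2 * (pn q x)\<^sup>2"
    by eventually_elim (auto simp: pn_rep[OF P(1)] pn_rep[OF Q(1)] pn_rep[OF A(1) rep_add] pn_rep[OF D(1) rep_diff])
  then have "(LINT x|m. (pn (preform_add p q) x)\<^sup>2 + (pn (preform_diff p q) x)\<^sup>2) = (LINT x|m. 2 * (pn p x)\<^sup>2 + 2 * (pn q x)\<^sup>2)"
    using I by (intro integral_cong_AE borel_measurable_integrable) auto
  then show par: "(L2_norm m (pn (preform_add p q)))\<^sup>2 + (L2_norm m (pn (preform_diff p q)))\<^sup>2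
    = 2 * (L2_norm m (pn p))\<^sup>2 + 2 * (L2_norm m (pn q))\<^sup>2"
    using I by (simp add: L2_norm_square)
  have "4 * (LINT x|m. pg p q x) = (L2_norm m (pn (preform_add p q)))\<^sup>2 - (L2_norm m (pn (preform_diff p q)))\<^sup>2"
    using I by (simp add: L2_norm_square pg_def)
  then show "(L2_norm m (pn (preform_add p q)))\<^sup>2
    = (L2_norm m (pn p))\<^sup>2 + 2 * (LINT x|m. pg p q x) + (L2_norm m (pn q))\<^sup>2"
    using par by argo
qed

lemma pg_scale:
  assumes p: "partitioned p" and q: "partitioned q"
  shows "AE x in m. pg p (scale t q) x = t * pg p q x"
proof -
  have "\<forall>f\<in>S. \<forall>g\<in>S. AE x in m. \<Gamma> f (\<lambda>y. t * g y) x = t * \<Gamma> f g x"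
  proof (intro ballI)
    fix f g assume f: "f \<in> S" and g: "g \<in> S"
    show "AE x in m. \<Gamma> f (\<lambda>y. t * g y) x = t * \<Gamma> f g x"
      using \<Gamma>_sym[OF f sobolev_cmult[OF g, of t]] \<Gamma>_cmult[OF g f, of t] \<Gamma>_sym[OF f g]
      by eventually_elim simp
  qed
  from AE_rep2[OF p q this] show ?thesis
    by eventually_elim (auto simp: pg_rep[OF p q] pg_rep[OF p partitioned_scale[OF q] _ rep_scale])
qed

lemma integrable_pg: "p \<in> PF \<Longrightarrow> q \<in> PF \<Longrightarrow> integrable m (pg p q)"
  using L1_limD(1)[OF fi_lim[OF cotangent_const cotangent_const]] .

text \<open>The variational argument uses exact real multiples of a preform, whereas
  \<open>form_mult\<close> with a constant has dyadic approximations at each index. The two differ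
  by at most \<open>(1/2) ^ n\<close> times the norm, which a continuous functional does not
  see.\<close>

lemma tangent_scale:
  assumes T: "T \<in> TM" and p: "p \<in> PF"
  shows "AE x in m. T (\<lambda>_. scale t p) x = t * T (\<lambda>_. p) x"
proof -
  note P = preformsD[OF p] and c = cotangent_const[OF p]
  have h: "(\<lambda>_. t) \<in> borel_measurable m" by simp
  have part: "partitioned (preform_diff (preform_dyadic_mult n (\<lambda>_. t) p) (scale t p))" for n
    by (intro partitioned_diff partitioned_mult P(1) partitioned_scale h)
  have le: "L2_norm m (pn (preform_diff (form_mult (\<lambda>_. t) (\<lambda>_. p) n) (scale t p))) \<le> (1/2) ^ n * L2_norm m (pn p)" for n
  proof -
    let ?c = "of_int \<lfloor>2 ^ n * t\<rfloor> / 2 ^ n :: real"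
    have "\<forall>f\<in>S. AE x in m. N (\<lambda>y. ?c * f y - t * f y) x = \<bar>?c - t\<bar> * N f x"
    proof (intro ballI)
      fix f assume f: "f \<in> S"
      have "(\<lambda>y. ?c * f y - t * f y) = (\<lambda>y. (?c - t) * f y)" by (intro ext) (rule left_diff_distrib[symmetric])
      then show "AE x in m. N (\<lambda>y. ?c * f y - t * f y) x = \<bar>?c - t\<bar> * N f x" using N_cmult[OF f, of "?c - t"] by simp
    qed
    from AE_rep1[OF P(1) this] have ae: "AE x in m. pn (preform_diff (preform_dyadic_mult n (\<lambda>_. t) p) (scale t p)) x = \<bar>?c - t\<bar> * pn p x"
    proof eventually_elim
      case (elim x)
      then obtain f where f: "rep p x f" "N (\<lambda>y. ?c * f y - t * f y) x = \<bar>?c - t\<bar> * N f x" by blast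
      then show ?case
        using pn_rep[OF part rep_diff[OF rep_mult[OF f(1)] rep_scale[OF f(1)]]] pn_rep[OF P(1) f(1)] by simp
    qed
    have "L2_norm m (pn (preform_diff (preform_dyadic_mult n (\<lambda>_. t) p) (scale t p))) = L2_norm m (\<lambda>x. \<bar>?c - t\<bar> * pn p x)"
      using ae by (intro L2_norm_cong_AE pn_measurable[OF part] L2_measurable[OF L2_cmult[OF P(2)]]) (auto elim!: eventually_mono)
    also have "\<dots> = \<bar>?c - t\<bar> * L2_norm m (pn p)" by (simp add: L2_norm_cmult)
    also have "\<dots> \<le> (1/2) ^ n * L2_norm m (pn p)"
      using dyadic_approx_abs[of t n] by (intro mult_right_mono) (auto simp: abs_minus_commute)
    finally show ?thesis by (simp add: form_mult_def)
  qed
  have "(\<lambda>n. (1/2) ^ n * L2_norm m (pn p)) \<longlonglongrightarrow> 0 * L2_norm m (pn p)"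
    by (intro tendsto_intros LIMSEQ_power_zero) simp
  then have "(\<lambda>n. (1/2) ^ n * L2_norm m (pn p)) \<longlonglongrightarrow> 0" by simp
  then have "(\<lambda>n. L2_norm m (pn (preform_diff (form_mult (\<lambda>_. t) (\<lambda>_. p) n) (scale t p)))) \<longlonglongrightarrow> 0"
    by (rule tendsto_sandwich[OF _ _ tendsto_const, rotated 2]) (use le in auto)
  from tangent_equiv[OF T cotangent_mult[OF c const_Linf] cotangent_const[OF preforms_scale(1)[OF p]] this]
    tangentD(3)[OF T const_Linf c, of t]
  show ?thesis by eventually_elim simp
qed

text \<open>An indicator is integer valued, so the dyadic product of level 0 already is the exact
  product and all higher levels agree with it.\<close>

lemma tangent_cut:
  assumes T: "T \<in> TM" and p: "p \<in> PF" and A: "A \<in> sets m"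
  shows "preform_dyadic_mult 0 (indicator A) p \<in> PF"
    "AE x in m. T (\<lambda>_. preform_dyadic_mult 0 (indicator A) p) x = indicator A x * T (\<lambda>_. p) x"
proof -
  let ?h = "indicator A :: 'a \<Rightarrow> real"
  note P = preformsD[OF p] and c = cotangent_const[OF p] and h = indicator_Linf[OF A]
  have hm: "?h \<in> borel_measurable m" using h by (simp add: Linf_def)
  show q: "preform_dyadic_mult 0 ?h p \<in> PF" by (rule preforms_mult[OF p h])
  have part: "partitioned (preform_diff (preform_dyadic_mult n ?h p) (preform_dyadic_mult 0 ?h p))" for n
    by (intro partitioned_diff partitioned_mult P(1) hm)
  have "AE x in m. pn (preform_diff (preform_dyadic_mult n ?h p) (preform_dyadic_mult 0 ?h p)) x = 0" for n
    using N_zero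
  proof eventually_elim
    case (elim x)
    obtain j where j: "x \<in> fst (p j)" using rep_exists[OF P(1)] by blast
    then have r: "rep p x (snd (p j))" by (auto simp: rep_def)
    have fl: "\<lfloor>2 ^ n :: real\<rfloor> = 2 ^ n" by (metis floor_of_int of_int_numeral of_int_power)
    have "(\<lambda>y. of_int \<lfloor>2 ^ n * ?h x\<rfloor> / 2 ^ n * snd (p j) y - of_int \<lfloor>2 ^ 0 * ?h x\<rfloor> / 2 ^ 0 * snd (p j) y) = (\<lambda>y. 0)"
      by (cases "x \<in> A") (simp_all add: fl)
    then show ?case using pn_rep[OF part rep_diff[OF rep_mult[OF r] rep_mult[OF r]]] elim by simp
  qed
  from L2_norm_AE_zero[OF pn_measurable[OF part] this]
  have z: "(\<lambda>n. L2_norm m (pn (preform_diff (form_mult ?h (\<lambda>_. p) n) (preform_dyadic_mult 0 ?h p)))) \<longlonglongrightarrow> 0"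
    by (simp add: form_mult_def)
  from tangent_equiv[OF T cotangent_mult[OF c h] cotangent_const[OF q] z] tangentD(3)[OF T h c]
  show "AE x in m. T (\<lambda>_. preform_dyadic_mult 0 ?h p) x = ?h x * T (\<lambda>_. p) x"
    by eventually_elim simp
qed

lemma quadratic_nonneg_imp_zero:
  fixes D M :: real
  assumes M: "0 \<le> M" and q: "\<And>t. 0 \<le> t * D + 1/2 * t\<^sup>2 * M"
  shows "D = 0"
proof (rule ccontr)
  assume D: "D \<noteq> 0"
  \<comment> \<open>The test value \<open>t = - s * D\<close> keeps the quadratic term below half of
    the linear gain.\<close>
  define s where "s = 1 / (M + 1)"
  have s: "0 < s" "s * M \<le> 1" using M by (auto simp: s_def field_simps)
  have "0 \<le> (- s * D) * D + 1/2 * (- s * D)\<^sup>2 * M" by (rule q)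
  also have "\<dots> = - s * D\<^sup>2 * (1 - 1/2 * (s * M))" by (simp add: power2_eq_square algebra_simps)
  also have "\<dots> < 0"
    using s D by (intro mult_neg_pos) (auto simp: mult_neg_pos)
  finally show False by simp
qed

text \<open>An unbounded functional admits preforms with value of modulus 1 and norms tending to 0,
  by homogeneity. They converge to the zero form, which contradicts continuity.\<close>

lemma tangent_functional_bounded:
  assumes T: "T \<in> TM"
  shows "\<exists>C. \<forall>p\<in>PF. \<bar>LINT x|m. T (\<lambda>_. p) x\<bar> \<le> C * L2_norm m (pn p)"
proof (rule ccontr)
  define l where "l p = (LINT x|m. T (\<lambda>_. p) x)" for p
  have l_int: "integrable m (T (\<lambda>_. p))" if "p \<in> PF" for p by (rule tangentD(1)[OF T cotangent_const[OF that]])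
  have l_scale: "l (scale t p) = t * l p" if p: "p \<in> PF" for t p
  proof -
    have "l (scale t p) = (LINT x|m. t * T (\<lambda>_. p) x)"
      unfolding l_def using tangent_scale[OF T p, of t] l_int[OF p] l_int[OF preforms_scale(1)[OF p], of t]
      by (intro integral_cong_AE) auto
    then show ?thesis by (simp add: l_def)
  qed
  assume "\<not> ?thesis"
  then have "\<forall>C. \<exists>p\<in>PF. C * L2_norm m (pn p) < \<bar>l p\<bar>" by (auto simp: l_def not_le)
  then have "\<forall>n. \<exists>p. p \<in> PF \<and> real (Suc n) * L2_norm m (pn p) < \<bar>l p\<bar>" by blast
  then obtain p where p: "\<And>n. p n \<in> PF" "\<And>n. real (Suc n) * L2_norm m (pn (p n)) < \<bar>l (p n)\<bar>" by metis
  have zS: "(\<lambda>x::'a. 0::real) \<in> S" using weak_slope_zero sobolev_iff_weak_slope by blast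
  define z where "z = single (\<lambda>_::'a. 0)"
  have z: "z \<in> PF" unfolding z_def by (rule preforms_single[OF zS])
  have "scale 0 z = z" by (simp add: scale_def z_def single_def)
  then have lz: "l z = 0" using l_scale[OF z, of 0] by simp
  have nz: "L2_norm m (pn z) = 0" using preforms_scale(2)[OF z, of 0] \<open>scale 0 z = z\<close> by simp
  define q where "q n = scale (1 / (\<bar>l (p n)\<bar>)) (p n)" for n
  have lp: "0 < \<bar>l (p n)\<bar>" for n
    using p(2)[of n] by (intro le_less_trans[OF _ p(2)[of n]]) simp
  have q: "q n \<in> PF" for n unfolding q_def by (rule preforms_scale(1)[OF p(1)])
  have ql: "\<bar>l (q n)\<bar> = 1" for n unfolding q_def l_scale[OF p(1)] using lp[of n] by (simp add: abs_mult)
  have qn: "L2_norm m (pn (q n)) \<le> inverse (real (Suc n))" for n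
  proof -
    have "L2_norm m (pn (q n)) = L2_norm m (pn (p n)) / \<bar>l (p n)\<bar>"
      unfolding q_def preforms_scale(2)[OF p(1)] by simp
    also have "\<dots> \<le> inverse (real (Suc n))"
    proof -
      have "L2_norm m (pn (p n)) * real (Suc n) \<le> \<bar>l (p n)\<bar>" using p(2)[of n] by (simp only: mult.commute less_imp_le)
      then show ?thesis using lp[of n] by (simp add: divide_le_eq inverse_eq_divide le_divide_eq mult.commute del: of_nat_Suc)
    qed
    finally show ?thesis .
  qed
  have "nn (form_diff (\<lambda>_. q n) (\<lambda>_. z)) \<le> inverse (real (Suc n))" for n
  proof -
    note Q = preformsD[OF q[of n]] and Z = preformsD[OF z]
    have e: "form_diff (\<lambda>_. q n) (\<lambda>_. z) = (\<lambda>_. preform_diff (q n) z)" by (simp add: form_diff_def)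
    have "nn (form_diff (\<lambda>_. q n) (\<lambda>_. z)) = L2_norm m (pn (preform_diff (q n) z))"
      unfolding e by (rule nn_const[OF preforms_diff[OF q z]])
    also have "\<dots> \<le> L2_norm m (\<lambda>x. pn (q n) x + pn z x)"
      by (intro L2_norm_abs_mono pn_diff_L2 q z L2_add Q Z pn_nonneg partitioned_diff pn_diff_le)
    also have "\<dots> \<le> L2_norm m (pn (q n)) + L2_norm m (pn z)" by (rule L2_norm_triangle[OF Q(2) Z(2)])
    finally show ?thesis using qn[of n] nz by simp
  qed
  then have "(\<lambda>n. nn (form_diff (\<lambda>_. q n) (\<lambda>_. z))) \<longlonglongrightarrow> 0"
    by (intro tendsto_sandwich[OF _ _ tendsto_const LIMSEQ_inverse_real_of_nat]) auto
  then have "L1_lim m (\<lambda>n. T (\<lambda>_. q n)) (T (\<lambda>_. z))"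
    by (intro tangentD(4)[OF T] cotangent_const q z)
  from L1_lim_integral[OF this] have "(\<lambda>n. l (q n)) \<longlonglongrightarrow> 0" using lz by (simp add: l_def)
  then have "(\<lambda>n. \<bar>l (q n)\<bar>) \<longlonglongrightarrow> 0" by (rule tendsto_rabs_zero)
  then show False unfolding ql using LIMSEQ_unique[OF tendsto_const] by fastforce
qed

text \<open>Riesz representation: minimize \<open>|p|\<^sup>2 / 2 - \<integral> T p\<close> over preforms. They are dense in the
  completion, and a minimizing sequence of preforms is Cauchy, hence itself a form.\<close>

lemma riesz_exists:
  assumes T: "T \<in> TM"
  shows "\<exists>\<omega>\<in>CT. \<forall>\<eta>\<in>CT. AE x in m. T \<eta> x = fi \<omega> \<eta> x"
proof -
  define l where "l p = (LINT x|m. T (\<lambda>_. p) x)" for p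
  define n2 where "n2 p = (L2_norm m (pn p))\<^sup>2" for p
  define J where "J p = 1/2 * n2 p - l p" for p
  have l_int: "integrable m (T (\<lambda>_. p))" if "p \<in> PF" for p by (rule tangentD(1)[OF T cotangent_const[OF that]])
  have l_scale: "l (scale t p) = t * l p" if p: "p \<in> PF" for t p
  proof -
    have "l (scale t p) = (LINT x|m. t * T (\<lambda>_. p) x)"
      unfolding l_def using tangent_scale[OF T p, of t] l_int[OF p] l_int[OF preforms_scale(1)[OF p], of t]
      by (intro integral_cong_AE) auto
    then show ?thesis by (simp add: l_def)
  qed
  have l_add: "l (preform_add p q) = l p + l q" if p: "p \<in> PF" and q: "q \<in> PF" for p q
  proof -
    have "form_add (\<lambda>_. p) (\<lambda>_. q) = (\<lambda>_. preform_add p q)" by (simp add: form_add_def)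
    then have "AE x in m. T (\<lambda>_. preform_add p q) x = T (\<lambda>_. p) x + T (\<lambda>_. q) x"
      using tangentD(2)[OF T cotangent_const[OF p] cotangent_const[OF q]] by simp
    then have "l (preform_add p q) = (LINT x|m. T (\<lambda>_. p) x + T (\<lambda>_. q) x)"
      unfolding l_def using l_int[OF p] l_int[OF q] l_int[OF preforms_add[OF p q]]
      by (intro integral_cong_AE) auto
    then show ?thesis using l_int[OF p] l_int[OF q] by (simp add: l_def)
  qed
  have n2_scale: "n2 (scale t p) = t\<^sup>2 * n2 p" if "p \<in> PF" for t p
    unfolding n2_def preforms_scale(2)[OF that] by (simp add: power_mult_distrib)
  obtain C where C: "\<And>p. p \<in> PF \<Longrightarrow> \<bar>l p\<bar> \<le> C * L2_norm m (pn p)"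
    using tangent_functional_bounded[OF T] unfolding l_def by blast
  \<comment> \<open>Completing the square, with the constant \<open>C\<close> that bounds the
    functional.\<close>
  have J_ge: "- (C\<^sup>2 / 2) \<le> J p" if p: "p \<in> PF" for p
  proof -
    have "0 \<le> 1/2 * (L2_norm m (pn p) - C)\<^sup>2" by simp
    also have "\<dots> = 1/2 * n2 p - C * L2_norm m (pn p) + C\<^sup>2 / 2"
      by (simp add: n2_def power2_diff field_simps)
    finally show ?thesis using C[OF p] unfolding J_def by linarith
  qed
  define I where "I = Inf (J ` PF)"
  have bdd: "bdd_below (J ` PF)" using J_ge by (intro bdd_belowI2[of _ "- (C\<^sup>2 / 2)"]) auto
  have I_le: "I \<le> J p" if "p \<in> PF" for p unfolding I_def using that by (intro cInf_lower bdd) auto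
  have zS: "(\<lambda>x::'a. 0::real) \<in> S" using weak_slope_zero sobolev_iff_weak_slope by blast
  have ne: "J ` PF \<noteq> {}" using preforms_single[OF zS] by blast
  define i where "i n = inverse (real (Suc n))" for n
  have i_pos: "0 < i n" for n by (simp add: i_def)
  have i_mono: "i k \<le> i n" if "n \<le> k" for n k
    unfolding i_def using that by (intro le_imp_inverse_le) auto
  have i_lim: "i \<longlonglongrightarrow> 0" unfolding i_def by (rule LIMSEQ_inverse_real_of_nat)
  have "\<exists>p. p \<in> PF \<and> J p < I + i n" for n
  proof -
    have "Inf (J ` PF) < I + i n" using i_pos[of n] unfolding I_def by simp
    from cInf_lessD[OF ne this] show ?thesis by blast
  qed
  then obtain \<omega> where \<omega>: "\<And>n. \<omega> n \<in> PF" "\<And>n. J (\<omega> n) < I + i n" by metis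
  have cauchy: "n2 (preform_diff p q) \<le> 4 * (J p + J q - 2 * I)" if p: "p \<in> PF" and q: "q \<in> PF" for p q
  proof -
    have "I \<le> J (scale (1/2) (preform_add p q))"
      by (intro I_le preforms_scale(1) preforms_add p q)
    also have "\<dots> = 1/8 * n2 (preform_add p q) - 1/2 * (l p + l q)"
      unfolding J_def n2_scale[OF preforms_add[OF p q]] l_scale[OF preforms_add[OF p q]] l_add[OF p q]
      by (simp add: power2_eq_square)
    finally show ?thesis
      using pn_parallelogram(1)[OF p q] unfolding J_def n2_def by argo
  qed
  have \<omega>CT: "\<omega> \<in> CT"
    unfolding cotangent_def
  proof (intro CollectI conjI allI impI \<omega>(1))
    fix e :: real assume e: "0 < e"
    \<comment> \<open>Two near-minimizers exceed the infimum by at most \<open>2 * i N\<close>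
      together, and the midpoint estimate \<open>cauchy\<close> contributes a factor 4.\<close>
    then have "0 < e\<^sup>2 / 8" by simp
    from order_tendstoD(2)[OF i_lim this] obtain N where N: "i N < e\<^sup>2 / 8" by (auto simp: eventually_sequentially)
    have "L2_norm m (pn (preform_diff (\<omega> n) (\<omega> k))) < e" if nk: "N \<le> n" "N \<le> k" for n k
    proof -
      have "n2 (preform_diff (\<omega> n) (\<omega> k)) < e\<^sup>2"
        using cauchy[OF \<omega>(1) \<omega>(1), of n k] \<omega>(2)[of n] \<omega>(2)[of k] i_mono[OF nk(1)] i_mono[OF nk(2)] N by argo
      then show ?thesis using e unfolding n2_def by (intro power2_less_imp_less[of _ e]) auto
    qed
    then show "\<exists>N. \<forall>n\<ge>N. \<forall>k\<ge>N. L2_norm m (pn (preform_diff (\<omega> n) (\<omega> k))) < e" by blast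
  qed
  \<comment> \<open>\<open>J (\<omega> n)\<close> is within \<open>i n\<close> of the infimum, so a
    variation by \<open>t\<close> times \<open>q\<close> lowers it by at most \<open>i n\<close>. In
    the limit the quadratic in \<open>t\<close> is nonnegative, hence its linear coefficient
    vanishes.\<close>
  have euler: "(LINT x|m. fi \<omega> (\<lambda>_. q) x) = l q" if q: "q \<in> PF" for q
  proof -
    let ?A = "\<lambda>n. LINT x|m. pg (\<omega> n) q x" and ?B = "LINT x|m. fi \<omega> (\<lambda>_. q) x"
    have A_lim: "?A \<longlonglongrightarrow> ?B" by (rule L1_lim_integral[OF fi_lim[OF \<omega>CT cotangent_const[OF q]]])
    have "0 \<le> t * (?B - l q) + 1/2 * t\<^sup>2 * n2 q" for t
    proof (rule LIMSEQ_le_const)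
      have "(\<lambda>n. i n + (t * (?A n - l q) + 1/2 * t\<^sup>2 * n2 q)) \<longlonglongrightarrow> 0 + (t * (?B - l q) + 1/2 * t\<^sup>2 * n2 q)"
        by (intro tendsto_intros A_lim i_lim)
      then show "(\<lambda>n. i n + (t * (?A n - l q) + 1/2 * t\<^sup>2 * n2 q)) \<longlonglongrightarrow> t * (?B - l q) + 1/2 * t\<^sup>2 * n2 q"
        by simp
      have "0 \<le> i n + (t * (?A n - l q) + 1/2 * t\<^sup>2 * n2 q)" for n
      proof -
        note sq = preforms_scale(1)[OF q, of t]
        note W = preformsD[OF \<omega>(1)[of n]] and Q = preformsD[OF q]
        have "(LINT x|m. pg (\<omega> n) (scale t q) x) = (LINT x|m. t * pg (\<omega> n) q x)"
          using pg_scale[OF W(1) Q(1), of t] integrable_pg[OF \<omega>(1)[of n] q] integrable_pg[OF \<omega>(1)[of n] sq]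
          by (intro integral_cong_AE) auto
        then have a: "n2 (preform_add (\<omega> n) (scale t q)) = n2 (\<omega> n) + 2 * (t * ?A n) + t\<^sup>2 * n2 q"
          using pn_parallelogram(2)[OF \<omega>(1)[of n] sq] n2_scale[OF q, of t] unfolding n2_def by simp
        have "I \<le> J (preform_add (\<omega> n) (scale t q))" by (intro I_le preforms_add \<omega>(1) sq)
        also have "\<dots> = J (\<omega> n) + (t * ?A n - t * l q + 1/2 * (t\<^sup>2 * n2 q))"
          unfolding J_def a l_add[OF \<omega>(1) sq] l_scale[OF q] by (simp add: algebra_simps)
        finally have "0 \<le> i n + (t * ?A n - t * l q + 1/2 * (t\<^sup>2 * n2 q))" using \<omega>(2)[of n] by linarith
        then show ?thesis by (simp add: right_diff_distrib mult.assoc)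
      qed
      then show "\<exists>N. \<forall>n\<ge>N. 0 \<le> i n + (t * (?A n - l q) + 1/2 * t\<^sup>2 * n2 q)" by blast
    qed
    then have "?B - l q = 0" by (intro quadratic_nonneg_imp_zero[of "n2 q"]) (auto simp: n2_def)
    then show ?thesis by simp
  qed
  have U: "fi \<omega> \<in> TM" by (rule fi_tangent[OF \<omega>CT])
  have const: "AE x in m. T (\<lambda>_. q) x = fi \<omega> (\<lambda>_. q) x" if q: "q \<in> PF" for q
  proof -
    note c = cotangent_const[OF q]
    note I = tangentD(1)[OF T c] tangentD(1)[OF U c]
    \<comment> \<open>Testing the integrated identity on \<open>q\<close> cut down to a compact set
      turns it into a pointwise one.\<close>
    have zero: "(LINT x|m. indicator K x * (T (\<lambda>_. q) x - fi \<omega> (\<lambda>_. q) x)) = 0" if "compact K" for K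
    proof -
      have K: "K \<in> sets m" using that by (simp add: sets_m borel_compact)
      note q' = tangent_cut(1)[OF T q K]
      note J = tangentD(1)[OF T cotangent_const[OF q']] tangentD(1)[OF U cotangent_const[OF q']]
      have i: "integrable m (\<lambda>x. indicator K x * T (\<lambda>_. q) x)" "integrable m (\<lambda>x. indicator K x * fi \<omega> (\<lambda>_. q) x)"
        using integrable_mult_indicator[OF K I(1)] integrable_mult_indicator[OF K I(2)] by simp_all
      have "(LINT x|m. indicator K x * T (\<lambda>_. q) x) = l (preform_dyadic_mult 0 (indicator K) q)"
        unfolding l_def using tangent_cut(2)[OF T q K] i J by (intro integral_cong_AE) auto
      also have "\<dots> = (LINT x|m. fi \<omega> (\<lambda>_. preform_dyadic_mult 0 (indicator K) q) x)" by (rule euler[OF q', symmetric])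
      also have "\<dots> = (LINT x|m. indicator K x * fi \<omega> (\<lambda>_. q) x)"
        using tangent_cut(2)[OF U q K] i J by (intro integral_cong_AE) auto
      finally show ?thesis using i by (simp add: right_diff_distrib)
    qed
    have "AE x in m. T (\<lambda>_. q) x - fi \<omega> (\<lambda>_. q) x \<le> 0"
      by (rule AE_nonpos_of_compact_integrals[OF sets_m]) (use I zero in auto)
    moreover have "AE x in m. - 1 * (T (\<lambda>_. q) x - fi \<omega> (\<lambda>_. q) x) \<le> 0"
    proof (rule AE_nonpos_of_compact_integrals[OF sets_m])
      show "integrable m (\<lambda>x. - 1 * (T (\<lambda>_. q) x - fi \<omega> (\<lambda>_. q) x))"
        by (intro integrable_mult_right Bochner_Integration.integrable_diff I)
      fix K :: "'a set" assume K: "compact K"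
      have "(LINT x|m. indicator K x * (- 1 * (T (\<lambda>_. q) x - fi \<omega> (\<lambda>_. q) x)))
          = (LINT x|m. - 1 * (indicator K x * (T (\<lambda>_. q) x - fi \<omega> (\<lambda>_. q) x)))"
        by (intro Bochner_Integration.integral_cong) (auto simp: algebra_simps)
      also have "\<dots> = 0" using zero[OF K] by (simp only: integral_mult_right_zero)
      finally show "(LINT x|m. indicator K x * (- 1 * (T (\<lambda>_. q) x - fi \<omega> (\<lambda>_. q) x))) \<le> 0" by simp
    qed
    ultimately show ?thesis by eventually_elim simp
  qed
  have "AE x in m. T \<eta> x = fi \<omega> \<eta> x" if "\<eta> \<in> CT" for \<eta>
  proof (rule tangent_eqI[OF T U _ that])
    show "AE x in m. T (differential m f) x = fi \<omega> (differential m f) x" if "f \<in> S" for f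
      unfolding differential_single by (rule const[OF preforms_single[OF that]])
  qed
  then show ?thesis using \<omega>CT by blast
qed

end

section \<open>Modules under a conformal change\<close>

lemma L2_lim_cong:
  assumes F: "L2_lim m F f" and G: "\<And>n. G n \<in> borel_measurable m" and eq: "\<And>n. AE x in m. G n x = F n x"
  shows "L2_lim m G f"
proof (rule L2_lim_squeeze[OF _ _ _ L2_limD(3)[OF F]])
  note D = L2_limD[OF F]
  show G2: "G n \<in> L2 m" for n
    by (rule L2_bounded[OF G D(1)[of n]]) (use eq[of n] in \<open>auto elim!: eventually_mono\<close>)
  show "L2_norm m (\<lambda>x. G n x - f x) \<le> L2_norm m (\<lambda>x. F n x - f x)" for n
    using eq[of n] L2_diff[OF G2[of n] D(2)] L2_diff[OF D(1)[of n] D(2)]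
    by (intro L2_norm_mono L2_measurable) (auto elim!: eventually_mono)
qed (rule L2_limD(2)[OF F])

locale conformal_hilbertian = conformal m v w + hilbertian m
  for m :: "'a::polish_space measure" and v w
begin

abbreviation "N' \<equiv> min_slope d' m'"
abbreviation "pn' \<equiv> preform_norm d' m'"
abbreviation "nf' \<equiv> form_norm d' m'"
abbreviation "fi' \<equiv> form_inner d' m'"

lemma N'_AE: "f \<in> S \<Longrightarrow> AE x in m. N' f x = exp (- w x) * N f x"
  by (rule min_slope_conformal[OF is_min_slope_N])

lemma N'_L2:
  assumes "f \<in> S"
  shows "N' f \<in> L2 m"
proof -
  have "is_min_slope d' m' f (N' f)"
    by (rule is_min_slope_min_slope[OF is_min_slope_conformal[OF is_min_slope_N[OF assms]]])
  then have "relaxed_slope d' m' f (N' f)" by (simp add: is_min_slope_def)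
  then show ?thesis unfolding relaxed_slope_def L2_lim_m' using L2_limD(2) by blast
qed

lemma pn'_AE:
  assumes p: "partitioned p"
  shows "AE x in m. pn' p x = exp (- w x) * pn p x"
proof -
  have "AE x in m. \<forall>i. N' (snd (p i)) x = exp (- w x) * N (snd (p i)) x"
    unfolding AE_all_countable using p N'_AE by (auto simp: partitioned_def)
  then show ?thesis
  proof eventually_elim
    case (elim x)
    obtain i where i: "x \<in> fst (p i)" using rep_exists[OF p] by blast
    have "x \<notin> fst (p j)" if "j \<noteq> i" for j
      using p i that unfolding partitioned_def disjoint_family_on_def by blast
    then have s: "summable (\<lambda>j. indicator (fst (p j)) x * N (snd (p j)) x)"
      by (intro summable_finite[of "{i}"]) auto
    have "pn' p x = (\<Sum>j. exp (- w x) * (indicator (fst (p j)) x * N (snd (p j)) x))"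
      unfolding preform_norm_def using elim by (simp add: mult.left_commute)
    also have "\<dots> = exp (- w x) * pn p x" unfolding preform_norm_def by (rule suminf_mult[OF s])
    finally show ?case .
  qed
qed

lemma pn'_measurable:
  assumes "partitioned p"
  shows "pn' p \<in> borel_measurable m"
proof -
  have "(\<lambda>x. \<Sum>i. indicator (fst (p i)) x * N' (snd (p i)) x) \<in> borel_measurable m"
    using assms L2_measurable[OF N'_L2]
    by (intro borel_measurable_suminf borel_measurable_times borel_measurable_indicator) (auto simp: partitioned_def)
  then show ?thesis by (simp add: preform_norm_def[abs_def])
qed

text \<open>The function \<open>exp (v x - 2 * w x)\<close> is the density of the energy on
  \<open>M'\<close> relative to the energy on \<open>M\<close>.\<close>

lemma weight_bounds:
  obtains K where "1 \<le> K" "\<And>x. exp (v x) * (exp (- w x))\<^sup>2 \<le> K" "\<And>x. 1 \<le> K * (exp (v x) * (exp (- w x))\<^sup>2)"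
proof -
  obtain V where V: "\<And>x. \<bar>v x\<bar> \<le> V" using v_bound by blast
  obtain W where W: "\<And>x. \<bar>w x\<bar> \<le> W" using w_bound by blast
  have e: "exp (v x) * (exp (- w x))\<^sup>2 = exp (v x - 2 * w x)" for x
  proof -
    have "exp (v x) * (exp (- w x))\<^sup>2 = exp (v x + (- w x + - w x))"
      by (simp only: exp_add power2_eq_square)
    then show ?thesis by (simp add: algebra_simps)
  qed
  have nn: "0 \<le> V" "0 \<le> W" using V[of undefined] W[of undefined] by linarith+
  have "v x - 2 * w x \<le> V + 2 * W" "0 \<le> (V + 2 * W) + (v x - 2 * w x)" for x
    using V[of x] W[of x] by linarith+
  then show thesis
    using nn by (intro that[of "exp (V + 2 * W)"]) (auto simp: e exp_add[symmetric])
qed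

lemma nn_integral_m':
  "f \<in> borel_measurable m \<Longrightarrow> (\<integral>\<^sup>+x. f x \<partial>m') = (\<integral>\<^sup>+x. ennreal (exp (v x)) * f x \<partial>m)"
  unfolding conformal_measure_def by (subst nn_integral_density) auto

text \<open>\<open>preforms_iff\<close> speaks of \<open>dist\<close> and \<open>m\<close>, so on
  the conformal side the defining sums are compared instead: each term changes by a factor that is
  bounded from above and from below.\<close>

lemma preforms_conformal: "preforms d' m' = PF"
proof -
  obtain K where K: "1 \<le> K" "\<And>x. exp (v x) * (exp (- w x))\<^sup>2 \<le> K" "\<And>x. 1 \<le> K * (exp (v x) * (exp (- w x))\<^sup>2)"
    using weight_bounds by blast
  have "(\<Sum>i. \<integral>\<^sup>+x\<in>fst (p i). ennreal ((N' (snd (p i)) x)\<^sup>2) \<partial>m') < \<infinity> \<longleftrightarrow>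
      (\<Sum>i. \<integral>\<^sup>+x\<in>fst (p i). ennreal ((N (snd (p i)) x)\<^sup>2) \<partial>m) < \<infinity>" if p: "partitioned p" for p
  proof -
    let ?a = "\<lambda>i. \<integral>\<^sup>+x\<in>fst (p i). ennreal ((N' (snd (p i)) x)\<^sup>2) \<partial>m'"
    let ?b = "\<lambda>i. \<integral>\<^sup>+x\<in>fst (p i). ennreal ((N (snd (p i)) x)\<^sup>2) \<partial>m"
    have ab: "?a i = (\<integral>\<^sup>+x\<in>fst (p i). ennreal (exp (v x) * (exp (- w x))\<^sup>2 * (N (snd (p i)) x)\<^sup>2) \<partial>m)" for i
    proof -
      have f: "snd (p i) \<in> S" "fst (p i) \<in> sets m" using p by (auto simp: partitioned_def)
      note [measurable] = L2_measurable[OF N'_L2[OF f(1)]] L2_measurable[OF N_L2[OF f(1)]] f(2)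
      have "?a i = (\<integral>\<^sup>+x. ennreal (exp (v x)) * (ennreal ((N' (snd (p i)) x)\<^sup>2) * indicator (fst (p i)) x) \<partial>m)"
        by (rule nn_integral_m') measurable
      also have "\<dots> = (\<integral>\<^sup>+x\<in>fst (p i). ennreal (exp (v x) * (exp (- w x))\<^sup>2 * (N (snd (p i)) x)\<^sup>2) \<partial>m)"
        using N'_AE[OF f(1)]
      proof (intro nn_integral_cong_AE, eventually_elim)
        case (elim x)
        show ?case unfolding elim
          by (simp add: power_mult_distrib ennreal_mult[symmetric] mult.assoc[symmetric])
      qed
      finally show ?thesis .
    qed
    have meas: "(\<lambda>x. ennreal ((N (snd (p i)) x)\<^sup>2) * indicator (fst (p i)) x) \<in> borel_measurable m"
       "(\<lambda>x. ennreal (exp (v x) * (exp (- w x))\<^sup>2 * (N (snd (p i)) x)\<^sup>2) * indicator (fst (p i)) x) \<in> borel_measurable m" for i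
    proof -
      have f: "snd (p i) \<in> S" "fst (p i) \<in> sets m" using p by (auto simp: partitioned_def)
      note [measurable] = L2_measurable[OF N_L2[OF f(1)]] f(2)
      show "(\<lambda>x. ennreal ((N (snd (p i)) x)\<^sup>2) * indicator (fst (p i)) x) \<in> borel_measurable m"
       "(\<lambda>x. ennreal (exp (v x) * (exp (- w x))\<^sup>2 * (N (snd (p i)) x)\<^sup>2) * indicator (fst (p i)) x) \<in> borel_measurable m"
        by measurable
    qed
    have le1: "?a i \<le> ennreal K * ?b i" for i
    proof -
      have "?a i \<le> (\<integral>\<^sup>+x. ennreal K * (ennreal ((N (snd (p i)) x)\<^sup>2) * indicator (fst (p i)) x) \<partial>m)"
        unfolding ab using K(1,2)
        by (intro nn_integral_mono) (auto simp: indicator_def ennreal_mult[symmetric] intro!: ennreal_leI mult_right_mono)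
      also have "\<dots> = ennreal K * ?b i" by (rule nn_integral_cmult[OF meas(1)])
      finally show ?thesis .
    qed
    have le2: "?b i \<le> ennreal K * ?a i" for i
    proof -
      have "?b i \<le> (\<integral>\<^sup>+x. ennreal K * (ennreal (exp (v x) * (exp (- w x))\<^sup>2 * (N (snd (p i)) x)\<^sup>2) * indicator (fst (p i)) x) \<partial>m)"
      proof (intro nn_integral_mono)
        fix x
        have "1 * (N (snd (p i)) x)\<^sup>2 \<le> (K * (exp (v x) * (exp (- w x))\<^sup>2)) * (N (snd (p i)) x)\<^sup>2"
          using K(3) by (intro mult_right_mono) auto
        then have "(N (snd (p i)) x)\<^sup>2 \<le> K * (exp (v x) * (exp (- w x))\<^sup>2 * (N (snd (p i)) x)\<^sup>2)"
          by (simp only: mult.assoc mult_1)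
        then show "ennreal ((N (snd (p i)) x)\<^sup>2) * indicator (fst (p i)) x \<le>
            ennreal K * (ennreal (exp (v x) * (exp (- w x))\<^sup>2 * (N (snd (p i)) x)\<^sup>2) * indicator (fst (p i)) x)"
          using K(1) by (auto simp: indicator_def ennreal_mult[symmetric] intro!: ennreal_leI)
      qed
      also have "\<dots> = ennreal K * ?a i" unfolding ab by (rule nn_integral_cmult[OF meas(2)])
      finally show ?thesis .
    qed
    have A: "(\<Sum>i. ?a i) \<le> ennreal K * (\<Sum>i. ?b i)"
      unfolding ennreal_suminf_cmult[symmetric] by (intro suminf_le le1) auto
    have B: "(\<Sum>i. ?b i) \<le> ennreal K * (\<Sum>i. ?a i)"
      unfolding ennreal_suminf_cmult[symmetric] by (intro suminf_le le2) auto
    have fin: "ennreal K * t < \<infinity>" if "t < \<infinity>" for t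
      using that by (simp add: ennreal_mult_less_top)
    show ?thesis
    proof
      assume "(\<Sum>i. ?a i) < \<infinity>"
      then show "(\<Sum>i. ?b i) < \<infinity>" by (rule le_less_trans[OF B fin])
    next
      assume "(\<Sum>i. ?b i) < \<infinity>"
      then show "(\<Sum>i. ?a i) < \<infinity>" by (rule le_less_trans[OF A fin])
    qed
  qed
  note iff = this
  have 1: "p \<in> preforms d' m' \<longleftrightarrow> partitioned p \<and> (\<Sum>i. \<integral>\<^sup>+x\<in>fst (p i). ennreal ((N' (snd (p i)) x)\<^sup>2) \<partial>m') < \<infinity>" for p
    unfolding preforms_def sobolev_conformal sets_m' space_m' partitioned_def mem_Collect_eq by (rule iffI; elim conjE; intro conjI)
  have 2: "p \<in> PF \<longleftrightarrow> partitioned p \<and> (\<Sum>i. \<integral>\<^sup>+x\<in>fst (p i). ennreal ((N (snd (p i)) x)\<^sup>2) \<partial>m) < \<infinity>" for p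
    unfolding preforms_def space_m partitioned_def mem_Collect_eq by (rule iffI; elim conjE; intro conjI)
  have "p \<in> preforms d' m' \<longleftrightarrow> p \<in> PF" for p
    unfolding 1 2 by (rule conj_cong[OF refl iff])
  then show ?thesis by (rule set_eqI)
qed

text \<open>One constant accounts for the change of measure and of the pointwise norm together;
  \<open>g\<close> and \<open>g'\<close> stand for the pointwise norms of the same object on
  \<open>M\<close> and on \<open>M'\<close>.\<close>

lemma conformal_norm_bounds:
  obtains K where "1 \<le> K"
    "\<And>g g'. g \<in> L2 m \<Longrightarrow> g' \<in> borel_measurable m \<Longrightarrow> AE x in m. g' x = exp (- w x) * g x \<Longrightarrow>
      L2_norm m' g' \<le> K * L2_norm m g \<and> L2_norm m g \<le> K * L2_norm m' g'"
proof -
  obtain A where A: "1 \<le> A" "\<And>f. f \<in> L2 m \<Longrightarrow> L2_norm m' f \<le> A * L2_norm m f"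
    "\<And>f. f \<in> L2 m \<Longrightarrow> L2_norm m f \<le> A * L2_norm m' f" using L2_norm_m'_bounds by blast
  obtain W where W: "\<And>x. \<bar>w x\<bar> \<le> W" using w_bound by blast
  have W': "\<bar>exp (- w x)\<bar> \<le> exp W" "\<bar>exp (w x)\<bar> \<le> exp W" for x using W[of x] by auto
  have W0: "0 \<le> W" using W[of undefined] by linarith
  show thesis
  proof (rule that[of "A * exp W"])
    have "1 * 1 \<le> A * exp W" using A(1) W0 by (intro mult_mono) auto
    then show "1 \<le> A * exp W" by simp
    fix g g' assume g: "g \<in> L2 m" and g': "g' \<in> borel_measurable m" and eq: "AE x in m. g' x = exp (- w x) * g x"
    note B = L2_bounded_mult[OF _ W'(1) g]
    have g2: "g' \<in> L2 m"
      by (rule L2_bounded[OF g' B(1)]) (use eq in \<open>auto elim!: eventually_mono\<close>)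
    have "L2_norm m g' = L2_norm m (\<lambda>x. exp (- w x) * g x)"
      using eq by (intro L2_norm_cong_AE g' L2_measurable[OF B(1)]) (auto elim!: eventually_mono)
    also have "\<dots> \<le> exp W * L2_norm m g" by (rule B(2)) measurable
    finally have 1: "L2_norm m g' \<le> exp W * L2_norm m g" .
    note B' = L2_bounded_mult[OF _ W'(2) g2]
    have "L2_norm m g = L2_norm m (\<lambda>x. exp (w x) * g' x)"
      using eq by (intro L2_norm_cong_AE L2_measurable[OF g] L2_measurable[OF B'(1)])
        (auto elim!: eventually_mono simp: exp_cancel)
    also have "\<dots> \<le> exp W * L2_norm m g'" by (rule B'(2)) measurable
    finally have 2: "L2_norm m g \<le> exp W * L2_norm m g'" .
    have "L2_norm m' g' \<le> A * (exp W * L2_norm m g)"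
      using A(2)[OF g2] mult_left_mono[OF 1, of A] A(1) by linarith
    moreover have "L2_norm m g \<le> exp W * (A * L2_norm m' g')"
      by (rule order_trans[OF 2 mult_left_mono[OF A(3)[OF g2]]]) simp
    ultimately show "L2_norm m' g' \<le> A * exp W * L2_norm m g \<and> L2_norm m g \<le> A * exp W * L2_norm m' g'"
      by (simp add: mult_ac)
  qed
qed

lemma cauchy_comparable:
  fixes a b :: "nat \<Rightarrow> nat \<Rightarrow> real"
  assumes "\<And>n k. a n k \<le> K * b n k" "1 \<le> K" "\<forall>e>0. \<exists>N. \<forall>n\<ge>N. \<forall>k\<ge>N. b n k < e"
  shows "\<forall>e>0. \<exists>N. \<forall>n\<ge>N. \<forall>k\<ge>N. a n k < e"
proof (intro allI impI)
  fix e :: real assume "0 < e"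
  then have "0 < e / K" using assms(2) by simp
  then obtain N where N: "\<forall>n\<ge>N. \<forall>k\<ge>N. b n k < e / K" using assms(3) by blast
  have "a n k < e" if "N \<le> n" "N \<le> k" for n k
  proof -
    have "b n k < e / K" using N that by blast
    then have "K * b n k < e" using assms(2) by (simp add: field_simps)
    then show ?thesis using assms(1)[of n k] by linarith
  qed
  then show "\<exists>N. \<forall>n\<ge>N. \<forall>k\<ge>N. a n k < e" by blast
qed

lemma cotangent_conformal: "cotangent d' m' = CT"
proof -
  obtain K where K: "1 \<le> K"
    "\<And>g g'. g \<in> L2 m \<Longrightarrow> g' \<in> borel_measurable m \<Longrightarrow> AE x in m. g' x = exp (- w x) * g x \<Longrightarrow>
      L2_norm m' g' \<le> K * L2_norm m g \<and> L2_norm m g \<le> K * L2_norm m' g'" using conformal_norm_bounds by blast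
  have cmp: "L2_norm m' (pn' r) \<le> K * L2_norm m (pn r) \<and> L2_norm m (pn r) \<le> K * L2_norm m' (pn' r)" if "r \<in> PF" for r
    using preformsD[OF that] by (intro K(2) pn'_measurable pn'_AE)
  have "(\<forall>e>0. \<exists>N. \<forall>n\<ge>N. \<forall>k\<ge>N. L2_norm m' (pn' (preform_diff (\<omega> n) (\<omega> k))) < e) \<longleftrightarrow>
      (\<forall>e>0. \<exists>N. \<forall>n\<ge>N. \<forall>k\<ge>N. L2_norm m (pn (preform_diff (\<omega> n) (\<omega> k))) < e)" if \<omega>: "\<forall>n. \<omega> n \<in> PF" for \<omega> :: "'a form"
  proof -
    have "L2_norm m' (pn' (preform_diff (\<omega> n) (\<omega> k))) \<le> K * L2_norm m (pn (preform_diff (\<omega> n) (\<omega> k)))"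
      "L2_norm m (pn (preform_diff (\<omega> n) (\<omega> k))) \<le> K * L2_norm m' (pn' (preform_diff (\<omega> n) (\<omega> k)))" for n k
      using cmp[OF preforms_diff] \<omega> by auto
    then show ?thesis
      using cauchy_comparable[OF _ K(1), of "\<lambda>n k. L2_norm m' (pn' (preform_diff (\<omega> n) (\<omega> k)))" "\<lambda>n k. L2_norm m (pn (preform_diff (\<omega> n) (\<omega> k)))"]
        cauchy_comparable[OF _ K(1), of "\<lambda>n k. L2_norm m (pn (preform_diff (\<omega> n) (\<omega> k)))" "\<lambda>n k. L2_norm m' (pn' (preform_diff (\<omega> n) (\<omega> k)))"]
      by blast
  qed
  then show ?thesis unfolding cotangent_def preforms_conformal by blast
qed

text \<open>Convergence of the weighted norms first secures a limit for the \<open>SOME\<close> in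
  \<open>form_norm\<close> on \<open>M'\<close>; uniqueness of L2 limits then identifies it.\<close>

lemma nf'_AE:
  assumes \<omega>: "\<omega> \<in> CT"
  shows "nf' \<omega> \<in> L2 m" "AE x in m. nf' \<omega> x = exp (- w x) * nf \<omega> x"
proof -
  note D = cotangentD[OF \<omega>]
  have "L2_lim m (\<lambda>n x. exp (- 1 * w x) * pn (\<omega> n) x) (\<lambda>x. exp (- 1 * w x) * nf \<omega> x)"
    by (rule L2_lim_exp_w[OF form_norm_lim[OF \<omega>]])
  then have "L2_lim m (\<lambda>n x. exp (- w x) * pn (\<omega> n) x) (\<lambda>x. exp (- w x) * nf \<omega> x)" by simp
  then have lim: "L2_lim m (\<lambda>n. pn' (\<omega> n)) (\<lambda>x. exp (- w x) * nf \<omega> x)"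
    by (rule L2_lim_cong[OF _ pn'_measurable[OF D(2)] pn'_AE[OF D(2)]])
  then have "\<exists>G. L2_lim m' (\<lambda>n. pn' (\<omega> n)) G" unfolding L2_lim_m' by blast
  then have "L2_lim m' (\<lambda>n. pn' (\<omega> n)) (nf' \<omega>)" unfolding form_norm_def by (rule someI_ex)
  then have lim': "L2_lim m (\<lambda>n. pn' (\<omega> n)) (nf' \<omega>)" unfolding L2_lim_m' .
  show "nf' \<omega> \<in> L2 m" using L2_limD(2)[OF lim'] .
  show "AE x in m. nf' \<omega> x = exp (- w x) * nf \<omega> x" by (rule L2_lim_unique[OF lim' lim])
qed

lemma exp_square: "(exp (- w x) * a)\<^sup>2 = exp (- 2 * w x) * a\<^sup>2"
  by (simp add: power_mult_distrib power2_eq_square exp_add[symmetric])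

lemma fi'_AE:
  assumes \<omega>: "\<omega> \<in> CT" and \<eta>: "\<eta> \<in> CT"
  shows "AE x in m. fi' \<omega> \<eta> x = exp (- 2 * w x) * fi \<omega> \<eta> x"
  using nf'_AE(2)[OF cotangent_add[OF \<omega> \<eta>]] nf'_AE(2)[OF cotangent_diff[OF \<omega> \<eta>]]
proof eventually_elim
  case (elim x)
  show ?case unfolding form_inner_def elim exp_square by (simp add: algebra_simps diff_divide_distrib)
qed

lemma carre_du_champ_conformal:
  assumes f: "f \<in> S" and g: "g \<in> S"
  shows "AE x in m. carre_du_champ d' m' f g x = exp (- 2 * w x) * \<Gamma> f g x"
  using N'_AE[OF sobolev_add[OF f g]] N'_AE[OF sobolev_diff[OF f g]]
proof eventually_elim
  case (elim x)
  show ?case unfolding carre_du_champ_def elim exp_square by (simp add: algebra_simps diff_divide_distrib)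
qed

section \<open>Vector fields on the two spaces\<close>

lemma Linf_conformal: "Linf m' = Linf m"
  by (simp add: Linf_def borel_measurable_m' AE_m')

lemma null_sequence_comparable:
  fixes a b :: "nat \<Rightarrow> real"
  assumes "\<And>n. 0 \<le> a n" "\<And>n. a n \<le> K * b n" "b \<longlonglongrightarrow> 0"
  shows "a \<longlonglongrightarrow> 0"
proof -
  have "(\<lambda>n. K * b n) \<longlonglongrightarrow> 0" using tendsto_mult_left[OF assms(3), of K] by simp
  then show ?thesis
    by (rule tendsto_sandwich[OF _ _ tendsto_const, rotated 2]) (use assms(1,2) in auto)
qed

text \<open>The conditions see the space only through forms, null sets, integrability, bounded
  functions and convergence of norms; the first four coincide and the norms are equivalent.\<close>

lemma tangent_conformal: "tangent d' m' = TM"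
proof -
  obtain K where K: "1 \<le> K"
    "\<And>g g'. g \<in> L2 m \<Longrightarrow> g' \<in> borel_measurable m \<Longrightarrow> AE x in m. g' x = exp (- w x) * g x \<Longrightarrow>
      L2_norm m' g' \<le> K * L2_norm m g \<and> L2_norm m g \<le> K * L2_norm m' g'" using conformal_norm_bounds by blast
  obtain V where V: "1 \<le> V" "\<And>x. exp (v x) \<le> V" "\<And>x. 1 \<le> V * exp (v x)" using exp_v_bounds by blast
  have norm_iff: "(\<lambda>n. L2_norm m' (nf' (form_diff (W n) \<omega>))) \<longlonglongrightarrow> 0 \<longleftrightarrow> (\<lambda>n. nn (form_diff (W n) \<omega>)) \<longlonglongrightarrow> 0"
    if W: "\<forall>n. W n \<in> CT" and \<omega>: "\<omega> \<in> CT" for W \<omega>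
  proof -
    have "L2_norm m' (nf' (form_diff (W n) \<omega>)) \<le> K * nn (form_diff (W n) \<omega>) \<and>
        nn (form_diff (W n) \<omega>) \<le> K * L2_norm m' (nf' (form_diff (W n) \<omega>))" for n
    proof -
      have c: "form_diff (W n) \<omega> \<in> CT" using W \<omega> by (intro cotangent_diff) auto
      show ?thesis by (rule K(2)[OF nf_L2[OF c] L2_measurable[OF nf'_AE(1)[OF c]] nf'_AE(2)[OF c]])
    qed
    then show ?thesis
      using null_sequence_comparable[of "\<lambda>n. L2_norm m' (nf' (form_diff (W n) \<omega>))" K "\<lambda>n. nn (form_diff (W n) \<omega>)"]
        null_sequence_comparable[of "\<lambda>n. nn (form_diff (W n) \<omega>)" K "\<lambda>n. L2_norm m' (nf' (form_diff (W n) \<omega>))"] by auto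
  qed
  have int_iff: "(\<lambda>n. LINT x|m'. \<bar>g n x\<bar>) \<longlonglongrightarrow> 0 \<longleftrightarrow> (\<lambda>n. LINT x|m. \<bar>g n x\<bar>) \<longlonglongrightarrow> 0"
    if g: "\<And>n. integrable m (g n)" for g :: "nat \<Rightarrow> 'a \<Rightarrow> real"
  proof -
    have "(LINT x|m'. \<bar>g n x\<bar>) \<le> V * (LINT x|m. \<bar>g n x\<bar>)" "(LINT x|m. \<bar>g n x\<bar>) \<le> V * (LINT x|m'. \<bar>g n x\<bar>)" for n
    proof -
      note [measurable] = borel_measurable_integrable[OF g[of n]]
      have i: "integrable m (\<lambda>x. exp (v x) * \<bar>g n x\<bar>)"
      proof (rule Bochner_Integration.integrable_bound)
        show "integrable m (\<lambda>x. V * \<bar>g n x\<bar>)" using g[of n] by simp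
        show "AE x in m. norm (exp (v x) * \<bar>g n x\<bar>) \<le> norm (V * \<bar>g n x\<bar>)"
          using V(1,2) by (auto simp: abs_mult intro!: mult_right_mono)
      qed measurable
      have e: "(LINT x|m'. \<bar>g n x\<bar>) = (LINT x|m. exp (v x) * \<bar>g n x\<bar>)" by (rule integral_m') measurable
      have "(LINT x|m. exp (v x) * \<bar>g n x\<bar>) \<le> (LINT x|m. V * \<bar>g n x\<bar>)"
        using i g[of n] V(2) by (intro integral_mono mult_right_mono) auto
      then show "(LINT x|m'. \<bar>g n x\<bar>) \<le> V * (LINT x|m. \<bar>g n x\<bar>)" unfolding e by simp
      have "(LINT x|m. \<bar>g n x\<bar>) \<le> (LINT x|m. V * (exp (v x) * \<bar>g n x\<bar>))"
        using i g[of n] mult_right_mono[OF V(3), of "\<bar>g n _\<bar>"] by (intro integral_mono) (auto simp: mult.assoc)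
      then show "(LINT x|m. \<bar>g n x\<bar>) \<le> V * (LINT x|m'. \<bar>g n x\<bar>)" unfolding e by simp
    qed
    then show ?thesis
      using null_sequence_comparable[of "\<lambda>n. LINT x|m'. \<bar>g n x\<bar>" V "\<lambda>n. LINT x|m. \<bar>g n x\<bar>"]
        null_sequence_comparable[of "\<lambda>n. LINT x|m. \<bar>g n x\<bar>" V "\<lambda>n. LINT x|m'. \<bar>g n x\<bar>"] by auto
  qed
  have "T \<in> tangent d' m' \<longleftrightarrow> T \<in> TM" for T :: "'a vfield"
  \<comment> \<open>Integrals of non-integrable functions default to 0 and cannot be compared; in
    that case both memberships already fail at their first condition.\<close>
  proof (cases "\<forall>\<omega>\<in>CT. integrable m (T \<omega>)")
    case False
    then show ?thesis unfolding tangent_def cotangent_conformal integrable_m' by blast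
  next
    case True
    have "((\<forall>n. W n \<in> CT) \<and> (\<lambda>n. L2_norm m' (nf' (form_diff (W n) \<omega>))) \<longlonglongrightarrow> 0 \<longrightarrow>
          (\<lambda>n. LINT x|m'. \<bar>T (W n) x - T \<omega> x\<bar>) \<longlonglongrightarrow> 0) \<longleftrightarrow>
        ((\<forall>n. W n \<in> CT) \<and> (\<lambda>n. nn (form_diff (W n) \<omega>)) \<longlonglongrightarrow> 0 \<longrightarrow>
          (\<lambda>n. LINT x|m. \<bar>T (W n) x - T \<omega> x\<bar>) \<longlonglongrightarrow> 0)" if \<omega>: "\<omega> \<in> CT" for W \<omega>
    proof (cases "\<forall>n. W n \<in> CT")
      case W: True
      have "integrable m (\<lambda>x. T (W n) x - T \<omega> x)" for n using True W \<omega> by (intro Bochner_Integration.integrable_diff) auto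
      from int_iff[of "\<lambda>n x. T (W n) x - T \<omega> x", OF this] show ?thesis using norm_iff[OF W \<omega>] by simp
    qed blast
    then show ?thesis
      unfolding tangent_def cotangent_conformal integrable_m' AE_m' Linf_conformal mem_Collect_eq by (simp cong: ball_cong)
  qed
  then show ?thesis by blast
qed

lemma differential_conformal: "differential m' f = differential m f"
  by (simp add: differential_def cong: if_cong)

text \<open>The two tangent modules are the same set and the differentials coincide, so
  \<open>X\<close> itself is a witness, and \<open>tangent_eqI\<close> makes every other choice
  agree with it almost everywhere.\<close>

lemma tangent_ident_AE:
  assumes X: "X \<in> TM"
  shows "tangent_ident dist m d' m' X \<in> TM" "\<And>\<omega>. \<omega> \<in> CT \<Longrightarrow> AE x in m. tangent_ident dist m d' m' X \<omega> x = X \<omega> x"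
proof -
  let ?P = "\<lambda>T'. T' \<in> tangent d' m' \<and> (\<forall>f\<in>S. AE x in m. T' (differential m' f) x = X (differential m f) x)"
  have "?P X" using X by (simp add: tangent_conformal differential_conformal)
  then have P: "?P (tangent_ident dist m d' m' X)" unfolding tangent_ident_def by (rule someI[of ?P X])
  then show T: "tangent_ident dist m d' m' X \<in> TM" by (simp add: tangent_conformal)
  show "AE x in m. tangent_ident dist m d' m' X \<omega> x = X \<omega> x" if "\<omega> \<in> CT" for \<omega>
    using P by (intro tangent_eqI[OF T X _ that]) (simp add: differential_conformal)
qed

lemma vfield_mult_tangent:
  assumes T: "T \<in> TM" and h: "h \<in> borel_measurable m" "\<And>x. \<bar>h x\<bar> \<le> K"
  shows "vfield_mult h T \<in> TM"
  unfolding tangent_def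
proof (intro CollectI conjI allI ballI impI)
  note [measurable] = h(1)
  have bi: "integrable m (\<lambda>x. h x * g x)" "(LINT x|m. \<bar>h x * g x\<bar>) \<le> K * (LINT x|m. \<bar>g x\<bar>)"
    if g: "integrable m g" for g
  proof -
    note [measurable] = borel_measurable_integrable[OF g]
    have le: "\<bar>h x * g x\<bar> \<le> K * \<bar>g x\<bar>" for x unfolding abs_mult using h(2) by (intro mult_right_mono) auto
    show i: "integrable m (\<lambda>x. h x * g x)"
    proof (rule Bochner_Integration.integrable_bound)
      show "integrable m (\<lambda>x. K * \<bar>g x\<bar>)" using g by simp
      show "AE x in m. norm (h x * g x) \<le> norm (K * \<bar>g x\<bar>)"
        using le by (intro AE_I2) (auto intro: order_trans[OF _ abs_ge_self])
    qed measurable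
    have "(LINT x|m. \<bar>h x * g x\<bar>) \<le> (LINT x|m. K * \<bar>g x\<bar>)"
      using i g le by (intro integral_mono) auto
    then show "(LINT x|m. \<bar>h x * g x\<bar>) \<le> K * (LINT x|m. \<bar>g x\<bar>)" by simp
  qed
  show "integrable m (vfield_mult h T \<omega>)" if "\<omega> \<in> CT" for \<omega>
    unfolding vfield_mult_def by (rule bi(1)[OF tangentD(1)[OF T that]])
  show "AE x in m. vfield_mult h T (form_add \<omega> \<eta>) x = vfield_mult h T \<omega> x + vfield_mult h T \<eta> x"
    if "\<omega> \<in> CT" "\<eta> \<in> CT" for \<omega> \<eta>
    using tangentD(2)[OF T that] by eventually_elim (simp add: vfield_mult_def distrib_left)
  show "AE x in m. vfield_mult h T (form_mult k \<omega>) x = k x * vfield_mult h T \<omega> x"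
    if "k \<in> Linf m" "\<omega> \<in> CT" for k \<omega>
    using tangentD(3)[OF T that] by eventually_elim (simp add: vfield_mult_def)
  fix W \<omega> assume \<omega>: "\<omega> \<in> CT" and W: "(\<forall>n. W n \<in> CT) \<and> (\<lambda>n. nn (form_diff (W n) \<omega>)) \<longlonglongrightarrow> 0"
  then have "L1_lim m (\<lambda>n. T (W n)) (T \<omega>)" by (intro tangentD(4)[OF T]) auto
  note L = L1_limD[OF this]
  show "(\<lambda>n. LINT x|m. \<bar>vfield_mult h T (W n) x - vfield_mult h T \<omega> x\<bar>) \<longlonglongrightarrow> 0"
  proof (rule null_sequence_comparable[OF _ _ L(3)])
    show "(LINT x|m. \<bar>vfield_mult h T (W n) x - vfield_mult h T \<omega> x\<bar>) \<le> K * (LINT x|m. \<bar>T (W n) x - T \<omega> x\<bar>)" for n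
      using bi(2)[of "\<lambda>x. T (W n) x - T \<omega> x"] L(1)[of n] L(2) by (simp add: vfield_mult_def right_diff_distrib)
  qed simp
qed

lemma exp_w_Linf: "(\<lambda>x. exp (c * w x)) \<in> Linf m"
proof -
  obtain K where "\<And>x. \<bar>exp (c * w x)\<bar> \<le> K" using exp_w_bound[of c] by blast
  then have "AE x in m. \<bar>exp (c * w x)\<bar> \<le> K" by (intro AE_I2)
  then show ?thesis unfolding Linf_def by (intro CollectI conjI exI[of _ K]) auto
qed

text \<open>On differentials both fields act as \<open>exp (- 2 * w x) * \<Gamma> f g x\<close>, and
  a field is determined by this action. The multiplied gradient is also the witness for the
  \<open>SOME\<close> in \<open>gradient\<close> on \<open>M'\<close>.\<close>

lemma gradient_conformal:
  assumes f: "f \<in> S" and \<omega>: "\<omega> \<in> CT"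
  shows "AE x in m. gradient d' m' f \<omega> x =
    tangent_ident dist m d' m' (vfield_mult (\<lambda>y. exp (- 2 * w y)) (gradient dist m f)) \<omega> x"
proof -
  let ?Y = "vfield_mult (\<lambda>y. exp (- 2 * w y)) (gradient dist m f)"
  let ?P = "\<lambda>T. T \<in> tangent d' m' \<and> (\<forall>g\<in>sobolev d' m'. AE x in m'. T (differential m' g) x = carre_du_champ d' m' f g x)"
  obtain K where K: "\<And>x. \<bar>exp (- 2 * w x)\<bar> \<le> K" using exp_w_bound[of "- 2"] by blast
  have Y: "?Y \<in> TM" by (rule vfield_mult_tangent[OF gradient_tangent(1)[OF f] _ K]) measurable
  have Yd: "AE x in m. ?Y (differential m g) x = exp (- 2 * w x) * \<Gamma> f g x" if "g \<in> S" for g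
    using gradient_tangent(2)[OF f that] by eventually_elim (simp add: vfield_mult_def)
  have "?P ?Y"
    unfolding tangent_conformal sobolev_conformal AE_m' differential_conformal
  proof (intro conjI ballI Y)
    show "AE x in m. ?Y (differential m g) x = carre_du_champ d' m' f g x" if "g \<in> S" for g
      using Yd[OF that] carre_du_champ_conformal[OF f that] by eventually_elim simp
  qed
  then have "?P (gradient d' m' f)" unfolding gradient_def[of d' m' f] by (rule someI[of ?P ?Y])
  then have G: "gradient d' m' f \<in> TM"
    "\<And>g. g \<in> S \<Longrightarrow> AE x in m. gradient d' m' f (differential m g) x = carre_du_champ d' m' f g x"
    unfolding tangent_conformal sobolev_conformal AE_m' differential_conformal by blast+
  have "AE x in m. gradient d' m' f \<omega> x = ?Y \<omega> x"
  proof (rule tangent_eqI[OF G(1) Y _ \<omega>])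
    show "AE x in m. gradient d' m' f (differential m g) x = ?Y (differential m g) x" if "g \<in> S" for g
      using G(2)[OF that] Yd[OF that] carre_du_champ_conformal[OF f that] by eventually_elim simp
  qed
  with tangent_ident_AE(2)[OF Y \<omega>] show ?thesis by eventually_elim simp
qed

lemma riesz_AE:
  assumes "X \<in> TM"
  shows "riesz dist m X \<in> CT" "\<And>\<eta>. \<eta> \<in> CT \<Longrightarrow> AE x in m. X \<eta> x = fi (riesz dist m X) \<eta> x"
proof -
  have "\<exists>\<omega>. \<omega> \<in> CT \<and> (\<forall>\<eta>\<in>CT. AE x in m. X \<eta> x = fi \<omega> \<eta> x)" using riesz_exists[OF assms] by blast
  from someI_ex[OF this] show "riesz dist m X \<in> CT" "\<And>\<eta>. \<eta> \<in> CT \<Longrightarrow> AE x in m. X \<eta> x = fi (riesz dist m X) \<eta> x"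
    unfolding riesz_def by blast+
qed

text \<open>The factor \<open>exp (2 * w x)\<close> on the representing form cancels the factor
  \<open>exp (- 2 * w x)\<close> in \<open>fi'\<close>.\<close>

lemma riesz_conformal_AE:
  assumes X: "X \<in> TM"
  shows "riesz d' m' X \<in> CT" "\<And>\<eta>. \<eta> \<in> CT \<Longrightarrow> AE x in m. X \<eta> x = fi' (riesz d' m' X) \<eta> x"
proof -
  note R = riesz_AE[OF X] and h = exp_w_Linf[of 2]
  let ?P = "\<lambda>\<omega>. \<omega> \<in> cotangent d' m' \<and> (\<forall>\<eta>\<in>cotangent d' m'. AE x in m'. X \<eta> x = fi' \<omega> \<eta> x)"
  have "?P (form_mult (\<lambda>x. exp (2 * w x)) (riesz dist m X))"
    unfolding cotangent_conformal AE_m'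
  proof (intro conjI ballI)
    show c: "form_mult (\<lambda>x. exp (2 * w x)) (riesz dist m X) \<in> CT" by (rule cotangent_mult[OF R(1) h])
    show "AE x in m. X \<eta> x = fi' (form_mult (\<lambda>x. exp (2 * w x)) (riesz dist m X)) \<eta> x" if \<eta>: "\<eta> \<in> CT" for \<eta>
      using R(2)[OF \<eta>] fi'_AE[OF c \<eta>] fi_mult[OF R(1) \<eta> h]
      by eventually_elim (simp add: mult.assoc[symmetric] exp_add[symmetric])
  qed
  then have "?P (riesz d' m' X)" unfolding riesz_def[of d' m' X] by (rule someI[of ?P])
  then show "riesz d' m' X \<in> CT" "\<And>\<eta>. \<eta> \<in> CT \<Longrightarrow> AE x in m. X \<eta> x = fi' (riesz d' m' X) \<eta> x"
    unfolding cotangent_conformal AE_m' by blast+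
qed

text \<open>With \<open>a\<close>, \<open>b\<close> and \<open>a'\<close>, \<open>b'\<close>
  representing the fields on \<open>M\<close> and \<open>M'\<close>, evaluating \<open>X\<close> at
  \<open>b'\<close> gives \<open>fi' a' b' = fi a b'\<close>, and evaluating \<open>Y\<close> at
  \<open>a\<close> gives \<open>fi b a = exp (- 2 * w x) * fi b' a\<close>. Symmetry of
  \<open>fi\<close> combines the two.\<close>

lemma vfield_inner_conformal:
  assumes X: "X \<in> TM" and Y: "Y \<in> TM"
  shows "AE x in m. vfield_inner d' m' (tangent_ident dist m d' m' X) (tangent_ident dist m d' m' Y) x =
    exp (2 * w x) * vfield_inner dist m X Y x"
proof -
  let ?X' = "tangent_ident dist m d' m' X" and ?Y' = "tangent_ident dist m d' m' Y"
  note IX = tangent_ident_AE[OF X] and IY = tangent_ident_AE[OF Y]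
  define a b a' b' where "a = riesz dist m X" and "b = riesz dist m Y"
    and "a' = riesz d' m' ?X'" and "b' = riesz d' m' ?Y'"
  note a = riesz_AE[OF X, folded a_def] and b = riesz_AE[OF Y, folded b_def]
    and a' = riesz_conformal_AE[OF IX(1), folded a'_def] and b' = riesz_conformal_AE[OF IY(1), folded b'_def]
  have "AE x in m. fi' a' b' x = fi a b' x"
    using a'(2)[OF b'(1)] IX(2)[OF b'(1)] a(2)[OF b'(1)] by eventually_elim simp
  moreover have "AE x in m. fi b a x = exp (- 2 * w x) * fi b' a x"
    using b(2)[OF a(1)] IY(2)[OF a(1)] b'(2)[OF a(1)] fi'_AE[OF b'(1) a(1)] by eventually_elim simp
  ultimately have "AE x in m. fi' a' b' x = exp (2 * w x) * fi a b x"
    using fi_sym[OF a(1) b'(1)] fi_sym[OF a(1) b(1)]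
    by eventually_elim (simp add: mult.assoc[symmetric] exp_add[symmetric])
  then show ?thesis by (simp add: vfield_inner_def a_def b_def a'_def b'_def)
qed

end

theorem proposition3p6:
  fixes m :: "'a::polish_space measure" and v w :: "'a \<Rightarrow> real"
  assumes "metric_measure_space m"
    and "infinitesimally_hilbertian dist m"
    and "continuous_on UNIV v" and "bounded (range v)"
    and "continuous_on UNIV w" and "bounded (range w)"
  shows "let d' = conformal_dist dist w; m' = conformal_measure m v in
    sobolev dist m = sobolev d' m' \<and>
    (\<forall>f\<in>sobolev dist m. \<forall>\<omega>\<in>cotangent d' m'. AE x in m.
       gradient d' m' f \<omega> x =
       tangent_ident dist m d' m'
         (vfield_mult (\<lambda>y. exp (- 2 * w y)) (gradient dist m f)) \<omega> x) \<and>
    (\<forall>X\<in>tangent dist m. \<forall>Y\<in>tangent dist m. AE x in m.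
       vfield_inner d' m' (tangent_ident dist m d' m' X) (tangent_ident dist m d' m' Y) x =
       exp (2 * w x) * vfield_inner dist m X Y x)"
proof -
  interpret conformal_hilbertian m v w
    by unfold_locales (use assms in auto)
  show ?thesis
    unfolding Let_def cotangent_conformal
    using sobolev_conformal gradient_conformal vfield_inner_conformal by blast
qed

end
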